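(* Let $m>0$, let $V$ satisfy the standing assumptions on the potential listed in the context, and let $H$ be the Dirac operator in $L^2(\mathbb{R},\mathbb{C}^2)$ $$H=-i\partial_x\sigma_1+m\sigma_3+iVI_2,\qquad\mathrm{Dom}(H)=H^1(\mathbb{R},\mathbb{C}^2)\cap\mathrm{Dom}(VI_2).$$ Suppose in addition that $$V(x)\gtrsim\langle x\rangle^\gamma,\qquad|x|>x_0,$$ with some $x_0\ge0$ and $\gamma>1$. Then the spectrum of $H$ comprises infinitely many (distinct) discrete eigenvalues of finite algebraic multiplicities and the vector space spanned by the generalised eigenfunctions of $H$ is complete (i.e. dense) in $L^2(\mathbb{R},\mathbb{C}^2)$.
   Context: $\sigma_1=\begin{pmatrix}0&1\\1&0\end{pmatrix}$, $\sigma_3=\begin{pmatrix}1&0\\0&-1\end{pmatrix}$, $I_2$ is the $2\times2$ identity matrix; $\mathrm{Dom}(VI_2)=\{u\in L^2(\mathbb{R},\mathbb{C}^2):VI_2u\in L^2(\mathbb{R},\mathbb{C}^2)\}$. $\langle x\rangle=(1+x^2)^{1/2}$. Generalised eigenfunctions of $H$ are the non-zero elements of $\bigcup_{n\ge1}\mathrm{Ker}((H-\lambda)^n)$, $\lambda$ an eigenvalue of $H$. Standing assumptions on $V$: $V\in C^1(\mathbb{R},\mathbb{R})\cap C^2((-\infty,-x_1)\cup(x_1,\infty),\mathbb{R})$ for some $x_1>1$, and (i) $\lim_{x\to+\infty}V(x)=+\infty$ and $V'(x)>0$ for $x>x_1$; $\lim_{x\to-\infty}V(x)=+\infty$ and $V'(x)<0$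 for $x<-x_1$; (ii) $|V'(x)|\approx V(x)|x|^{-1}$ and $|V''(x)|\lesssim|V'(x)||x|^{-1}$ for $|x|>x_1$. Here $a\lesssim b$ (equivalently $b\gtrsim a$) means $a\le Cb$ with $C>0$ independent of $x$, and $a\approx b$ means $a\lesssim b$ and $b\lesssim a$. *)

theory Defs
  imports "HOL-Analysis.Analysis"
begin

definition square_integrable :: "(real \<Rightarrow> complex^2) \<Rightarrow> bool"
  where "square_integrable f \<longleftrightarrow>
    f \<in> borel_measurable lborel \<and> integrable lborel (\<lambda>x. (norm (f x))\<^sup>2)"

definition L2_eq :: "(real \<Rightarrow> complex^2) \<Rightarrow> (real \<Rightarrow> complex^2) \<Rightarrow> bool"
  where "L2_eq f g \<longleftrightarrow>
    square_integrable f \<and> square_integrable g \<and> (AE x in lborel. f x = g x)"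

lemma square_integrable_0 [simp]: "square_integrable (\<lambda>x. 0)"
  by (simp add: square_integrable_def)

lemma square_integrable_measurable [measurable_dest]:
  "square_integrable f \<Longrightarrow> f \<in> borel_measurable borel"
  by (simp add: square_integrable_def)

lemma norm_add_squared_le:
  fixes a b :: "'a::real_normed_vector"
  shows "(norm (a + b))\<^sup>2 \<le> 2 * (norm a)\<^sup>2 + 2 * (norm b)\<^sup>2"
proof -
  have "(norm (a + b))\<^sup>2 \<le> (norm a + norm b)\<^sup>2"
    by (simp add: norm_triangle_ineq power_mono)
  also have "\<dots> \<le> 2 * (norm a)\<^sup>2 + 2 * (norm b)\<^sup>2"
    using sum_squares_bound[of "norm a" "norm b"] by (simp add: power2_sum)
  finally show ?thesis .
qed

lemma square_integrable_add:
  assumes "square_integrable f" "square_integrable g"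
  shows "square_integrable (\<lambda>x. f x + g x)"
  unfolding square_integrable_def
proof
  show [measurable]: "(\<lambda>x. f x + g x) \<in> borel_measurable lborel"
    using assms by (auto intro!: borel_measurable_add square_integrable_measurable)
  show "integrable lborel (\<lambda>x. (norm (f x + g x))\<^sup>2)"
  proof (rule Bochner_Integration.integrable_bound)
    show "integrable lborel (\<lambda>x. 2 * (norm (f x))\<^sup>2 + 2 * (norm (g x))\<^sup>2)"
      using assms by (simp add: square_integrable_def)
    show "(\<lambda>x. (norm (f x + g x))\<^sup>2) \<in> borel_measurable lborel"
      by measurable
    show "AE x in lborel. norm ((norm (f x + g x))\<^sup>2) \<le> norm (2 * (norm (f x))\<^sup>2 + 2 * (norm (g x))\<^sup>2)"
      by (simp add: norm_add_squared_le)
  qed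
qed

lemma norm_vector_scalar_mult: "norm (c *s v) = norm c * norm v" for v :: "complex^2"
  by (simp add: norm_vec_def L2_set_def vector_scalar_mult_def norm_mult power_mult_distrib
      flip: sum_distrib_left) (simp add: real_sqrt_mult)

lemma square_integrable_scaleC:
  assumes "square_integrable f"
  shows "square_integrable (\<lambda>x. c *s f x)"
  unfolding square_integrable_def
proof
  have "continuous_on UNIV (\<lambda>v :: complex^2. c *s v)"
    unfolding vector_scalar_mult_def by (intro continuous_intros)
  then have "(\<lambda>v :: complex^2. c *s v) \<in> borel_measurable borel"
    by (rule borel_measurable_continuous_onI)
  then show "(\<lambda>x. c *s f x) \<in> borel_measurable lborel"
    using measurable_compose[OF square_integrable_measurable[OF assms]] by simp
  show "integrable lborel (\<lambda>x. (norm (c *s f x))\<^sup>2)"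
    using assms by (simp add: norm_vector_scalar_mult power_mult_distrib square_integrable_def)
qed

lemma scaleR_eq_scalar_mult: "r *\<^sub>R v = complex_of_real r *s v" for v :: "complex^2"
  by (simp add: vec_eq_iff scaleR_conv_of_real[where 'a = complex])

lemma square_integrable_scaleR:
  "square_integrable f \<Longrightarrow> square_integrable (\<lambda>x. r *\<^sub>R f x)"
  unfolding scaleR_eq_scalar_mult by (rule square_integrable_scaleC)

lemma square_integrable_uminus:
  "square_integrable f \<Longrightarrow> square_integrable (\<lambda>x. - f x)"
  using square_integrable_scaleR[of f "-1"] by simp

lemma square_integrable_diff:
  "square_integrable f \<Longrightarrow> square_integrable g \<Longrightarrow> square_integrable (\<lambda>x. f x - g x)"
  using square_integrable_add[of f "\<lambda>x. - g x"] square_integrable_uminus[of g] by simp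

lemma integrable_inner_square_integrable:
  assumes "square_integrable f" "square_integrable g"
  shows "integrable lborel (\<lambda>x. f x \<bullet> g x)"
proof (rule Bochner_Integration.integrable_bound)
  have [measurable]: "f \<in> borel_measurable lborel" "g \<in> borel_measurable lborel"
    using assms by (auto simp: square_integrable_def)
  show "integrable lborel (\<lambda>x. (norm (f x))\<^sup>2 + (norm (g x))\<^sup>2)"
    using assms by (simp add: square_integrable_def)
  show "(\<lambda>x. f x \<bullet> g x) \<in> borel_measurable lborel"
    by measurable
  have "\<bar>a \<bullet> b\<bar> \<le> (norm a)\<^sup>2 + (norm b)\<^sup>2" for a b :: "complex^2"
  proof -
    have "2 * \<bar>a \<bullet> b\<bar> \<le> 2 * norm a * norm b"
      using Cauchy_Schwarz_ineq2[of a b] by simp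
    also have "\<dots> \<le> (norm a)\<^sup>2 + (norm b)\<^sup>2"
      by (rule sum_squares_bound)
    finally show ?thesis by (smt (verit) zero_le_power2)
  qed
  then show "AE x in lborel. norm (f x \<bullet> g x) \<le> norm ((norm (f x))\<^sup>2 + (norm (g x))\<^sup>2)"
    by simp
qed

quotient_type L2 = "real \<Rightarrow> complex^2" / partial: L2_eq
proof (rule part_equivpI)
  show "\<exists>f. L2_eq f f"
    by (rule exI[of _ "\<lambda>x. 0"]) (simp add: L2_eq_def)
  show "symp L2_eq"
    by (auto simp: symp_def L2_eq_def eq_commute)
  show "transp L2_eq"
    unfolding transp_def L2_eq_def by auto
qed

instantiation L2 :: real_inner
begin

lift_definition zero_L2 :: L2 is "\<lambda>x. 0"
  by (simp add: L2_eq_def)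

lift_definition plus_L2 :: "L2 \<Rightarrow> L2 \<Rightarrow> L2" is "\<lambda>f g x. f x + g x"
  unfolding L2_eq_def by (auto intro: square_integrable_add)

lift_definition minus_L2 :: "L2 \<Rightarrow> L2 \<Rightarrow> L2" is "\<lambda>f g x. f x - g x"
  unfolding L2_eq_def by (auto intro: square_integrable_diff)

lift_definition uminus_L2 :: "L2 \<Rightarrow> L2" is "\<lambda>f x. - f x"
  unfolding L2_eq_def by (auto intro: square_integrable_uminus)

lift_definition scaleR_L2 :: "real \<Rightarrow> L2 \<Rightarrow> L2" is "\<lambda>r f x. r *\<^sub>R f x"
  unfolding L2_eq_def by (auto intro: square_integrable_scaleR)

text \<open>The class \<^class>\<open>real_inner\<close> asks for a real inner product: on \<^typ>\<open>complex^2\<close> the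
  operation \<^term>\<open>(\<bullet>)\<close> is the real part of the Hermitian product, so that this is the real part
  of the usual inner product of \<open>L\<^sup>2\<close>, and the norm is the usual one.\<close>

lift_definition inner_L2 :: "L2 \<Rightarrow> L2 \<Rightarrow> real" is "\<lambda>f g. integral\<^sup>L lborel (\<lambda>x. f x \<bullet> g x)"
  unfolding L2_eq_def
  by (intro integral_cong_AE) (auto intro!: borel_measurable_inner square_integrable_measurable)

lift_definition norm_L2 :: "L2 \<Rightarrow> real" is "\<lambda>f. sqrt (integral\<^sup>L lborel (\<lambda>x. (norm (f x))\<^sup>2))"
  unfolding L2_eq_def
  by (intro arg_cong[where f = sqrt] integral_cong_AE)
    (auto intro!: borel_measurable_power borel_measurable_norm square_integrable_measurable)

definition dist_L2 :: "L2 \<Rightarrow> L2 \<Rightarrow> real"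
  where "dist_L2 f g = norm (f - g)"

definition sgn_L2 :: "L2 \<Rightarrow> L2"
  where "sgn_L2 f = inverse (norm f) *\<^sub>R f"

definition uniformity_L2 :: "(L2 \<times> L2) filter"
  where "uniformity_L2 = (INF e\<in>{0<..}. principal {(f, g). dist f g < e})"

definition open_L2 :: "L2 set \<Rightarrow> bool"
  where "open_L2 U = (\<forall>f\<in>U. \<forall>\<^sub>F (f', g) in uniformity. f' = f \<longrightarrow> g \<in> U)"

instance
proof
  fix f g h :: L2 and r s :: real
  show "f + g + h = f + (g + h)"
    by transfer (auto simp: L2_eq_def add.assoc intro!: square_integrable_add)
  show "f + g = g + f"
    by transfer (auto simp: L2_eq_def add.commute intro!: square_integrable_add)
  show "0 + f = f"
    by transfer (auto simp: L2_eq_def)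
  show "- f + f = 0"
    by transfer (auto simp: L2_eq_def)
  show "f - g = f + - g"
    by transfer (auto simp: L2_eq_def intro!: square_integrable_diff)
  show "r *\<^sub>R (f + g) = r *\<^sub>R f + r *\<^sub>R g"
    by transfer (auto simp: L2_eq_def scaleR_add_right
        intro!: square_integrable_scaleR square_integrable_add)
  show "(r + s) *\<^sub>R f = r *\<^sub>R f + s *\<^sub>R f"
    by transfer (auto simp: L2_eq_def scaleR_add_left
        intro!: square_integrable_scaleR square_integrable_add)
  show "r *\<^sub>R s *\<^sub>R f = (r * s) *\<^sub>R f"
    by transfer (auto simp: L2_eq_def intro!: square_integrable_scaleR)
  show "1 *\<^sub>R f = f"
    by transfer (auto simp: L2_eq_def)
  show "dist f g = norm (f - g)"
    by (rule dist_L2_def)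
  show "sgn f = inverse (norm f) *\<^sub>R f"
    by (rule sgn_L2_def)
  show "uniformity = (INF e\<in>{0<..}. principal {(f, g :: L2). dist f g < e})"
    by (rule uniformity_L2_def)
  show "open U = (\<forall>f\<in>U. \<forall>\<^sub>F (f', g) in uniformity. f' = f \<longrightarrow> g \<in> U)" for U :: "L2 set"
    by (rule open_L2_def)
  show "f \<bullet> g = g \<bullet> f"
    by transfer (simp add: inner_commute)
  show "(f + g) \<bullet> h = f \<bullet> h + g \<bullet> h"
    by transfer (simp add: L2_eq_def inner_add_left integrable_inner_square_integrable)
  show "(r *\<^sub>R f) \<bullet> g = r * (f \<bullet> g)"
    by transfer simp
  show "0 \<le> f \<bullet> f"
    by transfer simp
  show "(f \<bullet> f = 0) = (f = 0)"
  proof (transfer)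
    fix f assume "L2_eq f f"
    then have f: "square_integrable f" by (simp add: L2_eq_def)
    have "integral\<^sup>L lborel (\<lambda>x. f x \<bullet> f x) = 0 \<longleftrightarrow> (AE x in lborel. f x \<bullet> f x = 0)"
      by (rule integral_nonneg_eq_0_iff_AE[OF integrable_inner_square_integrable[OF f f]]) simp
    then show "integral\<^sup>L lborel (\<lambda>x. f x \<bullet> f x) = 0 \<longleftrightarrow> L2_eq f (\<lambda>x. 0)"
      using f by (simp add: L2_eq_def)
  qed
  show "norm f = sqrt (f \<bullet> f)"
    by transfer (simp add: power2_norm_eq_inner)
qed

end

lift_definition scaleC_L2 :: "complex \<Rightarrow> L2 \<Rightarrow> L2" (infixr \<open>*\<^sub>C\<close> 75) is "\<lambda>c f x. c *s f x"
  unfolding L2_eq_def by (auto intro: square_integrable_scaleC)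

global_interpretation L2: vector_space scaleC_L2
  defines L2_span = L2.span
proof
  fix a b :: complex and f g :: L2
  show "a *\<^sub>C (f + g) = a *\<^sub>C f + a *\<^sub>C g"
    by transfer (auto simp: L2_eq_def vector_add_ldistrib
        intro!: square_integrable_scaleC square_integrable_add)
  show "(a + b) *\<^sub>C f = a *\<^sub>C f + b *\<^sub>C f"
    by transfer (auto simp: L2_eq_def vector_sadd_rdistrib
        intro!: square_integrable_scaleC square_integrable_add)
  show "a *\<^sub>C b *\<^sub>C f = (a * b) *\<^sub>C f"
    by transfer (auto simp: L2_eq_def vector_smult_assoc intro!: square_integrable_scaleC)
  show "1 *\<^sub>C f = f"
    by transfer (auto simp: L2_eq_def)
qed

text \<open>An operator is a pair of its domain and a total function, whose values outside the domain
  are irrelevant.\<close>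

type_synonym L2_operator = "L2 set \<times> (L2 \<Rightarrow> L2)"

definition shifted :: "L2_operator \<Rightarrow> complex \<Rightarrow> L2 \<Rightarrow> L2"
  where "shifted A z u = snd A u - z *\<^sub>C u"

definition resolvent_set :: "L2_operator \<Rightarrow> complex set"
  where "resolvent_set A =
    {z. bij_betw (shifted A z) (fst A) UNIV \<and>
        (\<exists>K. \<forall>u\<in>fst A. norm u \<le> K * norm (shifted A z u))}"

definition spectrum :: "L2_operator \<Rightarrow> complex set"
  where "spectrum A = - resolvent_set A"

text \<open>The kernel of \<open>(A - z)\<^sup>n\<close>, on its natural domain.\<close>

definition ker_power :: "L2_operator \<Rightarrow> complex \<Rightarrow> nat \<Rightarrow> L2 set"
  where "ker_power A z n =
    {u. (\<forall>k<n. (shifted A z ^^ k) u \<in> fst A) \<and> (shifted A z ^^ n) u = 0}"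

definition eigenvalue :: "L2_operator \<Rightarrow> complex \<Rightarrow> bool"
  where "eigenvalue A z \<longleftrightarrow> (\<exists>u\<in>fst A. u \<noteq> 0 \<and> snd A u = z *\<^sub>C u)"

definition root_space :: "L2_operator \<Rightarrow> complex \<Rightarrow> L2 set"
  where "root_space A z = (\<Union>n\<in>{1..}. ker_power A z n)"

text \<open>The algebraic multiplicity of \<open>z\<close> is the complex dimension of its root space.\<close>

definition finite_algebraic_multiplicity :: "L2_operator \<Rightarrow> complex \<Rightarrow> bool"
  where "finite_algebraic_multiplicity A z \<longleftrightarrow> (\<exists>B. finite B \<and> L2_span B = root_space A z)"

text \<open>For an isolated point of the spectrum of a closed operator, a finite-dimensional root space
  together with a closed range of \<open>A - z\<close> amounts to a Riesz projection of finite rank; without the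
  condition on the range, \<open>z\<close> could still belong to the essential spectrum.\<close>

definition discrete_eigenvalue :: "L2_operator \<Rightarrow> complex \<Rightarrow> bool"
  where "discrete_eigenvalue A z \<longleftrightarrow>
    eigenvalue A z \<and> z isolated_in spectrum A \<and>
    finite_algebraic_multiplicity A z \<and> closed (shifted A z ` fst A)"

definition generalised_eigenfunctions :: "L2_operator \<Rightarrow> L2 set"
  where "generalised_eigenfunctions A = (\<Union>z\<in>{z. eigenvalue A z}. root_space A z) - {0}"

definition test_function :: "(real \<Rightarrow> real) \<Rightarrow> bool"
  where "test_function \<phi> \<longleftrightarrow>
    (\<forall>n. (deriv ^^ n) \<phi> differentiable_on UNIV) \<and> (\<exists>R. \<forall>x. \<bar>x\<bar> > R \<longrightarrow> \<phi> x = 0)"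

definition has_weak_derivative :: "L2 \<Rightarrow> L2 \<Rightarrow> bool"
  where "has_weak_derivative u w \<longleftrightarrow>
    (\<forall>\<phi>. test_function \<phi> \<longrightarrow>
      integral\<^sup>L lborel (\<lambda>x. deriv \<phi> x *\<^sub>R rep_L2 u x) =
      - integral\<^sup>L lborel (\<lambda>x. \<phi> x *\<^sub>R rep_L2 w x))"

definition Sobolev_H1 :: "L2 set"
  where "Sobolev_H1 = {u. \<exists>w. has_weak_derivative u w}"

text \<open>A weak derivative is unique as an element of \<^typ>\<open>L2\<close>, by the du Bois-Reymond lemma.\<close>

definition weak_derivative :: "L2 \<Rightarrow> L2"
  where "weak_derivative u = (THE w. has_weak_derivative u w)"

definition multiplication_domain :: "(real \<Rightarrow> real) \<Rightarrow> L2 set"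
  where "multiplication_domain V = {u. square_integrable (\<lambda>x. V x *\<^sub>R rep_L2 u x)}"

definition \<sigma>\<^sub>1 :: "complex^2^2"
  where "\<sigma>\<^sub>1 = vector [vector [0, 1], vector [1, 0]]"

definition \<sigma>\<^sub>3 :: "complex^2^2"
  where "\<sigma>\<^sub>3 = vector [vector [1, 0], vector [0, -1]]"

definition dirac_operator :: "real \<Rightarrow> (real \<Rightarrow> real) \<Rightarrow> L2_operator"
  where "dirac_operator m V =
    (Sobolev_H1 \<inter> multiplication_domain V,
     \<lambda>u. abs_L2 (\<lambda>x. (- \<i>) *s (\<sigma>\<^sub>1 *v rep_L2 (weak_derivative u) x)
                 + of_real m *s (\<sigma>\<^sub>3 *v rep_L2 u x)
                 + (\<i> * of_real (V x)) *s rep_L2 u x))"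

definition lesssim_on :: "real set \<Rightarrow> (real \<Rightarrow> real) \<Rightarrow> (real \<Rightarrow> real) \<Rightarrow> bool"
  where "lesssim_on S f g \<longleftrightarrow> (\<exists>C>0. \<forall>x\<in>S. f x \<le> C * g x)"

definition japanese_bracket :: "real \<Rightarrow> real"
  where "japanese_bracket x = sqrt (1 + x\<^sup>2)"

definition admissible_potential :: "(real \<Rightarrow> real) \<Rightarrow> bool"
  where "admissible_potential V \<longleftrightarrow>
    V C1_differentiable_on UNIV \<and>
    (\<exists>x1>1.
      deriv V C1_differentiable_on ({..<-x1} \<union> {x1<..}) \<and>
      filterlim V at_top at_top \<and> (\<forall>x>x1. deriv V x > 0) \<and>
      filterlim V at_top at_bot \<and> (\<forall>x < - x1. deriv V x < 0) \<and>
      lesssim_on {x. \<bar>x\<bar> > x1} (\<lambda>x. \<bar>deriv V x\<bar>) (\<lambda>x. V x / \<bar>x\<bar>) \<and>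
      lesssim_on {x. \<bar>x\<bar> > x1} (\<lambda>x. V x / \<bar>x\<bar>) (\<lambda>x. \<bar>deriv V x\<bar>) \<and>
      lesssim_on {x. \<bar>x\<bar> > x1} (\<lambda>x. \<bar>deriv (deriv V) x\<bar>) (\<lambda>x. \<bar>deriv V x\<bar> / \<bar>x\<bar>))"

end

theory Submission
  imports Defs "HOL-Complex_Analysis.Complex_Analysis" "HOL-Real_Asymp.Real_Asymp"
begin

text \<open>Put \<open>z = \<i> \<zeta>\<close>, \<open>f = v\<^sub>1 + v\<^sub>2\<close> and \<open>h = - \<i> (v\<^sub>1 - v\<^sub>2)\<close>. The resolvent equation \<open>(H - z) v = g\<close> becomes the
  system \<open>f' = W f + m h + \<i> (g\<^sub>1 + g\<^sub>2)\<close>, \<open>h' = m f - W h - (g\<^sub>1 - g\<^sub>2)\<close> with \<open>W = V - \<zeta>\<close>. Either half-line carries a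
  solution that decays at infinity and is entire in \<open>\<zeta>\<close>. The Wronskian of the two is an entire function
  \<open>D\<close> whose zeros are the eigenvalues. As \<open>V \<ge> c \<bar>x\<bar>\<^sup>\<gamma>\<close>, the potential dominates \<open>\<bar>\<zeta>\<bar>\<close> outside an interval of length
  of order \<open>\<bar>\<zeta>\<bar>\<close> to the power \<open>1 / \<gamma>\<close>, so that both \<open>D\<close> and \<open>D\<close> times the resolvent have order at most
  \<open>1 + 1 / \<gamma> < 2\<close>.

  The derivative of \<open>Re (f cnj h)\<close> bounds the resolvent by \<open>1 / m\<close> on the imaginary \<open>z\<close>-axis, and that of
  \<open>\<bar>f\<bar>\<^sup>2 - \<bar>h\<bar>\<^sup>2\<close> bounds it where \<open>- Im z\<close> is large. If \<open>v\<close> is orthogonal to all root vectors, the matrix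
  coefficients of the resolvent against \<open>v\<close> extend to entire functions of order below \<open>2\<close>. They are bounded by
  Phragmen--Lindeloef in quadrants, hence constant, and decay gives \<open>v = 0\<close>. A finite spectrum would
  make the span of the root vectors finite-dimensional, hence closed, and the operator everywhere
  defined.\<close>

section \<open>Absolutely continuous functions\<close>

text \<open>\<open>H\<close> is a symmetric operator plus \<open>\<i>\<close> times a potential that
  does not commute with it, so completeness has to come from the growth of the resolvent. Bounds are
  available on the real \<open>\<zeta>\<close>-axis, where the mass term supplies positivity, and in
  a left half-plane; what remains is a pair of quadrants, and \<open>1 + 1 / \<gamma> < 2\<close> is
  the condition \<open>\<gamma> > 1\<close>. A second obstacle is that the resolvent is a quotient
  by \<open>D\<close>, for which no lower bound is known on large circles. Moving zeros by Blaschke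
  factors requires \<open>D 0 \<noteq> 0\<close> alone, and this follows from the bound on the
  imaginary \<open>z\<close>-axis. A third is the pole at an eigenvalue: kernel and cokernel are
  one-dimensional, so a root space is a single Jordan chain, and the part of the resolvent seen by
  \<open>v\<close> is found by division with remainder. Sources are merely square integrable, hence
  solutions are absolutely continuous and identities for their derivatives are used in integrated
  form. As \<open>V\<close> tends to \<open>+\<infinity>\<close> at both ends, the reflection
  \<open>x \<mapsto> - x\<close> exchanges \<open>f\<close> and \<open>h\<close> up to sign, and one
  half-line theory serves both sides.\<close>

definition ac :: "(real \<Rightarrow> 'a::euclidean_space) \<Rightarrow> (real \<Rightarrow> 'a) \<Rightarrow> bool"
  where "ac F f \<longleftrightarrow> (\<forall>a b. a \<le> b \<longrightarrow>
    f absolutely_integrable_on {a..b} \<and> (f has_integral (F b - F a)) {a..b})"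

lemma ac_abs: "ac F f \<Longrightarrow> f absolutely_integrable_on {a..b}"
  unfolding ac_def by (cases "a \<le> b") auto

lemma ac_int: "ac F f \<Longrightarrow> f integrable_on {a..b}"
  using ac_abs set_lebesgue_integral_eq_integral(1) by blast

lemma ac_has: "ac F f \<Longrightarrow> a \<le> b \<Longrightarrow> (f has_integral (F b - F a)) {a..b}"
  unfolding ac_def by auto

lemma ac_integral: "ac F f \<Longrightarrow> a \<le> b \<Longrightarrow> integral {a..b} f = F b - F a"
  using ac_has by blast

lemma ac_continuous: assumes "ac F f" shows "continuous_on S F"
proof -
  have "continuous (at x) F" for x
  proof -
    have "continuous_on {x-1..x+1} (\<lambda>y. F (x-1) + integral {x-1..y} f)"
      by (intro continuous_intros indefinite_integral_continuous_1 ac_int[OF assms])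
    moreover have "F (x-1) + integral {x-1..y} f = F y" if "y \<in> {x-1..x+1}" for y
      using ac_integral[OF assms, of "x-1" y] that by simp
    ultimately have "continuous_on {x-1..x+1} F"
      by (rule continuous_on_eq)
    then show ?thesis
      by (rule continuous_on_interior) simp
  qed
  then show ?thesis by (simp add: continuous_at_imp_continuous_on)
qed

lemma ac_linear: assumes "ac F f" "bounded_linear T" shows "ac (\<lambda>x. T (F x)) (\<lambda>x. T (f x))"
  unfolding ac_def
proof (intro allI impI conjI)
  fix a b :: real assume ab: "a \<le> b"
  show "(\<lambda>x. T (f x)) absolutely_integrable_on {a..b}"
    using absolutely_integrable_linear[OF ac_abs[OF assms(1)] assms(2)] by (simp add: o_def)
  have "T (F b) - T (F a) = T (F b - F a)"
    by (simp add: assms(2) linear_diff bounded_linear.linear)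
  then show "((\<lambda>x. T (f x)) has_integral T (F b) - T (F a)) {a..b}"
    using has_integral_linear[OF ac_has[OF assms(1) ab] assms(2)] by (simp add: o_def)
qed

lemma ac_add: assumes "ac F f" "ac G g" shows "ac (\<lambda>x. F x + G x) (\<lambda>x. f x + g x)"
  unfolding ac_def
proof (intro allI impI conjI)
  fix a b :: real assume ab: "a \<le> b"
  show "(\<lambda>x. f x + g x) absolutely_integrable_on {a..b}"
    using set_integral_add(1)[OF ac_abs[OF assms(1)] ac_abs[OF assms(2)]] by simp
  show "((\<lambda>x. f x + g x) has_integral (F b + G b - (F a + G a))) {a..b}"
    using has_integral_add[OF ac_has[OF assms(1) ab] ac_has[OF assms(2) ab]]
    by (simp add: algebra_simps)
qed

lemma ac_const: "ac (\<lambda>x. c) (\<lambda>x. 0)"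
  by (simp add: ac_def)

lemma ac_uminus: "ac F f \<Longrightarrow> ac (\<lambda>x. - F x) (\<lambda>x. - f x)"
  by (rule ac_linear[OF _ bounded_linear_minus[OF bounded_linear_ident]])

lemma ac_diff: assumes "ac F f" "ac G g" shows "ac (\<lambda>x. F x - G x) (\<lambda>x. f x - g x)"
  using ac_add[OF assms(1) ac_uminus[OF assms(2)]] by simp

lemma ac_cmult: fixes c :: "'a::{euclidean_space,real_normed_algebra}"
  shows "ac F f \<Longrightarrow> ac (\<lambda>x. c * F x) (\<lambda>x. c * f x)"
  by (rule ac_linear[OF _ bounded_linear_mult_right])

lemma ac_cong: assumes "ac F f" "\<And>x. F x = G x" "\<And>x. f x = g x" shows "ac G g"
proof -
  have "F = G" "f = g" using assms by auto
  then show ?thesis using assms(1) by simp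
qed

lemma ac_C1:
  assumes "\<And>x. (F has_vector_derivative f x) (at x)" "continuous_on UNIV f"
  shows "ac F f"
  unfolding ac_def
proof (intro allI impI conjI)
  fix a b :: real assume "a \<le> b"
  show "f absolutely_integrable_on {a..b}"
    using absolutely_integrable_continuous[of a b f] assms(2) continuous_on_subset
    by (auto simp: cbox_interval)
  show "(f has_integral F b - F a) {a..b}"
    using \<open>a \<le> b\<close> by (rule fundamental_theorem_of_calculus)
      (use assms in \<open>auto intro: has_vector_derivative_at_within\<close>)
qed

text \<open>Null sets are invisible to both integrals in \<open>ac\<close>. This is what allows the
  chosen representative of an \<open>L2\<close> element to be exchanged for any other in the
  derivative slot.\<close>

lemma ac_AE: assumes "ac F f" "AE x in lborel. f x = g x" shows "ac F g"
proof -
  obtain N where N: "negligible N" "\<And>x. x \<notin> N \<Longrightarrow> f x = g x"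
  proof -
    have "AE x in lebesgue. f x = g x"
      using assms(2) by (simp add: AE_completion)
    then obtain N where "N \<in> null_sets lebesgue" "\<And>x. x \<notin> N \<Longrightarrow> f x = g x"
      unfolding completion.AE_iff_null_sets by auto
    then show ?thesis using that[of N] by (auto simp: negligible_iff_null_sets)
  qed
  show ?thesis unfolding ac_def
  proof (intro allI impI conjI)
    fix a b :: real assume ab: "a \<le> b"
    show "g absolutely_integrable_on {a..b}"
      using absolutely_integrable_spike[OF ac_abs[OF assms(1), of a b] N(1)] N(2)
      by (metis DiffD2)
    show "(g has_integral F b - F a) {a..b}"
      using has_integral_spike[OF N(1) _ ac_has[OF assms(1) ab], of g] N(2) by auto
  qed
qed

lemma abs_int_cont_mult:
  fixes f G :: "real \<Rightarrow> 'a::{euclidean_space,real_normed_algebra}"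
  assumes "f absolutely_integrable_on {a..b}" "continuous_on {a..b} G"
  shows "(\<lambda>x. G x * f x) absolutely_integrable_on {a..b}"
    and "(\<lambda>x. f x * G x) absolutely_integrable_on {a..b}"
proof -
  have m: "G \<in> borel_measurable (lebesgue_on {a..b})"
    by (rule continuous_imp_measurable_on_sets_lebesgue[OF assms(2)]) auto
  have bd: "bounded (G ` {a..b})"
    by (intro compact_imp_bounded compact_continuous_image assms) auto
  have S: "{a..b} \<in> sets lebesgue" by auto
  have b1: "bilinear ((*) :: 'a \<Rightarrow> 'a \<Rightarrow> 'a)"
    using bilinear_conv_bounded_bilinear bounded_bilinear_mult by blast
  have b2: "bilinear (\<lambda>x y :: 'a. y * x)"
    using b1 unfolding bilinear_def by auto
  show "(\<lambda>x. G x * f x) absolutely_integrable_on {a..b}"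
    by (rule absolutely_integrable_bounded_measurable_product[OF b1 m S bd assms(1)])
  show "(\<lambda>x. f x * G x) absolutely_integrable_on {a..b}"
    by (rule absolutely_integrable_bounded_measurable_product[OF b2 m S bd assms(1)])
qed

lemma ac_mult:
  fixes F G :: "real \<Rightarrow> 'a::{euclidean_space,real_normed_algebra}"
  assumes F: "ac F f" and G: "ac G g"
  shows "ac (\<lambda>x. F x * G x) (\<lambda>x. f x * G x + F x * g x)"
proof -
  let ?j = "\<lambda>x. f x * G x + F x * g x"
  have A: "?j absolutely_integrable_on {a..b}" for a b
    by (intro set_integral_add(1) abs_int_cont_mult ac_abs[OF F] ac_abs[OF G]
        ac_continuous[OF F] ac_continuous[OF G])
  have I: "?j integrable_on {a..b}" for a b
    using A set_lebesgue_integral_eq_integral(1) by blast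
  have nf: "(\<lambda>t. norm (f t) + norm (g t)) integrable_on {a..b}" for a b
    by (intro integrable_add) (use ac_abs[OF F] ac_abs[OF G] in
      \<open>auto simp: absolutely_integrable_on_def\<close>)
  have key: "norm (F b * G b - F a * G a - integral {a..b} ?j)
      \<le> e * integral {a..b} (\<lambda>t. norm (f t) + norm (g t))" if "a \<le> b" "e > 0" for a b e
  proof -
    define P where "P = (\<lambda>x y. norm (F y * G y - F x * G x - integral {x..y} ?j)
      \<le> e * integral {x..y} (\<lambda>t. norm (f t) + norm (g t)))"
    have "P a b"
    proof (rule Bolzano[OF \<open>a \<le> b\<close>])
      fix x y z assume xyz: "P x y" "P y z" "x \<le> y" "y \<le> z"
      have e1: "integral {x..z} ?j = integral {x..y} ?j + integral {y..z} ?j"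
        using Henstock_Kurzweil_Integration.integral_combine[OF xyz(3,4) I] by simp
      have e2: "integral {x..z} (\<lambda>t. norm (f t) + norm (g t)) =
        integral {x..y} (\<lambda>t. norm (f t) + norm (g t)) + integral {y..z} (\<lambda>t. norm (f t) + norm (g t))"
        using Henstock_Kurzweil_Integration.integral_combine[OF xyz(3,4) nf] by simp
      have tri: "norm (r - p - (u + v)) \<le> norm (q - p - u) + norm (r - q - v)" for p q r u v :: 'a
        using norm_triangle_ineq[of "q - p - u" "r - q - v"] by (simp add: algebra_simps)
      have "norm (F z * G z - F x * G x - integral {x..z} ?j)
        \<le> norm (F y * G y - F x * G x - integral {x..y} ?j) + norm (F z * G z - F y * G y - integral {y..z} ?j)"
        unfolding e1 by (rule tri)
      then show "P x z"
        using xyz(1,2) unfolding P_def e2 distrib_left by linarith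
    next
      fix x assume "a \<le> x" "x \<le> b"
      have cF: "continuous (at x) F" and cG: "continuous (at x) G"
        using ac_continuous[OF F, of UNIV] ac_continuous[OF G, of UNIV]
        by (auto simp: continuous_on_eq_continuous_at)
      have e2: "e / 2 > 0" using \<open>e > 0\<close> by simp
      obtain d1 where d1: "d1 > 0" "\<forall>t. dist t x < d1 \<longrightarrow> dist (F t) (F x) < e/2"
        using cF[unfolded continuous_at_eps_delta, rule_format, OF e2] by blast
      obtain d2 where d2: "d2 > 0" "\<forall>t. dist t x < d2 \<longrightarrow> dist (G t) (G x) < e/2"
        using cG[unfolded continuous_at_eps_delta, rule_format, OF e2] by blast
      note d = d1(1) d1(2)[rule_format] d2(1) d2(2)[rule_format]
      have "P u v" if uv: "u \<le> x" "x \<le> v" "v - u < min d1 d2" for u v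
      proof -
        have le: "u \<le> v" using uv by simp
        have i1: "((\<lambda>t. f t * G v) has_integral (F v - F u) * G v) {u..v}"
          by (rule has_integral_mult_left[OF ac_has[OF F le]])
        have i2: "((\<lambda>t. F u * g t) has_integral F u * (G v - G u)) {u..v}"
          by (rule has_integral_mult_right[OF ac_has[OF G le]])
        have "((\<lambda>t. f t * G v + F u * g t - ?j t) has_integral
          ((F v - F u) * G v + F u * (G v - G u) - integral {u..v} ?j)) {u..v}"
          by (intro has_integral_diff has_integral_add i1 i2 integrable_integral I)
        moreover have "(F v - F u) * G v + F u * (G v - G u) = F v * G v - F u * G u"
          by (simp add: algebra_simps)
        ultimately have "((\<lambda>t. f t * G v + F u * g t - ?j t) has_integral
          (F v * G v - F u * G u - integral {u..v} ?j)) {u..v}" by simp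
        then have eq: "F v * G v - F u * G u - integral {u..v} ?j
            = integral {u..v} (\<lambda>t. f t * G v + F u * g t - ?j t)"
          and int: "(\<lambda>t. f t * G v + F u * g t - ?j t) integrable_on {u..v}"
          by (auto simp: integral_unique)
        have "norm (integral {u..v} (\<lambda>t. f t * G v + F u * g t - ?j t))
          \<le> integral {u..v} (\<lambda>t. e * (norm (f t) + norm (g t)))"
        proof (rule integral_norm_bound_integral[OF int])
          show "(\<lambda>t. e * (norm (f t) + norm (g t))) integrable_on {u..v}"
            by (intro integrable_on_mult_right nf)
          fix t assume t: "t \<in> {u..v}"
          have "dist t x < d1" "dist u x < d1" "dist v x < d2" "dist t x < d2"
            using t uv by (auto simp: dist_real_def)
          then have "dist (F t) (F x) < e/2" "dist (F u) (F x) < e/2" "dist (G v) (G x) < e/2" "dist (G t) (G x) < e/2"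
            using d by auto
          then have a: "norm (F u - F t) \<le> e" "norm (G v - G t) \<le> e"
            using dist_triangle2[of "F u" "F t" "F x"] dist_triangle2[of "G v" "G t" "G x"]
            by (simp_all add: dist_norm[symmetric])
          have "f t * G v + F u * g t - ?j t = f t * (G v - G t) + (F u - F t) * g t"
            by (simp add: algebra_simps)
          then have "norm (f t * G v + F u * g t - ?j t) \<le> norm (f t * (G v - G t)) + norm ((F u - F t) * g t)"
            by (simp add: norm_triangle_ineq)
          also have "\<dots> \<le> norm (f t) * norm (G v - G t) + norm (F u - F t) * norm (g t)"
            by (intro add_mono norm_mult_ineq)
          also have "\<dots> \<le> norm (f t) * e + e * norm (g t)"
            by (intro add_mono mult_left_mono mult_right_mono a) auto
          finally show "norm (f t * G v + F u * g t - ?j t) \<le> e * (norm (f t) + norm (g t))"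
            by (simp add: algebra_simps)
        qed
        then show ?thesis unfolding P_def eq by simp
      qed
      then show "\<exists>d>0. \<forall>u v. u \<le> x \<and> x \<le> v \<and> v - u < d \<longrightarrow> P u v"
        using d by (intro exI[of _ "min d1 d2"]) auto
    qed
    then show ?thesis unfolding P_def .
  qed
  show ?thesis unfolding ac_def
  proof (intro allI impI conjI A)
    fix a b :: real assume ab: "a \<le> b"
    let ?N = "integral {a..b} (\<lambda>t. norm (f t) + norm (g t))"
    have N: "?N \<ge> 0" by (intro integral_nonneg nf) auto
    have "norm (F b * G b - F a * G a - integral {a..b} ?j) \<le> 0"
    proof (rule field_le_epsilon)
      fix e :: real assume "e > 0"
      then have "norm (F b * G b - F a * G a - integral {a..b} ?j) \<le> e / (?N + 1) * ?N"
        using key[OF ab, of "e / (?N + 1)"] N by simp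
      also have "\<dots> \<le> e" using N \<open>e > 0\<close> by (simp add: field_simps)
      finally show "norm (F b * G b - F a * G a - integral {a..b} ?j) \<le> 0 + e" by simp
    qed
    then show "(?j has_integral (F b * G b - F a * G a)) {a..b}"
      using I[of a b] by (simp add: has_integral_integral)
  qed
qed

lemma ac_reflect: assumes "ac F f" shows "ac (\<lambda>x. F (- x)) (\<lambda>x. - f (- x))"
  unfolding ac_def
proof (intro allI impI conjI)
  fix a b :: real assume ab: "a \<le> b"
  have "(\<lambda>x. f (- x)) absolutely_integrable_on {a..b}"
    using ac_abs[OF assms, of "- b" "- a"] absolutely_integrable_reflect_real[where f=f and a="-b" and b="-a"] by simp
  from absolutely_integrable_linear[OF this bounded_linear_minus[OF bounded_linear_ident]]
  show "(\<lambda>x. - f (- x)) absolutely_integrable_on {a..b}"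
    by (simp add: o_def)
  have "((\<lambda>x. f (- x)) has_integral (F (- a) - F (- b))) {a..b}"
    using ac_has[OF assms, of "-b" "-a"] ab has_integral_reflect_real[where f=f and a="-b" and b="-a"] by simp
  from has_integral_neg[OF this] show "((\<lambda>x. - f (- x)) has_integral F (- b) - F (- a)) {a..b}"
    by simp
qed

lemma ac_mono: fixes F :: "real \<Rightarrow> real"
  assumes "ac F f" "a \<le> b" "\<And>x. x \<in> {a..b} \<Longrightarrow> f x \<ge> 0" shows "F a \<le> F b"
  using has_integral_nonneg[OF ac_has[OF assms(1,2)]] assms(3) by auto

lemma ac_indefinite:
  assumes "\<And>a b. f absolutely_integrable_on {a..b}"
  shows "\<exists>F. ac F f \<and> F c = 0"
proof -
  have i: "f integrable_on {a..b}" for a b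
    using assms set_lebesgue_integral_eq_integral(1) by blast
  define F where "F x = (if x \<ge> c then integral {c..x} f else - integral {x..c} f)" for x
  have "(f has_integral (F b - F a)) {a..b}" if "a \<le> b" for a b
  proof -
    have "F b - F a = integral {a..b} f"
      using that Henstock_Kurzweil_Integration.integral_combine[of a c b f]
        Henstock_Kurzweil_Integration.integral_combine[of a b c f]
        Henstock_Kurzweil_Integration.integral_combine[of c a b f] i
      by (auto simp: F_def algebra_simps)
    then show ?thesis using i by (simp add: has_integral_integral)
  qed
  then show ?thesis using assms by (intro exI[of _ F]) (auto simp: ac_def F_def)
qed

lemma ac_indef_cont:
  fixes f :: "real \<Rightarrow> 'a::euclidean_space"
  assumes "continuous_on UNIV f"
  shows "\<exists>F. (\<forall>x. (F has_vector_derivative f x) (at x)) \<and> ac F f \<and> F c = 0"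
proof -
  have "f absolutely_integrable_on {a..b}" for a b
    using absolutely_integrable_continuous[of a b f] assms continuous_on_subset
    by (auto simp: cbox_interval)
  then obtain F where F: "ac F f" "F c = 0" using ac_indefinite[of f c] by auto
  have "(F has_vector_derivative f x) (at x)" for x
  proof -
    have c: "continuous_on {x-1..x+1} f" using assms continuous_on_subset by blast
    have "((\<lambda>u. F (x-1) + integral {x-1..u} f) has_vector_derivative 0 + f x) (at x within {x-1..x+1})"
      by (intro has_vector_derivative_add has_vector_derivative_const
          integral_has_vector_derivative[OF c]) auto
    then have "(F has_vector_derivative 0 + f x) (at x within {x-1..x+1})"
      by (rule has_vector_derivative_transform[rotated 2])
        (use ac_integral[OF F(1)] in auto)
    then show ?thesis by (simp add: at_within_Icc_at)
  qed
  then show ?thesis using F by blast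
qed

text \<open>The integrating factor \<open>exp (K a - K x)\<close> removes the term with
  \<open>k\<close>. It is at most \<open>1\<close> because \<open>K\<close> increases on
  \<open>{a..b}\<close>, so it may be dropped in front of the nonnegative source.\<close>

lemma ac_gronwall:
  fixes E :: "real \<Rightarrow> real"
  assumes E: "ac E e" and k: "continuous_on UNIV k" and K: "ac K k"
    and s: "s integrable_on {a..b}" and ab: "a \<le> b"
    and le: "\<And>x. x \<in> {a..b} \<Longrightarrow> e x \<le> k x * E x + s x"
    and k0: "\<And>x. x \<in> {a..b} \<Longrightarrow> k x \<ge> 0" and s0: "\<And>x. x \<in> {a..b} \<Longrightarrow> s x \<ge> 0"
  shows "E b \<le> exp (K b - K a) * (E a + integral {a..b} s)"
proof -
  \<comment> \<open>A primitive of a continuous function in the sense of \<open>ac\<close> is a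
    classical one: it differs by a constant from the primitive provided by
    \<open>ac_indef_cont\<close>.\<close>
  have Kd: "(K has_vector_derivative k x) (at x)" for x
  proof -
    obtain K' where K': "\<forall>x. (K' has_vector_derivative k x) (at x)" "ac K' k" "K' 0 = 0"
      using ac_indef_cont[OF k, of 0] by blast
    define c where "c = K 0"
    have "K y = K' y + c" for y
      using ac_integral[OF K, of 0 y] ac_integral[OF K, of y 0] ac_integral[OF K'(2), of 0 y]
        ac_integral[OF K'(2), of y 0] K'(3) c_def by (cases "y \<ge> 0") auto
    then have eq: "K = (\<lambda>y. K' y + c)" by (rule ext)
    have "((\<lambda>y. K' y + c) has_vector_derivative k x + 0) (at x)"
      by (intro has_vector_derivative_add has_vector_derivative_const) (use K' in auto)
    then show ?thesis unfolding eq by simp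
  qed
  have Kc: "continuous_on UNIV K" by (rule ac_continuous[OF K])
  have "ac (\<lambda>x. exp (K a - K x)) (\<lambda>x. - k x * exp (K a - K x))"
  proof (rule ac_C1)
    show "((\<lambda>x. exp (K a - K x)) has_vector_derivative - k x * exp (K a - K x)) (at x)" for x
      using Kd[of x] unfolding has_real_derivative_iff_has_vector_derivative[symmetric]
      by (auto intro!: derivative_eq_intros)
    show "continuous_on UNIV (\<lambda>x. - k x * exp (K a - K x))"
      by (intro continuous_intros k Kc)
  qed
  from ac_mult[OF E this]
  have "ac (\<lambda>x. E x * exp (K a - K x)) (\<lambda>x. (e x - k x * E x) * exp (K a - K x))"
    by (rule ac_cong) (auto simp: algebra_simps)
  from ac_has[OF this ab]
  have h: "((\<lambda>x. (e x - k x * E x) * exp (K a - K x)) has_integral E b * exp (K a - K b) - E a) {a..b}"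
    by simp
  have "E b * exp (K a - K b) - E a \<le> integral {a..b} s"
  proof (rule has_integral_le[OF h integrable_integral[OF s]])
    fix x assume x: "x \<in> {a..b}"
    have "K a \<le> K x" using ac_mono[OF K, of a x] x k0 by auto
    then have "exp (K a - K x) \<le> 1" by simp
    then have "s x * exp (K a - K x) \<le> s x" using s0[OF x] by (simp add: mult_left_le)
    moreover have "(e x - k x * E x) * exp (K a - K x) \<le> s x * exp (K a - K x)"
      using le[OF x] by (intro mult_right_mono) auto
    ultimately show "(e x - k x * E x) * exp (K a - K x) \<le> s x" by linarith
  qed
  then have "exp (K b - K a) * (E b * exp (K a - K b)) \<le> exp (K b - K a) * (E a + integral {a..b} s)"
    by (intro mult_left_mono) auto
  then show ?thesis by (simp add: exp_diff)
qed

text \<open>Reflection \<open>x \<mapsto> - x\<close> turns a bound propagating to the left into one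
  propagating to the right.\<close>

lemma ac_gronwall_back:
  fixes E :: "real \<Rightarrow> real"
  assumes E: "ac E e" and k: "continuous_on UNIV k" and K: "ac K k"
    and s: "s integrable_on {a..b}" and ab: "a \<le> b"
    and le: "\<And>x. x \<in> {a..b} \<Longrightarrow> - e x \<le> k x * E x + s x"
    and k0: "\<And>x. x \<in> {a..b} \<Longrightarrow> k x \<ge> 0" and s0: "\<And>x. x \<in> {a..b} \<Longrightarrow> s x \<ge> 0"
  shows "E a \<le> exp (K b - K a) * (E b + integral {a..b} s)"
proof -
  have "E (- (- a)) \<le> exp ((- K (-(-a))) - (- K (-(-b)))) * (E (-(-b)) + integral {-b..-a} (\<lambda>x. s (-x)))"
  proof (rule ac_gronwall[OF ac_reflect[OF E]])
    show "continuous_on UNIV (\<lambda>x. k (- x))"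
      by (rule continuous_on_compose2[OF k]) (auto intro!: continuous_intros)
    show "ac (\<lambda>x. - K (- x)) (\<lambda>x. k (- x))"
      using ac_uminus[OF ac_reflect[OF K]] by simp
    show "(\<lambda>x. s (- x)) integrable_on {-b..-a}"
      using s integrable_reflect_real[where f=s and a=a and b=b] by simp
  qed (use ab le k0 s0 in auto)
  moreover have "integral {-b..-a} (\<lambda>x. s (-x)) = integral {a..b} s"
    using integral_reflect_real[where f=s and a=a and b=b] by simp
  ultimately show ?thesis by simp
qed

section \<open>Test functions\<close>

text \<open>Cauchy's function \<open>exp (- c / x)\<close>, flat at \<open>0\<close>, with a
  polynomial in \<open>1 / x\<close> in front so that the family is closed under
  differentiation.\<close>

definition flat :: "real \<Rightarrow> real poly \<Rightarrow> real \<Rightarrow> real"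
  where "flat c P x = (if x > 0 then poly P (1 / x) * exp (- c / x) else 0)"

text \<open>In the variable \<open>t = 1 / x\<close> the derivative is \<open>- t\<^sup>2\<close>
  times \<open>d/dt\<close>, which explains the factor \<open>[:0, 0, 1:]\<close> and the
  signs.\<close>

definition flat_deriv :: "real \<Rightarrow> real poly \<Rightarrow> real poly"
  where "flat_deriv c P = [:0, 0, 1:] * (smult c P - pderiv P)"

lemma poly_exp_decay:
  assumes "c > 0" shows "((\<lambda>t. t ^ n * poly P t * exp (- c * t)) \<longlongrightarrow> (0::real)) at_top"
proof (induction P arbitrary: n)
  case 0 then show ?case by simp
next
  case (pCons a P)
  have "((\<lambda>t. a * t ^ n * exp (- c * t)) \<longlongrightarrow> 0) at_top" using assms by real_asymp
  from tendsto_add[OF this pCons.IH[of "Suc n"]]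
  show ?case by (simp add: algebra_simps)
qed

lemma flat_has_derivative:
  assumes "c > 0" shows "(flat c P has_real_derivative flat c (flat_deriv c P) x) (at x)"
proof -
  consider "x > 0" | "x < 0" | "x = 0" by linarith
  then show ?thesis
  proof cases
    case 1
    have "((\<lambda>x. poly P (1 / x) * exp (- c / x)) has_real_derivative flat c (flat_deriv c P) x) (at x)"
      using 1 by (auto intro!: derivative_eq_intros simp: flat_def flat_deriv_def field_simps power2_eq_square)
    moreover have "eventually (\<lambda>y. flat c P y = poly P (1 / y) * exp (- c / y)) (nhds x)"
      using eventually_nhds_in_open[of "{0<..}" x] 1 by (auto simp: flat_def elim: eventually_mono)
    ultimately show ?thesis by (simp add: DERIV_cong_ev)
  next
    case 2
    have "eventually (\<lambda>y. flat c P y = 0) (nhds x)"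
      using eventually_nhds_in_open[of "{..<0}" x] 2 by (auto simp: flat_def elim: eventually_mono)
    moreover have "flat c (flat_deriv c P) x = 0" using 2 by (simp add: flat_def)
    ultimately show ?thesis by (simp add: DERIV_cong_ev)
  next
    case 3
    have "((\<lambda>y. flat c P y / y) \<longlongrightarrow> 0) (at_right 0)"
    proof -
      have "((\<lambda>t. t ^ 1 * poly P t * exp (- c * t)) \<longlongrightarrow> 0) at_top" by (rule poly_exp_decay[OF assms])
      from filterlim_compose[OF this filterlim_inverse_at_top_right]
      have "((\<lambda>y. inverse y * poly P (inverse y) * exp (- c * inverse y)) \<longlongrightarrow> 0) (at_right 0)" by simp
      moreover have "eventually (\<lambda>y. inverse y * poly P (inverse y) * exp (- c * inverse y) = flat c P y / y) (at_right (0::real))"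
        using eventually_at_right_less[of "0::real"] by eventually_elim (auto simp: flat_def field_simps)
      ultimately show ?thesis by (rule Lim_transform_eventually)
    qed
    moreover have "((\<lambda>y. flat c P y / y) \<longlongrightarrow> 0) (at_left 0)"
    proof (rule tendsto_eventually)
      show "eventually (\<lambda>y. flat c P y / y = 0) (at_left 0)"
        unfolding eventually_at_left_field by (intro exI[of _ "-1"]) (auto simp: flat_def)
    qed
    ultimately have "((\<lambda>y. flat c P y / y) \<longlongrightarrow> 0) (at 0)" by (simp add: filterlim_at_split)
    then show ?thesis using 3 by (simp add: has_field_derivative_iff flat_def)
  qed
qed

text \<open>One flat factor switches on at \<open>a\<close>, the other switches off at
  \<open>b\<close>. Arbitrary polynomial prefactors and finite sums make the set closed under
  derivatives, so smoothness of every order reduces to a single differentiation,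
  \<open>bumps_has_derivative\<close>.\<close>

inductive_set bumps :: "(real \<Rightarrow> real) set" where
  prod: "c > 0 \<Longrightarrow> (\<lambda>x. flat c P (x - a) * flat c Q (b - x)) \<in> bumps"
| add: "f \<in> bumps \<Longrightarrow> g \<in> bumps \<Longrightarrow> (\<lambda>x. f x + g x) \<in> bumps"

lemma bumps_has_derivative:
  "f \<in> bumps \<Longrightarrow> \<exists>f'\<in>bumps. \<forall>x. (f has_real_derivative f' x) (at x)"
proof (induction rule: bumps.induct)
  case (prod c P a Q b)
  let ?f' = "\<lambda>x. flat c (flat_deriv c P) (x - a) * flat c Q (b - x) + flat c P (x - a) * flat c (- flat_deriv c Q) (b - x)"
  have neg: "flat c (- R) y = - flat c R y" for R y by (simp add: flat_def)
  have "((\<lambda>x. flat c P (x - a) * flat c Q (b - x)) has_real_derivative ?f' x) (at x)" for x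
  proof -
    have 1: "((\<lambda>x. flat c P (x - a)) has_real_derivative flat c (flat_deriv c P) (x - a) * 1) (at x)"
      by (rule DERIV_chain2[OF flat_has_derivative[OF prod]]) (auto intro!: derivative_eq_intros)
    have 2: "((\<lambda>x. flat c Q (b - x)) has_real_derivative flat c (flat_deriv c Q) (b - x) * (-1)) (at x)"
      by (rule DERIV_chain2[OF flat_has_derivative[OF prod]]) (auto intro!: derivative_eq_intros)
    show ?thesis using DERIV_mult[OF 1 2] by (simp add: neg algebra_simps)
  qed
  moreover have "?f' \<in> bumps" by (intro bumps.intros prod)
  ultimately show ?case by (intro bexI[of _ ?f']) auto
next
  case (add f g)
  then obtain f' g' where "f' \<in> bumps" "g' \<in> bumps" "\<And>x. (f has_real_derivative f' x) (at x)"
    "\<And>x. (g has_real_derivative g' x) (at x)" by blast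
  then show ?case
    by (intro bexI[of _ "\<lambda>x. f' x + g' x"]) (auto intro: bumps.intros derivative_intros)
qed

lemma bumps_deriv: "f \<in> bumps \<Longrightarrow> (deriv ^^ n) f \<in> bumps"
proof (induction n)
  case (Suc n)
  then obtain f' where f': "f' \<in> bumps" "\<And>x. ((deriv ^^ n) f has_real_derivative f' x) (at x)"
    using bumps_has_derivative by blast
  then have "deriv ((deriv ^^ n) f) = f'" by (intro ext DERIV_imp_deriv)
  then show ?case using f' by simp
qed auto

lemma bumps_differentiable: "f \<in> bumps \<Longrightarrow> f differentiable_on UNIV"
  using bumps_has_derivative[of f] unfolding differentiable_on_def
  by (auto simp: real_differentiable_def)

lemma bumps_continuous: "f \<in> bumps \<Longrightarrow> continuous_on S f"
  using bumps_differentiable differentiable_imp_continuous_on continuous_on_subset by blast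

lemma bumps_support: "f \<in> bumps \<Longrightarrow> \<exists>R. \<forall>x. \<bar>x\<bar> > R \<longrightarrow> f x = 0"
proof (induction rule: bumps.induct)
  case (prod c P a Q b)
  show ?case by (rule exI[of _ "max \<bar>a\<bar> \<bar>b\<bar>"]) (auto simp: flat_def)
next
  case (add f g)
  then obtain R S where "\<forall>x. \<bar>x\<bar> > R \<longrightarrow> f x = 0" "\<forall>x. \<bar>x\<bar> > S \<longrightarrow> g x = 0" by blast
  then show ?case by (intro exI[of _ "max R S"]) auto
qed

lemma bumps_test_function: "f \<in> bumps \<Longrightarrow> test_function f"
  unfolding test_function_def using bumps_deriv bumps_differentiable bumps_support by blast

lemma bumps_cmult: "f \<in> bumps \<Longrightarrow> (\<lambda>x. k * f x) \<in> bumps"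
proof (induction rule: bumps.induct)
  case (prod c P a Q b)
  have "(\<lambda>x. k * (flat c P (x - a) * flat c Q (b - x))) = (\<lambda>x. flat c (smult k P) (x - a) * flat c Q (b - x))"
    by (auto simp: flat_def)
  then show ?case using bumps.prod[OF prod] by simp
next
  case (add f g)
  then show ?case using bumps.add by (simp add: distrib_left)
qed

text \<open>The primitive that vanishes on the left of the support is constant on the right of it,
  and this constant is the mean of \<open>f\<close>; mean zero therefore makes it a test
  function.\<close>

lemma bumps_primitive:
  assumes f: "f \<in> bumps" and R: "\<And>x. \<bar>x\<bar> > R \<Longrightarrow> f x = 0" and "R \<ge> 0"
    and I: "(f has_integral 0) {- R..R}"
  shows "\<exists>\<phi>. test_function \<phi> \<and> deriv \<phi> = f"
proof -
  obtain \<phi> where \<phi>: "\<And>x. (\<phi> has_vector_derivative f x) (at x)" "ac \<phi> f" "\<phi> (-R) = 0"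
    using ac_indef_cont[OF bumps_continuous[OF f], of "-R"] by blast
  have d: "(\<phi> has_real_derivative f x) (at x)" for x
    using \<phi>(1)[of x] by (simp add: has_real_derivative_iff_has_vector_derivative)
  then have df: "deriv \<phi> = f" by (intro ext DERIV_imp_deriv)
  have "(deriv ^^ n) \<phi> differentiable_on UNIV" for n
  proof (cases n)
    case 0
    then show ?thesis using d by (auto simp: differentiable_on_def real_differentiable_def)
  next
    case (Suc k)
    then have "(deriv ^^ n) \<phi> = (deriv ^^ k) f" by (simp only: funpow_Suc_right o_apply df)
    then show ?thesis using bumps_deriv[OF f] bumps_differentiable by simp
  qed
  moreover have "\<phi> x = 0" if "\<bar>x\<bar> > R" for x
  proof (cases "x < 0")
    case True
    then have "(f has_integral (\<phi> (-R) - \<phi> x)) {x..-R}" using that by (intro ac_has[OF \<phi>(2)]) auto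
    moreover have "(f has_integral 0) {x..-R}"
    proof (rule has_integral_spike_finite[of "{-R}"])
      show "((\<lambda>x. 0) has_integral 0) {x..-R}" by simp
    qed (use R in auto)
    ultimately have "\<phi> (-R) - \<phi> x = 0" by (rule has_integral_unique)
    then show ?thesis using \<phi>(3) by simp
  next
    case False
    then have "(f has_integral (\<phi> x - \<phi> R)) {R..x}" using that by (intro ac_has[OF \<phi>(2)]) auto
    moreover have "(f has_integral 0) {R..x}"
    proof (rule has_integral_spike_finite[of "{R}"])
      show "((\<lambda>x. 0) has_integral 0) {R..x}" by simp
    qed (use R \<open>R \<ge> 0\<close> in auto)
    moreover have "\<phi> R = 0" using has_integral_unique[OF I ac_has[OF \<phi>(2), of "-R" R]] \<phi>(3) assms(3) by simp
    ultimately show ?thesis using has_integral_unique by (metis diff_0_right)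
  qed
  ultimately show ?thesis using df unfolding test_function_def by blast
qed

section \<open>Fundamental lemma of the calculus of variations and the du Bois-Reymond lemma\<close>

definition bump :: "nat \<Rightarrow> real \<Rightarrow> real \<Rightarrow> real \<Rightarrow> real"
  where "bump n a b = (\<lambda>x. flat (1 / Suc n) 1 (x - a) * flat (1 / Suc n) 1 (b - x))"

lemma bump_in: "bump n a b \<in> bumps"
  unfolding bump_def by (intro bumps.prod) simp

lemma bump_bounds: "0 \<le> bump n a b x" "bump n a b x \<le> indicator {a<..<b} x"
proof -
  have f: "0 \<le> flat (1 / Suc n) 1 y" "flat (1 / Suc n) 1 y \<le> 1" for y by (auto simp: flat_def)
  show "0 \<le> bump n a b x" unfolding bump_def by (intro mult_nonneg_nonneg f)
  show "bump n a b x \<le> indicator {a<..<b} x"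
  proof (cases "x \<in> {a<..<b}")
    case True then show ?thesis unfolding bump_def using mult_le_one[OF f(2) f(1) f(2)] by simp
  next
    case False then show ?thesis by (auto simp: bump_def flat_def)
  qed
qed

text \<open>The exponent \<open>1 / Suc n\<close> tends to \<open>0\<close>, so both exponentials
  tend to \<open>1\<close> inside the open interval, while outside the bump vanishes for every
  \<open>n\<close>.\<close>

lemma bump_lim: "(\<lambda>n. bump n a b x) \<longlonglongrightarrow> indicator {a<..<b} x"
proof (cases "x \<in> {a<..<b}")
  case True
  have "(\<lambda>n. exp (- (1 / real (Suc n)) / (x - a)) * exp (- (1 / real (Suc n)) / (b - x))) \<longlonglongrightarrow> exp (- 0 / (x - a)) * exp (- 0 / (b - x))"
    by (intro tendsto_intros LIMSEQ_Suc[OF lim_1_over_n]) (use True in auto)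
  then show ?thesis using True by (simp add: bump_def flat_def)
next
  case False
  then have "bump n a b x = 0" for n using bump_bounds[of n a b x] by simp
  then show ?thesis using False by simp
qed

lemma bump_meas [measurable]: "bump n a b \<in> borel_measurable borel"
  using bumps_continuous[OF bump_in] by (intro borel_measurable_continuous_onI)

text \<open>The Borel sets on which the integral vanishes form a Dynkin system.\<close>

lemma AE_zero_of_interval_integrals_real:
  fixes w :: "real \<Rightarrow> real"
  assumes [measurable]: "w \<in> borel_measurable borel" and i: "\<And>a b. set_integrable lborel {a<..<b} w"
    and z: "\<And>a b. a < b \<Longrightarrow> (LINT x:{a<..<b}|lborel. w x) = 0"
  shows "AE x in lborel. w x = 0"
proof -
  have gen: "sets borel = sigma_sets UNIV (range (\<lambda>(a, b). {a <..< b::real}))"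
  proof -
    have eq: "(\<lambda>(a, b). box a b :: real set) = (\<lambda>(a, b). {a<..<b})" by (auto simp: box_real)
    have "sets borel = sigma_sets UNIV (range (\<lambda>(a, b). box a b :: real set))"
      by (subst borel_eq_box) (rule sets_measure_of, simp)
    then show ?thesis unfolding eq .
  qed
  have main: "AE x in lborel. x \<in> {- R<..<R} \<longrightarrow> w x = 0" for R :: real
  proof -
    let ?I = "{- R<..<R}"
    have all: "(LINT x:A \<inter> ?I|lborel. w x) = 0" if A: "A \<in> sets borel" for A
    proof -
      have A': "A \<in> sigma_sets UNIV (range (\<lambda>(a, b). {a <..< b::real}))"
        using A unfolding gen .
      have "Int_stable (range (\<lambda>(a, b). {a <..< b::real}))"
        unfolding Int_stable_def by (auto simp: Int_greaterThanLessThan)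
      moreover have "range (\<lambda>(a, b). {a <..< b::real}) \<subseteq> Pow UNIV" by simp
      ultimately show ?thesis using A'
      proof (induction rule: sigma_sets_induct_disjoint)
        case (basic A)
        then obtain a b where A: "A = {a<..<b}" by auto
        have "A \<inter> ?I = {max a (-R)<..<min b R}" unfolding A by auto
        then show ?case using z[of "max a (-R)" "min b R"]
          by (cases "max a (-R) < min b R") (auto simp: set_lebesgue_integral_def)
      next
        case empty then show ?case by (simp add: set_lebesgue_integral_def)
      next
        case (compl A)
        have [measurable]: "A \<in> sets borel"
          using compl(1) unfolding gen .
        have iA: "set_integrable lborel (A \<inter> ?I) w" "set_integrable lborel ((UNIV - A) \<inter> ?I) w"
          by (rule set_integrable_subset[OF i[of "-R" R]]; auto)+
        have "(LINT x:?I|lborel. w x) = (LINT x:(A \<inter> ?I) \<union> ((UNIV - A) \<inter> ?I)|lborel. w x)"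
          by (rule arg_cong[where f = "\<lambda>S. LINT x:S|lborel. w x"]) auto
        also have "\<dots> = (LINT x:A \<inter> ?I|lborel. w x) + (LINT x:(UNIV - A) \<inter> ?I|lborel. w x)"
          by (rule set_integral_Un[OF _ iA]) auto
        finally have eq: "(LINT x:?I|lborel. w x) = (LINT x:A \<inter> ?I|lborel. w x) + (LINT x:(UNIV - A) \<inter> ?I|lborel. w x)" .
        have "(LINT x:?I|lborel. w x) = 0"
        proof (cases "-R < R")
          case False
          then have "?I = {}" by simp
          then show ?thesis by (simp only: set_lebesgue_integral_def) simp
        qed (rule z)
        then show ?case using eq compl(2) by linarith
      next
        case (union A)
        have [measurable]: "A n \<in> sets borel" for n
          using union(2) unfolding gen by auto
        have "(LINT x:(\<Union>n. A n \<inter> ?I)|lborel. w x) = (\<Sum>n. LINT x:A n \<inter> ?I|lborel. w x)"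
        proof (rule lebesgue_integral_countable_add)
          show "set_integrable lborel (\<Union>n. A n \<inter> ?I) w"
            by (rule set_integrable_subset[OF i[of "-R" R]]) auto
        qed (use union(1) in \<open>auto simp: disjoint_family_on_def\<close>)
        moreover have "\<Union> (range A) \<inter> ?I = (\<Union>n. A n \<inter> ?I)" by auto
        moreover have "(\<Sum>n. LINT x:A n \<inter> ?I|lborel. w x) = 0" using union(3) by (simp only: suminf_zero)
        ultimately show ?case by (simp only:)
      qed
    qed
    \<comment> \<open>Where \<open>w\<close> has constant sign, a vanishing integral forces
      \<open>w\<close> to vanish almost everywhere. It is applied to the sets \<open>w > 0\<close>
      and \<open>w < 0\<close>, with \<open>s\<close> as the sign.\<close>
    have "AE x in lborel. indicator (P \<inter> ?I) x *\<^sub>R (s * w x) = 0"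
      if P: "P \<in> sets borel" "\<And>x. x \<in> P \<Longrightarrow> s * w x \<ge> 0" for P and s :: real
    proof -
      have si: "set_integrable lborel (P \<inter> ?I) (\<lambda>x. s * w x)"
        by (intro set_integrable_mult_right set_integrable_subset[OF i[of "-R" R]]) (use P in auto)
      have "(LINT x:P \<inter> ?I|lborel. s * w x) = 0" using all[OF P(1)] by (simp add: set_integral_mult_right)
      then show ?thesis using si P(2) unfolding set_lebesgue_integral_def set_integrable_def
        by (subst (asm) integral_nonneg_eq_0_iff_AE) (auto simp: indicator_def)
    qed
    note pn = this
    have "AE x in lborel. indicator ({x. w x > 0} \<inter> ?I) x *\<^sub>R (1 * w x) = 0" by (rule pn) auto
    moreover have "AE x in lborel. indicator ({x. w x < 0} \<inter> ?I) x *\<^sub>R (-1 * w x) = 0" by (rule pn) auto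
    ultimately show ?thesis by eventually_elim (auto simp: indicator_def split: if_splits)
  qed
  have "AE x in lborel. \<forall>n::nat. x \<in> {- real n<..<real n} \<longrightarrow> w x = 0"
    unfolding AE_all_countable using main by blast
  then show ?thesis
  proof eventually_elim
    case (elim x)
    obtain n :: nat where "real n > \<bar>x\<bar>" using reals_Archimedean2 by blast
    then have "x \<in> {- real n<..<real n}" by auto
    then show ?case using elim by blast
  qed
qed

lemma AE_zero_of_interval_integrals:
  fixes w :: "real \<Rightarrow> 'a::euclidean_space"
  assumes m: "w \<in> borel_measurable borel" and i: "\<And>a b. set_integrable lborel {a<..<b} w"
    and z: "\<And>a b. a < b \<Longrightarrow> (LINT x:{a<..<b}|lborel. w x) = 0"
  shows "AE x in lborel. w x = 0"
proof -
  have "AE x in lborel. w x \<bullet> b = 0" for b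
  proof (rule AE_zero_of_interval_integrals_real)
    show "(\<lambda>x. w x \<bullet> b) \<in> borel_measurable borel" using m by measurable
    fix c d :: real
    show "set_integrable lborel {c<..<d} (\<lambda>x. w x \<bullet> b)"
      using integrable_inner_left[OF i[of c d, unfolded set_integrable_def]]
      by (cases "b = 0") (auto simp: set_integrable_def)
    assume "c < d"
    have "integral\<^sup>L lborel (\<lambda>x. (indicator {c<..<d} x *\<^sub>R w x) \<bullet> b) = integral\<^sup>L lborel (\<lambda>x. indicator {c<..<d} x *\<^sub>R w x) \<bullet> b"
      using i[of c d] by (intro integral_inner_left) (auto simp: set_integrable_def)
    then show "(LINT x:{c<..<d}|lborel. w x \<bullet> b) = 0"
      using z[OF \<open>c < d\<close>] by (simp add: set_lebesgue_integral_def)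
  qed
  then have "AE x in lborel. \<forall>b\<in>Basis. w x \<bullet> b = 0" by (simp add: AE_ball_countable countable_finite)
  then show ?thesis by eventually_elim (simp add: euclidean_all_zero_iff)
qed

lemma bump_integral_lim:
  fixes v :: "real \<Rightarrow> 'a::euclidean_space"
  assumes m: "v \<in> borel_measurable borel" and i: "\<And>a b. set_integrable lborel {a<..<b} v"
  shows "(\<lambda>n. integral\<^sup>L lborel (\<lambda>x. bump n a b x *\<^sub>R v x)) \<longlonglongrightarrow> (LINT x:{a<..<b}|lborel. v x)"
    and "integrable lborel (\<lambda>x. bump n a b x *\<^sub>R v x)"
proof -
  have ind: "integrable lborel (\<lambda>x. norm (indicator {a<..<b} x *\<^sub>R v x))"
    using i[of a b] unfolding set_integrable_def by (rule integrable_norm)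
  have bd: "norm (bump n a b x *\<^sub>R v x) \<le> norm (indicator {a<..<b} x *\<^sub>R v x)" for n x
  proof -
    have "bump n a b x * norm (v x) \<le> indicator {a<..<b} x * norm (v x)"
      by (intro mult_right_mono bump_bounds) auto
    then show ?thesis using bump_bounds(1)[of n a b x] by simp
  qed
  have m': "(\<lambda>x. bump n a b x *\<^sub>R v x) \<in> borel_measurable lborel" for n using m by measurable
  show "(\<lambda>n. integral\<^sup>L lborel (\<lambda>x. bump n a b x *\<^sub>R v x)) \<longlonglongrightarrow> (LINT x:{a<..<b}|lborel. v x)"
    unfolding set_lebesgue_integral_def
  proof (rule integral_dominated_convergence[OF _ _ ind])
    show "(\<lambda>x. indicator {a<..<b} x *\<^sub>R v x) \<in> borel_measurable lborel" using m by measurable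
    show "AE x in lborel. (\<lambda>n. bump n a b x *\<^sub>R v x) \<longlonglongrightarrow> indicator {a<..<b} x *\<^sub>R v x"
      by (intro AE_I2 tendsto_scaleR bump_lim tendsto_const)
  qed (use m' bd in auto)
  show "integrable lborel (\<lambda>x. bump n a b x *\<^sub>R v x)"
    using bd by (intro Bochner_Integration.integrable_bound[OF ind m'] AE_I2) auto
qed

lemma AE_zero_of_test_integrals:
  fixes v :: "real \<Rightarrow> 'a::euclidean_space"
  assumes m: "v \<in> borel_measurable borel" and i: "\<And>a b. set_integrable lborel {a<..<b} v"
    and z: "\<And>f. f \<in> bumps \<Longrightarrow> integral\<^sup>L lborel (\<lambda>x. f x *\<^sub>R v x) = 0"
  shows "AE x in lborel. v x = 0"
proof (rule AE_zero_of_interval_integrals[OF m i])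
  fix a b :: real
  have "(\<lambda>n. 0) \<longlonglongrightarrow> (LINT x:{a<..<b}|lborel. v x)"
    using bump_integral_lim(1)[OF m i, of a b] z[OF bump_in] by simp
  then show "(LINT x:{a<..<b}|lborel. v x) = 0" using LIMSEQ_unique tendsto_const by blast
qed

text \<open>Two bumps, each weighted by the integral of the other, have a difference of mean zero,
  hence equal to the derivative of a test function. Testing with it and letting the bumps tend to
  indicators shows that the mean of \<open>v\<close> over any interval equals its mean
  \<open>c\<close> over \<open>{0<..<1}\<close>.\<close>

lemma du_bois_reymond:
  fixes v :: "real \<Rightarrow> 'a::euclidean_space"
  assumes m: "v \<in> borel_measurable borel" and i: "\<And>a b. set_integrable lborel {a<..<b} v"
    and z: "\<And>\<phi>. test_function \<phi> \<Longrightarrow> integral\<^sup>L lborel (\<lambda>x. deriv \<phi> x *\<^sub>R v x) = 0"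
  shows "\<exists>c. AE x in lborel. v x = c"
proof -
  let ?J = "\<lambda>n a b. integral\<^sup>L lborel (bump n a b)"
  have one: "set_integrable lborel {a<..<b} (\<lambda>x. 1 :: real)" for a b :: real
    unfolding set_integrable_def by (cases "a \<le> b") auto
  have Jlim: "(\<lambda>n. ?J n a b) \<longlonglongrightarrow> b - a" if "a < b" for a b
    using bump_integral_lim(1)[of "\<lambda>x. 1::real" a b] one that by (simp add: set_lebesgue_integral_def)
  have Jint: "integrable lborel (bump n a b)" for n a b
    using bump_integral_lim(2)[of "\<lambda>x. 1::real" n a b] one by simp
  define c where "c = (LINT x:{0<..<1}|lborel. v x)"
  have eq: "(LINT x:{a<..<b}|lborel. v x) = (b - a) *\<^sub>R c" if ab: "a < b" for a b
  proof -
    have "?J n 0 1 *\<^sub>R integral\<^sup>L lborel (\<lambda>x. bump n a b x *\<^sub>R v x) = ?J n a b *\<^sub>R integral\<^sup>L lborel (\<lambda>x. bump n 0 1 x *\<^sub>R v x)" for n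
    proof -
      define f where "f = (\<lambda>x. ?J n 0 1 * bump n a b x + (- ?J n a b) * bump n 0 1 x)"
      have f: "f \<in> bumps" unfolding f_def by (intro bumps.add bumps_cmult bump_in)
      define R where "R = max (max \<bar>a\<bar> \<bar>b\<bar>) 1"
      have R0: "f x = 0" if "\<bar>x\<bar> > R" for x
      proof -
        have "x \<notin> {a<..<b}" "x \<notin> {0<..<1}" using that by (auto simp: R_def)
        then have "bump n a b x = 0" "bump n 0 1 x = 0"
          using bump_bounds[of n a b x] bump_bounds[of n 0 1 x] by auto
        then show ?thesis by (simp add: f_def)
      qed
      have fi: "integrable lborel f" unfolding f_def using Jint by simp
      have "integral\<^sup>L lborel f = 0" unfolding f_def using Jint by simp
      then have "(f has_integral 0) UNIV" using has_integral_integral_lborel[OF fi] by simp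
      moreover have "f = (\<lambda>x. if x \<in> {-R..R} then f x else 0)"
        using R0 by (intro ext) auto
      ultimately have "(f has_integral 0) {-R..R}"
        using has_integral_restrict_UNIV[of "{-R..R}" f] by metis
      moreover have "R \<ge> 0" by (simp add: R_def)
      ultimately obtain \<phi> where "test_function \<phi>" "deriv \<phi> = f"
        using bumps_primitive[OF f R0] by blast
      then have "integral\<^sup>L lborel (\<lambda>x. f x *\<^sub>R v x) = 0" using z by blast
      moreover have "f x *\<^sub>R v x = ?J n 0 1 *\<^sub>R (bump n a b x *\<^sub>R v x) - ?J n a b *\<^sub>R (bump n 0 1 x *\<^sub>R v x)" for x
        by (simp add: f_def scaleR_left_diff_distrib)
      ultimately have z0: "integral\<^sup>L lborel (\<lambda>x. ?J n 0 1 *\<^sub>R (bump n a b x *\<^sub>R v x) - ?J n a b *\<^sub>R (bump n 0 1 x *\<^sub>R v x)) = 0"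
        by (simp only:)
      have e: "integral\<^sup>L lborel (\<lambda>x. ?J n 0 1 *\<^sub>R (bump n a b x *\<^sub>R v x) - ?J n a b *\<^sub>R (bump n 0 1 x *\<^sub>R v x))
        = ?J n 0 1 *\<^sub>R integral\<^sup>L lborel (\<lambda>x. bump n a b x *\<^sub>R v x) - ?J n a b *\<^sub>R integral\<^sup>L lborel (\<lambda>x. bump n 0 1 x *\<^sub>R v x)"
        by (subst Bochner_Integration.integral_diff)
          (auto intro!: integrable_scaleR_right bump_integral_lim(2)[OF m i] simp del: scaleR_scaleR)
      show ?thesis by (rule right_minus_eq[THEN iffD1, OF trans[OF sym[OF e] z0]])
    qed
    moreover have "(\<lambda>n. ?J n 0 1 *\<^sub>R integral\<^sup>L lborel (\<lambda>x. bump n a b x *\<^sub>R v x)) \<longlonglongrightarrow> (1 - 0) *\<^sub>R (LINT x:{a<..<b}|lborel. v x)"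
      by (intro tendsto_scaleR Jlim bump_integral_lim(1)[OF m i]) simp
    moreover have "(\<lambda>n. ?J n a b *\<^sub>R integral\<^sup>L lborel (\<lambda>x. bump n 0 1 x *\<^sub>R v x)) \<longlonglongrightarrow> (b - a) *\<^sub>R c"
      unfolding c_def by (intro tendsto_scaleR Jlim ab bump_integral_lim(1)[OF m i])
    ultimately have "(\<lambda>n. ?J n a b *\<^sub>R integral\<^sup>L lborel (\<lambda>x. bump n 0 1 x *\<^sub>R v x)) \<longlonglongrightarrow> (1 - 0) *\<^sub>R (LINT x:{a<..<b}|lborel. v x)"
      by simp
    then have "(1 - 0) *\<^sub>R (LINT x:{a<..<b}|lborel. v x) = (b - a) *\<^sub>R c"
      using LIMSEQ_unique \<open>(\<lambda>n. ?J n a b *\<^sub>R integral\<^sup>L lborel (\<lambda>x. bump n 0 1 x *\<^sub>R v x)) \<longlonglongrightarrow> (b - a) *\<^sub>R c\<close> by blast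
    then show ?thesis by simp
  qed
  have ic: "set_integrable lborel {a<..<b} (\<lambda>x. c)" for a b :: real
    unfolding set_integrable_def by (cases "a \<le> b") auto
  have "AE x in lborel. v x - c = 0"
  proof (rule AE_zero_of_interval_integrals)
    show "(\<lambda>x. v x - c) \<in> borel_measurable borel" using m by measurable
    show "set_integrable lborel {a<..<b} (\<lambda>x. v x - c)" for a b
      by (rule set_integral_diff(1)[OF i ic])
    fix a b :: real assume "a < b"
    then have "(LINT x:{a<..<b}|lborel. c) = (b - a) *\<^sub>R c" by (simp add: set_lebesgue_integral_def)
    then show "(LINT x:{a<..<b}|lborel. v x - c) = 0"
      using eq[OF \<open>a < b\<close>] set_integral_diff(2)[OF i ic] by simp
  qed
  then show ?thesis by (intro exI[of _ c]) (auto elim: eventually_mono)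
qed

text \<open>Borel-Caratheodory inequality for the logarithm \<open>g\<close> of \<open>E\<close>.
  The function \<open>q\<close>, which is \<open>M + 1 - g\<close> made real at \<open>0\<close>,
  has real part at least \<open>1\<close>, so its Cayley transform \<open>s\<close> maps the disc
  into itself and fixes \<open>0\<close>. By the Schwarz lemma \<open>cmod s \<le> 1/2\<close> on
  the half disc, whence \<open>cmod q \<le> 3 * a\<close>; the factor \<open>3\<close> is
  \<open>(1 + 1/2) / (1 - 1/2)\<close>.\<close>

lemma zero_free_disc_bound:
  assumes E: "E holomorphic_on ball 0 1" and nz: "\<And>z. z \<in> ball 0 1 \<Longrightarrow> E z \<noteq> 0"
    and M: "\<And>z. z \<in> ball 0 1 \<Longrightarrow> cmod (E z) \<le> exp M" and z: "cmod z \<le> 1/2"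
  shows "cmod (inverse (E z)) \<le> exp (3 * (M + 1 - ln (cmod (E 0))) - M)"
proof -
  obtain g where g: "g holomorphic_on ball 0 1" "\<And>z. z \<in> ball 0 1 \<Longrightarrow> E z = exp (g z)"
    using contractible_imp_holomorphic_log[OF E convex_imp_contractible[OF convex_ball]] nz by metis
  define q where "q z = complex_of_real (M + 1) - (g z - \<i> * of_real (Im (g 0)))" for z
  define a where "a = M + 1 - Re (g 0)"
  have q0: "q 0 = of_real a" by (simp add: q_def a_def complex_eq_iff)
  have Req: "Re (q z) \<ge> 1" if "z \<in> ball 0 1" for z
  proof -
    have "exp (Re (g z)) \<le> exp M" using M[OF that] g(2)[OF that] by simp
    then show ?thesis by (simp add: q_def)
  qed
  have a1: "a \<ge> 1" using Req[of 0] q0 by simp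
  have nz': "q z + of_real a \<noteq> 0" if "z \<in> ball 0 1" for z
  proof
    assume "q z + of_real a = 0"
    then have "Re (q z + of_real a) = 0" by simp
    then show False using Req[OF that] a1 by simp
  qed
  define s where "s z = (q z - of_real a) / (q z + of_real a)" for z
  have "s holomorphic_on ball 0 1"
    unfolding s_def q_def using nz' by (intro holomorphic_intros g) (auto simp: q_def)
  moreover have "s 0 = 0" by (simp add: s_def q0)
  moreover have "cmod (s w) < 1" if "cmod w < 1" for w
  proof -
    have w: "w \<in> ball 0 1" using that by simp
    have "(cmod (q w - of_real a))\<^sup>2 = (Re (q w) - a)\<^sup>2 + (Im (q w))\<^sup>2"
      by (simp add: cmod_power2)
    also have "\<dots> < (Re (q w) + a)\<^sup>2 + (Im (q w))\<^sup>2"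
    proof -
      have "Re (q w) * a > 0" using Req[OF w] a1 by (intro mult_pos_pos) linarith+
      then show ?thesis by (simp add: power2_eq_square algebra_simps)
    qed
    also have "\<dots> = (cmod (q w + of_real a))\<^sup>2" by (simp add: cmod_power2)
    finally have "cmod (q w - of_real a) < cmod (q w + of_real a)"
      by (rule power_less_imp_less_base) simp
    then show ?thesis using nz'[OF w] by (simp add: s_def norm_divide)
  qed
  ultimately have s: "cmod (s z) \<le> cmod z" using z by (intro Schwarz_Lemma(1)) auto
  then have s2: "cmod (s z) \<le> 1/2" using z by simp
  have zb: "z \<in> ball 0 1" using z by simp
  have "q z * (1 - s z) = of_real a * (1 + s z)"
    using nz'[OF zb] by (simp add: s_def field_simps)
  then have "cmod (q z) * cmod (1 - s z) = a * cmod (1 + s z)"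
    using a1 by (metis norm_mult norm_of_real abs_of_nonneg order_trans zero_le_one)
  moreover have "cmod (1 - s z) \<ge> 1/2" using s2 norm_triangle_ineq2[of 1 "s z"] by simp
  moreover have "cmod (1 + s z) \<le> 3/2" using s2 norm_triangle_ineq[of 1 "s z"] by simp
  ultimately have "cmod (q z) * (1/2) \<le> a * (3/2)"
    using a1 mult_left_mono[of "1/2" "cmod (1 - s z)" "cmod (q z)"] mult_left_mono[of "cmod (1 + s z)" "3/2" a]
    by linarith
  then have "Re (q z) \<le> 3 * a" using complex_Re_le_cmod[of "q z"] by linarith
  then have "- Re (g z) \<le> 3 * a - M" by (simp add: q_def)
  moreover have "cmod (inverse (E z)) = exp (- Re (g z))"
    using g(2)[OF zb] by (simp add: norm_inverse exp_minus)
  moreover have "ln (cmod (E 0)) = Re (g 0)" using g(2)[of 0] by simp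
  ultimately show ?thesis by (simp add: a_def)
qed

section \<open>Entire functions of order below two\<close>

lemma entire_divide_zero_order:
  assumes D: "D holomorphic_on UNIV" and "D a = 0" "\<exists>w. D w \<noteq> 0"
  shows "\<exists>Q n. Q holomorphic_on UNIV \<and> Q a \<noteq> 0 \<and> (\<forall>z. D z = (z - a) ^ n * Q z) \<and> 0 < n"
proof -
  have "\<not> D constant_on UNIV"
    using assms(2,3) unfolding constant_on_def by (metis UNIV_I)
  then obtain g r n where g: "0 < n" "0 < r" "g holomorphic_on ball a r"
    "\<And>w. w \<in> ball a r \<Longrightarrow> D w = (w - a) ^ n * g w" "\<And>w. w \<in> ball a r \<Longrightarrow> g w \<noteq> 0"
    using holomorphic_factor_zero_nonconstant[OF D open_UNIV connected_UNIV UNIV_I assms(2)]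
    by (metis (full_types))
  define Q where "Q z = (if z = a then g a else D z / (z - a) ^ n)" for z
  have 1: "Q holomorphic_on ball a r"
  proof -
    have "g w = Q w" if "w \<in> ball a r" for w using that g(4)[OF that] by (auto simp: Q_def)
    then show ?thesis by (rule holomorphic_transform[OF g(3)])
  qed
  have 2: "Q holomorphic_on (- {a})"
  proof -
    have "(\<lambda>z. D z / (z - a) ^ n) holomorphic_on (- {a})"
      by (intro holomorphic_intros holomorphic_on_subset[OF D]) auto
    then show ?thesis
      by (rule holomorphic_transform) (auto simp: Q_def)
  qed
  have "Q holomorphic_on (ball a r \<union> - {a})"
    by (rule holomorphic_on_Un[OF 1 2]) auto
  moreover have "ball a r \<union> - {a} = UNIV" using g(2) by auto
  ultimately have "Q holomorphic_on UNIV" by simp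
  moreover have "Q a \<noteq> 0" using g(2) g(5)[of a] by (simp add: Q_def)
  moreover have "D z = (z - a) ^ n * Q z" for z
    using g(1) assms(2) by (auto simp: Q_def)
  ultimately show ?thesis using g(1) by blast
qed

lemma cball_bound_from_sphere:
  assumes "f holomorphic_on UNIV" "\<And>z. cmod z = 1 \<Longrightarrow> cmod (f z) \<le> B" "cmod z \<le> 1"
  shows "cmod (f z) \<le> B"
proof (rule maximum_modulus_frontier[of f "cball 0 1"])
  show "f holomorphic_on interior (cball 0 1)" using assms(1) holomorphic_on_subset by blast
  show "continuous_on (closure (cball 0 1)) f"
    using assms(1) holomorphic_on_imp_continuous_on holomorphic_on_subset by blast
qed (use assms in auto)

text \<open>The zeros of \<open>D\<close> in the unit disc are moved out by Blaschke factors.\<close>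

lemma quotient_bound_unit_disc:
  assumes "F holomorphic_on UNIV" "D holomorphic_on UNIV" "D 0 \<noteq> 0"
    and "\<And>z. cmod z = 1 \<Longrightarrow> cmod (D z) \<le> exp M" "\<And>z. cmod z = 1 \<Longrightarrow> cmod (F z * D z) \<le> exp M"
    and "cmod z \<le> 1/2"
  shows "cmod (F z) \<le> exp (3 * (M + 1 - ln (cmod (D 0))))"
proof -
  have "finite {z \<in> cball 0 1. D z = 0}"
  proof (cases "D constant_on UNIV")
    case True
    then have "{z \<in> cball 0 1. D z = 0} = {}"
      using assms(3) unfolding constant_on_def by (metis (mono_tags, lifting) UNIV_I empty_Collect_eq)
    then show ?thesis by (metis finite.emptyI)
  next
    case False
    then show ?thesis
      by (intro holomorphic_compact_finite_zeros[OF assms(2)]) auto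
  qed
  then have "finite {z \<in> ball 0 1. D z = 0}" by (rule rev_finite_subset) auto
  then show ?thesis using assms(2-5)
  proof (induction "card {z \<in> ball 0 1. D z = 0}" arbitrary: D)
    case 0
    then have nz: "D w \<noteq> 0" if "w \<in> ball 0 1" for w using that by auto
    have DM: "cmod (D w) \<le> exp M" if "cmod w \<le> 1" for w
      by (rule cball_bound_from_sphere[OF 0(3) 0(5) that])
    have FM: "cmod (F w * D w) \<le> exp M" if "cmod w \<le> 1" for w
      by (rule cball_bound_from_sphere[OF _ 0(6) that]) (intro holomorphic_intros assms 0)
    have "cmod (inverse (D z)) \<le> exp (3 * (M + 1 - ln (cmod (D 0))) - M)"
      using assms(6) nz DM holomorphic_on_subset[OF 0(3)]
      by (intro zero_free_disc_bound) auto
    then have "cmod (F z * D z) * cmod (inverse (D z)) \<le> exp M * exp (3 * (M + 1 - ln (cmod (D 0))) - M)"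
      using FM[of z] assms(6) by (intro mult_mono) auto
    moreover have "cmod (F z * D z) * cmod (inverse (D z)) = cmod (F z)"
      using nz[of z] assms(6) by (simp add: norm_mult norm_inverse)
    ultimately show ?case by (simp add: exp_add[symmetric] algebra_simps)
  next
    case (Suc k)
    let ?Z = "\<lambda>D. {z \<in> ball 0 1. D z = (0::complex)}"
    obtain a where a: "cmod a < 1" "D a = 0"
      using Suc(2) by (metis (mono_tags, lifting) card.empty empty_Collect_eq mem_ball_0 nat.distinct(1))
    obtain Q n where Q: "Q holomorphic_on UNIV" "Q a \<noteq> 0" "\<And>z. D z = (z - a) ^ n * Q z" "0 < n"
      using entire_divide_zero_order[OF Suc(4) a(2)] Suc(5) by metis
    \<comment> \<open>On the unit circle \<open>1 - cnj a * z\<close> and \<open>z - a\<close> have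
      equal modulus, so both boundary hypotheses survive. Inside the disc the new factor has no
      zero, and at \<open>0\<close> it has modulus \<open>1\<close>, larger than
      \<open>cmod a\<close>: the term \<open>ln (cmod (D 0))\<close> can only improve. The induction
      is on the number of distinct zeros in the open disc.\<close>
    define D1 where "D1 z = (1 - cnj a * z) ^ n * Q z" for z
    have nz: "1 - cnj a * w \<noteq> 0" if "cmod w \<le> 1" for w
    proof
      assume "1 - cnj a * w = 0"
      then have "cmod (cnj a * w) = 1" by (metis eq_iff_diff_eq_0 norm_one)
      then have "cmod a * cmod w = 1" by (simp add: norm_mult)
      moreover have "cmod a * cmod w \<le> cmod a * 1" using that by (intro mult_left_mono) auto
      ultimately show False using a by simp
    qed
    have sph: "cmod (1 - cnj a * w) = cmod (w - a)" if "cmod w = 1" for w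
    proof -
      have "w * cnj w = 1" using that by (simp add: complex_norm_square[symmetric])
      then have "1 - cnj a * w = w * cnj (w - a)" by (simp add: algebra_simps)
      then show ?thesis using that by (metis complex_mod_cnj mult_1 norm_mult)
    qed
    have zs: "?Z D1 = ?Z D - {a}"
      using Q(2,3) nz Q(4) by (auto simp: D1_def)
    have D1D: "cmod (D1 w) = cmod (D w)" if "cmod w = 1" for w
      using sph[OF that] by (simp add: D1_def Q(3) norm_mult norm_power)
    have a0: "a \<noteq> 0" using a(2) Suc(5) by auto
    have "cmod (D 0) \<le> cmod (D1 0)"
    proof -
      have "cmod (D 0) = cmod a ^ n * cmod (Q 0)" by (simp add: Q(3) norm_mult norm_power)
      also have "\<dots> \<le> 1 * cmod (Q 0)"
        using a by (intro mult_right_mono power_le_one) auto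
      finally show ?thesis by (simp add: D1_def)
    qed
    then have ln: "ln (cmod (D 0)) \<le> ln (cmod (D1 0))" using Suc(5) by (intro ln_mono) auto
    have "cmod (F z) \<le> exp (3 * (M + 1 - ln (cmod (D1 0))))"
    proof (rule Suc(1))
      show "k = card (?Z D1)" unfolding zs using Suc(2,3) a
        by (subst card_Diff_singleton) auto
      show "finite (?Z D1)" unfolding zs using Suc(3) by simp
      show "D1 holomorphic_on UNIV" unfolding D1_def by (intro holomorphic_intros Q)
      show "D1 0 \<noteq> 0" using \<open>cmod (D 0) \<le> cmod (D1 0)\<close> Suc(5) by auto
      show "cmod (D1 w) \<le> exp M" if "cmod w = 1" for w using D1D[OF that] Suc(6)[OF that] by simp
      show "cmod (F w * D1 w) \<le> exp M" if "cmod w = 1" for w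
        using D1D[OF that] Suc(7)[OF that] by (simp add: norm_mult)
    qed
    also have "\<dots> \<le> exp (3 * (M + 1 - ln (cmod (D 0))))" using ln by simp
    finally show ?case .
  qed
qed

text \<open>Rescaling to the unit disc. On half the radius the exponent \<open>M\<close> is merely
  tripled and shifted by a constant, so a quotient inherits the order of growth of its numerator and
  denominator.\<close>

lemma entire_quotient_bound:
  assumes F: "F holomorphic_on UNIV" and D: "D holomorphic_on UNIV" and "D 0 \<noteq> 0" and "R > 0"
    and "\<And>z. cmod z = R \<Longrightarrow> cmod (D z) \<le> exp M" "\<And>z. cmod z = R \<Longrightarrow> cmod (F z * D z) \<le> exp M"
    and "cmod z \<le> R/2"
  shows "cmod (F z) \<le> exp (3 * (M + 1 - ln (cmod (D 0))))"
proof -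
  have h: "(\<lambda>z. f (of_real R * z)) holomorphic_on UNIV" if "f holomorphic_on UNIV" for f :: "complex \<Rightarrow> complex"
    using holomorphic_on_compose_gen[of "\<lambda>z. of_real R * z" UNIV f UNIV] that
    by (auto simp: o_def intro!: holomorphic_intros)
  have "cmod (F (of_real R * (z / of_real R))) \<le> exp (3 * (M + 1 - ln (cmod (D (of_real R * 0)))))"
    using assms by (intro quotient_bound_unit_disc[of "\<lambda>z. F (of_real R * z)" "\<lambda>z. D (of_real R * z)"] h)
      (auto simp: norm_mult norm_divide field_simps)
  then show ?thesis using assms(4) by simp
qed

section \<open>Phragmen-Lindeloef principle in quadrants\<close>

text \<open>The sector has half-opening \<open>pi / 4\<close>, so the argument of the power is at
  most \<open>\<beta> * pi / 4\<close>. For \<open>\<beta> < 2\<close> its cosine is positive, and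
  the real part is comparable with the modulus.\<close>

lemma Re_powr_sector:
  assumes "\<bar>Im s\<bar> \<le> Re s" "Re s > 0" "0 \<le> \<beta>" "\<beta> \<le> 2"
  shows "Re (s powr of_real \<beta>) \<ge> cos (\<beta> * pi / 4) * cmod s powr \<beta>"
proof -
  have s0: "s \<noteq> 0" using assms by auto
  have "\<bar>Im s / Re s\<bar> \<le> 1" using assms by simp
  then have A: "\<bar>Im (Ln s)\<bar> \<le> pi / 4"
    using arg_conv_arctan[OF assms(2)] Arg_eq_Im_Ln[OF s0] arctan_le_pi4 by metis
  have "Re (s powr of_real \<beta>) = exp (\<beta> * ln (cmod s)) * cos (\<beta> * Im (Ln s))"
    using s0 by (simp add: powr_def Re_exp)
  also have "\<dots> = cmod s powr \<beta> * cos (\<bar>\<beta> * Im (Ln s)\<bar>)"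
    using s0 by (simp add: powr_def)
  also have "\<dots> \<ge> cmod s powr \<beta> * cos (\<beta> * pi / 4)"
  proof (intro mult_left_mono cos_monotone_0_pi_le)
    have "\<beta> * \<bar>Im (Ln s)\<bar> \<le> \<beta> * (pi / 4)" using A assms by (intro mult_left_mono) auto
    then show "\<bar>\<beta> * Im (Ln s)\<bar> \<le> \<beta> * pi / 4" using assms by (simp add: abs_mult)
    have "\<beta> * pi \<le> 2 * pi" using assms by (intro mult_right_mono) auto
    then show "\<beta> * pi / 4 \<le> pi" using pi_gt_zero by linarith
  qed auto
  finally show ?thesis by (simp add: mult.commute)
qed

text \<open>A quadrant has opening \<open>\<pi> / 2\<close>, so the comparison function \<open>exp (- e w\<^sup>\<beta>)\<close> is available for every order
  \<open>\<beta> < 2\<close>.\<close>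

lemma phragmen_lindelof_quadrant:
  assumes F: "F holomorphic_on UNIV" and rho: "0 < \<rho>" "\<rho> < 2" and C: "C > 0"
    and gr: "\<And>z. cmod (F z) \<le> exp (C * (1 + cmod z) powr \<rho>)"
    and bd: "\<And>z. Re z = 0 \<or> Im z = 0 \<Longrightarrow> Re z \<ge> 0 \<Longrightarrow> Im z \<ge> 0 \<Longrightarrow> cmod (F z) \<le> B"
    and z: "Re z \<ge> 0" "Im z \<ge> 0"
  shows "cmod (F z) \<le> B"
proof -
  \<comment> \<open>Strictly between \<open>\<rho>\<close> and \<open>2\<close>: above
    \<open>\<rho>\<close> so that the damping beats the growth of \<open>F\<close>, below
    \<open>2\<close> so that \<open>\<delta>\<close> is positive.\<close>
  define \<beta> where "\<beta> = (\<rho> + 2) / 2"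
  have beta: "\<rho> < \<beta>" "\<beta> < 2" "\<beta> > 0" using rho by (auto simp: \<beta>_def)
  define \<delta> where "\<delta> = cos (\<beta> * pi / 4)"
  have dpos: "\<delta> > 0" unfolding \<delta>_def
    using beta pi_gt_zero by (intro cos_gt_zero_pi) (auto simp: field_simps intro: order_less_trans[of _ 0])
  \<comment> \<open>Rotation by \<open>- pi / 4\<close> makes the quadrant symmetric about the
    positive axis; the shift by \<open>1\<close> keeps its corner off the branch cut of the
    power.\<close>
  define s where "s w = w * Complex (1 / sqrt 2) (- 1 / sqrt 2) + 1" for w
  have Res: "Re (s w) = (Re w + Im w) / sqrt 2 + 1" "Im (s w) = (Im w - Re w) / sqrt 2" for w
    by (simp_all add: s_def field_simps)
  have sec: "\<bar>Im (s w)\<bar> \<le> Re (s w)" "Re (s w) > 0" "cmod (s w) \<ge> cmod w" if "Re w \<ge> 0" "Im w \<ge> 0" for w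
  proof -
    have "\<bar>Im w - Re w\<bar> / sqrt 2 \<le> (Re w + Im w) / sqrt 2"
      using that by (intro divide_right_mono) auto
    then show "\<bar>Im (s w)\<bar> \<le> Re (s w)" by (simp add: Res)
    have p: "(Re w + Im w) / sqrt 2 \<ge> 0" using that by simp
    then show "Re (s w) > 0" unfolding Res by linarith
    have "(cmod (s w))\<^sup>2 = ((Re w + Im w) / sqrt 2 + 1)\<^sup>2 + ((Im w - Re w) / sqrt 2)\<^sup>2"
      by (simp only: cmod_power2 Res)
    also have "\<dots> \<ge> ((Re w + Im w) / sqrt 2)\<^sup>2 + ((Im w - Re w) / sqrt 2)\<^sup>2"
      using p by (intro add_mono power_mono order_refl) auto
    also have "((Re w + Im w) / sqrt 2)\<^sup>2 + ((Im w - Re w) / sqrt 2)\<^sup>2 = (Re w)\<^sup>2 + (Im w)\<^sup>2"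
      by (simp add: power_divide power2_eq_square algebra_simps add_divide_distrib diff_divide_distrib)
    also have "\<dots> = (cmod w)\<^sup>2" by (simp add: cmod_power2)
    finally show "cmod (s w) \<ge> cmod w" by (rule power2_le_imp_le) simp
  qed
  have B0: "B \<ge> 0" using bd[of 0] norm_ge_zero[of "F 0"] by (simp del: norm_ge_zero)
  \<comment> \<open>For fixed \<open>e\<close> the damped function is below
    \<open>B + \<eta>\<close> on a sufficiently large arc and below \<open>B\<close> on the two
    axes, so the maximum principle applies on the quarter disc. The damping is removed at the very
    end by letting \<open>e\<close> tend to \<open>0\<close> at the fixed point
    \<open>z\<close>.\<close>
  have key: "cmod (F z) * exp (- e * Re (s z powr of_real \<beta>)) \<le> B" if e: "e > 0" for e
  proof -
    have "e * \<delta> > 0" using e dpos by simp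
    then have lim: "filterlim (\<lambda>R. e * \<delta> * R powr \<beta> - C * (1 + R) powr \<rho>) at_top at_top"
      using rho(1) beta(1) C by real_asymp
    show ?thesis
    proof (rule field_le_epsilon)
      fix \<eta> :: real assume eta: "\<eta> > 0"
      have "eventually (\<lambda>R. e * \<delta> * R powr \<beta> - C * (1 + R) powr \<rho> \<ge> - ln (B + \<eta>) \<and> R \<ge> cmod z + 1) at_top"
        using lim eventually_ge_at_top[of "cmod z + 1"] by (auto simp: filterlim_at_top eventually_conj_iff)
      then obtain R where R: "e * \<delta> * R powr \<beta> - C * (1 + R) powr \<rho> \<ge> - ln (B + \<eta>)" "R \<ge> cmod z + 1"
        using eventually_happens by fastforce
      define S where "S = {w. Re w \<ge> 0} \<inter> {w. Im w \<ge> 0} \<inter> cball 0 R"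
      have cl: "closed S" unfolding S_def
        by (intro closed_Int closed_halfspace_Re_ge closed_halfspace_Im_ge closed_cball)
      define G where "G w = F w * exp (- of_real e * s w powr of_real \<beta>)" for w
      have nG: "cmod (G w) = cmod (F w) * exp (- e * Re (s w powr of_real \<beta>))" for w
        by (simp add: G_def norm_mult)
      have "s w \<notin> \<real>\<^sub>\<le>\<^sub>0" if "w \<in> S" for w
        using sec(2)[of w] that complex_nonpos_Reals_iff[of "s w"] by (auto simp: S_def)
      then have holG: "G holomorphic_on S" unfolding G_def s_def
        by (intro holomorphic_intros holomorphic_on_subset[OF F]) auto
      have "cmod (G z) \<le> B + \<eta>"
      proof (rule maximum_modulus_frontier[of G S])
        show "G holomorphic_on interior S" using holG holomorphic_on_subset interior_subset by blast
        show "continuous_on (closure S) G" using cl holG holomorphic_on_imp_continuous_on by simp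
        show "bounded S" unfolding S_def by (meson bounded_Int bounded_cball)
        show "z \<in> S" using z R by (auto simp: S_def)
        fix w assume w: "w \<in> frontier S"
        then have wS: "w \<in> S" using cl frontier_subset_closed by blast
        then have w0: "Re w \<ge> 0" "Im w \<ge> 0" by (auto simp: S_def)
        have pw: "Re (s w powr of_real \<beta>) \<ge> \<delta> * cmod (s w) powr \<beta>"
          using Re_powr_sector[of "s w" \<beta>] sec[OF w0] beta unfolding \<delta>_def by simp
        have pw2: "\<delta> * cmod (s w) powr \<beta> \<ge> \<delta> * cmod w powr \<beta>"
          using sec(3)[OF w0] dpos beta by (intro mult_left_mono powr_mono2) auto
        have ex1: "exp (- e * Re (s w powr of_real \<beta>)) \<le> exp (- (e * \<delta> * cmod w powr \<beta>))"
          using pw pw2 e by simp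
        also have "\<dots> \<le> 1" using e dpos by simp
        finally have ex2: "exp (- e * Re (s w powr of_real \<beta>)) \<le> 1" .
        have "Re w = 0 \<or> Im w = 0 \<or> cmod w = R"
        proof (rule ccontr)
          assume "\<not> ?thesis"
          then have "w \<in> {w. Re w > 0} \<inter> {w. Im w > 0} \<inter> ball 0 R" using wS by (auto simp: S_def)
          moreover have "open ({w. Re w > 0} \<inter> {w. Im w > 0} \<inter> ball 0 R)"
            by (intro open_Int open_halfspace_Re_gt open_halfspace_Im_gt open_ball)
          moreover have "{w. Re w > 0} \<inter> {w. Im w > 0} \<inter> ball 0 R \<subseteq> S" by (auto simp: S_def)
          ultimately have "w \<in> interior S" using interior_maximal by blast
          then show False using w by (simp add: frontier_def)
        qed
        then show "cmod (G w) \<le> B + \<eta>"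
        proof (elim disjE)
          assume R': "cmod w = R"
          have "cmod (G w) \<le> exp (C * (1 + R) powr \<rho>) * exp (- (e * \<delta> * R powr \<beta>))"
            unfolding nG using gr[of w] ex1 R' by (intro mult_mono) auto
          also have "\<dots> = exp (- (e * \<delta> * R powr \<beta> - C * (1 + R) powr \<rho>))" by (simp flip: exp_add)
          also have "\<dots> \<le> exp (ln (B + \<eta>))" using R(1) by simp
          also have "\<dots> = B + \<eta>" using B0 eta by simp
          finally show ?thesis .
        next
          assume "Re w = 0"
          then have "cmod (F w) \<le> B" using bd w0 by auto
          then have "cmod (G w) \<le> B * 1" unfolding nG using ex2 B0 by (intro mult_mono) auto
          then show ?thesis using eta by simp
        next
          assume "Im w = 0"
          then have "cmod (F w) \<le> B" using bd w0 by auto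
          then have "cmod (G w) \<le> B * 1" unfolding nG using ex2 B0 by (intro mult_mono) auto
          then show ?thesis using eta by simp
        qed
      qed
      then show "cmod (F z) * exp (- e * Re (s z powr of_real \<beta>)) \<le> B + \<eta>" by (simp add: nG)
    qed
  qed
  have "((\<lambda>e. cmod (F z) * exp (- e * Re (s z powr of_real \<beta>))) \<longlongrightarrow> cmod (F z) * exp (- 0 * Re (s z powr of_real \<beta>))) (at_right 0)"
    by (intro tendsto_intros)
  then show ?thesis
    using tendsto_upperbound[OF _ _ trivial_limit_at_right_real] key
    by (metis (mono_tags, lifting) eventually_at_right_less mult_zero_left exp_zero mult.right_neutral eventually_mono minus_zero)
qed

text \<open>Outside the half-plane \<open>Re z \<le> - c\<close> the real axis cuts the plane into
  two quadrants with corner \<open>- c\<close>. Translation preserves the order of growth, with the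
  larger constant \<open>C'\<close>; the lower quadrant is moved to the upper one by the conjugate
  function \<open>cnj (F (cnj z))\<close>.\<close>

lemma entire_bounded_of_order_less_2:
  assumes F: "F holomorphic_on UNIV" and rho: "0 < \<rho>" "\<rho> < 2" and C: "C > 0" and c: "c \<ge> 0"
    and gr: "\<And>z. cmod (F z) \<le> exp (C * (1 + cmod z) powr \<rho>)"
    and b1: "\<And>z. Im z = 0 \<Longrightarrow> cmod (F z) \<le> B" and b2: "\<And>z. Re z \<le> - c \<Longrightarrow> cmod (F z) \<le> B"
  shows "cmod (F z) \<le> B"
proof (cases "Re z \<le> - c")
  case False
  define C' where "C' = C * (1 + c) powr \<rho>"
  have C': "C' > 0" using C c by (auto simp: C'_def)
  have gr': "cmod (F (w - of_real c)) \<le> exp (C' * (1 + cmod w) powr \<rho>)" for w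
  proof -
    have "1 + cmod (w - of_real c) \<le> 1 + (cmod w + c)"
      using norm_triangle_ineq4[of w "of_real c"] c by simp
    also have "\<dots> \<le> (1 + c) * (1 + cmod w)" using c by (simp add: algebra_simps)
    finally have "(1 + cmod (w - of_real c)) powr \<rho> \<le> ((1 + c) * (1 + cmod w)) powr \<rho>"
      using rho by (intro powr_mono2) auto
    also have "\<dots> = (1 + c) powr \<rho> * (1 + cmod w) powr \<rho>" using c by (simp add: powr_mult)
    finally have "C * (1 + cmod (w - of_real c)) powr \<rho> \<le> C' * (1 + cmod w) powr \<rho>"
      using C by (simp add: C'_def mult.assoc)
    then show ?thesis using gr[of "w - of_real c"] by (meson exp_le_cancel_iff order_trans)
  qed
  have hol: "(\<lambda>w. F (w - of_real c)) holomorphic_on UNIV"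
    using holomorphic_on_compose_gen[of "\<lambda>w. w - of_real c" UNIV F UNIV] F
    by (simp add: o_def holomorphic_on_diff holomorphic_on_ident)
  show ?thesis
  proof (cases "Im z \<ge> 0")
    case True
    have "cmod (F ((z + of_real c) - of_real c)) \<le> B"
      by (rule phragmen_lindelof_quadrant[OF hol rho C' gr']) (use b1 b2 True False in auto)
    then show ?thesis by simp
  next
    case im: False
    define G where "G w = cnj (F (cnj (w - of_real c)))" for w
    have c1: "(cnj \<circ> F \<circ> cnj) holomorphic_on UNIV"
      using F by (subst holomorphic_on_compose_cnj_cnj) auto
    have c2: "(\<lambda>w. w - of_real c) holomorphic_on UNIV" by (intro holomorphic_intros)
    have "((cnj \<circ> F \<circ> cnj) \<circ> (\<lambda>w. w - of_real c)) holomorphic_on UNIV"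
      by (rule holomorphic_on_compose_gen[OF c2 c1]) auto
    moreover have "(cnj \<circ> F \<circ> cnj) \<circ> (\<lambda>w. w - of_real c) = G" by (auto simp: G_def)
    ultimately have holG: "G holomorphic_on UNIV" by simp
    have "cmod (G (cnj z + of_real c)) \<le> B"
    proof (rule phragmen_lindelof_quadrant[OF holG rho C'])
      show "cmod (G w) \<le> exp (C' * (1 + cmod w) powr \<rho>)" for w
        using gr'[of "cnj w"] by (simp add: G_def)
      show "cmod (G w) \<le> B" if "Re w = 0 \<or> Im w = 0" "Re w \<ge> 0" "Im w \<ge> 0" for w
        using that b1[of "cnj (w - of_real c)"] b2[of "cnj (w - of_real c)"] by (auto simp: G_def)
    qed (use im False in auto)
    then show ?thesis by (simp add: G_def)
  qed
qed (use b2 in auto)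

section \<open>Removable singularities and integrals depending on a parameter\<close>

text \<open>The zeros of \<open>D\<close> are isolated because \<open>D\<close> is not identically
  zero, and boundedness makes each of them a removable singularity of \<open>F\<close>; the
  extension takes the limit as its value there.\<close>

lemma entire_extension:
  assumes D: "D holomorphic_on UNIV" and nc: "\<exists>w. D w \<noteq> 0"
    and F: "F holomorphic_on {z. D z \<noteq> 0}"
    and bd: "\<And>z. D z = 0 \<Longrightarrow> \<exists>B. eventually (\<lambda>w. cmod (F w) \<le> B) (at z)"
  shows "\<exists>G. G holomorphic_on UNIV \<and> (\<forall>z. D z \<noteq> 0 \<longrightarrow> G z = F z)"
proof -
  have iso: "\<exists>r>0. \<forall>w\<in>ball z r - {z}. D w \<noteq> 0" for z
  proof (cases "D z = 0")
    case True
    obtain Q n where Q: "Q holomorphic_on UNIV" "Q z \<noteq> 0" "\<And>w. D w = (w - z) ^ n * Q w" "0 < n"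
      using entire_divide_zero_order[OF D True nc] by metis
    have "continuous (at z) Q"
      using holomorphic_on_imp_continuous_on[OF Q(1)] by (simp add: continuous_on_eq_continuous_at)
    from continuous_at_avoid[OF this Q(2)]
    obtain r where "r > 0" "\<And>w. dist z w < r \<Longrightarrow> Q w \<noteq> 0" by blast
    then show ?thesis using Q(3) by (intro exI[of _ r]) auto
  next
    case False
    have "continuous (at z) D"
      using holomorphic_on_imp_continuous_on[OF D] by (simp add: continuous_on_eq_continuous_at)
    from continuous_at_avoid[OF this False]
    obtain r where "r > 0" "\<And>w. dist z w < r \<Longrightarrow> D w \<noteq> 0" by blast
    then show ?thesis by (intro exI[of _ r]) auto
  qed
  define G where "G z = (if D z \<noteq> 0 then F z else Lim (at z) F)" for z
  have "\<exists>r>0. G holomorphic_on ball z r" for z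
  proof -
    obtain r where r: "r > 0" "\<And>w. w \<in> ball z r - {z} \<Longrightarrow> D w \<noteq> 0" using iso by blast
    have F1: "F holomorphic_on ball z r - {z}" by (rule holomorphic_on_subset[OF F]) (use r in auto)
    show ?thesis
    proof (cases "D z = 0")
      case True
      have "\<exists>g. g holomorphic_on ball z r \<and> (\<forall>w\<in>ball z r - {z}. g w = F w)"
        using holomorphic_on_extend_bounded[OF F1] r bd[OF True] by auto
      then obtain g where g: "g holomorphic_on ball z r" "\<And>w. w \<in> ball z r - {z} \<Longrightarrow> g w = F w" by blast
      have "continuous (at z) g"
        using g(1) r(1) holomorphic_on_imp_continuous_on continuous_on_interior by fastforce
      then have "(g \<longlongrightarrow> g z) (at z)" by (simp add: continuous_at)
      moreover have "eventually (\<lambda>w. g w = F w) (at z)"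
        unfolding eventually_at using r(1) g(2) by (intro exI[of _ r]) (auto simp: dist_commute)
      ultimately have "(F \<longlongrightarrow> g z) (at z)" by (rule Lim_transform_eventually)
      then have "G z = g z" using True by (simp add: G_def tendsto_Lim)
      then have Gz: "G z = g z" .
      have gG: "g w = G w" if w: "w \<in> ball z r" for w
      proof (cases "w = z")
        case False
        then have wz: "w \<in> ball z r - {z}" using w by blast
        show ?thesis using r(2)[OF wz] g(2)[OF wz] by (simp add: G_def)
      qed (use Gz in simp)
      show ?thesis using holomorphic_transform[OF g(1) gG] r(1) by blast
    next
      case False
      then have "ball z r \<subseteq> {z. D z \<noteq> 0}" using r(2) by blast
      then have "F holomorphic_on ball z r" by (rule holomorphic_on_subset[OF F])
      moreover have "F w = G w" if w: "w \<in> ball z r" for w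
      proof (cases "w = z")
        case False
        then have wz: "w \<in> ball z r - {z}" using w by blast
        show ?thesis using r(2)[OF wz] by (simp add: G_def)
      qed (use False in \<open>simp add: G_def\<close>)
      ultimately have "G holomorphic_on ball z r" by (rule holomorphic_transform)
      then show ?thesis using r(1) by blast
    qed
  qed
  then have "G field_differentiable at z" for z
    by (meson centre_in_ball holomorphic_on_imp_differentiable_at open_ball)
  then have "G holomorphic_on UNIV" by (auto simp: holomorphic_on_def)
  then show ?thesis by (intro exI[of _ G]) (auto simp: G_def)
qed

text \<open>Cauchy's inequality on discs of half the radius turns the majorant \<open>w\<close> of
  \<open>g\<close> into the majorant \<open>w y * (2 / e)\<close> of its derivative in
  \<open>z\<close>, hence of all nearby difference quotients. Dominated convergence then
  differentiates under the integral.\<close>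

lemma holomorphic_integral_parameter:
  fixes g :: "complex \<Rightarrow> 'a \<Rightarrow> complex"
  assumes S: "open S" and hol: "\<And>y. (\<lambda>z. g z y) holomorphic_on S"
    and meas: "\<And>z. z \<in> S \<Longrightarrow> g z \<in> borel_measurable M"
    and dom: "\<And>z. z \<in> S \<Longrightarrow> \<exists>e>0. \<exists>w. cball z e \<subseteq> S \<and> integrable M w \<and>
      (\<forall>z'\<in>cball z e. \<forall>y. cmod (g z' y) \<le> w y)"
  shows "(\<lambda>z. integral\<^sup>L M (g z)) holomorphic_on S"
proof -
  have "(\<lambda>z. integral\<^sup>L M (g z)) field_differentiable at z" if zS: "z \<in> S" for z
  proof -
    obtain e w where e: "e > 0" "cball z e \<subseteq> S" "integrable M w"
      "\<And>z' y. z' \<in> cball z e \<Longrightarrow> cmod (g z' y) \<le> w y" using dom[OF zS] by blast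
    have int: "integrable M (g z')" if "z' \<in> cball z e" for z'
    proof (rule Bochner_Integration.integrable_bound[OF e(3)])
      show "g z' \<in> borel_measurable M" using meas that e(2) by blast
      show "AE y in M. norm (g z' y) \<le> norm (w y)"
        using e(4)[OF that] by (intro AE_I2) (smt (verit) norm_ge_zero real_norm_def)
    qed
    have der: "cmod (deriv (\<lambda>z. g z y) v) \<le> w y * (2 / e)" if v: "v \<in> cball z (e/2)" for v y
    proof -
      have sub: "cball v (e/2) \<subseteq> cball z e"
      proof
        fix x assume "x \<in> cball v (e/2)"
        then show "x \<in> cball z e" using v dist_triangle[of z x v] by auto
      qed
      have h: "(\<lambda>z. g z y) holomorphic_on cball v (e/2)"
        using hol holomorphic_on_subset sub e(2) by blast
      have "norm ((deriv ^^ 1) (\<lambda>z. g z y) v) \<le> fact 1 * w y / (e/2) ^ 1"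
      proof (rule Cauchy_inequality)
        show "(\<lambda>z. g z y) holomorphic_on ball v (e/2)" using h holomorphic_on_subset ball_subset_cball by blast
        show "continuous_on (cball v (e/2)) (\<lambda>z. g z y)" using h holomorphic_on_imp_continuous_on by blast
        show "cmod (g x y) \<le> w y" if "cmod (v - x) = e / 2" for x
          using e(4) sub that by (auto simp: subset_iff dist_norm)
      qed (use e in auto)
      then show ?thesis by (simp add: field_simps)
    qed
    have lip: "cmod (g a y - g z y) \<le> w y * (2 / e) * cmod (a - z)" if "a \<in> cball z (e/2)" for a y
    proof (rule field_differentiable_bound[of "cball z (e/2)" "\<lambda>z. g z y" "deriv (\<lambda>z. g z y)"])
      show "((\<lambda>z. g z y) has_field_derivative deriv (\<lambda>z. g z y) v) (at v within cball z (e/2))"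
        if "v \<in> cball z (e/2)" for v
      proof -
        have "v \<in> S" using that e(1,2) by (auto simp: subset_iff)
        then show ?thesis
          using holomorphic_derivI[OF hol S] has_field_derivative_at_within by blast
      qed
    qed (use der that e in auto)
    define d where "d y = deriv (\<lambda>z. g z y) z" for y
    have "((\<lambda>a. (integral\<^sup>L M (g a) - integral\<^sup>L M (g z)) / (a - z)) \<longlongrightarrow> integral\<^sup>L M d) (at z)"
      unfolding tendsto_at_iff_sequentially
    proof (intro allI impI)
      fix X :: "nat \<Rightarrow> complex" assume X: "\<forall>i. X i \<in> UNIV - {z}" "X \<longlonglongrightarrow> z"
      obtain N where N: "\<And>n. n \<ge> N \<Longrightarrow> dist (X n) z < e / 2"
        using metric_LIMSEQ_D[OF X(2), of "e/2"] e(1) by auto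
      define Y where "Y n = X (n + N)" for n
      have Y: "Y \<longlonglongrightarrow> z" "\<And>n. Y n \<noteq> z" "\<And>n. Y n \<in> cball z (e/2)"
        using LIMSEQ_ignore_initial_segment[OF X(2)] X(1) N unfolding Y_def
        by (auto simp: dist_commute less_imp_le)
      have Ye: "Y n \<in> cball z e" "z \<in> cball z e" for n using Y(3)[of n] e(1) by auto
      have q: "(\<lambda>n. (g (Y n) y - g z y) / (Y n - z)) \<longlonglongrightarrow> d y" for y
      proof -
        have "((\<lambda>z. g z y) has_field_derivative d y) (at z)"
          unfolding d_def by (rule holomorphic_derivI[OF hol S zS])
        then have "((\<lambda>a. (g a y - g z y) / (a - z)) \<longlongrightarrow> d y) (at z)"
          by (simp add: has_field_derivative_iff)
        then show ?thesis using Y(1,2) unfolding tendsto_at_iff_sequentially by (auto simp: o_def)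
      qed
      have mq: "(\<lambda>y. (g (Y n) y - g z y) / (Y n - z)) \<in> borel_measurable M" for n
        using borel_measurable_integrable[OF int[OF Ye(1)[of n]]] borel_measurable_integrable[OF int[OF Ye(2)]] by measurable
      have "(\<lambda>n. integral\<^sup>L M (\<lambda>y. (g (Y n) y - g z y) / (Y n - z))) \<longlonglongrightarrow> integral\<^sup>L M d"
      proof (rule integral_dominated_convergence)
        show "d \<in> borel_measurable M"
          by (rule borel_measurable_LIMSEQ_metric[OF mq q])
        show "integrable M (\<lambda>y. w y * (2 / e))" using e(3) by simp
        show "AE y in M. norm ((g (Y n) y - g z y) / (Y n - z)) \<le> w y * (2 / e)" for n
          using lip[OF Y(3)[of n]] Y(2)[of n] by (auto simp: norm_divide divide_le_eq)
      qed (use q mq in auto)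
      moreover have "integral\<^sup>L M (\<lambda>y. (g (Y n) y - g z y) / (Y n - z)) =
        (integral\<^sup>L M (g (Y n)) - integral\<^sup>L M (g z)) / (Y n - z)" for n
        using int[OF Ye(1)] int[OF Ye(2)] by simp
      ultimately have "(\<lambda>n. (integral\<^sup>L M (g (Y n)) - integral\<^sup>L M (g z)) / (Y n - z)) \<longlonglongrightarrow> integral\<^sup>L M d"
        by (simp only:)
      then show "((\<lambda>a. (integral\<^sup>L M (g a) - integral\<^sup>L M (g z)) / (a - z)) \<circ> X) \<longlonglongrightarrow> integral\<^sup>L M d"
        unfolding o_def Y_def by (rule LIMSEQ_offset)
    qed
    then show ?thesis
      unfolding field_differentiable_def has_field_derivative_iff by blast
  qed
  then show ?thesis by (auto simp: holomorphic_on_def intro: field_differentiable_at_within)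
qed

section \<open>The Hilbert space\<close>

lemma L2_eq_refl: "square_integrable f \<Longrightarrow> L2_eq f f"
  by (simp add: L2_eq_def)

lemma L2_eq_rep: "L2_eq (rep_L2 u) (rep_L2 u)"
  using Quotient_rep_reflp[OF Quotient_L2] .

lemma sq_rep: "square_integrable (rep_L2 u)"
  using L2_eq_rep by (simp add: L2_eq_def)

lemma rep_abs: "square_integrable f \<Longrightarrow> AE x in lborel. rep_L2 (abs_L2 f) x = f x"
  using Quotient_rep_abs[OF Quotient_L2 L2_eq_refl] by (simp add: L2_eq_def)

lemma abs_rep: "abs_L2 (rep_L2 u) = u"
  using Quotient_abs_rep[OF Quotient_L2] .

lemma abs_eq: "L2_eq f g \<Longrightarrow> abs_L2 f = abs_L2 g"
  using Quotient_rel_abs[OF Quotient_L2] .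

lemma L2_eqI: assumes "AE x in lborel. rep_L2 u x = rep_L2 v x" shows "u = v"
proof -
  have "abs_L2 (rep_L2 u) = abs_L2 (rep_L2 v)"
    by (rule abs_eq) (use assms sq_rep in \<open>simp add: L2_eq_def\<close>)
  then show ?thesis by (simp add: abs_rep)
qed

lemma rep_eq_op:
  assumes "u = abs_L2 f" "square_integrable f" shows "AE x in lborel. rep_L2 u x = f x"
  using assms rep_abs by simp

lemma rep_diff: "AE x in lborel. rep_L2 (u - v) x = rep_L2 u x - rep_L2 v x"
  by (rule rep_eq_op) (auto simp: minus_L2_def intro!: square_integrable_diff sq_rep)

lemma rep_scaleC: "AE x in lborel. rep_L2 (c *\<^sub>C v) x = c *s rep_L2 v x"
  by (rule rep_eq_op) (auto simp: scaleC_L2_def intro!: square_integrable_scaleC sq_rep)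

lemma rep_0: "AE x in lborel. rep_L2 0 x = 0"
  by (rule rep_eq_op) (auto simp: zero_L2_def)

lemma norm_L2_eq: "norm u = sqrt (integral\<^sup>L lborel (\<lambda>x. (norm (rep_L2 u x))\<^sup>2))"
  by (simp add: norm_L2_def)

lemma norm_L2_sq: "(norm u)\<^sup>2 = integral\<^sup>L lborel (\<lambda>x. (norm (rep_L2 u x))\<^sup>2)"
  by (simp add: norm_L2_eq)

lemma inner_L2_eq: "u \<bullet> v = integral\<^sup>L lborel (\<lambda>x. rep_L2 u x \<bullet> rep_L2 v x)"
  by (simp add: inner_L2_def)

lemma scaleC_inner: "(c *s a) \<bullet> (c *s b) = (cmod c)\<^sup>2 * (a \<bullet> b)" for a b :: "complex^2"
proof -
  have "(c * x) \<bullet> (c * y) = (cmod c)\<^sup>2 * (x \<bullet> y)" for x y :: complex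
    by (simp add: inner_complex_def cmod_power2) algebra
  then show ?thesis by (simp add: inner_vec_def vector_scalar_mult_def sum_distrib_left)
qed

lemma L2_scaleC_inner: "(c *\<^sub>C u) \<bullet> (c *\<^sub>C v) = (cmod c)\<^sup>2 * (u \<bullet> v)"
proof -
  have "integral\<^sup>L lborel (\<lambda>x. rep_L2 (c *\<^sub>C u) x \<bullet> rep_L2 (c *\<^sub>C v) x)
    = integral\<^sup>L lborel (\<lambda>x. (cmod c)\<^sup>2 * (rep_L2 u x \<bullet> rep_L2 v x))"
  proof (rule integral_cong_AE)
    show "AE x in lborel. rep_L2 (c *\<^sub>C u) x \<bullet> rep_L2 (c *\<^sub>C v) x = (cmod c)\<^sup>2 * (rep_L2 u x \<bullet> rep_L2 v x)"
      using rep_scaleC[of c u] rep_scaleC[of c v] by eventually_elim (simp add: scaleC_inner)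
  qed (use sq_rep square_integrable_measurable in \<open>auto intro!: borel_measurable_inner borel_measurable_times\<close>)
  then show ?thesis by (simp add: inner_L2_eq)
qed

lemma norm_scaleC: "norm (c *\<^sub>C u) = cmod c * norm u" for u :: L2
  using L2_scaleC_inner[of c u u] by (simp add: norm_eq_sqrt_inner real_sqrt_mult)

lemma scaleC_add_right: "c *\<^sub>C (u + v) = c *\<^sub>C u + c *\<^sub>C v"
  and scaleC_add_left: "(c + d) *\<^sub>C u = c *\<^sub>C u + d *\<^sub>C u"
  and scaleC_scaleC: "c *\<^sub>C d *\<^sub>C u = (c * d) *\<^sub>C u"
  and scaleC_one: "1 *\<^sub>C u = u"
  and scaleC_zero_left: "0 *\<^sub>C u = 0" and scaleC_zero_right: "c *\<^sub>C 0 = 0"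
  and scaleC_diff_right: "c *\<^sub>C (u - v) = c *\<^sub>C u - c *\<^sub>C v"
  and scaleC_diff_left: "(c - d) *\<^sub>C u = c *\<^sub>C u - d *\<^sub>C u"
  and scaleC_minus_left: "(- c) *\<^sub>C u = - (c *\<^sub>C u)"
  and scaleC_minus_right: "c *\<^sub>C (- u) = - (c *\<^sub>C u)"
  by (simp_all add: L2.scale_right_distrib L2.scale_left_distrib L2.scale_right_diff_distrib
      L2.scale_left_diff_distrib)

lemma scaleR_scaleC: "r *\<^sub>R u = complex_of_real r *\<^sub>C u"
  by transfer (auto simp: L2_eq_def scaleR_eq_scalar_mult intro!: square_integrable_scaleC)

lemma inner_i_left: "(\<i> *\<^sub>C u) \<bullet> v = - (u \<bullet> (\<i> *\<^sub>C v))"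
proof -
  have B: "\<i> *\<^sub>C \<i> *\<^sub>C v = - v" by (simp add: scaleC_scaleC scaleC_minus_left)
  have "(\<i> *\<^sub>C u) \<bullet> (\<i> *\<^sub>C \<i> *\<^sub>C v) = u \<bullet> (\<i> *\<^sub>C v)"
    by (subst L2_scaleC_inner) simp
  then show ?thesis unfolding B by simp
qed

text \<open>The Hermitian product recovered from its real part. It is linear in the first argument
  and antilinear in the second, so its imaginary part is the real product of \<open>u\<close> with
  \<open>\<i> *\<^sub>C v\<close>.\<close>

definition cinner :: "L2 \<Rightarrow> L2 \<Rightarrow> complex"
  where "cinner u v = Complex (u \<bullet> v) (u \<bullet> (\<i> *\<^sub>C v))"

lemma cinner_add_left: "cinner (u + u') v = cinner u v + cinner u' v"
  by (simp add: cinner_def inner_add_left complex_eq_iff)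

lemma cinner_scaleC_left: "cinner (c *\<^sub>C u) v = c * cinner u v"
proof -
  have "c *\<^sub>C u = Re c *\<^sub>R u + Im c *\<^sub>R (\<i> *\<^sub>C u)"
    by (simp add: scaleR_scaleC scaleC_scaleC complex_eq_iff flip: scaleC_add_left)
  moreover have "(\<i> *\<^sub>C u) \<bullet> (\<i> *\<^sub>C v) = u \<bullet> v" by (simp add: L2_scaleC_inner)
  ultimately show ?thesis by (simp add: cinner_def inner_add_left inner_i_left complex_eq_iff)
qed

lemma cinner_diff_left: "cinner (u - u') v = cinner u v - cinner u' v"
  by (simp add: cinner_def inner_diff_left complex_eq_iff)

lemma cmod_cinner_le: "cmod (cinner u v) \<le> 2 * norm u * norm v"
proof -
  have "cmod (cinner u v) \<le> \<bar>u \<bullet> v\<bar> + \<bar>u \<bullet> (\<i> *\<^sub>C v)\<bar>"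
    using cmod_le[of "cinner u v"] by (simp add: cinner_def)
  also have "\<dots> \<le> norm u * norm v + norm u * norm (\<i> *\<^sub>C v)"
    by (intro add_mono Cauchy_Schwarz_ineq2)
  finally show ?thesis by (simp add: norm_scaleC)
qed

lemma Re_cinner_self: "Re (cinner u u) = (norm u)\<^sup>2"
  by (simp add: cinner_def power2_norm_eq_inner)

lemma Im_cinner_self: "Im (cinner u u) = 0"
  using inner_i_left[of u u] by (simp add: cinner_def inner_commute)

lemma nn_integral_sq_norm:
  "square_integrable f \<Longrightarrow> (\<integral>\<^sup>+ x. ennreal ((norm (f x))\<^sup>2) \<partial>lborel) = ennreal (integral\<^sup>L lborel (\<lambda>x. (norm (f x))\<^sup>2))"
  by (intro nn_integral_eq_integral) (auto simp: square_integrable_def)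

lemma square_integrable_iff_nn:
  assumes "f \<in> borel_measurable borel"
  shows "square_integrable f \<longleftrightarrow> (\<integral>\<^sup>+ x. ennreal ((norm (f x))\<^sup>2) \<partial>lborel) < \<infinity>"
proof -
  have "(\<lambda>x. (norm (f x))\<^sup>2) \<in> borel_measurable lborel" using assms by measurable
  then show ?thesis using assms by (auto simp: square_integrable_def integrable_iff_bounded)
qed

lemma nn_rep: "(\<integral>\<^sup>+ x. ennreal ((norm (rep_L2 u x))\<^sup>2) \<partial>lborel) = ennreal ((norm u)\<^sup>2)"
  by (simp add: nn_integral_sq_norm[OF sq_rep] norm_L2_sq)

text \<open>A subsequence with summable increments converges almost everywhere, and Fatou turns this into
  convergence in norm.\<close>

lemma L2_Cauchy_convergent: fixes X :: "nat \<Rightarrow> L2" assumes "Cauchy X" shows "convergent X"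
proof -
  have ex: "\<exists>N. \<forall>i\<ge>N. \<forall>j\<ge>N. norm (X i - X j) < (1/2) ^ k" for k
    using assms unfolding Cauchy_iff by simp
  then obtain N where N: "\<And>k i j. i \<ge> N k \<Longrightarrow> j \<ge> N k \<Longrightarrow> norm (X i - X j) < (1/2) ^ k" by metis
  define r where "r k = (\<Sum>i\<le>k. N i) + k" for k
  have rN: "r k \<ge> N k" for k
    unfolding r_def by (metis atMost_iff finite_atMost le_add1 le_trans member_le_sum order_refl zero_le)
  have rm: "strict_mono r"
    unfolding strict_mono_Suc_iff by (auto simp: r_def)
  define f where "f k = rep_L2 (X (r k))" for k
  have fm [measurable]: "f k \<in> borel_measurable borel" for k
    unfolding f_def using sq_rep square_integrable_measurable by blast
  have dist_f: "(\<integral>\<^sup>+ x. ennreal ((norm (f i x - f j x))\<^sup>2) \<partial>lborel) = ennreal ((norm (X (r i) - X (r j)))\<^sup>2)" for i j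
  proof -
    have "AE x in lborel. ennreal ((norm (f i x - f j x))\<^sup>2) = ennreal ((norm (rep_L2 (X (r i) - X (r j)) x))\<^sup>2)"
      using rep_diff[of "X (r i)" "X (r j)"] by eventually_elim (simp add: f_def)
    from nn_integral_cong_AE[OF this] show ?thesis by (simp add: nn_rep)
  qed
  define g where "g k x = norm (f (Suc k) x - f k x)" for k x
  have gm [measurable]: "g k \<in> borel_measurable borel" for k unfolding g_def by measurable
  \<comment> \<open>The integral of the squared increment is at most \<open>(1/4) ^ k\<close>, so
    there is room for the weight \<open>2 ^ k\<close>. The weight is what later yields absolute
    convergence at a point: \<open>g\<close> is bounded by half of
    \<open>(1/2) ^ k + 2 ^ k * g\<^sup>2\<close>, and both series converge.\<close>
  have gI: "(\<integral>\<^sup>+ x. ennreal (2 ^ k * (g k x)\<^sup>2) \<partial>lborel) \<le> ennreal ((1/2) ^ k)" for k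
  proof -
    have "norm (X (r (Suc k)) - X (r k)) \<le> (1/2) ^ k"
      using N[of k "r (Suc k)" "r k"] rN strict_monoD[OF rm, of k "Suc k"] by (simp add: less_imp_le le_trans)
    then have "(norm (X (r (Suc k)) - X (r k)))\<^sup>2 \<le> ((1/2) ^ k)\<^sup>2" by (intro power_mono) auto
    moreover have "(\<integral>\<^sup>+ x. ennreal (2 ^ k * (g k x)\<^sup>2) \<partial>lborel) = ennreal (2 ^ k) * (\<integral>\<^sup>+ x. ennreal ((g k x)\<^sup>2) \<partial>lborel)"
      by (subst nn_integral_cmult[symmetric]) (auto simp: ennreal_mult)
    moreover have "\<dots> = ennreal (2 ^ k * (norm (X (r (Suc k)) - X (r k)))\<^sup>2)"
      unfolding g_def dist_f by (simp add: ennreal_mult)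
    moreover have "2 ^ k * ((1/2) ^ k)\<^sup>2 = ((1/2) ^ k :: real)"
      by (simp add: power2_eq_square field_simps flip: power_mult_distrib)
    ultimately show ?thesis by (smt (verit) ennreal_leI mult_left_mono zero_le_power)
  qed
  have "(\<integral>\<^sup>+ x. (\<Sum>k. ennreal (2 ^ k * (g k x)\<^sup>2)) \<partial>lborel) = (\<Sum>k. (\<integral>\<^sup>+ x. ennreal (2 ^ k * (g k x)\<^sup>2) \<partial>lborel))"
    by (intro nn_integral_suminf) measurable
  also have "\<dots> \<le> (\<Sum>k. ennreal ((1/2) ^ k))"
    by (intro suminf_le gI) auto
  also have "\<dots> = ennreal (\<Sum>k. (1/2) ^ k)" by (intro suminf_ennreal2) auto
  also have "\<dots> < \<infinity>" by simp
  finally have "AE x in lborel. (\<Sum>k. ennreal (2 ^ k * (g k x)\<^sup>2)) \<noteq> \<infinity>"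
    by (intro nn_integral_noteq_infinite) auto
  then have conv: "AE x in lborel. convergent (\<lambda>k. f k x)"
  proof eventually_elim
    case (elim x)
    then have sm: "summable (\<lambda>k. 2 ^ k * (g k x)\<^sup>2)"
      by (intro summable_suminf_not_top) auto
    then have "summable (\<lambda>k. (1/2) ^ k + 2 ^ k * (g k x)\<^sup>2)"
      by (intro summable_add) auto
    then have "summable (\<lambda>k. norm (f (Suc k) x - f k x))"
    proof (rule summable_comparison_test')
      fix k :: nat
      have "2 * (g k x) = 2 * (sqrt ((1/2) ^ k) * (sqrt (2 ^ k) * g k x))"
        by (simp add: power_divide real_sqrt_divide flip: mult.assoc)
      also have "\<dots> \<le> (sqrt ((1/2) ^ k))\<^sup>2 + (sqrt (2 ^ k) * g k x)\<^sup>2"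
        using sum_squares_bound[of "sqrt ((1/2) ^ k)" "sqrt (2 ^ k) * g k x"] by simp
      also have "\<dots> = (1/2) ^ k + 2 ^ k * (g k x)\<^sup>2" by (simp add: power_mult_distrib)
      finally have "2 * g k x \<le> (1/2) ^ k + 2 ^ k * (g k x)\<^sup>2" .
      moreover have "g k x \<ge> 0" by (simp add: g_def)
      ultimately have "g k x \<le> (1/2) ^ k + 2 ^ k * (g k x)\<^sup>2" by linarith
      then show "norm (norm (f (Suc k) x - f k x)) \<le> (1/2) ^ k + 2 ^ k * (g k x)\<^sup>2"
        by (simp add: g_def)
    qed
    then have "summable (\<lambda>k. f (Suc k) x - f k x)" by (rule summable_norm_cancel)
    then have "convergent (\<lambda>n. \<Sum>k<n. f (Suc k) x - f k x)" by (simp add: summable_iff_convergent)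
    moreover have "(\<lambda>n. \<Sum>k<n. f (Suc k) x - f k x) = (\<lambda>n. f n x - f 0 x)"
      by (intro ext sum_lessThan_telescope)
    ultimately have "convergent (\<lambda>n. f n x - f 0 x)" by simp
    then have "convergent (\<lambda>n. (f n x - f 0 x) + f 0 x)" by (intro convergent_add convergent_const)
    then show ?case by simp
  qed
  define h where "h x = lim (\<lambda>k. f k x)" for x
  have hm [measurable]: "h \<in> borel_measurable borel"
    unfolding h_def by (intro borel_measurable_lim_metric) measurable
  have fl: "AE x in lborel. (\<lambda>k. f k x) \<longlonglongrightarrow> h x"
    using conv by eventually_elim (simp add: h_def convergent_LIMSEQ_iff)
  have hf: "(\<integral>\<^sup>+ x. ennreal ((norm (h x - f k x))\<^sup>2) \<partial>lborel) \<le> ennreal (((1/2) ^ k)\<^sup>2)" for k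
  proof -
    have "AE x in lborel. ennreal ((norm (h x - f k x))\<^sup>2) = liminf (\<lambda>j. ennreal ((norm (f j x - f k x))\<^sup>2))"
      using fl
    proof eventually_elim
      case (elim x)
      then have "(\<lambda>j. ennreal ((norm (f j x - f k x))\<^sup>2)) \<longlonglongrightarrow> ennreal ((norm (h x - f k x))\<^sup>2)"
        by (intro tendsto_intros)
      then show ?case by (rule lim_imp_Liminf[OF sequentially_bot, symmetric])
    qed
    then have "(\<integral>\<^sup>+ x. ennreal ((norm (h x - f k x))\<^sup>2) \<partial>lborel) = (\<integral>\<^sup>+ x. liminf (\<lambda>j. ennreal ((norm (f j x - f k x))\<^sup>2)) \<partial>lborel)"
      by (rule nn_integral_cong_AE)
    also have "\<dots> \<le> liminf (\<lambda>j. \<integral>\<^sup>+ x. ennreal ((norm (f j x - f k x))\<^sup>2) \<partial>lborel)"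
      by (intro nn_integral_liminf) measurable
    also have "\<dots> \<le> ennreal (((1/2) ^ k)\<^sup>2)"
    proof (rule Liminf_le)
      show "eventually (\<lambda>j. (\<integral>\<^sup>+ x. ennreal ((norm (f j x - f k x))\<^sup>2) \<partial>lborel) \<le> ennreal (((1/2) ^ k)\<^sup>2)) sequentially"
        using eventually_ge_at_top[of k]
      proof eventually_elim
        case (elim j)
        have "norm (X (r j) - X (r k)) \<le> (1/2) ^ k"
          using N[of k "r j" "r k"] rN[of k] strict_mono_leD[OF rm elim] by (simp add: less_imp_le le_trans)
        then show ?case unfolding dist_f by (intro ennreal_leI power_mono) auto
      qed
    qed simp
    finally show ?thesis .
  qed
  have sqd: "square_integrable (\<lambda>x. h x - f k x)" for k
    by (subst square_integrable_iff_nn) (use hf[of k] in \<open>auto simp: less_top[symmetric] top_unique intro: le_less_trans\<close>)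
  have "square_integrable (\<lambda>x. (h x - f 0 x) + f 0 x)"
    by (rule square_integrable_add[OF sqd]) (simp add: f_def sq_rep)
  then have sqh: "square_integrable h" by simp
  define Y where "Y = abs_L2 h"
  have Yr: "norm (Y - X (r k)) \<le> (1/2) ^ k" for k
  proof -
    have "AE x in lborel. ennreal ((norm (rep_L2 (Y - X (r k)) x))\<^sup>2) = ennreal ((norm (h x - f k x))\<^sup>2)"
      using rep_diff[of Y "X (r k)"] rep_abs[OF sqh] by eventually_elim (simp add: f_def Y_def)
    from nn_integral_cong_AE[OF this] have "ennreal ((norm (Y - X (r k)))\<^sup>2) \<le> ennreal (((1/2) ^ k)\<^sup>2)"
      using hf[of k] by (simp add: nn_rep)
    then have "(norm (Y - X (r k)))\<^sup>2 \<le> ((1/2) ^ k)\<^sup>2" by (subst (asm) ennreal_le_iff) auto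
    then show ?thesis by (rule power2_le_imp_le) simp
  qed
  have "(X \<circ> r) \<longlonglongrightarrow> Y"
    unfolding LIMSEQ_iff
  proof (intro allI impI)
    fix e :: real assume "e > 0"
    then obtain n where n: "(1/2) ^ n < e" using real_arch_pow_inv[of e "1/2"] by (metis divide_less_eq_1_pos one_less_numeral_iff semiring_norm(76) zero_less_numeral)
    have "norm ((X \<circ> r) k - Y) < e" if "k \<ge> n" for k
    proof -
      have "(1/2) ^ k \<le> ((1/2) ^ n :: real)" using that by (intro power_decreasing) auto
      then have "norm (Y - X (r k)) < e" using Yr[of k] n by linarith
      then show ?thesis by (simp add: norm_minus_commute)
    qed
    then show "\<exists>no. \<forall>k\<ge>no. norm ((X \<circ> r) k - Y) < e" by blast
  qed
  then have "X \<longlonglongrightarrow> Y" using Cauchy_converges_subseq[OF assms rm] by blast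
  then show ?thesis by (rule convergentI)
qed

instance L2 :: banach
  by standard (rule L2_Cauchy_convergent)

section \<open>Orthogonal projection and finite-dimensional spans\<close>

text \<open>Projection theorem: by the parallelogram law a sequence in \<open>S\<close> minimising
  the distance to \<open>u\<close> is Cauchy, and \<open>v\<close> is \<open>u\<close> minus its
  limit. If \<open>v\<close> had a component along some \<open>w\<close> in \<open>S\<close>, moving
  the limit by the optimal multiple \<open>t\<close> of \<open>w\<close> would shorten the
  distance.\<close>

lemma closed_subspace_orthogonal:
  fixes S :: "'a::{real_inner, complete_space} set"
  assumes S: "closed S" "subspace S" and u: "u \<notin> S"
  shows "\<exists>v. v \<noteq> 0 \<and> (\<forall>s\<in>S. v \<bullet> s = 0) \<and> u - v \<in> S"
proof -
  define d where "d = infdist u S"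
  have ne: "S \<noteq> {}" using subspace_0[OF S(2)] by blast
  have dle: "d \<le> norm (u - s)" if "s \<in> S" for s
    using infdist_le[OF that, of u] by (simp add: d_def dist_norm)
  have d0: "d \<ge> 0" by (simp add: d_def infdist_nonneg)
  have "\<exists>s\<in>S. (norm (u - s))\<^sup>2 < d\<^sup>2 + 1 / real (Suc n)" for n
  proof (rule ccontr)
    assume "\<not> ?thesis"
    then have *: "d\<^sup>2 + 1 / real (Suc n) \<le> (norm (u - s))\<^sup>2" if "s \<in> S" for s using that by force
    have "sqrt (d\<^sup>2 + 1 / real (Suc n)) \<le> dist u s" if "s \<in> S" for s
      using real_sqrt_le_mono[OF *[OF that]] by (simp add: dist_norm)
    then have "sqrt (d\<^sup>2 + 1 / real (Suc n)) \<le> d"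
      unfolding d_def infdist_notempty[OF ne] by (intro cINF_greatest ne) (simp add: d_def infdist_notempty[OF ne])
    then have "d\<^sup>2 + 1 / real (Suc n) \<le> d\<^sup>2" using d0 by (simp add: real_sqrt_le_iff' real_le_lsqrt sqrt_le_D)
    then show False by simp
  qed
  then obtain s where s: "\<And>n. s n \<in> S" "\<And>n. (norm (u - s n))\<^sup>2 < d\<^sup>2 + 1 / real (Suc n)" by metis
  have par: "(norm (s m - s n))\<^sup>2 < 2 / real (Suc m) + 2 / real (Suc n)" for m n
  proof -
    have mid: "(1/2) *\<^sub>R (s m + s n) \<in> S" using s(1) S(2) by (intro subspace_scale subspace_add)
    have "(norm (s m - s n))\<^sup>2 + 4 * (norm (u - (1/2) *\<^sub>R (s m + s n)))\<^sup>2
        = 2 * (norm (u - s m))\<^sup>2 + 2 * (norm (u - s n))\<^sup>2"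
      by (simp add: power2_norm_eq_inner inner_diff inner_add inner_commute algebra_simps)
    moreover have "d\<^sup>2 \<le> (norm (u - (1/2) *\<^sub>R (s m + s n)))\<^sup>2"
      using dle[OF mid] d0 by (intro power_mono)
    ultimately show ?thesis using s(2)[of m] s(2)[of n] by linarith
  qed
  have "Cauchy s"
    unfolding Cauchy_iff
  proof (intro allI impI)
    fix e :: real assume e: "e > 0"
    then have "e\<^sup>2 / 4 > 0" by simp
    then obtain N where N: "1 / real (Suc N) < e\<^sup>2 / 4" using nat_approx_posE by blast
    have "norm (s m - s n) < e" if "m \<ge> N" "n \<ge> N" for m n
    proof -
      have "1 / real (Suc m) \<le> 1 / real (Suc N)" "1 / real (Suc n) \<le> 1 / real (Suc N)"
        using that by (auto intro!: divide_left_mono)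
      then have "(norm (s m - s n))\<^sup>2 < e\<^sup>2" using par[of m n] N by simp
      then show ?thesis using e by (simp add: power_less_imp_less_base)
    qed
    then show "\<exists>M. \<forall>m\<ge>M. \<forall>n\<ge>M. norm (s m - s n) < e" by blast
  qed
  then obtain p where p: "s \<longlonglongrightarrow> p" using Cauchy_convergent convergent_def by blast
  have pS: "p \<in> S" using closed_sequentially[OF S(1)] s(1) p by blast
  have np: "(norm (u - p))\<^sup>2 \<le> d\<^sup>2"
  proof (rule LIMSEQ_le)
    show "(\<lambda>n. (norm (u - s n))\<^sup>2) \<longlonglongrightarrow> (norm (u - p))\<^sup>2" by (intro tendsto_intros p)
    show "(\<lambda>n. d\<^sup>2 + 1 / real (Suc n)) \<longlonglongrightarrow> d\<^sup>2"
      using tendsto_add[OF tendsto_const[of "d\<^sup>2"] LIMSEQ_Suc[OF lim_1_over_n]] by simp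
    show "\<exists>N. \<forall>n\<ge>N. (norm (u - s n))\<^sup>2 \<le> d\<^sup>2 + 1 / real (Suc n)" using s(2) less_imp_le by blast
  qed
  have orth: "(u - p) \<bullet> w = 0" if w: "w \<in> S" for w
  proof (rule ccontr)
    assume nz: "(u - p) \<bullet> w \<noteq> 0"
    then have w0: "w \<noteq> 0" by auto
    define t where "t = ((u - p) \<bullet> w) / (w \<bullet> w)"
    have "p + t *\<^sub>R w \<in> S" using pS w S(2) by (intro subspace_add subspace_scale)
    then have "d\<^sup>2 \<le> (norm (u - (p + t *\<^sub>R w)))\<^sup>2" using dle d0 by (intro power_mono)
    also have "\<dots> = (norm (u - p))\<^sup>2 - 2 * t * ((u - p) \<bullet> w) + t\<^sup>2 * (w \<bullet> w)"
    proof -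
      have "(norm (q - t *\<^sub>R w))\<^sup>2 = (norm q)\<^sup>2 - 2 * t * (q \<bullet> w) + t\<^sup>2 * (w \<bullet> w)" for q
        unfolding power2_norm_eq_inner
        by (simp add: inner_diff inner_commute algebra_simps power2_eq_square)
      from this[of "u - p"] show ?thesis by (simp add: diff_diff_add)
    qed
    also have "\<dots> = (norm (u - p))\<^sup>2 - ((u - p) \<bullet> w)\<^sup>2 / (w \<bullet> w)"
      using w0 by (simp add: t_def power2_eq_square field_simps)
    also have "\<dots> < (norm (u - p))\<^sup>2" using nz w0 by simp
    finally show False using np by simp
  qed
  show ?thesis
    by (rule exI[of _ "u - p"]) (use orth pS u in auto)
qed

lemma span_complex_subspace:
  "0 \<in> L2_span B" "u \<in> L2_span B \<Longrightarrow> v \<in> L2_span B \<Longrightarrow> u + v \<in> L2_span B"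
  "u \<in> L2_span B \<Longrightarrow> c *\<^sub>C u \<in> L2_span B" "u \<in> B \<Longrightarrow> u \<in> L2_span B"
  by (auto intro: L2.span_zero L2.span_add L2.span_scale L2.span_base)

lemma closure_span_subspace:
  "subspace (closure (L2_span B))" "u \<in> closure (L2_span B) \<Longrightarrow> c *\<^sub>C u \<in> closure (L2_span B)"
proof -
  show "subspace (closure (L2_span B))"
  proof -
    have z: "0 \<in> closure (L2_span B)" using closure_subset span_complex_subspace(1) by blast
    have "u + v \<in> closure (L2_span B)" if uv: "u \<in> closure (L2_span B)" "v \<in> closure (L2_span B)" for u v
    proof -
      obtain x y where "\<And>n. x n \<in> L2_span B" "x \<longlonglongrightarrow> u" "\<And>n. y n \<in> L2_span B" "y \<longlonglongrightarrow> v"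
        using uv unfolding closure_sequential by metis
      then show ?thesis unfolding closure_sequential
        by (intro exI[of _ "\<lambda>n. x n + y n"]) (auto intro: span_complex_subspace tendsto_add)
    qed
    moreover have "k *\<^sub>R u \<in> closure (L2_span B)" if u: "u \<in> closure (L2_span B)" for k u
    proof -
      obtain x where "\<And>n. x n \<in> L2_span B" "x \<longlonglongrightarrow> u"
        using u unfolding closure_sequential by metis
      moreover have "k *\<^sub>R y \<in> L2_span B" if "y \<in> L2_span B" for y
        unfolding scaleR_scaleC by (rule span_complex_subspace(3)[OF that])
      ultimately show ?thesis unfolding closure_sequential
        by (intro exI[of _ "\<lambda>n. k *\<^sub>R x n"]) (auto intro: tendsto_scaleR)
    qed
    ultimately show ?thesis using z unfolding subspace_def by blast
  qed
  assume "u \<in> closure (L2_span B)"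
  then obtain x where x: "\<And>n. x n \<in> L2_span B" "x \<longlonglongrightarrow> u" by (auto simp: closure_sequential)
  have "(\<lambda>n. c *\<^sub>C x n) \<longlonglongrightarrow> c *\<^sub>C u"
  proof -
    have "(\<lambda>n. cmod c * norm (x n - u)) \<longlonglongrightarrow> cmod c * 0"
      by (intro tendsto_intros) (use x(2) in \<open>simp add: LIM_zero tendsto_norm_zero\<close>)
    then have "(\<lambda>n. norm (c *\<^sub>C x n - c *\<^sub>C u)) \<longlonglongrightarrow> 0"
      by (simp add: norm_scaleC flip: scaleC_diff_right)
    then show ?thesis by (rule LIM_zero_cancel[OF tendsto_norm_zero_cancel])
  qed
  then show "c *\<^sub>C u \<in> closure (L2_span B)"
    unfolding closure_sequential
    by (intro exI[of _ "\<lambda>n. c *\<^sub>C x n"] conjI allI span_complex_subspace(3) x(1))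
qed

text \<open>Orthogonality in the real product is enough to start from: the closed span is invariant
  under multiplication by \<open>\<i>\<close>, so a vector real-orthogonal to it is orthogonal for
  \<open>cinner\<close> too.\<close>

lemma closure_span_UNIV:
  assumes "\<And>v. (\<And>s. s \<in> B \<Longrightarrow> cinner s v = 0) \<Longrightarrow> v = 0"
  shows "closure (L2_span B) = UNIV"
proof (rule ccontr)
  assume "closure (L2_span B) \<noteq> UNIV"
  then obtain u where "u \<notin> closure (L2_span B)" by blast
  then obtain v where v: "v \<noteq> 0" "\<And>s. s \<in> closure (L2_span B) \<Longrightarrow> v \<bullet> s = 0"
    using closed_subspace_orthogonal[OF closed_closure closure_span_subspace(1)] by blast
  have "cinner s v = 0" if "s \<in> B" for s
  proof -
    have s: "s \<in> closure (L2_span B)" using that closure_subset span_complex_subspace(4) by blast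
    have "v \<bullet> (\<i> *\<^sub>C s) = 0" using v(2) closure_span_subspace(2)[OF s] by blast
    then show ?thesis using v(2)[OF s] inner_i_left[of s v]
      by (simp add: cinner_def inner_commute complex_eq_iff)
  qed
  then show False using assms v(1) by blast
qed

text \<open>When a vector \<open>e\<close> is added, it is replaced by its component
  \<open>v\<close> orthogonal to the old, closed span. Membership in the new span then says that the
  continuous map \<open>x \<mapsto> x - (cinner x v / N) *\<^sub>C v\<close> takes \<open>x\<close>
  into the old one, a closed condition.\<close>

lemma closed_span_finite: "finite B \<Longrightarrow> closed (L2_span B)"
proof (induction B rule: finite_induct)
  case empty then show ?case by simp
next
  case (insert e B)
  let ?S = "L2_span B"
  have sub: "subspace ?S" by (auto simp: subspace_def scaleR_scaleC intro: span_complex_subspace)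
  show ?case
  proof (cases "e \<in> ?S")
    case True
    then have "L2_span (insert e B) = ?S" by (simp add: L2.span_redundant)
    then show ?thesis using insert by simp
  next
    case False
    then obtain v where v: "v \<noteq> 0" "\<And>s. s \<in> ?S \<Longrightarrow> v \<bullet> s = 0" "e - v \<in> ?S"
      using closed_subspace_orthogonal[OF insert(3) sub] by blast
    have orth: "cinner s v = 0" if "s \<in> ?S" for s
      using v(2)[OF that] v(2)[OF span_complex_subspace(3)[OF that, of \<i>]] inner_i_left[of s v]
      by (simp add: cinner_def inner_commute complex_eq_iff)
    define N where "N = (norm v)\<^sup>2"
    have N: "N > 0" using v(1) by (simp add: N_def)
    have vv: "cinner v v = of_real N" by (simp add: complex_eq_iff Re_cinner_self Im_cinner_self N_def)
    have char: "x \<in> L2_span (insert e B) \<longleftrightarrow> x - (cinner x v / of_real N) *\<^sub>C v \<in> ?S" for x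
    proof
      assume "x \<in> L2_span (insert e B)"
      then obtain k where k: "x - k *\<^sub>C e \<in> ?S" using L2.span_breakdown_eq by blast
      have "x - k *\<^sub>C v \<in> ?S"
        using span_complex_subspace(2)[OF k span_complex_subspace(3)[OF v(3), of k]]
        by (simp add: scaleC_diff_right)
      from orth[OF this] have "cinner x v = k * of_real N"
        by (simp add: cinner_diff_left cinner_scaleC_left vv)
      then show "x - (cinner x v / of_real N) *\<^sub>C v \<in> ?S" using \<open>x - k *\<^sub>C v \<in> ?S\<close> N by simp
    next
      assume a: "x - (cinner x v / of_real N) *\<^sub>C v \<in> ?S"
      let ?k = "cinner x v / of_real N"
      have "x - ?k *\<^sub>C e = (x - ?k *\<^sub>C v) + (- ?k) *\<^sub>C (e - v)"
        by (simp add: scaleC_diff_right scaleC_minus_left)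
      then have "x - ?k *\<^sub>C e \<in> ?S"
        using span_complex_subspace(2)[OF a span_complex_subspace(3)[OF v(3)]] by metis
      then show "x \<in> L2_span (insert e B)" using L2.span_breakdown_eq by blast
    qed
    show ?thesis unfolding closed_sequential_limits
    proof (intro allI impI, elim conjE)
      fix x l assume x: "\<forall>n. x n \<in> L2_span (insert e B)" "x \<longlonglongrightarrow> l"
      let ?P = "\<lambda>x. x - (cinner x v / of_real N) *\<^sub>C v"
      have Pl: "(\<lambda>n. ?P (x n)) \<longlonglongrightarrow> ?P l"
      proof -
        have nb: "norm (?P (x n) - ?P l) \<le> norm (x n - l) * (1 + 2 * norm v / N * norm v)" for n
        proof -
          have "?P (x n) - ?P l = (x n - l) - (cinner (x n - l) v / of_real N) *\<^sub>C v"
            by (simp add: cinner_diff_left diff_divide_distrib scaleC_diff_left)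
          then have "norm (?P (x n) - ?P l) \<le> norm (x n - l) + cmod (cinner (x n - l) v / of_real N) * norm v"
            by (metis norm_scaleC norm_triangle_ineq4)
          also have "cmod (cinner (x n - l) v / of_real N) \<le> 2 * norm (x n - l) * norm v / N"
            using cmod_cinner_le[of "x n - l" v] N by (simp add: norm_divide divide_right_mono)
          finally show ?thesis by (simp add: algebra_simps mult_right_mono)
        qed
        have lim: "(\<lambda>n. norm (x n - l) * (1 + 2 * norm v / N * norm v)) \<longlonglongrightarrow> 0"
          using x(2) by (intro tendsto_mult_left_zero tendsto_norm_zero LIM_zero)
        have "eventually (\<lambda>n. norm (?P (x n) - ?P l) \<le> norm (x n - l) * (1 + 2 * norm v / N * norm v)) sequentially"
          using nb by (intro always_eventually allI)
        from Lim_null_comparison[OF this lim]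
        have "(\<lambda>n. ?P (x n) - ?P l) \<longlonglongrightarrow> 0" .
        then show ?thesis by (rule LIM_zero_cancel)
      qed
      have in_S: "?P (x n) \<in> ?S" for n by (rule iffD1[OF char]) (rule x(1)[rule_format])
      have "?P l \<in> ?S" by (rule closed_sequentially[OF insert(3) in_S Pl])
      then show "l \<in> L2_span (insert e B)" by (rule iffD2[OF char])
    qed
  qed
qed

lemma tendsto_scaleC_left:
  assumes "(f \<longlongrightarrow> c) F" shows "((\<lambda>x. f x *\<^sub>C u) \<longlongrightarrow> c *\<^sub>C u) F"
proof -
  have "((\<lambda>x. cmod (f x - c) * norm u) \<longlongrightarrow> 0) F"
    by (intro tendsto_mult_left_zero tendsto_norm_zero LIM_zero assms)
  then have "((\<lambda>x. norm (f x *\<^sub>C u - c *\<^sub>C u)) \<longlongrightarrow> 0) F"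
    by (simp add: norm_scaleC flip: scaleC_diff_left)
  then show ?thesis by (rule LIM_zero_cancel[OF tendsto_norm_zero_cancel])
qed

text \<open>The indexing by \<open>Suc j\<close> anticipates Jordan chains, whose zeroth member is
  the zero vector. Repetitions in \<open>e\<close> are harmless, since no linear independence is
  claimed.\<close>

lemma span_finite_sequence:
  assumes "v \<in> L2_span (e ` {1..k})" shows "\<exists>c. v = (\<Sum>j<k. c j *\<^sub>C e (Suc j))"
proof -
  have "L2_span (e ` {1..k}) \<subseteq> {v. \<exists>c. v = (\<Sum>j<k. c j *\<^sub>C e (Suc j))}"
  proof (rule L2.span_minimal)
    show "L2.subspace {v. \<exists>c. v = (\<Sum>j<k. c j *\<^sub>C e (Suc j))}"
    proof (unfold L2.subspace_def, intro conjI ballI allI)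
      show "0 \<in> {v. \<exists>c. v = (\<Sum>j<k. c j *\<^sub>C e (Suc j))}"
        by (simp add: exI[of _ "\<lambda>_. 0"])
      fix x y assume "x \<in> {v. \<exists>c. v = (\<Sum>j<k. c j *\<^sub>C e (Suc j))}" "y \<in> {v. \<exists>c. v = (\<Sum>j<k. c j *\<^sub>C e (Suc j))}"
      then obtain c d where "x = (\<Sum>j<k. c j *\<^sub>C e (Suc j))" "y = (\<Sum>j<k. d j *\<^sub>C e (Suc j))" by blast
      then have "x + y = (\<Sum>j<k. (c j + d j) *\<^sub>C e (Suc j))"
        by (simp add: sum.distrib scaleC_add_left)
      then show "x + y \<in> {v. \<exists>c. v = (\<Sum>j<k. c j *\<^sub>C e (Suc j))}"
        by (intro CollectI exI[of _ "\<lambda>j. c j + d j"])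
    next
      fix a x assume "x \<in> {v. \<exists>c. v = (\<Sum>j<k. c j *\<^sub>C e (Suc j))}"
      then obtain c where "x = (\<Sum>j<k. c j *\<^sub>C e (Suc j))" by blast
      then have "a *\<^sub>C x = (\<Sum>j<k. (a * c j) *\<^sub>C e (Suc j))"
        by (simp add: L2.scale_sum_right scaleC_scaleC)
      then show "a *\<^sub>C x \<in> {v. \<exists>c. v = (\<Sum>j<k. c j *\<^sub>C e (Suc j))}"
        by (intro CollectI exI[of _ "\<lambda>j. a * c j"])
    qed
  next
    show "e ` {1..k} \<subseteq> {v. \<exists>c. v = (\<Sum>j<k. c j *\<^sub>C e (Suc j))}"
    proof
    fix x assume "x \<in> e ` {1..k}"
    then obtain i where i: "x = e (Suc i)" "i < k"
      by (metis Suc_le_D Suc_le_lessD atLeastAtMost_iff image_iff numeral_nat(7) One_nat_def)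
    have "(\<Sum>j<k. (if j = i then 1 else 0) *\<^sub>C e (Suc j)) = (\<Sum>j<k. if j = i then e (Suc j) else 0)"
      by (intro sum.cong) (auto simp: scaleC_zero_left scaleC_one)
    also have "\<dots> = x" using i by simp
    finally have eq: "(\<Sum>j<k. (if j = i then 1 else 0) *\<^sub>C e (Suc j)) = x" .
    show "x \<in> {v. \<exists>c. v = (\<Sum>j<k. c j *\<^sub>C e (Suc j))}"
      by (intro CollectI exI[of _ "\<lambda>j. if j = i then 1 else 0"]) (rule eq[symmetric])
    qed
  qed
  then show ?thesis using assms by blast
qed

section \<open>Operators with a characteristic determinant\<close>

text \<open>The function \<open>D\<close> plays the role of a characteristic determinant: its zeros are the eigenvalues and
  \<open>D(z)\<close> times the resolvent at \<open>z\<close> has growth order below \<open>2\<close>.\<close>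

locale determinant_operator =
  fixes A :: L2_operator and D :: "complex \<Rightarrow> complex" and \<rho> C c m :: real
  assumes dom0: "0 \<in> fst A" and dom_add: "\<And>u v. u \<in> fst A \<Longrightarrow> v \<in> fst A \<Longrightarrow> u + v \<in> fst A"
    and dom_scale: "\<And>k u. u \<in> fst A \<Longrightarrow> k *\<^sub>C u \<in> fst A"
    and op_add: "\<And>u v. u \<in> fst A \<Longrightarrow> v \<in> fst A \<Longrightarrow> snd A (u + v) = snd A u + snd A v"
    and op_scale: "\<And>k u. u \<in> fst A \<Longrightarrow> snd A (k *\<^sub>C u) = k *\<^sub>C snd A u"
    and rho: "0 < \<rho>" "\<rho> < 2" and C: "C > 0" and m: "m > 0" and c: "c \<ge> 0"
    and D_hol: "D holomorphic_on UNIV"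
    and D_bound: "\<And>z. cmod (D z) \<le> exp (C * (1 + cmod z) powr \<rho>)"
    and ap: "\<And>z u. u \<in> fst A \<Longrightarrow> cmod (D z) * norm u \<le> exp (C * (1 + cmod z) powr \<rho>) * norm (shifted A z u)"
    and surj: "\<And>z g. D z \<noteq> 0 \<Longrightarrow> \<exists>u\<in>fst A. shifted A z u = g"
    and zero: "\<And>z. D z = 0 \<Longrightarrow> \<exists>e\<in>fst A. e \<noteq> 0 \<and> shifted A z e = 0 \<and>
      (\<forall>u\<in>fst A. shifted A z u = 0 \<longrightarrow> (\<exists>k. u = k *\<^sub>C e))"
    and zero_range: "\<And>z. D z = 0 \<Longrightarrow> \<exists>l :: L2 \<Rightarrow> complex. (\<forall>u v. l (u + v) = l u + l v) \<and>
      (\<forall>k u. l (k *\<^sub>C u) = k * l u) \<and> (\<exists>K. \<forall>u. cmod (l u) \<le> K * norm u) \<and>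
      shifted A z ` fst A = {g. l g = 0}"
    and imag: "\<And>z u. Re z = 0 \<Longrightarrow> u \<in> fst A \<Longrightarrow> m * norm u \<le> norm (shifted A z u)"
    and low: "\<And>z u. u \<in> fst A \<Longrightarrow> (- Im z - c) * norm u \<le> norm (shifted A z u)"
    and dense: "\<And>v. (\<And>u. u \<in> fst A \<Longrightarrow> u \<bullet> v = 0) \<Longrightarrow> v = 0"
    and proper: "fst A \<noteq> UNIV"
begin

abbreviation "T \<equiv> shifted A"

lemma T_add: "u \<in> fst A \<Longrightarrow> v \<in> fst A \<Longrightarrow> T z (u + v) = T z u + T z v"
  by (simp add: shifted_def op_add scaleC_add_right)

lemma T_scale: "u \<in> fst A \<Longrightarrow> T z (k *\<^sub>C u) = k *\<^sub>C T z u"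
  by (simp add: shifted_def op_scale scaleC_diff_right scaleC_scaleC mult.commute)

lemma T_0: "T z 0 = 0"
  using T_scale[OF dom0, of z 0] by (simp add: scaleC_zero_left)

lemma dom_diff: "u \<in> fst A \<Longrightarrow> v \<in> fst A \<Longrightarrow> u - v \<in> fst A"
  using dom_add[of u "(-1) *\<^sub>C v"] dom_scale[of v "-1"] by (simp add: scaleC_minus_left)

lemma T_diff: "u \<in> fst A \<Longrightarrow> v \<in> fst A \<Longrightarrow> T z (u - v) = T z u - T z v"
  using T_add[of u "(-1) *\<^sub>C v" z] T_scale[of v z "-1"] dom_scale[of v "-1"]
  by (simp add: scaleC_minus_left)

lemma T_shift: "T w u = T z u - (w - z) *\<^sub>C u"
  by (simp add: shifted_def scaleC_diff_left)

lemma dom_sum: "(\<And>j. j \<in> J \<Longrightarrow> f j \<in> fst A) \<Longrightarrow> (\<Sum>j\<in>J. f j) \<in> fst A"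
  by (induction J rule: infinite_finite_induct) (auto intro: dom0 dom_add)

lemma T_sum: "(\<And>j. j \<in> J \<Longrightarrow> f j \<in> fst A) \<Longrightarrow> T z (\<Sum>j\<in>J. f j) = (\<Sum>j\<in>J. T z (f j))"
  by (induction J rule: infinite_finite_induct) (auto simp: T_0 T_add dom_sum)

lemma inj_T: assumes "D z \<noteq> 0" "u \<in> fst A" "v \<in> fst A" "T z u = T z v" shows "u = v"
proof -
  have "cmod (D z) * norm (u - v) \<le> 0"
    using ap[OF dom_diff[OF assms(2,3)], of z] T_diff[OF assms(2,3), of z] assms(4) by simp
  then show ?thesis using assms(1) by (simp add: mult_le_0_iff)
qed

definition R where "R z g = (SOME u. u \<in> fst A \<and> T z u = g)"

lemma R: assumes "D z \<noteq> 0" shows "R z g \<in> fst A" "T z (R z g) = g"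
  using someI_ex[of "\<lambda>u. u \<in> fst A \<and> T z u = g"] surj[OF assms, of g] unfolding R_def by blast+

lemma R_eq: "D z \<noteq> 0 \<Longrightarrow> u \<in> fst A \<Longrightarrow> T z u = g \<Longrightarrow> R z g = u"
  using R[of z g] inj_T by metis

lemma R_add: "D z \<noteq> 0 \<Longrightarrow> R z (g + h) = R z g + R z h"
  by (rule R_eq) (auto simp: R T_add intro: dom_add)

lemma R_scale: "D z \<noteq> 0 \<Longrightarrow> R z (k *\<^sub>C g) = k *\<^sub>C R z g"
  by (rule R_eq) (auto simp: R T_scale intro: dom_scale)

lemma R_bound: "D z \<noteq> 0 \<Longrightarrow> cmod (D z) * norm (R z g) \<le> exp (C * (1 + cmod z) powr \<rho>) * norm g"
  using ap[of "R z g" z] by (simp add: R)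

lemma resolvent_iff: "z \<in> resolvent_set A \<longleftrightarrow> D z \<noteq> 0"
proof
  assume z: "z \<in> resolvent_set A"
  show "D z \<noteq> 0"
  proof
    assume "D z = 0"
    then obtain e where "e \<in> fst A" "e \<noteq> 0" "T z e = 0" using zero by blast
    then show False using z dom0 T_0[of z] by (auto simp: resolvent_set_def bij_betw_def inj_on_def)
  qed
next
  assume nz: "D z \<noteq> 0"
  have "bij_betw (T z) (fst A) UNIV"
    unfolding bij_betw_def inj_on_def using inj_T[OF nz] surj[OF nz] by (metis (no_types) image_iff UNIV_eq_I)
  moreover have "norm u \<le> exp (C * (1 + cmod z) powr \<rho>) / cmod (D z) * norm (T z u)" if "u \<in> fst A" for u
    using ap[OF that, of z] nz by (simp add: field_simps)
  ultimately show "z \<in> resolvent_set A" unfolding resolvent_set_def by blast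
qed

lemma spectrum_eq: "spectrum A = {z. D z = 0}"
  by (auto simp: spectrum_def resolvent_iff)

lemma eigenvalue_iff: "eigenvalue A z \<longleftrightarrow> D z = 0"
proof
  assume "eigenvalue A z"
  then obtain u where u: "u \<in> fst A" "u \<noteq> 0" "T z u = 0" by (auto simp: eigenvalue_def shifted_def)
  then show "D z = 0" using inj_T[of z u 0] dom0 T_0 by metis
next
  assume "D z = 0"
  then show "eigenvalue A z" using zero by (force simp: eigenvalue_def shifted_def)
qed

lemma D_imag: "Re z = 0 \<Longrightarrow> D z \<noteq> 0"
proof
  assume z: "Re z = 0" "D z = 0"
  then obtain e where "e \<in> fst A" "e \<noteq> 0" "T z e = 0" using zero by blast
  then show False using imag[OF z(1), of e] m by (simp add: mult_le_0_iff)
qed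

lemma D_low: "Im z < - c \<Longrightarrow> D z \<noteq> 0"
proof
  assume z: "Im z < - c" "D z = 0"
  then obtain e where "e \<in> fst A" "e \<noteq> 0" "T z e = 0" using zero by blast
  then show False using low[of e z] z(1) by (simp add: mult_le_0_iff)
qed

lemma D_zero_order:
  assumes "D z = 0"
  obtains Q N where "Q holomorphic_on UNIV" "Q z \<noteq> 0" "\<And>w. D w = (w - z) ^ N * Q w" "0 < N"
proof -
  have "\<exists>w. D w \<noteq> 0" using D_imag[of 0] by auto
  from entire_divide_zero_order[OF D_hol assms this] show ?thesis using that by blast
qed

lemma spectrum_isolated: assumes "D z = 0" shows "z isolated_in spectrum A"
proof -
  obtain Q N where Q: "Q holomorphic_on UNIV" "Q z \<noteq> 0" "\<And>w. D w = (w - z) ^ N * Q w" "0 < N"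
    using D_zero_order[OF assms] by metis
  have "continuous (at z) Q"
    using holomorphic_on_imp_continuous_on[OF Q(1)] by (simp add: continuous_on_eq_continuous_at)
  from continuous_at_avoid[OF this Q(2)]
  obtain r where r: "r > 0" "\<And>w. dist z w < r \<Longrightarrow> Q w \<noteq> 0" by blast
  have "ball z r \<inter> spectrum A = {z}" using r Q(3,4) assms by (auto simp: spectrum_eq)
  then show ?thesis using r(1) assms
    unfolding isolated_in_def by (auto simp: spectrum_eq intro!: exI[of _ "ball z r"])
qed

section \<open>Jordan chains and root spaces\<close>

text \<open>A Jordan chain of length \<open>n\<close> that starts with an eigenvector. The
  convention \<open>e 0 = 0\<close> makes the lowering rule uniform in the index.\<close>

definition chain where "chain z n e \<longleftrightarrow> e 0 = 0 \<and> e (Suc 0) \<noteq> 0 \<and>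
  (\<forall>j<n. e (Suc j) \<in> fst A \<and> T z (e (Suc j)) = e j)"

text \<open>As \<open>T (z + \<delta>)\<close> is \<open>T z\<close> minus \<open>\<delta>\<close>,
  the sum telescopes. It is an approximate eigenvector at \<open>z + \<delta>\<close> with error of
  order \<open>\<delta> ^ n\<close>.\<close>

lemma chain_sum:
  assumes "chain z n e"
  shows "T (z + \<delta>) (\<Sum>j<n. \<delta> ^ j *\<^sub>C e (Suc j)) = - (\<delta> ^ n *\<^sub>C e n)"
proof -
  have d: "e (Suc j) \<in> fst A" "T z (e (Suc j)) = e j" if "j < n" for j
    using assms that by (auto simp: chain_def)
  have "T (z + \<delta>) (\<Sum>j<n. \<delta> ^ j *\<^sub>C e (Suc j)) = (\<Sum>j<n. T (z + \<delta>) (\<delta> ^ j *\<^sub>C e (Suc j)))"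
    by (rule T_sum) (use d in \<open>auto intro: dom_scale\<close>)
  also have "\<dots> = (\<Sum>j<n. \<delta> ^ j *\<^sub>C e j - \<delta> ^ Suc j *\<^sub>C e (Suc j))"
  proof (rule sum.cong)
    fix j assume "j \<in> {..<n}"
    then have j: "j < n" by simp
    have "T (z + \<delta>) (e (Suc j)) = e j - \<delta> *\<^sub>C e (Suc j)"
      using T_shift[of "z + \<delta>" "e (Suc j)" z] d(2)[OF j] by simp
    then show "T (z + \<delta>) (\<delta> ^ j *\<^sub>C e (Suc j)) = \<delta> ^ j *\<^sub>C e j - \<delta> ^ Suc j *\<^sub>C e (Suc j)"
      by (simp add: T_scale[OF d(1)[OF j]] scaleC_diff_right scaleC_scaleC mult.commute)
  qed simp
  also have "\<dots> = \<delta> ^ 0 *\<^sub>C e 0 - \<delta> ^ n *\<^sub>C e n" by (rule sum_lessThan_telescope')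
  finally show ?thesis using assms by (simp add: chain_def scaleC_zero_right)
qed

text \<open>The order \<open>N\<close> of the zero of \<open>D\<close> bounds the length. The
  telescoping vector tends to \<open>e 1 \<noteq> 0\<close>, while its image under
  \<open>T (z + \<delta>)\<close> has size of order \<open>cmod \<delta> ^ n\<close>. In the a
  priori estimate \<open>D\<close> contributes \<open>cmod \<delta> ^ N\<close>, and for
  \<open>n > N\<close> the limit \<open>\<delta> \<rightarrow> 0\<close> would give
  \<open>e 1 = 0\<close>.\<close>

lemma chain_bounded:
  assumes "D z = 0" shows "\<exists>N. \<forall>n e. chain z n e \<longrightarrow> n \<le> N"
proof -
  obtain Q N where Q: "Q holomorphic_on UNIV" "Q z \<noteq> 0" "\<And>w. D w = (w - z) ^ N * Q w" "0 < N"
    using D_zero_order[OF assms] by metis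
  have "n \<le> N" if ch: "chain z n e" for n e
  proof (rule ccontr)
    assume n: "\<not> n \<le> N"
    define y where "y \<delta> = (\<Sum>j<n. \<delta> ^ j *\<^sub>C e (Suc j))" for \<delta>
    have yd: "y \<delta> \<in> fst A" for \<delta>
      unfolding y_def using ch by (intro dom_sum dom_scale) (auto simp: chain_def)
    define K where "K = exp (C * (2 + cmod z) powr \<rho>)"
    have est: "cmod (Q (z + \<delta>)) * norm (y \<delta>) \<le> K * cmod \<delta> ^ (n - N) * norm (e n)"
      if \<delta>: "\<delta> \<noteq> 0" "cmod \<delta> < 1" for \<delta>
    proof -
      have "cmod (D (z + \<delta>)) * norm (y \<delta>) \<le> exp (C * (1 + cmod (z + \<delta>)) powr \<rho>) * norm (\<delta> ^ n *\<^sub>C e n)"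
        using ap[OF yd, of "z + \<delta>" \<delta>] chain_sum[OF ch, of \<delta>] by (simp add: y_def)
      also have "\<dots> \<le> K * norm (\<delta> ^ n *\<^sub>C e n)"
      proof (intro mult_right_mono)
        have "1 + cmod (z + \<delta>) \<le> 2 + cmod z" using norm_triangle_ineq[of z \<delta>] \<delta> by simp
        then have "(1 + cmod (z + \<delta>)) powr \<rho> \<le> (2 + cmod z) powr \<rho>" using rho by (intro powr_mono2) auto
        then show "exp (C * (1 + cmod (z + \<delta>)) powr \<rho>) \<le> K" using C by (simp add: K_def)
      qed simp
      finally have "cmod \<delta> ^ N * (cmod (Q (z + \<delta>)) * norm (y \<delta>)) \<le> K * (cmod \<delta> ^ n * norm (e n))"
        by (simp add: Q(3) norm_mult norm_power norm_scaleC mult.assoc)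
      also have "cmod \<delta> ^ n = cmod \<delta> ^ N * cmod \<delta> ^ (n - N)" using n by (simp flip: power_add)
      finally have "cmod \<delta> ^ N * (cmod (Q (z + \<delta>)) * norm (y \<delta>)) \<le> cmod \<delta> ^ N * (K * cmod \<delta> ^ (n - N) * norm (e n))"
        by (simp add: algebra_simps)
      then show ?thesis using \<delta> by simp
    qed
    have "((\<lambda>\<delta>. cmod (Q (z + \<delta>)) * norm (y \<delta>)) \<longlongrightarrow> cmod (Q (z + 0)) * norm (\<Sum>j<n. 0 ^ j *\<^sub>C e (Suc j))) (at 0)"
    proof (intro tendsto_mult tendsto_norm)
      have "continuous (at (z + 0)) Q"
        using holomorphic_on_imp_continuous_on[OF Q(1)] by (simp add: continuous_on_eq_continuous_at)
      then show "((\<lambda>\<delta>. Q (z + \<delta>)) \<longlongrightarrow> Q (z + 0)) (at 0)"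
        by (rule isCont_tendsto_compose) (intro tendsto_intros)
      show "(y \<longlongrightarrow> (\<Sum>j<n. 0 ^ j *\<^sub>C e (Suc j))) (at 0)"
        unfolding y_def by (intro tendsto_sum tendsto_scaleC_left tendsto_intros)
    qed
    moreover have "(\<Sum>j<n. 0 ^ j *\<^sub>C e (Suc j)) = e (Suc 0)"
    proof -
      have "(\<Sum>j<n. 0 ^ j *\<^sub>C e (Suc j)) = (\<Sum>j<n. if j = 0 then e (Suc j) else 0)"
        by (intro sum.cong) (auto simp: scaleC_zero_left scaleC_one)
      then show ?thesis using n by simp
    qed
    moreover have "((\<lambda>\<delta>. K * cmod \<delta> ^ (n - N) * norm (e n)) \<longlongrightarrow> K * cmod 0 ^ (n - N) * norm (e n)) (at 0)"
      by (intro tendsto_intros)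
    moreover have "eventually (\<lambda>\<delta>. cmod (Q (z + \<delta>)) * norm (y \<delta>) \<le> K * cmod \<delta> ^ (n - N) * norm (e n)) (at 0)"
      unfolding eventually_at using est by (intro exI[of _ 1]) (auto simp: dist_norm)
    ultimately have "cmod (Q z) * norm (e (Suc 0)) \<le> K * cmod 0 ^ (n - N) * norm (e n)"
      using tendsto_le[OF at_neq_bot] by fastforce
    then have "cmod (Q z) * norm (e (Suc 0)) \<le> 0" using n by (simp add: power_0_left)
    then show False using Q(2) ch by (simp add: mult_le_0_iff chain_def)
  qed
  then show ?thesis by blast
qed

text \<open>A chain of greatest length cannot be prolonged, and a preimage of its last vector would
  prolong it.\<close>

lemma maximal_chain:
  assumes "D z = 0"
  obtains k e where "chain z k e" "k > 0" "e k \<notin> T z ` fst A" "e k \<noteq> 0"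
proof -
  obtain N where N: "\<And>n e. chain z n e \<Longrightarrow> n \<le> N" using chain_bounded[OF assms] by blast
  obtain e1 where e1: "e1 \<in> fst A" "e1 \<noteq> 0" "T z e1 = 0" using zero[OF assms] by blast
  define P where "P n \<longleftrightarrow> (\<exists>e. chain z n e)" for n
  have P1: "P 1" unfolding P_def chain_def
    by (rule exI[of _ "\<lambda>j. if j = 0 then 0 else e1"]) (use e1 in auto)
  have PN: "\<And>n. P n \<Longrightarrow> n \<le> N" using N by (auto simp: P_def)
  define k where "k = Greatest P"
  have Pk: "P k" unfolding k_def by (rule GreatestI_nat[of P, OF P1 PN])
  have kmax: "n \<le> k" if "P n" for n unfolding k_def by (rule Greatest_le_nat[of P, OF that PN])
  obtain e where e: "chain z k e" using Pk by (auto simp: P_def)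
  have k0: "k > 0" using kmax[OF P1] by simp
  have nr: "e k \<notin> T z ` fst A"
  proof
    assume "e k \<in> T z ` fst A"
    then obtain u where u: "u \<in> fst A" "T z u = e k" by auto
    have "chain z (Suc k) (e(Suc k := u))"
      using e u k0 by (auto simp: chain_def less_Suc_eq)
    then show False using kmax[of "Suc k"] by (auto simp: P_def)
  qed
  moreover have "e k \<noteq> 0" using nr dom0 T_0 by (metis image_eqI)
  ultimately show ?thesis using that e k0 by blast
qed

text \<open>For the first inclusion, let \<open>T z u\<close> be a combination of the chain. The top
  coefficient vanishes because \<open>e k\<close> is not in the range; the others are hit by the
  combination with indices raised by one, and the difference lies in the kernel, which is the line
  through \<open>e 1\<close>. Conversely, every application of \<open>T z\<close> lowers the indices
  by one.\<close>

lemma root_space_eq: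
  assumes z: "D z = 0" and ch: "chain z k e" "k > 0" "e k \<notin> T z ` fst A"
  shows "root_space A z = L2_span (e ` {1..k})"
proof
  have ed: "e (Suc j) \<in> fst A" "T z (e (Suc j)) = e j" if "j < k" for j
    using ch that by (auto simp: chain_def)
  have sub: "(\<Sum>j<k. f j *\<^sub>C e (Suc j)) \<in> L2_span (e ` {1..k})" for f
    by (intro L2.span_sum span_complex_subspace(3) span_complex_subspace(4)) auto
  obtain e0 where e0: "\<And>u. u \<in> fst A \<Longrightarrow> T z u = 0 \<Longrightarrow> \<exists>c. u = c *\<^sub>C e0" using zero[OF z] by blast
  have ker: "\<exists>a. u = a *\<^sub>C e 1" if u: "u \<in> fst A" "T z u = 0" for u
  proof -
    have "T z (e (Suc 0)) = 0" using ed(2)[of 0] ch by (simp add: chain_def)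
    then obtain b where b: "e 1 = b *\<^sub>C e0" using e0[OF ed(1)] ch(2) by auto
    then have "b \<noteq> 0" using ch(1) by (auto simp: chain_def scaleC_zero_left)
    obtain a where "u = a *\<^sub>C e0" using e0[OF u] by blast
    then have "u = (a / b) *\<^sub>C e 1" using b \<open>b \<noteq> 0\<close> by (simp add: scaleC_scaleC)
    then show ?thesis by blast
  qed
  have "u \<in> L2_span (e ` {1..k})" if "u \<in> ker_power A z n" for u n
    using that
  proof (induction n arbitrary: u)
    case 0 then show ?case by (simp add: ker_power_def span_complex_subspace(1))
  next
    case (Suc n)
    have u: "u \<in> fst A" using Suc.prems by (auto simp: ker_power_def dest: spec[of _ 0])
    have "T z u \<in> ker_power A z n"
      unfolding ker_power_def
    proof (intro CollectI conjI allI impI)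
      show "(T z ^^ n) (T z u) = 0" using Suc.prems by (simp add: ker_power_def funpow_swap1)
      fix j assume "j < n"
      then have "(T z ^^ Suc j) u \<in> fst A" using Suc.prems unfolding ker_power_def by blast
      then show "(T z ^^ j) (T z u) \<in> fst A" by (simp add: funpow_swap1)
    qed
    from span_finite_sequence[OF Suc.IH[OF this]]
    obtain a where a: "T z u = (\<Sum>j<k. a j *\<^sub>C e (Suc j))" by blast
    obtain l where l: "k = Suc l" using ch(2) gr0_implies_Suc by blast
    define s where "s = (\<Sum>j<l. a j *\<^sub>C e (Suc (Suc j)))"
    have sd: "s \<in> fst A" unfolding s_def using ed(1) l by (intro dom_sum dom_scale) auto
    have Ts: "T z s = (\<Sum>j<l. a j *\<^sub>C e (Suc j))"
    proof -
      have "T z s = (\<Sum>j<l. T z (a j *\<^sub>C e (Suc (Suc j))))"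
        unfolding s_def using ed(1) l by (intro T_sum dom_scale) auto
      also have "\<dots> = (\<Sum>j<l. a j *\<^sub>C e (Suc j))"
        using ed l by (intro sum.cong refl) (simp add: T_scale)
      finally show ?thesis .
    qed
    have Tus: "T z (u - s) = a l *\<^sub>C e k"
      using a l by (simp add: T_diff[OF u sd] Ts)
    \<comment> \<open>All other terms of \<open>T z u\<close> have already been produced by
      \<open>s\<close>; a nonzero coefficient here would put \<open>e k\<close> into the
      range.\<close>
    have "a l = 0"
    proof (rule ccontr)
      assume al: "a l \<noteq> 0"
      have "T z (inverse (a l) *\<^sub>C (u - s)) = e k"
        using T_scale[OF dom_diff[OF u sd]] Tus al by (simp add: scaleC_scaleC scaleC_one)
      then show False using ch(3) dom_scale[OF dom_diff[OF u sd]] by (metis image_eqI)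
    qed
    then have "T z (u - s) = 0" using Tus by (simp add: scaleC_zero_left)
    then obtain b where b: "u - s = b *\<^sub>C e 1" using ker dom_diff[OF u sd] by blast
    have "b *\<^sub>C e 1 \<in> L2_span (e ` {1..k})"
      using ch(2) by (intro span_complex_subspace(3) span_complex_subspace(4)) auto
    moreover have "s \<in> L2_span (e ` {1..k})" unfolding s_def using l
      by (intro L2.span_sum span_complex_subspace(3) span_complex_subspace(4)) auto
    ultimately have "b *\<^sub>C e 1 + s \<in> L2_span (e ` {1..k})" by (rule span_complex_subspace(2))
    then show ?case using b by (metis diff_add_cancel)
  qed
  then show "root_space A z \<subseteq> L2_span (e ` {1..k})" by (auto simp: root_space_def)
  show "L2_span (e ` {1..k}) \<subseteq> root_space A z"
  proof
    fix v assume "v \<in> L2_span (e ` {1..k})"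
    then obtain a where v: "v = (\<Sum>j<k. a j *\<^sub>C e (Suc j))" using span_finite_sequence by blast
    \<comment> \<open>Natural subtraction truncates at \<open>0\<close>; together with
      \<open>e 0 = 0\<close> and \<open>T z 0 = 0\<close> the lowering rule holds past the end of
      the chain as well.\<close>
    have edom: "e (Suc j - i) \<in> fst A" "T z (e (Suc j - i)) = e (Suc j - Suc i)" if "j < k" for i j
    proof -
      show "e (Suc j - i) \<in> fst A"
        using ed(1)[of "j - i"] that ch(1) dom0 by (cases "i \<le> j") (auto simp: Suc_diff_le chain_def)
      show "T z (e (Suc j - i)) = e (Suc j - Suc i)"
        using ed(2)[of "j - i"] that ch(1) T_0 by (cases "i \<le> j") (auto simp: Suc_diff_le chain_def)
    qed
    have pow: "(T z ^^ i) v = (\<Sum>j<k. a j *\<^sub>C e (Suc j - i))" for i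
    proof (induction i)
      case 0 then show ?case by (simp add: v)
    next
      case (Suc i)
      have "(T z ^^ Suc i) v = T z (\<Sum>j<k. a j *\<^sub>C e (Suc j - i))" using Suc by simp
      also have "\<dots> = (\<Sum>j<k. T z (a j *\<^sub>C e (Suc j - i)))"
        using edom(1) by (intro T_sum dom_scale) auto
      also have "\<dots> = (\<Sum>j<k. a j *\<^sub>C e (Suc j - Suc i))"
        using edom by (intro sum.cong refl) (simp add: T_scale del: diff_Suc_Suc)
      finally show ?case .
    qed
    have "(T z ^^ k) v = 0" unfolding pow
      by (rule sum.neutral) (use ch(1) in \<open>auto simp: chain_def scaleC_zero_right\<close>)
    moreover have "(T z ^^ i) v \<in> fst A" for i
      unfolding pow using edom(1) by (intro dom_sum dom_scale) auto
    ultimately have "v \<in> ker_power A z k" by (simp add: ker_power_def)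
    then show "v \<in> root_space A z" using ch(2) by (auto simp: root_space_def)
  qed
qed

lemma discrete: assumes "D z = 0" shows "discrete_eigenvalue A z"
proof -
  obtain k e where ch: "chain z k e" "k > 0" "e k \<notin> T z ` fst A" using maximal_chain[OF assms] by metis
  have "finite_algebraic_multiplicity A z"
    unfolding finite_algebraic_multiplicity_def root_space_eq[OF assms ch]
    by (intro exI[of _ "e ` {1..k}"]) auto
  moreover have "closed (T z ` fst A)"
  proof -
    obtain l K where l: "\<And>u v. l (u + v) = l u + l v" "\<And>k u. l (k *\<^sub>C u) = k * (l u :: complex)"
      "\<And>u. cmod (l u) \<le> K * norm u" "T z ` fst A = {g. l g = 0}" using zero_range[OF assms] by metis
    have ld: "l (u - v) = l u - l v" for u v
      using l(1)[of u "(-1) *\<^sub>C v"] l(2)[of "-1" v] by (simp add: scaleC_minus_left)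
    show ?thesis unfolding l(4) closed_sequential_limits
    proof (intro allI impI, elim conjE)
      fix x g assume x: "\<forall>n. x n \<in> {g. l g = 0}" "x \<longlonglongrightarrow> g"
      have "(\<lambda>n. K * norm (g - x n)) \<longlonglongrightarrow> K * norm (g - g)" by (intro tendsto_intros x)
      moreover have "cmod (l g) \<le> K * norm (g - x n)" for n
        using l(3)[of "g - x n"] x(1) by (simp add: ld)
      ultimately have "cmod (l g) \<le> K * norm (g - g)" by (intro LIMSEQ_le_const) auto
      then show "g \<in> {g. l g = 0}" by simp
    qed
  qed
  ultimately show ?thesis
    unfolding discrete_eigenvalue_def using eigenvalue_iff spectrum_isolated assms by blast
qed

section \<open>Matrix coefficients of the resolvent\<close>

lemma resolvent_identity: "D w \<noteq> 0 \<Longrightarrow> x \<in> fst A \<Longrightarrow> R w (T z x) = x + (w - z) *\<^sub>C R w x"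
  using R_add[of w "T w x" "(w - z) *\<^sub>C x"] R_eq[of w x] T_shift[of w x z] by (simp add: R_scale)

text \<open>Division with remainder. The range of \<open>T z\<close> has codimension one and
  \<open>e k\<close> lies outside it, so every \<open>u\<close> is a multiple of \<open>e k\<close>
  plus some \<open>T z x\<close>. The resolvent of \<open>e k\<close> is a multiple of a root
  vector, hence invisible to \<open>v\<close>, and
  \<open>R w (T z x) = x + (w - z) *\<^sub>C R w x\<close> gains one factor \<open>w - z\<close>.
  After \<open>N\<close> rounds, \<open>N\<close> being the order of the zero of \<open>D\<close>,
  the gained factor cancels the pole allowed by \<open>R_bound\<close>.\<close>

lemma resolvent_matrix_bounded_at_eigenvalue:
  assumes z: "D z = 0" and v: "\<And>s. s \<in> root_space A z \<Longrightarrow> cinner s v = 0"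
  shows "\<exists>B. eventually (\<lambda>w. cmod (cinner (R w u) v) \<le> B) (at z)"
proof -
  obtain Q N where Q: "Q holomorphic_on UNIV" "Q z \<noteq> 0" "\<And>w. D w = (w - z) ^ N * Q w" "0 < N"
    using D_zero_order[OF z] by metis
  obtain k e where ch: "chain z k e" "k > 0" "e k \<notin> T z ` fst A" "e k \<noteq> 0" using maximal_chain[OF z] by metis
  obtain l where l: "\<And>u v. l (u + v) = l u + l v" "\<And>k u. l (k *\<^sub>C u) = k * (l u :: complex)"
      "T z ` fst A = {g. l g = 0}" using zero_range[OF z] by metis
  have lek: "l (e k) \<noteq> 0" using ch(3) l(3) by blast
  have dec: "\<exists>a. \<exists>x\<in>fst A. u = a *\<^sub>C e k + T z x" for u
  proof -
    let ?a = "l u / l (e k)"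
    have "l (u + (- ?a) *\<^sub>C e k) = l u + (- ?a) * l (e k)" by (simp only: l)
    then have "l (u + (- ?a) *\<^sub>C e k) = 0" using lek by simp
    then have "u + (- ?a) *\<^sub>C e k \<in> T z ` fst A" using l(3) by blast
    then obtain x where "x \<in> fst A" "T z x = u + (- ?a) *\<^sub>C e k" by auto
    then show ?thesis by (intro exI[of _ ?a] bexI[of _ x]) (auto simp: scaleC_minus_left)
  qed
  have ek: "cinner (R w (e k)) v = 0" if w: "D w \<noteq> 0" for w
  proof -
    have wz: "w \<noteq> z" using w z by auto
    let ?y = "\<Sum>j<k. (w - z) ^ j *\<^sub>C e (Suc j)"
    have yd: "?y \<in> fst A" using ch(1) by (intro dom_sum dom_scale) (auto simp: chain_def)
    have "T w ?y = - ((w - z) ^ k *\<^sub>C e k)" using chain_sum[OF ch(1), of "w - z"] by simp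
    then have "T w ((- 1 / (w - z) ^ k) *\<^sub>C ?y) = e k"
      using T_scale[OF yd, of w "- 1 / (w - z) ^ k"] wz
      by (simp add: scaleC_minus_left scaleC_minus_right scaleC_scaleC scaleC_one)
    then have "R w (e k) = (- 1 / (w - z) ^ k) *\<^sub>C ?y" by (intro R_eq w dom_scale yd)
    moreover have "?y \<in> root_space A z" unfolding root_space_eq[OF z ch(1-3)]
      by (intro L2.span_sum span_complex_subspace(3) span_complex_subspace(4)) auto
    ultimately show ?thesis using v[of ?y] by (simp only: cinner_scaleC_left mult_zero_right)
  qed
  have rep: "\<exists>b x B. (\<forall>w\<in>ball z 1. cmod (b w) \<le> B) \<and>
      (\<forall>w. D w \<noteq> 0 \<longrightarrow> cinner (R w u) v = b w + (w - z) ^ n * cinner (R w x) v)" for n u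
  proof (induction n arbitrary: u)
    case 0 show ?case by (rule exI[of _ "\<lambda>_. 0"]) auto
  next
    case (Suc n)
    obtain a x where x: "x \<in> fst A" "u = a *\<^sub>C e k + T z x" using dec by blast
    obtain b y B where b: "\<And>w. w \<in> ball z 1 \<Longrightarrow> cmod (b w) \<le> B"
      "\<And>w. D w \<noteq> 0 \<Longrightarrow> cinner (R w x) v = b w + (w - z) ^ n * cinner (R w y) v" using Suc[of x] by metis
    have "cinner (R w u) v = (cinner x v + (w - z) * b w) + (w - z) ^ Suc n * cinner (R w y) v" if "D w \<noteq> 0" for w
    proof -
      have "R w u = a *\<^sub>C R w (e k) + (x + (w - z) *\<^sub>C R w x)"
        by (simp only: x(2) R_add[OF that] R_scale[OF that] resolvent_identity[OF that x(1)])
      then have "cinner (R w u) v = a * 0 + (cinner x v + (w - z) * cinner (R w x) v)"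
        by (simp only: cinner_add_left cinner_scaleC_left ek[OF that])
      then show ?thesis unfolding b(2)[OF that] by (simp add: algebra_simps)
    qed
    moreover have "cmod (cinner x v + (w - z) * b w) \<le> cmod (cinner x v) + 1 * B" if "w \<in> ball z 1" for w
    proof -
      have "cmod ((w - z) * b w) \<le> 1 * B" unfolding norm_mult
        using that b(1)[OF that] by (intro mult_mono) (auto simp: dist_norm norm_minus_commute)
      then show ?thesis using norm_triangle_ineq[of "cinner x v" "(w - z) * b w"] by linarith
    qed
    ultimately show ?case by (intro exI[of _ "\<lambda>w. cinner x v + (w - z) * b w"] exI[of _ y] exI) auto
  qed
  obtain b x B where b: "\<And>w. w \<in> ball z 1 \<Longrightarrow> cmod (b w) \<le> B"
    "\<And>w. D w \<noteq> 0 \<Longrightarrow> cinner (R w u) v = b w + (w - z) ^ N * cinner (R w x) v" using rep[where n = N and u = u] by metis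
  have "continuous (at z) Q"
    using holomorphic_on_imp_continuous_on[OF Q(1)] by (simp add: continuous_on_eq_continuous_at)
  then have "(Q \<longlongrightarrow> Q z) (at z)" by (simp add: continuous_at)
  then have "eventually (\<lambda>w. cmod (Q w) > cmod (Q z) / 2) (at z)"
    using Q(2) by (intro order_tendstoD(1)[OF tendsto_norm]) auto
  moreover have "eventually (\<lambda>w. w \<in> ball z 1 - {z}) (at z)"
    unfolding eventually_at by (intro exI[of _ 1]) (auto simp: dist_commute)
  ultimately have "eventually (\<lambda>w. cmod (cinner (R w u) v) \<le> B + 2 * norm v * (exp (C * (2 + cmod z) powr \<rho>) * norm x) * 2 / cmod (Q z)) (at z)"
  proof eventually_elim
    case (elim w)
    have wz: "w \<noteq> z" "cmod (w - z) < 1" using elim by (auto simp: dist_norm norm_minus_commute)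
    have Qw: "Q w \<noteq> 0" using elim by auto
    have Dw: "D w \<noteq> 0" using wz Qw by (simp add: Q(3))
    have "1 + cmod w \<le> 2 + cmod z" using norm_triangle_ineq2[of w z] wz by simp
    then have "(1 + cmod w) powr \<rho> \<le> (2 + cmod z) powr \<rho>" using rho by (intro powr_mono2) auto
    then have "exp (C * (1 + cmod w) powr \<rho>) \<le> exp (C * (2 + cmod z) powr \<rho>)" using C by simp
    then have "cmod (D w) * norm (R w x) \<le> exp (C * (2 + cmod z) powr \<rho>) * norm x"
      using R_bound[OF Dw, of x] by (meson mult_right_mono norm_ge_zero order_trans)
    then have "cmod (Q w) * (cmod (w - z) ^ N * norm (R w x)) \<le> exp (C * (2 + cmod z) powr \<rho>) * norm x"
      by (simp add: Q(3) norm_mult norm_power mult_ac)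
    moreover have "cmod (Q z) / 2 * (cmod (w - z) ^ N * norm (R w x)) \<le> cmod (Q w) * (cmod (w - z) ^ N * norm (R w x))"
      using elim by (intro mult_right_mono) auto
    ultimately have *: "cmod (w - z) ^ N * norm (R w x) \<le> exp (C * (2 + cmod z) powr \<rho>) * norm x * 2 / cmod (Q z)"
      using Q(2) by (simp add: field_simps)
    have "cmod ((w - z) ^ N * cinner (R w x) v) \<le> cmod (w - z) ^ N * (2 * norm (R w x) * norm v)"
      unfolding norm_mult norm_power by (intro mult_left_mono cmod_cinner_le) auto
    also have "\<dots> = 2 * norm v * (cmod (w - z) ^ N * norm (R w x))" by simp
    also have "\<dots> \<le> 2 * norm v * (exp (C * (2 + cmod z) powr \<rho>) * norm x * 2 / cmod (Q z))"
      using * by (intro mult_left_mono) auto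
    finally have "cmod ((w - z) ^ N * cinner (R w x) v) \<le> 2 * norm v * (exp (C * (2 + cmod z) powr \<rho>) * norm x) * 2 / cmod (Q z)"
      by (simp add: mult.assoc)
    moreover have "cmod (b w) \<le> B" using b(1) elim by blast
    ultimately show ?case unfolding b(2)[OF Dw]
      using norm_triangle_ineq[of "b w" "(w - z) ^ N * cinner (R w x) v"] by linarith
  qed
  then show ?thesis by blast
qed

lemma resolvent_locally_bounded:
  assumes w: "D w \<noteq> 0"
  shows "\<exists>K. eventually (\<lambda>w'. D w' \<noteq> 0 \<and> (\<forall>x. norm (R w' x) \<le> K * norm x)) (at w)"
proof -
  have "continuous (at w) D"
    using holomorphic_on_imp_continuous_on[OF D_hol] by (simp add: continuous_on_eq_continuous_at)
  then have "(D \<longlongrightarrow> D w) (at w)" by (simp add: continuous_at)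
  then have "eventually (\<lambda>w'. cmod (D w') > cmod (D w) / 2) (at w)"
    using w by (intro order_tendstoD(1)[OF tendsto_norm]) auto
  moreover have "eventually (\<lambda>w'. w' \<in> ball w 1) (at w)"
    unfolding eventually_at by (intro exI[of _ 1]) (auto simp: dist_commute)
  ultimately have "eventually (\<lambda>w'. D w' \<noteq> 0 \<and> (\<forall>x. norm (R w' x) \<le> (exp (C * (2 + cmod w) powr \<rho>) * 2 / cmod (D w)) * norm x)) (at w)"
  proof eventually_elim
    case (elim w')
    have nz: "D w' \<noteq> 0" using elim by auto
    have "1 + cmod w' \<le> 2 + cmod w" using norm_triangle_ineq2[of w' w] elim by (simp add: dist_norm norm_minus_commute)
    then have "(1 + cmod w') powr \<rho> \<le> (2 + cmod w) powr \<rho>" using rho by (intro powr_mono2) auto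
    then have e: "exp (C * (1 + cmod w') powr \<rho>) \<le> exp (C * (2 + cmod w) powr \<rho>)" using C by simp
    have "norm (R w' x) \<le> (exp (C * (2 + cmod w) powr \<rho>) * 2 / cmod (D w)) * norm x" for x
    proof -
      have "cmod (D w) / 2 * norm (R w' x) \<le> cmod (D w') * norm (R w' x)"
        using elim by (intro mult_right_mono) auto
      also have "\<dots> \<le> exp (C * (2 + cmod w) powr \<rho>) * norm x"
        using R_bound[OF nz, of x] e by (meson mult_right_mono norm_ge_zero order_trans)
      finally show ?thesis using w by (simp add: field_simps)
    qed
    then show ?case using nz by blast
  qed
  then show ?thesis by blast
qed

lemma resolvent_matrix_holomorphic:
  "(\<lambda>w. cinner (R w u) v) holomorphic_on {z. D z \<noteq> 0}"
proof -
  have step: "cinner (R w' x) v - cinner (R w x) v = (w' - w) * cinner (R w' (R w x)) v"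
    if "D w \<noteq> 0" "D w' \<noteq> 0" for w w' x
    using resolvent_identity[OF that(2) R(1)[OF that(1), of x], of w] R(2)[OF that(1), of x]
    by (simp add: cinner_add_left cinner_scaleC_left)
  have cont: "((\<lambda>w'. cinner (R w' x) v) \<longlongrightarrow> cinner (R w x) v) (at w)" if w: "D w \<noteq> 0" for w x
  proof -
    obtain K where K: "eventually (\<lambda>w'. D w' \<noteq> 0 \<and> (\<forall>x. norm (R w' x) \<le> K * norm x)) (at w)"
      using resolvent_locally_bounded[OF w] by blast
    have "((\<lambda>w'. cinner (R w' x) v - cinner (R w x) v) \<longlongrightarrow> 0) (at w)"
    proof (rule Lim_null_comparison)
      show "eventually (\<lambda>w'. norm (cinner (R w' x) v - cinner (R w x) v) \<le> cmod (w' - w) * (2 * (K * norm (R w x)) * norm v)) (at w)"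
        using K
      proof eventually_elim
        case (elim w')
        have "cmod (cinner (R w' (R w x)) v) \<le> 2 * norm (R w' (R w x)) * norm v" by (rule cmod_cinner_le)
        also have "\<dots> \<le> 2 * (K * norm (R w x)) * norm v" using elim by (intro mult_right_mono mult_left_mono) auto
        finally show ?case using step[OF w, of w' x] elim by (simp add: norm_mult mult_left_mono)
      qed
      show "((\<lambda>w'. cmod (w' - w) * (2 * (K * norm (R w x)) * norm v)) \<longlongrightarrow> 0) (at w)"
        by (intro tendsto_mult_left_zero tendsto_norm_zero LIM_zero tendsto_ident_at)
    qed
    then show ?thesis by (rule LIM_zero_cancel)
  qed
  have "((\<lambda>w. cinner (R w u) v) has_field_derivative cinner (R w (R w u)) v) (at w)" if w: "D w \<noteq> 0" for w
    unfolding has_field_derivative_iff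
  proof (rule Lim_transform_eventually[OF cont[OF w, of "R w u"]])
    obtain K where "eventually (\<lambda>w'. D w' \<noteq> 0 \<and> (\<forall>x. norm (R w' x) \<le> K * norm x)) (at w)"
      using resolvent_locally_bounded[OF w] by blast
    moreover have "eventually (\<lambda>w'. w' \<noteq> w) (at w)" by (simp add: eventually_at_filter)
    ultimately show "eventually (\<lambda>w'. cinner (R w' (R w u)) v = (cinner (R w' u) v - cinner (R w u) v) / (w' - w)) (at w)"
      by eventually_elim (simp add: step[OF w])
  qed
  then show ?thesis unfolding holomorphic_on_def field_differentiable_def
    by (blast intro: has_field_derivative_at_within)
qed

section \<open>Completeness and infinitude of the spectrum\<close>

lemma orthogonal_root_vectors_zero:
  assumes v: "\<And>z s. D z = 0 \<Longrightarrow> s \<in> root_space A z \<Longrightarrow> cinner s v = 0"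
  shows "v = 0"
proof -
  have zero_at: "cinner (R 0 u) v = 0" for u
  proof -
    have D0: "D 0 \<noteq> 0" by (rule D_imag) simp
    have bd: "\<exists>B. eventually (\<lambda>w. cmod (cinner (R w u) v) \<le> B) (at z)" if "D z = 0" for z
      by (rule resolvent_matrix_bounded_at_eigenvalue[OF that v[OF that]])
    obtain G where G: "G holomorphic_on UNIV" "\<And>z. D z \<noteq> 0 \<Longrightarrow> G z = cinner (R z u) v"
      using entire_extension[OF D_hol _ resolvent_matrix_holomorphic[of u v] bd] D0 by blast
    \<comment> \<open>One constant for both hypotheses of the quotient bound: at least
      \<open>1\<close> for \<open>D\<close> itself, and at least \<open>2 * norm u * norm v\<close>
      for \<open>D\<close> times the matrix coefficient.\<close>
    define \<kappa> where "\<kappa> = max 1 (2 * norm u * norm v)"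
    have kap: "\<kappa> \<ge> 1" "2 * norm u * norm v \<le> \<kappa>" "ln \<kappa> \<ge> 0" by (auto simp: \<kappa>_def)
    define M where "M z = C * (1 + (2 * cmod z + 1)) powr \<rho> + ln \<kappa>" for z
    \<comment> \<open>The quotient bound reaches half the radius of the circle on which the
      hypotheses are checked; radius \<open>2 * cmod z + 1\<close> is positive and brings
      \<open>z\<close> within reach.\<close>
    have gr1: "cmod (G z) \<le> exp (3 * (M z + 1 - ln (cmod (D 0))))" for z
    proof (rule entire_quotient_bound[OF G(1) D_hol D0, of "2 * cmod z + 1"])
      fix w assume w: "cmod w = 2 * cmod z + 1"
      have e: "exp (C * (1 + cmod w) powr \<rho>) * \<kappa> = exp (M z)"
        using kap(1) by (simp add: M_def w exp_add)
      have "cmod (D w) \<le> exp (C * (1 + cmod w) powr \<rho>) * 1" using D_bound[of w] by simp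
      also have "\<dots> \<le> exp (C * (1 + cmod w) powr \<rho>) * \<kappa>" using kap by (intro mult_left_mono) auto
      finally show "cmod (D w) \<le> exp (M z)" by (simp add: e)
      show "cmod (G w * D w) \<le> exp (M z)"
      proof (cases "D w = 0")
        case False
        have "cmod (G w * D w) \<le> (2 * norm (R w u) * norm v) * cmod (D w)"
          unfolding norm_mult G(2)[OF False] by (intro mult_right_mono cmod_cinner_le) auto
        also have "\<dots> = (cmod (D w) * norm (R w u)) * (2 * norm v)" by simp
        also have "\<dots> \<le> (exp (C * (1 + cmod w) powr \<rho>) * norm u) * (2 * norm v)"
          using R_bound[OF False] by (intro mult_right_mono) auto
        also have "\<dots> = exp (C * (1 + cmod w) powr \<rho>) * (2 * norm u * norm v)" by simp
        also have "\<dots> \<le> exp (C * (1 + cmod w) powr \<rho>) * \<kappa>" using kap by (intro mult_left_mono) auto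
        finally show ?thesis by (simp add: e)
      qed simp
    qed (use norm_ge_zero[of z] in \<open>simp_all add: add_nonneg_pos\<close>)
    define C' where "C' = 3 * (C * 2 powr \<rho> + ln \<kappa> + 1 + \<bar>ln (cmod (D 0))\<bar>)"
    have "C * 2 powr \<rho> > 0" using C by simp
    then have C': "C' > 0" unfolding C'_def by (intro mult_pos_pos add_pos_nonneg add_pos_pos kap(3) abs_ge_zero) (use C in auto)
    have gr: "cmod (G z) \<le> exp (C' * (1 + cmod z) powr \<rho>)" for z
    proof -
      have p1: "(1 + cmod z) powr \<rho> \<ge> 1" using rho by (simp add: ge_one_powr_ge_zero)
      have eq: "(1 + (2 * cmod z + 1)) powr \<rho> = 2 powr \<rho> * (1 + cmod z) powr \<rho>"
      proof -
        have "1 + (2 * cmod z + 1) = 2 * (1 + cmod z)" by simp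
        then show ?thesis by (simp only: powr_mult)
      qed
      have "(ln \<kappa> + 1 + \<bar>ln (cmod (D 0))\<bar>) * 1 \<le> (ln \<kappa> + 1 + \<bar>ln (cmod (D 0))\<bar>) * (1 + cmod z) powr \<rho>"
        using p1 kap(3) by (intro mult_left_mono) auto
      then have "3 * (M z + 1 - ln (cmod (D 0))) \<le> C' * (1 + cmod z) powr \<rho>"
        unfolding M_def C'_def eq by (simp add: algebra_simps)
      then show ?thesis using gr1[of z] by (meson exp_le_cancel_iff order_trans)
    qed
    \<comment> \<open>Passage to the variable \<open>\<zeta>\<close>: the imaginary axis of
      \<open>z\<close> becomes the real axis, and the region where \<open>- Im z\<close> is large
      becomes a left half-plane.\<close>
    define G' where "G' w = G (\<i> * w)" for w
    have G'h: "G' holomorphic_on UNIV"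
      using holomorphic_on_compose_gen[of "\<lambda>w. \<i> * w" UNIV G UNIV] G(1)
      by (simp add: o_def G'_def[abs_def] holomorphic_on_mult holomorphic_on_const holomorphic_on_ident)
    define B where "B = max (2 * norm u * norm v / m) (2 * norm u * norm v)"
    have Gb: "cmod (G' w) \<le> 2 * norm (R (\<i> * w) u) * norm v" if "D (\<i> * w) \<noteq> 0" for w
      unfolding G'_def G(2)[OF that] by (rule cmod_cinner_le)
    have low': "cmod (G' w) * (- Re w - c) \<le> 2 * norm u * norm v" if w: "Re w < - c" for w
    proof -
      have nz: "D (\<i> * w) \<noteq> 0" using D_low[of "\<i> * w"] w by simp
      have "(- Re w - c) * norm (R (\<i> * w) u) \<le> norm u"
        using low[OF R(1)[OF nz], of "\<i> * w" u] R(2)[OF nz] by simp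
      then have "(- Re w - c) * norm (R (\<i> * w) u) * (2 * norm v) \<le> norm u * (2 * norm v)"
        by (intro mult_right_mono) auto
      moreover have "cmod (G' w) * (- Re w - c) \<le> 2 * norm (R (\<i> * w) u) * norm v * (- Re w - c)"
        using Gb[OF nz] w by (intro mult_right_mono) auto
      ultimately show ?thesis by (simp add: mult_ac)
    qed
    have "cmod (G' w) \<le> B" for w
    proof (rule entire_bounded_of_order_less_2[OF G'h rho C', of "c + 1"])
      show "cmod (G' w) \<le> exp (C' * (1 + cmod w) powr \<rho>)" for w
        using gr[of "\<i> * w"] by (simp add: G'_def norm_mult)
      show "cmod (G' w) \<le> B" if "Im w = 0" for w
      proof -
        have nz: "D (\<i> * w) \<noteq> 0" using D_imag[of "\<i> * w"] that by simp
        have "m * norm (R (\<i> * w) u) \<le> norm u"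
          using imag[OF _ R(1)[OF nz], of "\<i> * w" u] R(2)[OF nz] that by simp
        then have "norm (R (\<i> * w) u) \<le> norm u / m" using m by (simp add: field_simps)
        then have "2 * norm (R (\<i> * w) u) * norm v \<le> 2 * (norm u / m) * norm v"
          by (intro mult_right_mono mult_left_mono) auto
        then show ?thesis using Gb[OF nz] by (simp add: B_def)
      qed
      show "cmod (G' w) \<le> B" if "Re w \<le> - (c + 1)" for w
      proof -
        have "cmod (G' w) * 1 \<le> cmod (G' w) * (- Re w - c)" using that by (intro mult_left_mono) auto
        then show ?thesis using low'[of w] that by (simp add: B_def)
      qed
    qed (use c in auto)
    then have "bounded (range G')" by (auto simp: bounded_iff)
    then obtain g where g: "\<And>w. G' w = g" using Liouville_theorem[OF G'h] by (metis constant_on_def UNIV_I)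
    have "g = 0"
    proof (rule ccontr)
      assume "g \<noteq> 0"
      \<comment> \<open>At distance \<open>t\<close> to the left of \<open>- c\<close> the resolvent
        bound gives \<open>cmod g * t \<le> 2 * norm u * norm v\<close>; this \<open>t\<close>
        violates it.\<close>
      define t where "t = (2 * norm u * norm v + 1) / cmod g"
      have t: "t > 0" using \<open>g \<noteq> 0\<close> by (auto simp: t_def intro!: divide_pos_pos add_nonneg_pos)
      have "cmod g * t \<le> 2 * norm u * norm v" using low'[of "of_real (- c - t)"] t g by simp
      then show False using \<open>g \<noteq> 0\<close> by (simp add: t_def)
    qed
    then have "G' 0 = 0" using g by simp
    then show ?thesis using G(2)[OF D0] by (simp add: G'_def)
  qed
  \<comment> \<open>The resolvent at \<open>0\<close> maps onto the domain, so \<open>v\<close> is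
    orthogonal to a dense set.\<close>
  show "v = 0"
  proof (rule dense)
    fix x assume x: "x \<in> fst A"
    have D0: "D 0 \<noteq> 0" by (rule D_imag) simp
    have "x = R 0 (T 0 x)" using R_eq[OF D0 x refl] by simp
    then have "cinner x v = 0" using zero_at by metis
    then show "x \<bullet> v = 0" by (simp add: cinner_def complex_eq_iff)
  qed
qed

lemma complete: "closure (L2_span (generalised_eigenfunctions A)) = UNIV"
proof (rule closure_span_UNIV)
  fix v assume v: "\<And>s. s \<in> generalised_eigenfunctions A \<Longrightarrow> cinner s v = 0"
  have "cinner s v = 0" if "D z = 0" "s \<in> root_space A z" for z s
  proof (cases "s = 0")
    case True then show ?thesis by (simp add: cinner_def complex_eq_iff)
  next
    case False
    then show ?thesis using that eigenvalue_iff by (intro v) (auto simp: generalised_eigenfunctions_def)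
  qed
  then show "v = 0" by (rule orthogonal_root_vectors_zero)
qed

lemma root_space_subset: "root_space A z \<subseteq> fst A"
proof
  fix x assume "x \<in> root_space A z"
  then obtain n where n: "n \<ge> 1" "x \<in> ker_power A z n" by (auto simp: root_space_def)
  then have "\<forall>j<n. (T z ^^ j) x \<in> fst A" by (simp add: ker_power_def)
  then have "(T z ^^ 0) x \<in> fst A" using n(1) by (metis less_le_trans zero_less_one)
  then show "x \<in> fst A" by simp
qed

lemma infinite_spectrum: "infinite (spectrum A)"
proof
  assume fin: "finite (spectrum A)"
  have "\<exists>B. finite B \<and> L2_span B = root_space A z" if "z \<in> spectrum A" for z
    using discrete[of z] that unfolding discrete_eigenvalue_def finite_algebraic_multiplicity_def spectrum_eq by blast
  then obtain B where B: "\<And>z. z \<in> spectrum A \<Longrightarrow> finite (B z) \<and> L2_span (B z) = root_space A z" by metis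
  let ?B = "\<Union>z\<in>spectrum A. B z"
  have "generalised_eigenfunctions A \<subseteq> L2_span ?B"
  proof
    fix s assume "s \<in> generalised_eigenfunctions A"
    then obtain z where z: "z \<in> spectrum A" "s \<in> root_space A z"
      by (auto simp: generalised_eigenfunctions_def eigenvalue_iff spectrum_eq)
    then have "s \<in> L2_span (B z)" using B by blast
    then show "s \<in> L2_span ?B" using L2.span_mono[of "B z" ?B] z(1) by blast
  qed
  then have "L2_span (generalised_eigenfunctions A) \<subseteq> L2_span ?B"
    by (rule L2.span_minimal) simp
  moreover have "closed (L2_span ?B)" using fin B by (intro closed_span_finite) blast
  ultimately have "closure (L2_span (generalised_eigenfunctions A)) \<subseteq> L2_span ?B" by (rule closure_minimal)
  then have univ: "L2_span ?B = UNIV" using complete by blast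
  have "?B \<subseteq> fst A"
  proof
    fix x assume "x \<in> ?B"
    then obtain z where z: "z \<in> spectrum A" "x \<in> B z" by blast
    then have "x \<in> root_space A z" using B span_complex_subspace(4) by blast
    then show "x \<in> fst A" using root_space_subset by blast
  qed
  moreover have "L2.subspace (fst A)" by (intro L2.subspaceI dom0 dom_add dom_scale)
  ultimately have "L2_span ?B \<subseteq> fst A" by (rule L2.span_minimal)
  then show False using univ proper by blast
qed

end

section \<open>Solutions decaying at infinity\<close>

definition tail :: "(real \<Rightarrow> 'a::euclidean_space) \<Rightarrow> real \<Rightarrow> 'a"
  where "tail g x = (LINT y:{x..}|lborel. g y)"

definition tail_int :: "(real \<Rightarrow> 'a::euclidean_space) \<Rightarrow> bool"
  where "tail_int g \<longleftrightarrow> (\<forall>x. set_integrable lborel {x..} g)"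

lemma set_integrable_scale:
  fixes f :: "_ \<Rightarrow> 'a::{real_normed_field, second_countable_topology}"
  assumes "set_integrable M A f"
  shows "set_integrable M A (\<lambda>t. a * f t)" "set_integrable M A (\<lambda>t. f t * a)"
  using set_integrable_mult_right[of a M A f] set_integrable_mult_left[of a M A f] assms by auto

lemma set_integrable_lborel_abs:
  fixes g :: "real \<Rightarrow> 'a::euclidean_space"
  assumes "set_integrable lborel S g" shows "g absolutely_integrable_on S"
proof -
  have "(\<lambda>x. indicator S x *\<^sub>R g x) \<in> borel_measurable lborel"
    using assms unfolding set_integrable_def by (rule borel_measurable_integrable)
  from integrable_completion[OF this] show ?thesis using assms unfolding set_integrable_def by simp
qed

lemma tail_ac: assumes "tail_int g" shows "ac (tail g) (\<lambda>x. - g x)"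
  unfolding ac_def
proof (intro allI impI conjI)
  fix a b :: real assume ab: "a \<le> b"
  have iab: "set_integrable lborel {a..b} g"
    by (rule set_integrable_subset[of _ "{a..}"]) (use assms in \<open>auto simp: tail_int_def\<close>)
  have "(\<lambda>x. - g x) absolutely_integrable_on {a..b}"
    using absolutely_integrable_linear[OF set_integrable_lborel_abs[OF iab] bounded_linear_minus[OF bounded_linear_ident]]
    by (simp add: o_def)
  then show "(\<lambda>x. - g x) absolutely_integrable_on {a..b}" .
  have i1: "set_integrable lborel {a..<b} g" "set_integrable lborel {b..} g" "set_integrable lborel {a..<b} g"
    by (rule set_integrable_subset[of _ "{a..}"]; use assms ab in \<open>auto simp: tail_int_def\<close>)+
  have "tail g a = (LINT y:{a..<b} \<union> {b..}|lborel. g y)"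
    unfolding tail_def using ab by (intro arg_cong[where f = "\<lambda>S. LINT y:S|lborel. g y"]) auto
  also have "\<dots> = (LINT y:{a..<b}|lborel. g y) + tail g b"
    unfolding tail_def by (rule set_integral_Un[OF _ i1(1,2)]) auto
  also have "(LINT y:{a..<b}|lborel. g y) = (LINT y:{a..b}|lborel. g y)"
    unfolding set_lebesgue_integral_def
  proof (rule integral_cong_AE)
    show "(\<lambda>x. indicator {a..<b} x *\<^sub>R g x) \<in> borel_measurable lborel"
      using i1 unfolding set_integrable_def by (auto intro: borel_measurable_integrable)
    show "(\<lambda>x. indicator {a..b} x *\<^sub>R g x) \<in> borel_measurable lborel"
      using iab unfolding set_integrable_def by (auto intro: borel_measurable_integrable)
    show "AE x in lborel. indicator {a..<b} x *\<^sub>R g x = indicator {a..b} x *\<^sub>R g x"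
      using AE_lborel_singleton[of b] by eventually_elim (auto simp: indicator_def)
  qed
  also have "\<dots> = integral {a..b} g" by (rule set_borel_integral_eq_integral(2)[OF iab])
  finally have e: "tail g b - tail g a = - integral {a..b} g" by simp
  have "(g has_integral integral {a..b} g) {a..b}"
    using set_borel_integral_eq_integral(1)[OF iab] by (rule integrable_integral)
  from has_integral_neg[OF this] show "((\<lambda>x. - g x) has_integral tail g b - tail g a) {a..b}"
    unfolding e .
qed

lemma tail_tendsto_0:
  assumes "tail_int g" shows "(tail g \<longlongrightarrow> 0) at_top"
proof -
  have i: "integrable lborel (\<lambda>y. norm (indicator {0..} y *\<^sub>R g y))"
    using assms unfolding tail_int_def set_integrable_def by (intro integrable_norm) blast
  show ?thesis
  proof (rule tendsto_at_topI_sequentially)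
    fix X :: "nat \<Rightarrow> real" assume X: "filterlim X at_top sequentially"
    then have "eventually (\<lambda>n. X n \<ge> 0) sequentially" by (simp add: filterlim_at_top)
    then obtain N where N: "\<And>n. n \<ge> N \<Longrightarrow> X n \<ge> 0" by (auto simp: eventually_sequentially)
    have "(\<lambda>n. integral\<^sup>L lborel (\<lambda>y. indicator {X (n + N)..} y *\<^sub>R g y)) \<longlonglongrightarrow> integral\<^sup>L lborel (\<lambda>y :: real. 0 :: 'a)"
    proof (rule integral_dominated_convergence[OF _ _ i])
      show "(\<lambda>y. indicator {X (n + N)..} y *\<^sub>R g y) \<in> borel_measurable lborel" for n
        using assms unfolding tail_int_def set_integrable_def by (intro borel_measurable_integrable) blast
      show "AE y in lborel. norm (indicator {X (n + N)..} y *\<^sub>R g y) \<le> norm (indicator {0..} y *\<^sub>R g y)" for n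
        using N[of "n + N"] by (intro AE_I2) (auto simp: indicator_def)
      show "AE y in lborel. (\<lambda>n. indicator {X (n + N)..} y *\<^sub>R g y) \<longlonglongrightarrow> 0"
      proof (rule AE_I2)
        fix y :: real
        have "eventually (\<lambda>n. X n > y) sequentially" using X by (simp add: filterlim_at_top_dense)
        then have "eventually (\<lambda>n. indicator {X n..} y *\<^sub>R g y = 0) sequentially"
          by eventually_elim auto
        then have "(\<lambda>n. indicator {X n..} y *\<^sub>R g y) \<longlonglongrightarrow> 0" by (rule tendsto_eventually)
        then show "(\<lambda>n. indicator {X (n + N)..} y *\<^sub>R g y) \<longlonglongrightarrow> 0" by (rule LIMSEQ_ignore_initial_segment)
      qed
    qed simp
    then have "(\<lambda>n. tail g (X (n + N))) \<longlonglongrightarrow> 0" by (simp add: tail_def set_lebesgue_integral_def)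
    then show "(\<lambda>n. tail g (X n)) \<longlonglongrightarrow> 0" by (rule LIMSEQ_offset)
  qed
qed

lemma tail_bound:
  assumes "set_integrable lborel {x..} g" "set_integrable lborel {x..} w" "\<And>y. y \<ge> x \<Longrightarrow> norm (g y) \<le> w y"
  shows "norm (tail g x) \<le> (tail w x :: real)"
proof -
  have "norm (tail g x) \<le> (LINT y:{x..}|lborel. norm (g y))"
    unfolding tail_def by (rule set_integral_norm_bound[OF assms(1)])
  also have "\<dots> \<le> tail w x"
    unfolding tail_def by (rule set_integral_mono[OF set_integrable_norm[OF assms(1)] assms(2)]) (use assms(3) in auto)
  finally show ?thesis .
qed

lemma tail_sum:
  assumes "\<And>n. n \<in> I \<Longrightarrow> set_integrable lborel {x..} (g n)"
  shows "tail (\<lambda>y. \<Sum>n\<in>I. g n y) x = (\<Sum>n\<in>I. tail (g n) x)"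
  unfolding tail_def set_lebesgue_integral_def scaleR_sum_right
  by (rule Bochner_Integration.integral_sum) (use assms in \<open>simp add: set_integrable_def\<close>)

lemma FTC_tail:
  fixes G g :: "real \<Rightarrow> real"
  assumes m: "g \<in> borel_measurable borel" and d: "\<And>y. y \<ge> x \<Longrightarrow> (G has_real_derivative - g y) (at y)"
    and nn: "\<And>y. y \<ge> x \<Longrightarrow> g y \<ge> 0" and l: "(G \<longlongrightarrow> 0) at_top"
  shows "set_integrable lborel {x..} g" "tail g x = G x"
proof -
  have nI: "(\<integral>\<^sup>+y. ennreal (g y) * indicator {x..} y \<partial>lborel) = 0 - (- G x)"
    using nn_integral_FTC_atLeast[of g x "\<lambda>y. - G y" 0] m nn d tendsto_minus[OF l] DERIV_minus by fastforce
  have e: "ennreal (g y) * indicator {x..} y = ennreal (indicator {x..} y *\<^sub>R g y)" for y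
    by (auto simp: indicator_def)
  have nn': "AE y in lborel. 0 \<le> indicator {x..} y *\<^sub>R g y" using nn by (intro AE_I2) (auto simp: indicator_def)
  have m': "(\<lambda>y. indicator {x..} y *\<^sub>R g y) \<in> borel_measurable lborel" using m by measurable
  have G0: "G x \<ge> 0"
  proof (rule tendsto_upperbound[OF l _ trivial_limit_at_top_linorder])
    show "eventually (\<lambda>y. G y \<le> G x) at_top"
      using eventually_ge_at_top[of x]
    proof eventually_elim
      case (elim y)
      show ?case
      proof (rule DERIV_nonpos_imp_nonincreasing[OF elim])
        fix t assume "x \<le> t" "t \<le> y"
        then show "\<exists>D. (G has_real_derivative D) (at t) \<and> D \<le> 0" using d[of t] nn[of t] by auto
      qed
    qed
  qed
  have h: "has_bochner_integral lborel (\<lambda>y. indicator {x..} y *\<^sub>R g y) (G x)"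
    by (rule has_bochner_integral_nn_integral[OF m' nn' G0]) (use nI e in simp)
  then show "set_integrable lborel {x..} g" "tail g x = G x"
    unfolding set_integrable_def tail_def set_lebesgue_integral_def
    by (auto simp: has_bochner_integral_iff)
qed

lemma set_integrable_cont_interval:
  fixes g :: "real \<Rightarrow> 'a::euclidean_space"
  assumes "continuous_on UNIV g" shows "set_integrable lborel {a..b} g"
  using borel_integrable_atLeastAtMost'[of a b g] continuous_on_subset[OF assms] by auto

lemma tail_int_bound:
  fixes g :: "real \<Rightarrow> 'a::euclidean_space"
  assumes g: "continuous_on UNIV g" and w: "set_integrable lborel {X..} w"
    and le: "\<And>y. y \<ge> X \<Longrightarrow> norm (g y) \<le> w y"
  shows "tail_int g"
  unfolding tail_int_def
proof
  fix x
  have m: "g \<in> borel_measurable borel" using g by (rule borel_measurable_continuous_onI)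
  have "set_integrable lborel {X..} g"
  proof (rule set_integrable_bound[OF w])
    show "set_borel_measurable lborel {X..} g" unfolding set_borel_measurable_def using m by measurable
    show "AE y in lborel. y \<in> {X..} \<longrightarrow> norm (g y) \<le> norm (w y)"
      using le by (intro AE_I2 impI) (metis abs_ge_self atLeast_iff order_trans real_norm_def)
  qed
  then have "set_integrable lborel ({x..X} \<union> {X..}) g"
    by (intro set_integrable_Un set_integrable_cont_interval[OF g]) auto
  then show "set_integrable lborel {x..} g"
    by (rule set_integrable_subset) auto
qed

lemma exp_tail: assumes "a > 0"
  shows "set_integrable lborel {x..} (\<lambda>y. exp (- a * (y - x)))" "tail (\<lambda>y. exp (- a * (y - x))) x = 1 / a"
proof -
  have 1: "(\<lambda>y. exp (- a * (y - x))) \<in> borel_measurable borel" by measurable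
  have 2: "((\<lambda>y. exp (- a * (y - x)) / a) has_real_derivative - exp (- a * (y - x))) (at y)" for y
    using assms by (auto intro!: derivative_eq_intros)
  have 3: "((\<lambda>y. exp (- a * (y - x)) / a) \<longlongrightarrow> 0) at_top" using assms by real_asymp
  show "set_integrable lborel {x..} (\<lambda>y. exp (- a * (y - x)))" by (rule FTC_tail(1)[OF 1 2 _ 3]) simp
  show "tail (\<lambda>y. exp (- a * (y - x))) x = 1 / a"
    using FTC_tail(2)[OF 1 2 _ 3] by simp
qed

lemma powr_tail: assumes "\<gamma> > 1" "x > 0"
  shows "set_integrable lborel {x..} (\<lambda>y. y powr - \<gamma>)" "tail (\<lambda>y. y powr - \<gamma>) x = x powr (1 - \<gamma>) / (\<gamma> - 1)"
proof -
  have 1: "(\<lambda>y::real. y powr - \<gamma>) \<in> borel_measurable borel" by measurable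
  have 2: "((\<lambda>y. y powr (1 - \<gamma>) / (\<gamma> - 1)) has_real_derivative - (y powr - \<gamma>)) (at y)" if "y \<ge> x" for y
  proof -
    have "((\<lambda>y. y powr (1 - \<gamma>) / (\<gamma> - 1)) has_real_derivative (1 - \<gamma>) * y powr (1 - \<gamma> - 1) / (\<gamma> - 1)) (at y)"
      using assms that by (intro DERIV_cdivide has_real_derivative_powr) auto
    moreover have "(1 - \<gamma>) * y powr (1 - \<gamma> - 1) / (\<gamma> - 1) = - (y powr - \<gamma>)"
    proof -
      have "(1 - \<gamma>) / (\<gamma> - 1) = - 1" using assms by (simp add: divide_eq_minus_1_iff)
      moreover have "(1 - \<gamma>) * y powr (1 - \<gamma> - 1) / (\<gamma> - 1) = (1 - \<gamma>) / (\<gamma> - 1) * y powr - \<gamma>" by simp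
      ultimately show ?thesis by simp
    qed
    ultimately show ?thesis by (simp only:)
  qed
  have 3: "((\<lambda>y. y powr (1 - \<gamma>) / (\<gamma> - 1)) \<longlongrightarrow> 0) at_top"
    using assms by real_asymp
  show "set_integrable lborel {x..} (\<lambda>y. y powr - \<gamma>)" by (rule FTC_tail(1)[OF 1 2 _ 3]) auto
  show "tail (\<lambda>y. y powr - \<gamma>) x = x powr (1 - \<gamma>) / (\<gamma> - 1)" by (rule FTC_tail(2)[OF 1 2 _ 3]) auto
qed

section \<open>The decaying solution as a Volterra series\<close>

text \<open>Writing a solution of \<open>f' = W f + m h\<close>, \<open>h' = m f - W h\<close> with \<open>W = V - \<zeta>\<close> as \<open>exp (- \<Omega>) (p, k)\<close>,
  \<open>\<Omega>' = W\<close>, gives \<open>p' = 2 W p + m k\<close> and \<open>k' = m p\<close>. The series below solves this system with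
  \<open>(p, k) \<rightarrow> (0, 1)\<close> at infinity.\<close>

locale jost =
  fixes V :: "real \<Rightarrow> real" and m \<gamma> c x1 :: real
  assumes V_cont: "continuous_on UNIV V" and m: "m > 0" and gam: "\<gamma> > 1" and c: "c > 0" and x1: "x1 \<ge> 1"
    and V_lower: "\<And>x. x \<ge> x1 \<Longrightarrow> c * x powr \<gamma> \<le> V x"
    and V_mono: "\<And>x y. x1 \<le> x \<Longrightarrow> x \<le> y \<Longrightarrow> V x \<le> V y"
begin

definition om :: "real \<Rightarrow> real"
  where "om = (SOME F. (\<forall>x. (F has_vector_derivative V x) (at x)) \<and> ac F V \<and> F 0 = 0)"

lemma om: "(om has_vector_derivative V x) (at x)" "ac om V" "om 0 = 0"
  using someI_ex[OF ac_indef_cont[OF V_cont, of 0]] unfolding om_def by blast+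

lemma om_cont: "continuous_on S om"
  by (rule ac_continuous[OF om(2)])

definition omr :: "real \<Rightarrow> real \<Rightarrow> real" where "omr r x = om x - r * x"

text \<open>Primitive of \<open>V - z\<close>. The normalisation \<open>om 0 = 0\<close> makes the
  weight \<open>exp (- Om z x)\<close> equal to \<open>1\<close> at the origin, so that the matching
  data at \<open>0\<close> are simply \<open>P z 0\<close> and \<open>K z 0\<close>.\<close>

definition Om :: "complex \<Rightarrow> real \<Rightarrow> complex" where "Om z x = of_real (om x) - z * of_real x"

lemma Re_Om: "Re (Om z x) = omr (Re z) x"
  by (simp add: Om_def omr_def)

lemma omr_ac: "ac (omr r) (\<lambda>x. V x - r)"
proof -
  have "ac (\<lambda>x. r * x) (\<lambda>x. r)"
    by (rule ac_C1) (auto intro!: derivative_eq_intros simp: has_real_derivative_iff_has_vector_derivative[symmetric])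
  from ac_diff[OF om(2) this] show ?thesis by (simp add: omr_def[abs_def])
qed

lemma omr_lower: assumes "x \<le> y" "\<And>t. x \<le> t \<Longrightarrow> t \<le> y \<Longrightarrow> V t \<ge> r + a"
  shows "omr r y - omr r x \<ge> a * (y - x)"
proof -
  have "integral {x..y} (\<lambda>t. a) \<le> integral {x..y} (\<lambda>t. V t - r)"
    using assms(2) ac_int[OF omr_ac] by (intro integral_le) (force simp: algebra_simps)+
  then show ?thesis using ac_integral[OF omr_ac assms(1), of r] assms(1) by (simp add: mult.commute)
qed

lemma omr_antimono_r: assumes "x \<le> y" "r' \<le> r" shows "omr r y - omr r x \<le> omr r' y - omr r' x"
proof -
  have "r' * (y - x) \<le> r * (y - x)" using assms by (intro mult_right_mono) auto
  then show ?thesis by (simp add: omr_def algebra_simps)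
qed

lemma V_unbounded: "\<exists>X\<ge>x1. \<forall>x\<ge>X. V x \<ge> A"
proof -
  have "filterlim (\<lambda>x. c * x powr \<gamma>) at_top at_top"
    using gam c by real_asymp
  then have "eventually (\<lambda>x. c * x powr \<gamma> \<ge> A) at_top" by (simp add: filterlim_at_top)
  then obtain N where "\<And>x. x \<ge> N \<Longrightarrow> c * x powr \<gamma> \<ge> A" by (auto simp: eventually_at_top_linorder)
  then show ?thesis using V_lower by (intro exI[of _ "max x1 N"]) (force intro: order_trans)
qed

text \<open>Majorant on \<open>y \<ge> x\<close> of the complex kernel \<open>qc\<close> below,
  uniform in \<open>Re z \<le> r\<close>. The factor \<open>2\<close> is that of
  \<open>2 W p\<close> in the equation for \<open>p\<close>.\<close>

definition q :: "real \<Rightarrow> real \<Rightarrow> real \<Rightarrow> real" where "q r x y = exp (2 * omr r x - 2 * omr r y)"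

definition Th :: "real \<Rightarrow> real \<Rightarrow> real" where "Th r x = tail (q r x) x"

lemma q_cont: "continuous_on S (q r x)"
  unfolding q_def omr_def by (intro continuous_intros om_cont)

lemma q_tail_int: "tail_int (q r x)"
proof -
  obtain X where X: "X \<ge> x1" "\<And>y. y \<ge> X \<Longrightarrow> V y \<ge> r + 1" using V_unbounded[of "r + 1"] by blast
  show ?thesis
  proof (rule tail_int_bound[OF q_cont, of X "\<lambda>y. exp (2 * omr r x - 2 * omr r X) * exp (- 2 * (y - X))"])
    show "set_integrable lborel {X..} (\<lambda>y. exp (2 * omr r x - 2 * omr r X) * exp (- 2 * (y - X)))"
      using exp_tail(1)[of 2 X] by (intro set_integrable_mult_right) auto
    fix y assume y: "y \<ge> X"
    have "omr r y - omr r X \<ge> 1 * (y - X)" by (rule omr_lower[OF y]) (use X in auto)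
    then show "norm (q r x y) \<le> exp (2 * omr r x - 2 * omr r X) * exp (- 2 * (y - X))"
      by (simp add: q_def flip: exp_add)
  qed
qed

lemma Th_eq: "Th r x = exp (2 * omr r x) * tail (\<lambda>y. exp (- 2 * omr r y)) x"
proof -
  have e: "q r x = (\<lambda>y. exp (2 * omr r x) * exp (- 2 * omr r y))" by (auto simp: q_def exp_diff exp_minus divide_inverse)
  show ?thesis unfolding Th_def tail_def e by simp
qed

lemma Th_cont: "continuous_on S (Th r)"
proof -
  have "tail_int (\<lambda>y. exp (- 2 * omr r y))"
  proof -
    have e: "(\<lambda>y. exp (- 2 * omr r y)) = (\<lambda>y. q r 0 y)" by (simp add: q_def omr_def om(3))
    show ?thesis unfolding e by (rule q_tail_int)
  qed
  from ac_continuous[OF tail_ac[OF this]]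
  have "continuous_on S (tail (\<lambda>y. exp (- 2 * omr r y)))" .
  moreover have "continuous_on S (\<lambda>x. exp (2 * omr r x))" unfolding omr_def by (intro continuous_intros om_cont)
  ultimately have "continuous_on S (\<lambda>x. exp (2 * omr r x) * tail (\<lambda>y. exp (- 2 * omr r y)) x)"
    by (intro continuous_on_mult)
  then show ?thesis by (simp add: Th_eq[abs_def])
qed

lemma Th_nonneg: "Th r x \<ge> 0"
  unfolding Th_def tail_def set_lebesgue_integral_def by (intro Bochner_Integration.integral_nonneg) (auto simp: q_def)

text \<open>If \<open>V x \<ge> 2 * r\<close>, monotonicity gives \<open>V - r \<ge> V x / 2\<close>
  to the right of \<open>x\<close>, so the kernel is at most an exponential of rate
  \<open>V x\<close>, whose integral is \<open>1 / V x\<close>.\<close>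

lemma Th_le: assumes "x \<ge> x1" "V x \<ge> 2 * r" "V x > 0" shows "Th r x \<le> 1 / V x"
proof -
  have "norm (Th r x) \<le> tail (\<lambda>y. exp (- V x * (y - x))) x"
    unfolding Th_def
  proof (rule tail_bound)
    show "set_integrable lborel {x..} (q r x)" using q_tail_int by (auto simp: tail_int_def)
    show "set_integrable lborel {x..} (\<lambda>y. exp (- V x * (y - x)))" by (rule exp_tail[OF assms(3)])
    fix y assume y: "y \<ge> x"
    have "omr r y - omr r x \<ge> (V x / 2) * (y - x)"
      by (rule omr_lower[OF y]) (use assms V_mono[OF assms(1)] in \<open>force simp: field_simps\<close>)
    then show "norm (q r x y) \<le> exp (- V x * (y - x))" by (simp add: q_def)
  qed
  then show ?thesis using exp_tail(2)[OF assms(3), of x] by simp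
qed

lemma Th_tail_int: "tail_int (Th r)"
proof -
  obtain X where X: "X \<ge> x1" "\<And>y. y \<ge> X \<Longrightarrow> V y \<ge> max 1 (2 * r)" using V_unbounded by blast
  show ?thesis
  proof (rule tail_int_bound[OF Th_cont, of X "\<lambda>y. (1 / c) * y powr - \<gamma>"])
    show "set_integrable lborel {X..} (\<lambda>y. (1 / c) * y powr - \<gamma>)"
      using powr_tail(1)[OF gam, of X] X(1) x1 by (intro set_integrable_mult_right) auto
    fix y assume y: "y \<ge> X"
    have V: "V y \<ge> 1" "V y \<ge> 2 * r" using X(2)[OF y] by auto
    have yp: "y \<ge> x1" "y > 0" using y X(1) x1 by auto
    have "Th r y \<le> 1 / V y" using Th_le[of y r] V yp by simp
    also have "\<dots> \<le> 1 / (c * y powr \<gamma>)"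
      using V_lower[OF yp(1)] yp c V by (intro divide_left_mono) (auto intro!: mult_pos_pos)
    finally show "norm (Th r y) \<le> 1 / c * y powr - \<gamma>"
      using Th_nonneg[of r y] by (simp add: powr_minus divide_inverse)
  qed
qed

text \<open>Cost of one round of the iteration: inner integral at most \<open>m * Th\<close>, outer
  integral of \<open>m\<close> times that. It is finite because \<open>Th\<close> is eventually at
  most \<open>1 / V\<close> and \<open>\<gamma> > 1\<close> makes \<open>1 / V\<close>
  integrable.\<close>

definition b :: "real \<Rightarrow> real \<Rightarrow> real" where "b r x = m\<^sup>2 * tail (Th r) x"

lemma b_ac: "ac (b r) (\<lambda>x. - (m\<^sup>2 * Th r x))"
  using ac_cmult[OF tail_ac[OF Th_tail_int], of "m\<^sup>2" r] by (simp add: b_def[abs_def])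

lemma b_cont: "continuous_on S (b r)"
  by (rule ac_continuous[OF b_ac])

lemma b_nonneg: "b r x \<ge> 0"
  unfolding b_def tail_def set_lebesgue_integral_def
  by (intro mult_nonneg_nonneg Bochner_Integration.integral_nonneg) (auto simp: Th_nonneg)

lemma b_antimono: assumes "x \<le> y" shows "b r y \<le> b r x"
proof -
  have "- b r x \<le> - b r y"
    by (rule ac_mono[OF ac_uminus[OF b_ac] assms]) (auto simp: Th_nonneg)
  then show ?thesis by simp
qed

lemma b_lim: "(b r \<longlongrightarrow> 0) at_top"
  using tendsto_mult[OF tendsto_const[of "m\<^sup>2"] tail_tendsto_0[OF Th_tail_int[of r]]] by (simp add: b_def[abs_def])

text \<open>The bound does not involve \<open>r\<close>: the spectral parameter matters only through
  the place from which on \<open>V \<ge> 2 * r\<close>. There \<open>Th \<le> 1 / V\<close>, and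
  \<open>x \<ge> 1\<close> disposes of the remaining power of \<open>x\<close>.\<close>

lemma b_le: assumes "x \<ge> x1" "\<And>y. y \<ge> x \<Longrightarrow> V y \<ge> 2 * r" shows "b r x \<le> m\<^sup>2 / (c * (\<gamma> - 1))"
proof -
  have x0: "x > 0" "x \<ge> 1" using assms x1 by auto
  have "norm (tail (Th r) x) \<le> tail (\<lambda>y. (1 / c) * y powr - \<gamma>) x"
  proof (rule tail_bound)
    show "set_integrable lborel {x..} (Th r)" using Th_tail_int by (auto simp: tail_int_def)
    show "set_integrable lborel {x..} (\<lambda>y. (1 / c) * y powr - \<gamma>)"
      using powr_tail(1)[OF gam x0(1)] by (intro set_integrable_mult_right) auto
    fix y assume y: "y \<ge> x"
    have yp: "y \<ge> x1" "y > 0" using y assms x1 by auto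
    have "c * y powr \<gamma> > 0" using c yp by simp
    then have V0: "V y > 0" using V_lower[OF yp(1)] by linarith
    have "Th r y \<le> 1 / V y" using Th_le[of y r] assms(2)[OF y] yp V0 by simp
    also have "\<dots> \<le> 1 / (c * y powr \<gamma>)"
      using V_lower[OF yp(1)] yp c V0 by (intro divide_left_mono) (auto intro!: mult_pos_pos)
    finally show "norm (Th r y) \<le> 1 / c * y powr - \<gamma>"
      using Th_nonneg[of r y] by (simp add: powr_minus divide_inverse)
  qed
  then have "tail (Th r) x \<le> (1 / c) * tail (\<lambda>y. y powr - \<gamma>) x" by (simp add: tail_def)
  also have "\<dots> = x powr (1 - \<gamma>) / (c * (\<gamma> - 1))" using powr_tail(2)[OF gam x0(1)] by simp
  also have "\<dots> \<le> 1 / (c * (\<gamma> - 1))"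
  proof (rule divide_right_mono)
    have "x powr (1 - \<gamma>) \<le> x powr 0" using x0 gam by (intro powr_mono) auto
    then show "x powr (1 - \<gamma>) \<le> 1" using x0 by simp
  qed (use c gam in auto)
  finally have "m\<^sup>2 * tail (Th r) x \<le> m\<^sup>2 * (1 / (c * (\<gamma> - 1)))" by (rule mult_left_mono) simp
  then show ?thesis by (simp add: b_def)
qed

definition qc :: "complex \<Rightarrow> real \<Rightarrow> real \<Rightarrow> complex" where "qc z x y = exp (2 * Om z x - 2 * Om z y)"

lemma qc_cont: "continuous_on S (qc z x)"
  unfolding qc_def Om_def by (intro continuous_intros om_cont)

lemma qc_norm: assumes "x \<le> y" "Re z \<le> r" shows "cmod (qc z x y) \<le> q r x y"
proof -
  have "cmod (qc z x y) = exp (2 * omr (Re z) x - 2 * omr (Re z) y)" by (simp add: qc_def Re_Om)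
  then show ?thesis using omr_antimono_r[OF assms] by (simp add: q_def)
qed

text \<open>Picard iterates for \<open>k' = m p\<close>, \<open>k \<rightarrow> 1\<close> and
  \<open>p' = 2 W p + m k\<close>, \<open>p \<rightarrow> 0\<close>. Integrating from infinity
  selects the kernel \<open>exp (2 * Om z x - 2 * Om z y)\<close> with \<open>y \<ge> x\<close>,
  which decays in \<open>y\<close>. The inner integral is the iterate \<open>pp\<close> of
  \<open>p\<close>; it is spelled out because \<open>pp\<close> is defined from
  \<open>kk\<close>.\<close>

primrec kk :: "complex \<Rightarrow> nat \<Rightarrow> real \<Rightarrow> complex" where
  "kk z 0 = (\<lambda>x. 1)"
| "kk z (Suc n) = (\<lambda>x. - of_real m * tail (\<lambda>t. - of_real m * tail (\<lambda>y. qc z t y * kk z n y) t) x)"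

definition pp :: "complex \<Rightarrow> nat \<Rightarrow> real \<Rightarrow> complex"
  where "pp z n x = - of_real m * tail (\<lambda>y. qc z x y * kk z n y) x"

lemma kk_Suc: "kk z (Suc n) x = - of_real m * tail (pp z n) x"
  by (simp add: pp_def[abs_def])

lemma set_tail_int: "tail_int g \<Longrightarrow> set_integrable lborel {x..} g" by (simp add: tail_int_def)

text \<open>Origin of the factorials: \<open>b\<close> has derivative
  \<open>- m\<^sup>2 * Th\<close>, so the integrand is the exact derivative of
  \<open>- b ^ Suc n / fact (Suc n)\<close>, and \<open>b\<close> tends to \<open>0\<close> at
  infinity.\<close>

lemma b_power_tail:
  "tail_int (\<lambda>x. m\<^sup>2 * Th r x * b r x ^ n / fact n)"
  "tail (\<lambda>x. m\<^sup>2 * Th r x * b r x ^ n / fact n) x = b r x ^ Suc n / fact (Suc n)"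
proof -
  have cont: "continuous_on UNIV (\<lambda>x. m\<^sup>2 * Th r x * b r x ^ n / fact n)"
    by (intro continuous_intros Th_cont b_cont) auto
  have ms: "(\<lambda>x. m\<^sup>2 * Th r x * b r x ^ n / fact n) \<in> borel_measurable borel"
    using cont by (rule borel_measurable_continuous_onI)
  have db: "(b r has_real_derivative - (m\<^sup>2 * Th r y)) (at y)" for y
  proof -
    have c1: "continuous_on UNIV (\<lambda>x. - (m\<^sup>2 * Th r x))" by (intro continuous_intros Th_cont)
    obtain F where F: "\<forall>x. (F has_vector_derivative - (m\<^sup>2 * Th r x)) (at x)" "ac F (\<lambda>x. - (m\<^sup>2 * Th r x))" "F 0 = 0"
      using ac_indef_cont[OF c1, of 0] by blast
    define k where "k = b r 0"
    have "b r y = F y + k" for y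
      using ac_integral[OF b_ac, of 0 y r] ac_integral[OF b_ac, of y 0 r] ac_integral[OF F(2), of 0 y]
        ac_integral[OF F(2), of y 0] F(3) k_def by (cases "y \<ge> 0") auto
    then have e: "b r = (\<lambda>y. F y + k)" by (rule ext)
    have "((\<lambda>y. F y + k) has_vector_derivative - (m\<^sup>2 * Th r y) + 0) (at y)"
      by (intro has_vector_derivative_add has_vector_derivative_const) (use F in auto)
    then show ?thesis unfolding e by (simp add: has_real_derivative_iff_has_vector_derivative)
  qed
  have d: "((\<lambda>y. b r y ^ Suc n / fact (Suc n)) has_real_derivative - (m\<^sup>2 * Th r y * b r y ^ n / fact n)) (at y)" for y
  proof -
    have "((\<lambda>y. b r y ^ Suc n / fact (Suc n)) has_real_derivative (real (Suc n) * (- (m\<^sup>2 * Th r y) * b r y ^ n)) / fact (Suc n)) (at y)"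
      using DERIV_cdivide[OF DERIV_power_Suc[OF db[of y], of n], of "fact (Suc n)"] by simp
    moreover have "(real (Suc n) * (- (m\<^sup>2 * Th r y) * b r y ^ n)) / fact (Suc n) = - (m\<^sup>2 * Th r y * b r y ^ n / fact n)"
      by (simp add: fact_Suc del: of_nat_Suc)
    ultimately show ?thesis by (simp only:)
  qed
  have "((\<lambda>y. b r y ^ Suc n) \<longlongrightarrow> 0 ^ Suc n) at_top"
    by (rule tendsto_power[OF b_lim])
  then have l: "((\<lambda>y. b r y ^ Suc n / fact (Suc n)) \<longlongrightarrow> 0) at_top"
    using tendsto_divide[OF _ tendsto_const[of "fact (Suc n) :: real"]] by fastforce
  have nn: "m\<^sup>2 * Th r y * b r y ^ n / fact n \<ge> 0" for y by (simp add: Th_nonneg b_nonneg)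
  show "tail_int (\<lambda>x. m\<^sup>2 * Th r x * b r x ^ n / fact n)"
    unfolding tail_int_def by (intro allI FTC_tail(1)[OF ms d nn l])
  show "tail (\<lambda>x. m\<^sup>2 * Th r x * b r x ^ n / fact n) x = b r x ^ Suc n / fact (Suc n)"
    by (rule FTC_tail(2)[OF ms d nn l])
qed

lemma qc_tail:
  assumes kc: "continuous_on UNIV k" and kb: "\<And>y. y \<ge> x \<Longrightarrow> cmod (k y) \<le> B" and z: "Re z \<le> r" and B: "B \<ge> 0"
  shows "set_integrable lborel {x..} (\<lambda>y. qc z x y * k y)" "cmod (tail (\<lambda>y. qc z x y * k y) x) \<le> Th r x * B"
proof -
  have le: "norm (qc z x y * k y) \<le> q r x y * B" if "y \<ge> x" for y
    unfolding norm_mult using qc_norm[OF that z] kb[OF that] by (intro mult_mono) (auto simp: q_def)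
  have qi: "set_integrable lborel {x..} (\<lambda>y. q r x y * B)"
    using set_tail_int[OF q_tail_int] by (rule set_integrable_mult_left)
  have "tail_int (\<lambda>y. qc z x y * k y)"
    by (rule tail_int_bound[OF _ qi le]) (intro continuous_intros qc_cont kc)
  then show i: "set_integrable lborel {x..} (\<lambda>y. qc z x y * k y)" by (rule set_tail_int)
  have "cmod (tail (\<lambda>y. qc z x y * k y) x) \<le> tail (\<lambda>y. q r x y * B) x"
    by (rule tail_bound[OF i qi le])
  then show "cmod (tail (\<lambda>y. qc z x y * k y) x) \<le> Th r x * B" by (simp add: Th_def tail_def)
qed

text \<open>The kernel splits into \<open>exp (2 * Om z x)\<close> and
  \<open>exp (- 2 * Om z y)\<close>, so the product rule applies: the exponential contributes the
  linear term, the moving endpoint the source \<open>m * k\<close>.\<close>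

lemma qc_tail_ac:
  assumes kc: "continuous_on UNIV k" and kb: "\<And>x y. y \<ge> x \<Longrightarrow> cmod (k y) \<le> B x"
  shows "ac (\<lambda>x. - of_real m * tail (\<lambda>y. qc z x y * k y) x)
    (\<lambda>x. 2 * (of_real (V x) - z) * (- of_real m * tail (\<lambda>y. qc z x y * k y) x) + of_real m * k x)"
proof -
  let ?g = "\<lambda>y. exp (- 2 * Om z y) * k y"
  have B: "B x \<ge> 0" for x using kb[of x x] norm_ge_zero[of "k x"] by linarith
  have e: "(\<lambda>y. qc z x y * k y) = (\<lambda>y. exp (2 * Om z x) * ?g y)" for x
    by (auto simp: qc_def exp_diff exp_minus divide_inverse)
  have gi: "tail_int ?g"
  proof (unfold tail_int_def, intro allI)
    fix x
    have "?g = (\<lambda>y. exp (- 2 * Om z x) * (qc z x y * k y))"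
      by (auto simp: qc_def mult.assoc[symmetric] simp flip: exp_add)
    then show "set_integrable lborel {x..} ?g"
      using set_integrable_scale(1)[OF qc_tail(1)[OF kc kb order_refl B[of x]], of x] by metis
  qed
  have t: "- of_real m * tail (\<lambda>y. qc z x y * k y) x = - of_real m * (exp (2 * Om z x) * tail ?g x)" for x
    unfolding e by (simp add: tail_def)
  have dO: "(Om z has_vector_derivative (of_real (V x) - z)) (at x)" for x
  proof -
    have "((\<lambda>x. of_real (om x) - z * of_real x) has_vector_derivative of_real (V x) - z * of_real 1) (at x)"
      by (intro has_vector_derivative_diff has_vector_derivative_mult_right has_vector_derivative_of_real DERIV_ident
          om(1)[folded has_real_derivative_iff_has_vector_derivative])
    then show ?thesis by (simp add: Om_def[abs_def])
  qed
  have a1: "ac (\<lambda>x. exp (2 * Om z x)) (\<lambda>x. 2 * (of_real (V x) - z) * exp (2 * Om z x))"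
  proof (rule ac_C1)
    fix x
    have 1: "((\<lambda>x. 2 * Om z x) has_vector_derivative 2 * (of_real (V x) - z)) (at x)"
      by (rule has_vector_derivative_mult_right[OF dO])
    show "((\<lambda>x. exp (2 * Om z x)) has_vector_derivative 2 * (of_real (V x) - z) * exp (2 * Om z x)) (at x)"
      using field_vector_diff_chain_at[OF 1 DERIV_exp] by (simp add: o_def)
    show "continuous_on UNIV (\<lambda>x. 2 * (of_real (V x) - z) * exp (2 * Om z x))"
      unfolding Om_def by (intro continuous_intros om_cont V_cont)
  qed
  have "exp (2 * Om z x) * exp (- (2 * Om z x)) = 1" for x by (simp add: exp_minus)
  then have e1: "exp (2 * Om z x) * (exp (- 2 * Om z x) * k x) = k x" for x
    by (simp add: mult.assoc[symmetric])
  have "ac (\<lambda>x. - of_real m * (exp (2 * Om z x) * tail ?g x))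
    (\<lambda>x. - of_real m * (2 * (of_real (V x) - z) * exp (2 * Om z x) * tail ?g x + exp (2 * Om z x) * - ?g x))"
    by (rule ac_cmult[OF ac_mult[OF a1 tail_ac[OF gi]]])
  then show ?thesis
  proof (rule ac_cong)
    fix x
    show "- of_real m * (exp (2 * Om z x) * tail ?g x) = - of_real m * tail (\<lambda>y. qc z x y * k y) x"
      by (rule t[symmetric])
    have "exp (2 * Om z x) * - ?g x = - k x" using e1[of x] by simp
    then show "- of_real m * (2 * (of_real (V x) - z) * exp (2 * Om z x) * tail ?g x + exp (2 * Om z x) * - ?g x)
      = 2 * (of_real (V x) - z) * (- of_real m * tail (\<lambda>y. qc z x y * k y) x) + of_real m * k x"
      unfolding t by (simp add: algebra_simps)
  qed
qed

text \<open>The estimate is carried for all \<open>r \<ge> Re z\<close>, since holomorphy in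
  \<open>z\<close> requires majorants valid on a whole neighbourhood of the parameter. Continuity
  goes along in the induction because it supplies measurability of the next integrand.\<close>

lemma kk_props:
  "continuous_on UNIV (kk z n) \<and> (\<forall>r\<ge>Re z. \<forall>x. cmod (kk z n x) \<le> b r x ^ n / fact n)"
proof (induction n)
  case 0 then show ?case by auto
next
  case (Suc n)
  have kc: "continuous_on UNIV (kk z n)" using Suc by blast
  have kb: "cmod (kk z n y) \<le> b r x ^ n / fact n" if "y \<ge> x" "r \<ge> Re z" for r x y
  proof -
    have "cmod (kk z n y) \<le> b r y ^ n / fact n" using Suc that by blast
    also have "\<dots> \<le> b r x ^ n / fact n"
      by (intro divide_right_mono power_mono b_antimono that b_nonneg) auto
    finally show ?thesis .
  qed
  have pc: "continuous_on UNIV (pp z n)"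
    unfolding pp_def[abs_def] by (rule ac_continuous[OF qc_tail_ac[OF kc kb[OF _ order_refl]]])
  have pb: "norm (pp z n x) \<le> m * (Th r x * (b r x ^ n / fact n))" if "r \<ge> Re z" for r x
    using mult_left_mono[OF qc_tail(2)[OF kc kb[OF _ that] that, of x x], of m] m b_nonneg
    by (simp add: pp_def norm_mult)
  have pi: "set_integrable lborel {x..} (\<lambda>x. m * (Th r x * (b r x ^ n / fact n)))" for r x
    using set_integrable_scale(1)[OF set_tail_int[OF b_power_tail(1)[of r n]], of x "1 / m"] m
    by (simp add: power2_eq_square mult.assoc)
  have pt: "tail_int (pp z n)"
    by (rule tail_int_bound[OF pc pi[of 0 "Re z"] pb[OF order_refl]])
  have "continuous_on UNIV (kk z (Suc n))"
    unfolding kk_Suc[abs_def] by (intro continuous_intros ac_continuous[OF tail_ac[OF pt]])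
  moreover have "cmod (kk z (Suc n) x) \<le> b r x ^ Suc n / fact (Suc n)" if "r \<ge> Re z" for r x
  proof -
    have "cmod (tail (pp z n) x) \<le> tail (\<lambda>x. m * (Th r x * (b r x ^ n / fact n))) x"
      by (rule tail_bound[OF set_tail_int[OF pt] pi pb[OF that]])
    then have "m * cmod (tail (pp z n) x) \<le> m * tail (\<lambda>x. m * (Th r x * (b r x ^ n / fact n))) x"
      using m by (intro mult_left_mono) auto
    also have "\<dots> = tail (\<lambda>x. m\<^sup>2 * Th r x * b r x ^ n / fact n) x"
      unfolding tail_def by (subst set_integral_mult_right[symmetric]) (simp add: power2_eq_square mult_ac)
    also have "\<dots> = b r x ^ Suc n / fact (Suc n)" by (rule b_power_tail(2))
    finally show ?thesis using m by (simp add: kk_Suc norm_mult del: kk.simps)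
  qed
  ultimately show ?case by blast
qed

lemma kk_cont: "continuous_on UNIV (kk z n)" using kk_props by blast

lemma kk_bound: "Re z \<le> r \<Longrightarrow> x \<le> y \<Longrightarrow> cmod (kk z n y) \<le> b r x ^ n / fact n"
proof -
  assume a: "Re z \<le> r" "x \<le> y"
  have "cmod (kk z n y) \<le> b r y ^ n / fact n" using kk_props[of z n] a(1) by blast
  also have "\<dots> \<le> b r x ^ n / fact n"
    by (intro divide_right_mono power_mono b_antimono a b_nonneg) auto
  finally show ?thesis .
qed

lemma pp_ac: "ac (pp z n) (\<lambda>x. 2 * (of_real (V x) - z) * pp z n x + of_real m * kk z n x)"
  unfolding pp_def[abs_def] by (rule qc_tail_ac[OF kk_cont kk_bound[OF order_refl]])

lemma pp_bound: assumes "Re z \<le> r" shows "cmod (pp z n x) \<le> m * Th r x * (b r x ^ n / fact n)"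
  using mult_left_mono[OF qc_tail(2)[OF kk_cont kk_bound[OF assms] assms, of x x n], of m] m b_nonneg
  by (simp add: pp_def norm_mult mult.assoc)

lemma pp_majorant_tail_int: "tail_int (\<lambda>x. m * Th r x * (b r x ^ n / fact n))"
  using set_integrable_scale(1)[OF set_tail_int[OF b_power_tail(1)[of r n]], of _ "1 / m"] m
  by (simp add: tail_int_def power2_eq_square mult.assoc)

lemma pp_tail_int: "tail_int (pp z n)"
  by (rule tail_int_bound[OF ac_continuous[OF pp_ac] set_tail_int[OF pp_majorant_tail_int, of 0 "Re z" n] pp_bound[OF order_refl]])

text \<open>Two applications of \<open>holomorphic_integral_parameter\<close>, to the inner and the
  outer integral. On the unit disc about \<open>z\<close> real parts are at most
  \<open>Re z + 1\<close>, and the majorants are taken with this \<open>r\<close>.\<close>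

lemma kk_holomorphic: "(\<lambda>z. kk z n x) holomorphic_on UNIV"
proof (induction n arbitrary: x)
  case 0 then show ?case by simp
next
  case (Suc n)
  have ball: "Re z' \<le> Re z + 1" if "z' \<in> cball z 1" for z z'
  proof -
    have "\<bar>Re (z' - z)\<bar> \<le> 1" using abs_Re_le_cmod[of "z' - z"] that by (simp add: dist_norm norm_minus_commute)
    then show ?thesis by simp
  qed
  have pph: "(\<lambda>z. pp z n t) holomorphic_on UNIV" for t
  proof -
    have "(\<lambda>z. integral\<^sup>L lborel (\<lambda>y. indicator {t..} y *\<^sub>R (qc z t y * kk z n y))) holomorphic_on UNIV"
    proof (rule holomorphic_integral_parameter)
      show "(\<lambda>z. indicator {t..} y *\<^sub>R (qc z t y * kk z n y)) holomorphic_on UNIV" for y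
        unfolding scaleR_conv_of_real qc_def Om_def by (intro holomorphic_intros Suc)
      show "(\<lambda>y. indicator {t..} y *\<^sub>R (qc z t y * kk z n y)) \<in> borel_measurable lborel" for z
        using borel_measurable_continuous_onI[OF continuous_on_mult[OF qc_cont[of UNIV z t] kk_cont[of z n]]] by measurable
      fix z
      let ?r = "Re z + 1"
      show "\<exists>e>0. \<exists>w. cball z e \<subseteq> UNIV \<and> integrable lborel w \<and>
        (\<forall>z'\<in>cball z e. \<forall>y. cmod (indicator {t..} y *\<^sub>R (qc z' t y * kk z' n y)) \<le> w y)"
      proof (intro exI[of _ 1] conjI exI[of _ "\<lambda>y. indicator {t..} y *\<^sub>R (q ?r t y * (b ?r t ^ n / fact n))"] ballI allI)
        show "integrable lborel (\<lambda>y. indicator {t..} y *\<^sub>R (q ?r t y * (b ?r t ^ n / fact n)))"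
          using set_integrable_scale(2)[OF set_tail_int[OF q_tail_int[of ?r t], of t]] unfolding set_integrable_def by blast
        fix z' y assume z': "z' \<in> cball z 1"
        show "cmod (indicator {t..} y *\<^sub>R (qc z' t y * kk z' n y)) \<le> indicator {t..} y *\<^sub>R (q ?r t y * (b ?r t ^ n / fact n))"
        proof (cases "y \<ge> t")
          case True
          have "cmod (qc z' t y * kk z' n y) \<le> q ?r t y * (b ?r t ^ n / fact n)"
            unfolding norm_mult using qc_norm[OF True ball[OF z']] kk_bound[OF ball[OF z'] True]
            by (intro mult_mono) (auto simp: q_def)
          then show ?thesis using True by simp
        qed simp
      qed auto
    qed auto
    then show ?thesis unfolding pp_def tail_def set_lebesgue_integral_def by (intro holomorphic_intros)
  qed
  have "(\<lambda>z. integral\<^sup>L lborel (\<lambda>y. indicator {x..} y *\<^sub>R pp z n y)) holomorphic_on UNIV"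
  proof (rule holomorphic_integral_parameter)
    show "(\<lambda>z. indicator {x..} y *\<^sub>R pp z n y) holomorphic_on UNIV" for y
      unfolding scaleR_conv_of_real by (intro holomorphic_intros pph)
    show "(\<lambda>y. indicator {x..} y *\<^sub>R pp z n y) \<in> borel_measurable lborel" for z
      using borel_measurable_continuous_onI[OF ac_continuous[OF pp_ac[of z n]]] by measurable
    fix z
    let ?r = "Re z + 1"
    show "\<exists>e>0. \<exists>w. cball z e \<subseteq> UNIV \<and> integrable lborel w \<and>
      (\<forall>z'\<in>cball z e. \<forall>y. cmod (indicator {x..} y *\<^sub>R pp z' n y) \<le> w y)"
    proof (intro exI[of _ 1] conjI exI[of _ "\<lambda>y. indicator {x..} y *\<^sub>R (m * Th ?r y * (b ?r y ^ n / fact n))"] ballI allI)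
      show "integrable lborel (\<lambda>y. indicator {x..} y *\<^sub>R (m * Th ?r y * (b ?r y ^ n / fact n)))"
        using set_tail_int[OF pp_majorant_tail_int[of ?r n], of x] unfolding set_integrable_def .
      fix z' y assume z': "z' \<in> cball z 1"
      show "cmod (indicator {x..} y *\<^sub>R pp z' n y) \<le> indicator {x..} y *\<^sub>R (m * Th ?r y * (b ?r y ^ n / fact n))"
        using pp_bound[OF ball[OF z'], of n y] by (auto simp: indicator_def)
    qed auto
  qed auto
  then show ?case unfolding kk_Suc tail_def set_lebesgue_integral_def by (intro holomorphic_intros)
qed

definition K :: "complex \<Rightarrow> real \<Rightarrow> complex" where "K z x = (\<Sum>n. kk z n x)"
definition P :: "complex \<Rightarrow> real \<Rightarrow> complex" where "P z x = - of_real m * tail (\<lambda>y. qc z x y * K z y) x"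

lemma exp_series: "summable (\<lambda>n. t ^ n / fact n :: real)" "(\<Sum>n. t ^ n / fact n) = exp t"
  using summable_exp[of t] by (auto simp: exp_def divide_inverse mult.commute)

lemma kk_summable: "summable (\<lambda>n. cmod (kk z n x))"
  by (rule summable_comparison_test'[OF exp_series(1)[of "b (Re z) x"]]) (use kk_bound[OF order_refl order_refl] in auto)

lemma K_sub_partial: assumes "Re z \<le> r" "x \<le> y"
  shows "cmod (K z y) \<le> exp (b r x)"
proof -
  have "cmod (K z y) \<le> (\<Sum>n. cmod (kk z n y))" unfolding K_def by (rule summable_norm[OF kk_summable])
  also have "\<dots> \<le> (\<Sum>n. b r x ^ n / fact n)"
    by (rule suminf_le[OF _ kk_summable exp_series(1)]) (rule kk_bound[OF assms])
  finally show ?thesis by (simp add: exp_series)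
qed

lemma K_uniform: "uniform_limit {x..} (\<lambda>N y. \<Sum>n<N. kk z n y) (K z) sequentially"
  unfolding K_def[abs_def]
  by (rule Weierstrass_m_test[OF _ exp_series(1)[of "b (Re z) x"]]) (use kk_bound[OF order_refl] in auto)

lemma K_cont: "continuous_on UNIV (K z)"
proof -
  have "continuous_on {x..} (K z)" for x
  proof (rule uniform_limit_theorem[OF _ K_uniform])
    show "eventually (\<lambda>N. continuous_on {x..} (\<lambda>y. \<Sum>n<N. kk z n y)) sequentially"
      by (intro always_eventually allI continuous_intros continuous_on_subset[OF kk_cont]) auto
  qed simp
  then have "continuous (at x) (K z)" for x
    by (rule continuous_on_interior[of "{x-1..}"]) (auto simp: mem_interior intro!: exI[of _ 1] simp: dist_real_def)
  then show ?thesis by (simp add: continuous_at_imp_continuous_on)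
qed

lemma K_holomorphic: "(\<lambda>z. K z x) holomorphic_on UNIV"
proof (rule holomorphic_uniform_sequence[OF open_UNIV])
  show "(\<lambda>z. \<Sum>n<N. kk z n x) holomorphic_on UNIV" for N by (intro holomorphic_intros kk_holomorphic)
  fix z
  have "uniform_limit (cball z 1) (\<lambda>N z. \<Sum>n<N. kk z n x) (\<lambda>z. K z x) sequentially"
    unfolding K_def
  proof (rule Weierstrass_m_test[OF _ exp_series(1)[of "b (Re z + 1) x"]])
    fix n z' assume "z' \<in> cball z 1"
    then have "\<bar>Re (z' - z)\<bar> \<le> 1" using abs_Re_le_cmod[of "z' - z"] by (simp add: dist_norm norm_minus_commute)
    then show "norm (kk z' n x) \<le> b (Re z + 1) x ^ n / fact n" by (intro kk_bound) auto
  qed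
  then show "\<exists>d>0. cball z d \<subseteq> UNIV \<and> uniform_limit (cball z d) (\<lambda>N z. \<Sum>n<N. kk z n x) (\<lambda>z. K z x) sequentially"
    by (intro exI[of _ 1]) auto
qed

lemma P_bound: assumes "Re z \<le> r" shows "cmod (P z x) \<le> m * Th r x * exp (b r x)"
  using qc_tail(2)[OF K_cont K_sub_partial[OF assms] assms, of x x] m
  by (simp add: P_def norm_mult mult.assoc)

lemma P_ac: "ac (P z) (\<lambda>x. 2 * (of_real (V x) - z) * P z x + of_real m * K z x)"
  unfolding P_def[abs_def] by (rule qc_tail_ac[OF K_cont K_sub_partial[OF order_refl]])

lemma P_holomorphic: "(\<lambda>z. P z x) holomorphic_on UNIV"
proof -
  have "(\<lambda>z. integral\<^sup>L lborel (\<lambda>y. indicator {x..} y *\<^sub>R (qc z x y * K z y))) holomorphic_on UNIV"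
  proof (rule holomorphic_integral_parameter)
    show "(\<lambda>z. indicator {x..} y *\<^sub>R (qc z x y * K z y)) holomorphic_on UNIV" for y
      unfolding scaleR_conv_of_real qc_def Om_def by (intro holomorphic_intros K_holomorphic)
    show "(\<lambda>y. indicator {x..} y *\<^sub>R (qc z x y * K z y)) \<in> borel_measurable lborel" for z
      using borel_measurable_continuous_onI[OF continuous_on_mult[OF qc_cont[of UNIV z x] K_cont[of z]]] by measurable
    fix z
    let ?r = "Re z + 1"
    show "\<exists>e>0. \<exists>w. cball z e \<subseteq> UNIV \<and> integrable lborel w \<and>
      (\<forall>z'\<in>cball z e. \<forall>y. cmod (indicator {x..} y *\<^sub>R (qc z' x y * K z' y)) \<le> w y)"
    proof (intro exI[of _ 1] conjI exI[of _ "\<lambda>y. indicator {x..} y *\<^sub>R (q ?r x y * exp (b ?r x))"] ballI allI)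
      show "integrable lborel (\<lambda>y. indicator {x..} y *\<^sub>R (q ?r x y * exp (b ?r x)))"
        using set_integrable_scale(2)[OF set_tail_int[OF q_tail_int[of ?r x], of x]] unfolding set_integrable_def by blast
      fix z' y assume "z' \<in> cball z 1"
      then have "\<bar>Re (z' - z)\<bar> \<le> 1" using abs_Re_le_cmod[of "z' - z"] by (simp add: dist_norm norm_minus_commute)
      then have z': "Re z' \<le> ?r" by simp
      show "cmod (indicator {x..} y *\<^sub>R (qc z' x y * K z' y)) \<le> indicator {x..} y *\<^sub>R (q ?r x y * exp (b ?r x))"
      proof (cases "y \<ge> x")
        case True
        have "cmod (qc z' x y * K z' y) \<le> q ?r x y * exp (b ?r x)"
          unfolding norm_mult using qc_norm[OF True z'] K_sub_partial[OF z' True]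
          by (intro mult_mono) (auto simp: q_def)
        then show ?thesis using True by simp
      qed simp
    qed auto
  qed auto
  then show ?thesis unfolding P_def tail_def set_lebesgue_integral_def by (intro holomorphic_intros)
qed

lemma P_sums: "(\<lambda>n. pp z n x) sums P z x"
proof -
  have u: "uniform_limit {x..} (\<lambda>N y. \<Sum>n<N. kk z n y) (K z) sequentially" by (rule K_uniform)
  have "(\<lambda>N. tail (\<lambda>y. qc z x y * (\<Sum>n<N. kk z n y)) x) \<longlonglongrightarrow> tail (\<lambda>y. qc z x y * K z y) x"
    unfolding tail_def set_lebesgue_integral_def
  proof (rule integral_dominated_convergence)
    show "(\<lambda>y. indicator {x..} y *\<^sub>R (qc z x y * K z y)) \<in> borel_measurable lborel"
      using borel_measurable_continuous_onI[OF continuous_on_mult[OF qc_cont[of UNIV z x] K_cont[of z]]] by measurable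
    show "(\<lambda>y. indicator {x..} y *\<^sub>R (qc z x y * (\<Sum>n<N. kk z n y))) \<in> borel_measurable lborel" for N
    proof -
      have "continuous_on UNIV (\<lambda>y. qc z x y * (\<Sum>n<N. kk z n y))" by (intro continuous_intros qc_cont kk_cont)
      from borel_measurable_continuous_onI[OF this] show ?thesis by measurable
    qed
    show "integrable lborel (\<lambda>y. indicator {x..} y *\<^sub>R (q (Re z) x y * exp (b (Re z) x)))"
      using set_integrable_scale(2)[OF set_tail_int[OF q_tail_int[of "Re z" x], of x]] unfolding set_integrable_def by blast
    show "AE y in lborel. (\<lambda>N. indicator {x..} y *\<^sub>R (qc z x y * (\<Sum>n<N. kk z n y))) \<longlonglongrightarrow> indicator {x..} y *\<^sub>R (qc z x y * K z y)"
    proof (rule AE_I2)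
      fix y :: real
      have "(\<lambda>N. \<Sum>n<N. kk z n y) \<longlonglongrightarrow> K z y"
        unfolding K_def using summable_LIMSEQ[OF summable_norm_cancel[OF kk_summable]] .
      then show "(\<lambda>N. indicator {x..} y *\<^sub>R (qc z x y * (\<Sum>n<N. kk z n y))) \<longlonglongrightarrow> indicator {x..} y *\<^sub>R (qc z x y * K z y)"
        by (intro tendsto_intros)
    qed
    show "AE y in lborel. norm (indicator {x..} y *\<^sub>R (qc z x y * (\<Sum>n<N. kk z n y))) \<le> indicator {x..} y *\<^sub>R (q (Re z) x y * exp (b (Re z) x))" for N
    proof (rule AE_I2)
      fix y
      show "norm (indicator {x..} y *\<^sub>R (qc z x y * (\<Sum>n<N. kk z n y))) \<le> indicator {x..} y *\<^sub>R (q (Re z) x y * exp (b (Re z) x))"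
      proof (cases "y \<ge> x")
        case True
        have "cmod (\<Sum>n<N. kk z n y) \<le> (\<Sum>n<N. b (Re z) x ^ n / fact n)"
          by (rule sum_norm_le) (rule kk_bound[OF order_refl True])
        also have "\<dots> \<le> exp (b (Re z) x)" unfolding exp_series(2)[symmetric]
          by (rule sum_le_suminf[OF exp_series(1)]) (auto simp: b_nonneg)
        finally have "cmod (qc z x y * (\<Sum>n<N. kk z n y)) \<le> q (Re z) x y * exp (b (Re z) x)"
          unfolding norm_mult using qc_norm[OF True order_refl] by (intro mult_mono) (auto simp: q_def)
        then show ?thesis using True by simp
      qed simp
    qed
  qed
  then have "(\<lambda>N. - of_real m * tail (\<lambda>y. qc z x y * (\<Sum>n<N. kk z n y)) x) \<longlonglongrightarrow> P z x"
    unfolding P_def by (intro tendsto_intros)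
  moreover have "- of_real m * tail (\<lambda>y. qc z x y * (\<Sum>n<N. kk z n y)) x = (\<Sum>n<N. pp z n x)" for N
  proof -
    have "tail (\<lambda>y. qc z x y * (\<Sum>n<N. kk z n y)) x = (\<Sum>n<N. tail (\<lambda>y. qc z x y * kk z n y) x)"
      unfolding sum_distrib_left
      by (rule tail_sum) (use qc_tail(1)[OF kk_cont kk_bound[OF order_refl] order_refl] b_nonneg in auto)
    then show ?thesis by (simp add: pp_def sum_distrib_left)
  qed
  ultimately show ?thesis unfolding sums_def by simp
qed

lemma P_tail_int: "tail_int (P z)"
proof (rule tail_int_bound[OF ac_continuous[OF P_ac]])
  show "set_integrable lborel {0..} (\<lambda>x. Th (Re z) x * (m * exp (b (Re z) 0)))"
    by (rule set_integrable_scale(2)[OF set_tail_int[OF Th_tail_int]])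
  fix x :: real assume "0 \<le> x"
  then have "m * Th (Re z) x * exp (b (Re z) x) \<le> m * Th (Re z) x * exp (b (Re z) 0)"
    using m Th_nonneg b_antimono by (intro mult_left_mono) auto
  then show "norm (P z x) \<le> Th (Re z) x * (m * exp (b (Re z) 0))"
    using P_bound[OF order_refl, of z x] by (simp add: mult_ac)
qed

text \<open>Summing the recursion \<open>kk_Suc\<close> over all \<open>n\<close>, with the constant
  \<open>1\<close> as the zeroth term. The partial sums of \<open>pp\<close> are dominated by a
  multiple of \<open>Th\<close>, which allows the sum to enter the integral and closes the integral
  equation for \<open>K\<close> and \<open>P\<close>.\<close>

lemma K_eq: "K z x = 1 - of_real m * tail (P z) x"
proof -
  have le: "cmod (\<Sum>n<N. pp z n y) \<le> Th (Re z) y * (m * exp (b (Re z) x))" if "y \<ge> x" for N y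
  proof -
    have "cmod (\<Sum>n<N. pp z n y) \<le> (\<Sum>n<N. m * Th (Re z) y * (b (Re z) x ^ n / fact n))"
    proof (rule sum_norm_le)
      fix n
      have "m * Th (Re z) y * (b (Re z) y ^ n / fact n) \<le> m * Th (Re z) y * (b (Re z) x ^ n / fact n)"
        using m Th_nonneg that by (intro mult_left_mono divide_right_mono power_mono b_antimono b_nonneg) auto
      then show "cmod (pp z n y) \<le> m * Th (Re z) y * (b (Re z) x ^ n / fact n)"
        using pp_bound[OF order_refl, of z n y] by linarith
    qed
    also have "\<dots> = m * Th (Re z) y * (\<Sum>n<N. b (Re z) x ^ n / fact n)" by (simp add: sum_distrib_left)
    also have "\<dots> \<le> m * Th (Re z) y * exp (b (Re z) x)"
    proof (rule mult_left_mono)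
      show "(\<Sum>n<N. b (Re z) x ^ n / fact n) \<le> exp (b (Re z) x)" unfolding exp_series(2)[symmetric]
        by (rule sum_le_suminf[OF exp_series(1)]) (auto simp: b_nonneg)
    qed (use m Th_nonneg in auto)
    finally show ?thesis by (simp add: mult_ac)
  qed
  have "(\<lambda>N. tail (\<lambda>y. \<Sum>n<N. pp z n y) x) \<longlonglongrightarrow> tail (P z) x"
    unfolding tail_def set_lebesgue_integral_def
  proof (rule integral_dominated_convergence)
    show "(\<lambda>y. indicator {x..} y *\<^sub>R P z y) \<in> borel_measurable lborel"
      using borel_measurable_continuous_onI[OF ac_continuous[OF P_ac[of z]]] by measurable
    show "(\<lambda>y. indicator {x..} y *\<^sub>R (\<Sum>n<N. pp z n y)) \<in> borel_measurable lborel" for N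
    proof -
      have "continuous_on UNIV (\<lambda>y. \<Sum>n<N. pp z n y)" by (intro continuous_intros ac_continuous[OF pp_ac])
      from borel_measurable_continuous_onI[OF this] show ?thesis by measurable
    qed
    show "integrable lborel (\<lambda>y. indicator {x..} y *\<^sub>R (Th (Re z) y * (m * exp (b (Re z) x))))"
      using set_integrable_scale(2)[OF set_tail_int[OF Th_tail_int[of "Re z"], of x]] unfolding set_integrable_def by blast
    show "AE y in lborel. (\<lambda>N. indicator {x..} y *\<^sub>R (\<Sum>n<N. pp z n y)) \<longlonglongrightarrow> indicator {x..} y *\<^sub>R P z y"
      using P_sums[of z] by (intro AE_I2 tendsto_scaleR tendsto_const) (simp add: sums_def)
    show "AE y in lborel. norm (indicator {x..} y *\<^sub>R (\<Sum>n<N. pp z n y)) \<le> indicator {x..} y *\<^sub>R (Th (Re z) y * (m * exp (b (Re z) x)))" for N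
      using le by (intro AE_I2) (auto simp: indicator_def)
  qed
  moreover have "tail (\<lambda>y. \<Sum>n<N. pp z n y) x = (\<Sum>n<N. tail (pp z n) x)" for N
    by (rule tail_sum) (use set_tail_int[OF pp_tail_int] in auto)
  ultimately have "(\<lambda>N. 1 - of_real m * (\<Sum>n<N. tail (pp z n) x)) \<longlonglongrightarrow> 1 - of_real m * tail (P z) x"
    by (intro tendsto_intros) simp
  moreover have "1 - of_real m * (\<Sum>n<N. tail (pp z n) x) = (\<Sum>n<Suc N. kk z n x)" for N
    unfolding sum.lessThan_Suc_shift by (simp add: kk_Suc sum_distrib_left sum_negf del: kk.simps(2))
  ultimately have "(\<lambda>N. \<Sum>n<Suc N. kk z n x) \<longlonglongrightarrow> 1 - of_real m * tail (P z) x" by simp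
  then have "(\<lambda>N. \<Sum>n<N. kk z n x) \<longlonglongrightarrow> 1 - of_real m * tail (P z) x" by (rule LIMSEQ_imp_Suc)
  moreover have "(\<lambda>N. \<Sum>n<N. kk z n x) \<longlonglongrightarrow> K z x"
    unfolding K_def using summable_LIMSEQ[OF summable_norm_cancel[OF kk_summable]] .
  ultimately show ?thesis using LIMSEQ_unique by blast
qed

lemma K_ac: "ac (K z) (\<lambda>x. of_real m * P z x)"
proof -
  have "ac (\<lambda>x. 1 - of_real m * tail (P z) x) (\<lambda>x. 0 - of_real m * - P z x)"
    by (rule ac_diff[OF ac_const ac_cmult[OF tail_ac[OF P_tail_int]]])
  then show ?thesis by (rule ac_cong) (auto simp: K_eq)
qed

lemma K_lim: "(K z \<longlongrightarrow> 1) at_top"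
proof -
  have "((\<lambda>x. 1 - of_real m * tail (P z) x) \<longlongrightarrow> 1 - of_real m * 0) at_top"
    by (intro tendsto_intros tail_tendsto_0 P_tail_int)
  then show ?thesis by (simp add: K_eq[abs_def])
qed

lemma Th_lim: "(Th r \<longlongrightarrow> 0) at_top"
proof -
  have "eventually (\<lambda>x. norm (Th r x) \<le> (1 / c) * x powr - \<gamma>) at_top"
  proof -
    obtain X where X: "X \<ge> x1" "\<And>y. y \<ge> X \<Longrightarrow> V y \<ge> max 1 (2 * r)" using V_unbounded by blast
    show ?thesis using eventually_ge_at_top[of X]
    proof eventually_elim
      case (elim y)
      have V: "V y \<ge> 1" "V y \<ge> 2 * r" using X(2)[OF elim] by auto
      have yp: "y \<ge> x1" "y > 0" using elim X(1) x1 by auto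
      have "Th r y \<le> 1 / V y" using Th_le[of y r] V yp by simp
      also have "\<dots> \<le> 1 / (c * y powr \<gamma>)"
        using V_lower[OF yp(1)] yp c V by (intro divide_left_mono) (auto intro!: mult_pos_pos)
      finally show "norm (Th r y) \<le> 1 / c * y powr - \<gamma>"
        using Th_nonneg[of r y] by (simp add: powr_minus divide_inverse)
    qed
  qed
  moreover have "((\<lambda>x. (1 / c) * x powr - \<gamma>) \<longlongrightarrow> 0) at_top"
    using gam by (intro tendsto_mult_right_zero tendsto_neg_powr filterlim_ident) auto
  ultimately show ?thesis by (rule Lim_null_comparison)
qed

lemma P_lim: "(P z \<longlongrightarrow> 0) at_top"
proof (rule Lim_null_comparison)
  show "eventually (\<lambda>x. norm (P z x) \<le> m * Th (Re z) x * exp (b (Re z) x)) at_top"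
    using P_bound[OF order_refl] by (intro always_eventually allI)
  have "((\<lambda>x. m * Th (Re z) x * exp (b (Re z) x)) \<longlongrightarrow> m * 0 * exp 0) at_top"
    by (intro tendsto_intros Th_lim b_lim)
  then show "((\<lambda>x. m * Th (Re z) x * exp (b (Re z) x)) \<longlongrightarrow> 0) at_top" by simp
qed

end

section \<open>First-order systems with square integrable sources\<close>

definition L2c :: "(real \<Rightarrow> complex) \<Rightarrow> bool"
  where "L2c G \<longleftrightarrow> G \<in> borel_measurable borel \<and> integrable lborel (\<lambda>x. (cmod (G x))\<^sup>2)"

text \<open>The resolvent system of the overview with a general complex coefficient \<open>W\<close>
  and sources \<open>G\<close>, \<open>H\<close>, understood almost everywhere through
  \<open>ac\<close>.\<close>

definition sol :: "real \<Rightarrow> (real \<Rightarrow> complex) \<Rightarrow> (real \<Rightarrow> complex) \<Rightarrow> (real \<Rightarrow> complex) \<Rightarrow>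
    (real \<Rightarrow> complex) \<Rightarrow> (real \<Rightarrow> complex) \<Rightarrow> bool"
  where "sol m W f h G H \<longleftrightarrow> ac f (\<lambda>x. W x * f x + of_real m * h x + G x) \<and>
    ac h (\<lambda>x. of_real m * f x - W x * h x + H x)"

definition nsq :: "(real \<Rightarrow> complex) \<Rightarrow> (real \<Rightarrow> complex) \<Rightarrow> real \<Rightarrow> real"
  where "nsq f h x = (cmod (f x))\<^sup>2 + (cmod (h x))\<^sup>2"

lemma nsq_nonneg: "nsq f h x \<ge> 0" by (simp add: nsq_def)

lemma sol_cont: "sol m W f h G H \<Longrightarrow> continuous_on S f" "sol m W f h G H \<Longrightarrow> continuous_on S h"
  unfolding sol_def using ac_continuous by blast+

lemma nsq_cont: "continuous_on S f \<Longrightarrow> continuous_on S h \<Longrightarrow> continuous_on S (nsq f h)"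
  unfolding nsq_def[abs_def] by (intro continuous_intros)

text \<open>Reflection changes the sign of both derivatives; passing from \<open>(f, h)\<close> to
  \<open>(h, - f)\<close> restores the signs of the mass terms and keeps \<open>W\<close>. The left
  half-line thus becomes a right half-line for the reflected potential.\<close>

lemma sol_reflect:
  assumes "sol m W f h G H"
  shows "sol m (\<lambda>x. W (- x)) (\<lambda>x. h (- x)) (\<lambda>x. - f (- x)) (\<lambda>x. - H (- x)) (\<lambda>x. G (- x))"
  unfolding sol_def
proof
  have a: "ac f (\<lambda>x. W x * f x + of_real m * h x + G x)" "ac h (\<lambda>x. of_real m * f x - W x * h x + H x)"
    using assms by (auto simp: sol_def)
  show "ac (\<lambda>x. h (- x)) (\<lambda>x. W (- x) * h (- x) + of_real m * - f (- x) + - H (- x))"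
    by (rule ac_cong[OF ac_reflect[OF a(2)]]) auto
  show "ac (\<lambda>x. - f (- x)) (\<lambda>x. of_real m * h (- x) - W (- x) * - f (- x) + G (- x))"
    by (rule ac_cong[OF ac_uminus[OF ac_reflect[OF a(1)]]]) auto
qed

lemma sol_diff_scale:
  assumes "sol m W f h G H" "sol m W f' h' G' H'"
  shows "sol m W (\<lambda>x. f x - k * f' x) (\<lambda>x. h x - k * h' x) (\<lambda>x. G x - k * G' x) (\<lambda>x. H x - k * H' x)"
  unfolding sol_def
proof
  show "ac (\<lambda>x. f x - k * f' x) (\<lambda>x. W x * (f x - k * f' x) + of_real m * (h x - k * h' x) + (G x - k * G' x))"
    by (rule ac_cong[OF ac_diff[OF _ ac_cmult]]) (use assms in \<open>auto simp: sol_def algebra_simps\<close>)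
  show "ac (\<lambda>x. h x - k * h' x) (\<lambda>x. of_real m * (f x - k * f' x) - W x * (h x - k * h' x) + (H x - k * H' x))"
    by (rule ac_cong[OF ac_diff[OF _ ac_cmult]]) (use assms in \<open>auto simp: sol_def algebra_simps\<close>)
qed

lemma ac_cnj: "ac f f' \<Longrightarrow> ac (\<lambda>x. cnj (f x)) (\<lambda>x. cnj (f' x))"
  by (rule ac_linear[OF _ bounded_linear_cnj])

lemma ac_Re: "ac f f' \<Longrightarrow> ac (\<lambda>x. Re (f x)) (\<lambda>x. Re (f' x))"
  by (rule ac_linear[OF _ bounded_linear_Re])

lemma cmod_sq: "(cmod w)\<^sup>2 = Re w * Re w + Im w * Im w"
  unfolding cmod_power2 by (simp add: power2_eq_square)

lemma ac_cmod_sq: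
  assumes "ac f f'" shows "ac (\<lambda>x. (cmod (f x))\<^sup>2) (\<lambda>x. 2 * Re (f' x * cnj (f x)))"
  by (rule ac_cong[OF ac_Re[OF ac_mult[OF assms ac_cnj[OF assms]]]])
    (simp_all add: cmod_sq algebra_simps)

text \<open>The mass terms of the two equations cancel in the difference, and the remaining term is
  definite wherever \<open>Re W\<close> has a sign.\<close>

lemma sol_energy:
  assumes "sol m W f h G H"
  shows "ac (\<lambda>x. (cmod (f x))\<^sup>2 - (cmod (h x))\<^sup>2)
    (\<lambda>x. 2 * Re (W x) * nsq f h x + 2 * Re (G x * cnj (f x) - H x * cnj (h x)))"
proof -
  have "ac f (\<lambda>x. W x * f x + of_real m * h x + G x)" "ac h (\<lambda>x. of_real m * f x - W x * h x + H x)"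
    using assms by (auto simp: sol_def)
  from ac_diff[OF ac_cmod_sq[OF this(1)] ac_cmod_sq[OF this(2)]] show ?thesis
    by (rule ac_cong) (auto simp: nsq_def cmod_sq algebra_simps)
qed

text \<open>For real \<open>W\<close> the potential drops out of this combination and the mass
  appears with a definite sign; this yields an estimate independent of the size of
  \<open>V\<close>.\<close>

lemma sol_cross:
  assumes "sol m W f h G H" "\<And>x. Im (W x) = 0"
  shows "ac (\<lambda>x. Re (f x * cnj (h x))) (\<lambda>x. m * nsq f h x + Re (G x * cnj (h x) + f x * cnj (H x)))"
proof -
  have "ac f (\<lambda>x. W x * f x + of_real m * h x + G x)" "ac h (\<lambda>x. of_real m * f x - W x * h x + H x)"
    using assms by (auto simp: sol_def)
  from ac_Re[OF ac_mult[OF this(1) ac_cnj[OF this(2)]]] show ?thesis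
    by (rule ac_cong) (auto simp: nsq_def cmod_sq algebra_simps assms(2))
qed

text \<open>The coefficient matrix is trace free, so the Wronskian with a homogeneous solution
  changes through the sources only.\<close>

lemma sol_wedge:
  assumes "sol m W f h G H" "sol m W f' h' (\<lambda>x. 0) (\<lambda>x. 0)"
  shows "ac (\<lambda>x. f x * h' x - h x * f' x) (\<lambda>x. G x * h' x - H x * f' x)"
proof -
  have "ac f (\<lambda>x. W x * f x + of_real m * h x + G x)" "ac h (\<lambda>x. of_real m * f x - W x * h x + H x)"
    "ac f' (\<lambda>x. W x * f' x + of_real m * h' x + 0)" "ac h' (\<lambda>x. of_real m * f' x - W x * h' x + 0)"
    using assms by (auto simp: sol_def)
  from ac_diff[OF ac_mult[OF this(1,4)] ac_mult[OF this(2,3)]] show ?thesis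
    by (rule ac_cong) (auto simp: algebra_simps)
qed

lemma two_Re_le: "2 * \<bar>Re (a * cnj b)\<bar> \<le> (cmod a)\<^sup>2 + (cmod b)\<^sup>2"
proof -
  have "\<bar>Re (a * cnj b)\<bar> \<le> cmod a * cmod b" using abs_Re_le_cmod[of "a * cnj b"] by (simp add: norm_mult)
  then show ?thesis using sum_squares_bound[of "cmod a" "cmod b"] by linarith
qed

lemma sol_mass:
  assumes "sol m W f h G H" "m \<ge> 0"
  obtains e where "ac (nsq f h) e"
    "\<And>x. \<bar>e x\<bar> \<le> (2 * (cmod (W x) + m) + 1) * nsq f h x + nsq G H x"
proof -
  have a: "ac f (\<lambda>x. W x * f x + of_real m * h x + G x)" "ac h (\<lambda>x. of_real m * f x - W x * h x + H x)"
    using assms by (auto simp: sol_def)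
  let ?e = "\<lambda>x. 2 * Re ((W x * f x + of_real m * h x + G x) * cnj (f x)) + 2 * Re ((of_real m * f x - W x * h x + H x) * cnj (h x))"
  have "ac (nsq f h) ?e"
    using ac_add[OF ac_cmod_sq[OF a(1)] ac_cmod_sq[OF a(2)]] by (simp add: nsq_def[abs_def])
  moreover have "\<bar>?e x\<bar> \<le> (2 * (cmod (W x) + m) + 1) * nsq f h x + nsq G H x" for x
  proof -
    have 1: "?e x = 2 * (Re (W x) * ((cmod (f x))\<^sup>2 - (cmod (h x))\<^sup>2)) + m * (4 * Re (h x * cnj (f x)))
      + 2 * Re (G x * cnj (f x)) + 2 * Re (H x * cnj (h x))"
      by (simp add: cmod_sq algebra_simps)
    have 2: "\<bar>Re (W x) * ((cmod (f x))\<^sup>2 - (cmod (h x))\<^sup>2)\<bar> \<le> cmod (W x) * nsq f h x"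
      unfolding abs_mult by (intro mult_mono abs_Re_le_cmod) (auto simp: nsq_def abs_le_iff)
    have 3: "\<bar>m * (4 * Re (h x * cnj (f x)))\<bar> \<le> m * (2 * nsq f h x)"
      unfolding abs_mult using two_Re_le[of "h x" "f x"] assms(2)
      by (simp add: nsq_def mult_left_mono)
    have abs4: "\<bar>2 * A + B + 2 * C + 2 * D\<bar> \<le> 2 * a + b + c + d"
      if "\<bar>A\<bar> \<le> a" "\<bar>B\<bar> \<le> b" "2 * \<bar>C\<bar> \<le> c" "2 * \<bar>D\<bar> \<le> d" for A B C D a b c d :: real
      using that by linarith
    have "2 * (cmod (W x) * nsq f h x) + m * (2 * nsq f h x) + ((cmod (G x))\<^sup>2 + (cmod (f x))\<^sup>2) + ((cmod (H x))\<^sup>2 + (cmod (h x))\<^sup>2)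
      = (2 * (cmod (W x) + m) + 1) * nsq f h x + nsq G H x"
      by (simp add: nsq_def algebra_simps)
    then show ?thesis unfolding 1 using abs4[OF 2 3 two_Re_le[of "G x" "f x"] two_Re_le[of "H x" "h x"]] by (simp only:)
  qed
  ultimately show ?thesis by (rule that)
qed

lemma L2c_nsq: "L2c G \<Longrightarrow> L2c H \<Longrightarrow> integrable lborel (nsq G H)"
  unfolding L2c_def nsq_def[abs_def] by auto

lemma integrable_interval:
  fixes s :: "real \<Rightarrow> real"
  assumes "integrable lborel s" shows "s integrable_on {a..b}"
  using integrable_on_subinterval[OF integrable_on_lborel[OF assms]] by auto

lemma integral_interval_le:
  fixes s :: "real \<Rightarrow> real"
  assumes "integrable lborel s" "\<And>x. s x \<ge> (0::real)" shows "integral {a..b} s \<le> integral\<^sup>L lborel s"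
proof -
  have "integral {a..b} s \<le> integral UNIV s"
    by (rule integral_subset_le[OF _ integrable_interval[OF assms(1)] integrable_on_lborel[OF assms(1)]])
      (use assms in auto)
  then show ?thesis using integral_lborel[OF assms(1)] by simp
qed

lemma sol_gronwall:
  assumes s: "sol m W f h G H" and m: "m \<ge> 0" and W: "continuous_on UNIV W" and S: "integrable lborel (nsq G H)"
    and ab: "a \<le> b" and k: "\<And>x. a \<le> x \<Longrightarrow> x \<le> b \<Longrightarrow> 2 * (cmod (W x) + m) + 1 \<le> \<kappa>"
  shows "nsq f h b \<le> exp (\<kappa> * (b - a)) * (nsq f h a + integral\<^sup>L lborel (nsq G H))"
    and "nsq f h a \<le> exp (\<kappa> * (b - a)) * (nsq f h b + integral\<^sup>L lborel (nsq G H))"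
proof -
  obtain e where e: "ac (nsq f h) e" "\<And>x. \<bar>e x\<bar> \<le> (2 * (cmod (W x) + m) + 1) * nsq f h x + nsq G H x"
    using sol_mass[OF s m] by metis
  let ?k = "\<lambda>x. 2 * (cmod (W x) + m) + 1"
  have kc: "continuous_on UNIV ?k" by (intro continuous_intros W)
  obtain K where K: "ac K ?k" using ac_indef_cont[OF kc, of 0] by blast
  have kn: "?k x \<ge> 0" for x using m by simp
  have "K b - K a \<le> \<kappa> * (b - a)"
  proof -
    have "integral {a..b} ?k \<le> integral {a..b} (\<lambda>x. \<kappa>)"
      using k by (intro integral_le ac_int[OF K]) auto
    then show ?thesis using ac_integral[OF K ab] ab by (simp add: mult.commute)
  qed
  then have ex: "exp (K b - K a) \<le> exp (\<kappa> * (b - a))" by simp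
  have le: "integral {a..b} (nsq G H) \<le> integral\<^sup>L lborel (nsq G H)"
    by (rule integral_interval_le[OF S nsq_nonneg])
  have i0: "integral {a..b} (nsq G H) \<ge> 0"
    by (intro Henstock_Kurzweil_Integration.integral_nonneg integrable_interval[OF S]) (auto simp: nsq_nonneg)
  have up: "e x \<le> ?k x * nsq f h x + nsq G H x" and dn: "- e x \<le> ?k x * nsq f h x + nsq G H x" for x
    using e(2)[of x] by auto
  have "nsq f h b \<le> exp (K b - K a) * (nsq f h a + integral {a..b} (nsq G H))"
    by (rule ac_gronwall[OF e(1) kc K integrable_interval[OF S] ab up kn nsq_nonneg])
  also have "\<dots> \<le> exp (\<kappa> * (b - a)) * (nsq f h a + integral\<^sup>L lborel (nsq G H))"
    using ex le i0 nsq_nonneg[of f h a] by (intro mult_mono) auto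
  finally show "nsq f h b \<le> exp (\<kappa> * (b - a)) * (nsq f h a + integral\<^sup>L lborel (nsq G H))" .
  have "nsq f h a \<le> exp (K b - K a) * (nsq f h b + integral {a..b} (nsq G H))"
    by (rule ac_gronwall_back[OF e(1) kc K integrable_interval[OF S] ab dn kn nsq_nonneg])
  also have "\<dots> \<le> exp (\<kappa> * (b - a)) * (nsq f h b + integral\<^sup>L lborel (nsq G H))"
    using ex le i0 nsq_nonneg[of f h b] by (intro mult_mono) auto
  finally show "nsq f h a \<le> exp (\<kappa> * (b - a)) * (nsq f h b + integral\<^sup>L lborel (nsq G H))" .
qed

lemma sol_zero:
  assumes s: "sol m W f h (\<lambda>x. 0) (\<lambda>x. 0)" and m: "m \<ge> 0" and W: "continuous_on UNIV W"
    and z: "f a = 0" "h a = 0"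
  shows "f x = 0 \<and> h x = 0"
proof -
  have S: "nsq (\<lambda>x. 0) (\<lambda>x. 0) = (\<lambda>x. 0)" by (auto simp: nsq_def)
  define l u where "l = min a x" and "u = max a x"
  have "compact ((\<lambda>x. 2 * (cmod (W x) + m) + 1) ` {l..u})"
    by (intro compact_continuous_image continuous_intros continuous_on_subset[OF W]) auto
  from compact_imp_bounded[OF this] obtain \<kappa> where "\<forall>y\<in>(\<lambda>x. 2 * (cmod (W x) + m) + 1) ` {l..u}. norm y \<le> \<kappa>"
    unfolding bounded_iff by blast
  then have k: "2 * (cmod (W y) + m) + 1 \<le> \<kappa>" if "y \<in> {l..u}" for y using that by force
  have i: "integrable lborel (nsq (\<lambda>x. 0) (\<lambda>x. 0))" unfolding S by simp
  have "nsq f h x \<le> 0"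
  proof (cases "a \<le> x")
    case True
    then show ?thesis using sol_gronwall(1)[OF s m W i True, of \<kappa>] k z by (auto simp: S nsq_def l_def u_def)
  next
    case False
    then have "x \<le> a" by simp
    then show ?thesis using sol_gronwall(2)[OF s m W i \<open>x \<le> a\<close>, of \<kappa>] k z by (auto simp: S nsq_def l_def u_def)
  qed
  then show ?thesis by (simp add: nsq_def sum_power2_le_zero_iff)
qed

lemma ac_continuous_deriv:
  fixes F :: "real \<Rightarrow> 'a::euclidean_space"
  assumes "ac F f" "continuous_on UNIV f" shows "(F has_vector_derivative f x) (at x)"
proof -
  obtain F' where F': "\<forall>x. (F' has_vector_derivative f x) (at x)" "ac F' f" "F' 0 = 0"
    using ac_indef_cont[OF assms(2), of 0] by blast
  define c where "c = F 0"
  have "F y = F' y + c" for y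
    using ac_integral[OF assms(1), of 0 y] ac_integral[OF assms(1), of y 0] ac_integral[OF F'(2), of 0 y]
      ac_integral[OF F'(2), of y 0] F'(3) c_def by (cases "y \<ge> 0") (auto simp: algebra_simps)
  then have eq: "F = (\<lambda>y. F' y + c)" by (rule ext)
  have "((\<lambda>y. F' y + c) has_vector_derivative f x + 0) (at x)"
    by (intro has_vector_derivative_add has_vector_derivative_const) (use F' in auto)
  then show ?thesis unfolding eq by simp
qed

text \<open>Variation of constants with the frame \<open>\<phi> = (f, h)\<close> and \<open>(- cnj h, cnj f) / \<bar>\<phi>\<bar>\<^sup>2\<close>.\<close>

lemma sol_exists:
  assumes s: "sol m W f h (\<lambda>x. 0) (\<lambda>x. 0)" and W: "continuous_on UNIV W"
    and nz: "\<And>x. nsq f h x \<noteq> 0"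
    and GH: "\<And>a b. G absolutely_integrable_on {a..b}" "\<And>a b. H absolutely_integrable_on {a..b}"
  shows "\<exists>u v. sol m W u v G H \<and> u 0 = u0 \<and> v 0 = v0"
proof -
  let ?f' = "\<lambda>x. W x * f x + of_real m * h x" and ?h' = "\<lambda>x. of_real m * f x - W x * h x"
  have a: "ac f ?f'" "ac h ?h'" using s by (auto simp: sol_def)
  have c: "continuous_on S f" "continuous_on S h" for S using sol_cont[OF s] by auto
  have df: "(f has_vector_derivative ?f' x) (at x)" "(h has_vector_derivative ?h' x) (at x)" for x
    by (rule ac_continuous_deriv[OF a(1)] ac_continuous_deriv[OF a(2)]; intro continuous_intros W c)+
  define n where "n x = f x * cnj (f x) + h x * cnj (h x)" for x
  have n: "n x = of_real (nsq f h x)" for x by (simp add: n_def nsq_def cmod_sq complex_eq_iff algebra_simps)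
  have n0: "n x \<noteq> 0" for x using nz by (simp add: n)
  define n' where "n' x = (?f' x * cnj (f x) + f x * cnj (?f' x)) + (?h' x * cnj (h x) + h x * cnj (?h' x))" for x
  have dc: "((\<lambda>x. cnj (g x)) has_vector_derivative cnj g') (at x)" if "(g has_vector_derivative g') (at x)" for g g' x
    using bounded_linear.has_vector_derivative[OF bounded_linear_cnj that] .
  have dn: "(n has_vector_derivative n' x) (at x)" for x
  proof -
    have "(n has_vector_derivative (f x * cnj (?f' x) + ?f' x * cnj (f x)) + (h x * cnj (?h' x) + ?h' x * cnj (h x))) (at x)"
      unfolding n_def[abs_def] by (intro has_vector_derivative_add has_vector_derivative_mult df dc)
    moreover have "(f x * cnj (?f' x) + ?f' x * cnj (f x)) + (h x * cnj (?h' x) + ?h' x * cnj (h x)) = n' x"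
      unfolding n'_def by (simp only: add.commute)
    ultimately show ?thesis by (simp only:)
  qed
  define P where "P x = - cnj (h x) / n x" for x
  define Q where "Q x = cnj (f x) / n x" for x
  define P' where "P' x = (- cnj (?h' x) * n x + cnj (h x) * n' x) / (n x * n x)" for x
  define Q' where "Q' x = (cnj (?f' x) * n x - cnj (f x) * n' x) / (n x * n x)" for x
  have di: "((\<lambda>x. inverse (n x)) has_vector_derivative - n' x / (n x * n x)) (at x)" for x
    using field_vector_diff_chain_at[OF dn DERIV_inverse[OF n0[of x]]] n0[of x]
    by (simp add: o_def power2_eq_square divide_inverse)
  have dP: "(P has_vector_derivative P' x) (at x)" for x
  proof -
    have "((\<lambda>x. - cnj (h x) * inverse (n x)) has_vector_derivative
      - cnj (h x) * (- n' x / (n x * n x)) + - cnj (?h' x) * inverse (n x)) (at x)"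
      by (intro has_vector_derivative_mult di has_vector_derivative_minus dc df)
    moreover have "- cnj (h x) * (- n' x / (n x * n x)) + - cnj (?h' x) * inverse (n x) = P' x"
      using n0[of x] by (simp add: P'_def field_simps)
    ultimately show ?thesis by (simp add: P_def[abs_def] divide_inverse)
  qed
  have dQ: "(Q has_vector_derivative Q' x) (at x)" for x
  proof -
    have "((\<lambda>x. cnj (f x) * inverse (n x)) has_vector_derivative
      cnj (f x) * (- n' x / (n x * n x)) + cnj (?f' x) * inverse (n x)) (at x)"
      by (intro has_vector_derivative_mult di dc df)
    moreover have "cnj (f x) * (- n' x / (n x * n x)) + cnj (?f' x) * inverse (n x) = Q' x"
      using n0[of x] by (simp add: Q'_def field_simps)
    ultimately show ?thesis by (simp add: Q_def[abs_def] divide_inverse)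
  qed
  have cn: "continuous_on S n" for S unfolding n_def[abs_def] by (intro continuous_intros c)
  have Wc: "continuous_on S W" for S using W continuous_on_subset by blast
  have cn': "continuous_on S n'" for S unfolding n'_def[abs_def] by (intro continuous_intros c Wc)
  have cPQ': "continuous_on S P'" "continuous_on S Q'" for S
    unfolding P'_def[abs_def] Q'_def[abs_def] using n0 by (intro continuous_intros c Wc cn cn'; simp)+
  have aP: "ac P P'" "ac Q Q'" using ac_C1[OF dP cPQ'(1)] ac_C1[OF dQ cPQ'(2)] by auto
  have cPQ: "continuous_on S P" "continuous_on S Q" for S using ac_continuous[OF aP(1)] ac_continuous[OF aP(2)] by auto
  have one: "f x * Q x - h x * P x = 1" for x
    using n0[of x] by (simp add: P_def Q_def add_divide_distrib[symmetric] n_def)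
  have wr: "?f' x * Q x + f x * Q' x - (?h' x * P x + h x * P' x) = 0" for x
  proof -
    have "((\<lambda>x. f x * Q x - h x * P x) has_vector_derivative
      (f x * Q' x + ?f' x * Q x) - (h x * P' x + ?h' x * P x)) (at x)"
      by (intro has_vector_derivative_diff has_vector_derivative_mult df dP dQ)
    moreover have "((\<lambda>x. f x * Q x - h x * P x) has_vector_derivative 0) (at x)" by (simp add: one)
    ultimately have "(f x * Q' x + ?f' x * Q x) - (h x * P' x + ?h' x * P x) = 0"
      by (rule vector_derivative_unique_at)
    then show ?thesis by (simp add: algebra_simps)
  qed
  \<comment> \<open>The second frame vector \<open>(P, Q)\<close> is not a solution;
    \<open>(R1, R2)\<close> is its defect. Since \<open>f Q - h P\<close> is constantly
    \<open>1\<close> and the system is trace free, the defect is parallel to \<open>(f, h)\<close>.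
    The equations for the coefficients are therefore triangular: \<open>b\<close> is a plain
    integral of the sources, and \<open>A\<close> is obtained from \<open>b\<close>.\<close>
  define R1 where "R1 x = W x * P x + of_real m * Q x - P' x" for x
  define R2 where "R2 x = of_real m * P x - W x * Q x - Q' x" for x
  have R: "f x * R2 x = h x * R1 x" for x using wr[of x] by (simp add: R1_def R2_def algebra_simps)
  have cR: "continuous_on S R1" "continuous_on S R2" for S
    unfolding R1_def[abs_def] R2_def[abs_def] by (intro continuous_intros Wc cPQ cPQ')+
  have ib: "(\<lambda>x. f x * H x - h x * G x) absolutely_integrable_on {a..b}" for a b
    by (intro set_integral_diff(1) abs_int_cont_mult GH c)
  obtain b0 where b0: "ac b0 (\<lambda>x. f x * H x - h x * G x)" "b0 0 = 0"
    using ac_indefinite[OF ib, of 0] by blast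
  define \<beta> where "\<beta> = f 0 * v0 - h 0 * u0"
  define b where "b x = b0 x + \<beta>" for x
  have ab: "ac b (\<lambda>x. f x * H x - h x * G x)" unfolding b_def[abs_def]
    using ac_add[OF b0(1) ac_const[of \<beta>]] by simp
  have cb: "continuous_on S b" for S by (rule ac_continuous[OF ab])
  have ia: "(\<lambda>x. (b x * R1 x + G x) * Q x - (b x * R2 x + H x) * P x) absolutely_integrable_on {a..b'}" for a b'
  proof -
    have cc: "(\<lambda>x. b x * R1 x) absolutely_integrable_on {a..b'}" "(\<lambda>x. b x * R2 x) absolutely_integrable_on {a..b'}"
      by (rule absolutely_integrable_continuous_real; intro continuous_intros cb cR)+
    show ?thesis by (intro set_integral_diff(1) abs_int_cont_mult set_integral_add(1) cc GH cPQ)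
  qed
  obtain a0 where a0: "ac a0 (\<lambda>x. (b x * R1 x + G x) * Q x - (b x * R2 x + H x) * P x)" "a0 0 = 0"
    using ac_indefinite[OF ia, of 0] by blast
  define \<alpha> where "\<alpha> = u0 * Q 0 - v0 * P 0"
  define A where "A x = a0 x + \<alpha>" for x
  have aA: "ac A (\<lambda>x. (b x * R1 x + G x) * Q x - (b x * R2 x + H x) * P x)" unfolding A_def[abs_def]
    using ac_add[OF a0(1) ac_const[of \<alpha>]] by simp
  have "ac (\<lambda>x. A x * f x + b x * P x) (\<lambda>x. W x * (A x * f x + b x * P x) + of_real m * (A x * h x + b x * Q x) + G x)"
  proof (rule ac_cong[OF ac_add[OF ac_mult[OF aA a(1)] ac_mult[OF ab aP(1)]]])
    fix x
    have "((b x * R1 x + G x) * Q x - (b x * R2 x + H x) * P x) * f x + (f x * H x - h x * G x) * P x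
      = b x * (f x * R1 x * Q x - (f x * R2 x) * P x) + G x * (f x * Q x - h x * P x)"
      by (simp add: algebra_simps)
    also have "\<dots> = b x * R1 x * (f x * Q x - h x * P x) + G x * (f x * Q x - h x * P x)"
      unfolding R by (simp add: algebra_simps)
    finally have *: "((b x * R1 x + G x) * Q x - (b x * R2 x + H x) * P x) * f x + (f x * H x - h x * G x) * P x
      = b x * R1 x + G x" by (simp only: one mult_1_right)
    have "((b x * R1 x + G x) * Q x - (b x * R2 x + H x) * P x) * f x + A x * ?f' x +
      ((f x * H x - h x * G x) * P x + b x * P' x) = (b x * R1 x + G x) + A x * ?f' x + b x * P' x"
      using * by (simp add: algebra_simps)
    also have "\<dots> = W x * (A x * f x + b x * P x) + of_real m * (A x * h x + b x * Q x) + G x"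
      by (simp add: R1_def algebra_simps)
    finally show "((b x * R1 x + G x) * Q x - (b x * R2 x + H x) * P x) * f x + A x * ?f' x +
      ((f x * H x - h x * G x) * P x + b x * P' x) = W x * (A x * f x + b x * P x) + of_real m * (A x * h x + b x * Q x) + G x" .
  qed simp
  moreover have "ac (\<lambda>x. A x * h x + b x * Q x) (\<lambda>x. of_real m * (A x * f x + b x * P x) - W x * (A x * h x + b x * Q x) + H x)"
  proof (rule ac_cong[OF ac_add[OF ac_mult[OF aA a(2)] ac_mult[OF ab aP(2)]]])
    fix x
    have "((b x * R1 x + G x) * Q x - (b x * R2 x + H x) * P x) * h x + (f x * H x - h x * G x) * Q x
      = b x * ((h x * R1 x) * Q x - h x * R2 x * P x) + H x * (f x * Q x - h x * P x)"
      by (simp add: algebra_simps)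
    also have "\<dots> = b x * R2 x * (f x * Q x - h x * P x) + H x * (f x * Q x - h x * P x)"
      unfolding R[symmetric] by (simp add: algebra_simps)
    finally have *: "((b x * R1 x + G x) * Q x - (b x * R2 x + H x) * P x) * h x + (f x * H x - h x * G x) * Q x
      = b x * R2 x + H x" by (simp only: one mult_1_right)
    have "((b x * R1 x + G x) * Q x - (b x * R2 x + H x) * P x) * h x + A x * ?h' x +
      ((f x * H x - h x * G x) * Q x + b x * Q' x) = (b x * R2 x + H x) + A x * ?h' x + b x * Q' x"
      using * by (simp add: algebra_simps)
    also have "\<dots> = of_real m * (A x * f x + b x * P x) - W x * (A x * h x + b x * Q x) + H x"
      by (simp add: R2_def algebra_simps)
    finally show "((b x * R1 x + G x) * Q x - (b x * R2 x + H x) * P x) * h x + A x * ?h' x +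
      ((f x * H x - h x * G x) * Q x + b x * Q' x) = of_real m * (A x * f x + b x * P x) - W x * (A x * h x + b x * Q x) + H x" .
  qed simp
  moreover have "A 0 * f 0 + b 0 * P 0 = u0"
  proof -
    have "A 0 * f 0 + b 0 * P 0 = u0 * (f 0 * Q 0 - h 0 * P 0)"
      by (simp add: A_def b_def a0 b0 \<alpha>_def \<beta>_def algebra_simps)
    then show ?thesis by (simp add: one)
  qed
  moreover have "A 0 * h 0 + b 0 * Q 0 = v0"
  proof -
    have "A 0 * h 0 + b 0 * Q 0 = v0 * (f 0 * Q 0 - h 0 * P 0)"
      by (simp add: A_def b_def a0 b0 \<alpha>_def \<beta>_def algebra_simps)
    then show ?thesis by (simp add: one)
  qed
  ultimately show ?thesis unfolding sol_def by (intro exI conjI)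
qed

text \<open>Integrability gives no pointwise decay, but a function bounded below by \<open>e\<close>
  on a half-line would have infinite integral. Points where it is small are all that the limiting
  arguments use.\<close>

lemma small_values:
  fixes N :: "real \<Rightarrow> real"
  assumes "tail_int N" "e > 0" shows "\<exists>x\<ge>X. N x < e"
proof (rule ccontr)
  assume "\<not> ?thesis"
  then have ge: "N x \<ge> e" if "x \<ge> X" for x using that by force
  have i: "set_integrable lborel {X..} N" using assms(1) by (simp add: tail_int_def)
  obtain n :: nat where n: "real n > tail N X / e" using reals_Archimedean2 by blast
  have h: "(N has_integral tail N X - tail N (X + n)) {X..X + n}"
    using ac_has[OF ac_uminus[OF tail_ac[OF assms(1)]], of X "X + n"] by simp
  have "tail N (X + n) \<ge> 0"
    unfolding tail_def set_lebesgue_integral_def using ge assms(2)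
    by (intro Bochner_Integration.integral_nonneg) (force simp: indicator_def intro: order_trans[OF less_imp_le])
  moreover have "e * real n \<le> tail N X - tail N (X + n)"
    using has_integral_le[OF has_integral_const_real[of e X "X + n"] h] ge by (simp add: mult.commute)
  ultimately have "e * real n \<le> tail N X" by simp
  then show False using n assms(2) by (simp add: field_simps)
qed

text \<open>\<open>w + tail d\<close> is constant; \<open>tail d\<close> tends to \<open>0\<close>,
  and \<open>w\<close> is small at suitable points arbitrarily far out, so the constant is
  zero.\<close>

lemma tail_limit:
  fixes w d :: "real \<Rightarrow> complex"
  assumes w: "ac w d" and d: "tail_int d" and N: "tail_int N" and le: "\<And>x. x \<ge> 0 \<Longrightarrow> cmod (w x) \<le> N x"
  shows "w x = - tail d x"
proof -
  have a: "ac (\<lambda>x. w x + tail d x) (\<lambda>x. 0)"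
    using ac_add[OF w tail_ac[OF d]] by simp
  have const: "w y + tail d y = w x + tail d x" for y
    using ac_integral[OF a, of x y] ac_integral[OF a, of y x] by (cases "x \<le> y") auto
  have "cmod (w x + tail d x) \<le> 0"
  proof (rule field_le_epsilon)
    fix e :: real assume e: "e > 0"
    have "eventually (\<lambda>y. cmod (tail d y) < e / 2) at_top"
      using tendstoD[OF tail_tendsto_0[OF d], of "e/2"] e by simp
    then obtain Y where Y: "\<And>y. y \<ge> Y \<Longrightarrow> cmod (tail d y) < e / 2" by (auto simp: eventually_at_top_linorder)
    obtain y where y: "y \<ge> max Y 0" "N y < e / 2" using small_values[OF N, of "e/2" "max Y 0"] e by auto
    have "cmod (w y + tail d y) \<le> cmod (w y) + cmod (tail d y)" by (rule norm_triangle_ineq)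
    also have "\<dots> < e" using Y[of y] y le[of y] by auto
    finally show "cmod (w x + tail d x) \<le> 0 + e" using const[of y] by simp
  qed
  then show ?thesis by (simp add: eq_neg_iff_add_eq_0)
qed

lemma tail_int_of_bounded:
  fixes N :: "real \<Rightarrow> real"
  assumes c: "continuous_on UNIV N" and nn: "\<And>x. N x \<ge> 0" and b: "\<And>x. x \<ge> X \<Longrightarrow> integral {X..x} N \<le> B"
  shows "tail_int N"
proof -
  have Nm: "N \<in> borel_measurable borel" using c by (rule borel_measurable_continuous_onI)
  have "integrable lborel (\<lambda>x. indicator {X..} x *\<^sub>R N x)"
  proof (rule integrableI_bounded)
    show "(\<lambda>x. indicator {X..} x *\<^sub>R N x) \<in> borel_measurable lborel" using Nm by measurable
    have e: "ennreal (norm (indicator {X..} x *\<^sub>R N x)) = (SUP n::nat. ennreal (N x) * indicator {X..X + real n} x)" for x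
    proof (cases "x \<ge> X")
      case True
      obtain n :: nat where "real n \<ge> x - X" using real_arch_simple by blast
      then have "x \<in> {X..X + real n}" using True by auto
      then have "ennreal (N x) \<le> (SUP n::nat. ennreal (N x) * indicator {X..X + real n} x)"
        by (intro SUP_upper2[of n]) auto
      moreover have "(SUP n::nat. ennreal (N x) * indicator {X..X + real n} x) \<le> ennreal (N x)"
        by (intro SUP_least) (auto simp: indicator_def)
      ultimately show ?thesis using True nn by (simp add: antisym)
    qed (auto simp: indicator_def)
    have "(\<integral>\<^sup>+x. ennreal (norm (indicator {X..} x *\<^sub>R N x)) \<partial>lborel) = (SUP n::nat. \<integral>\<^sup>+x. ennreal (N x) * indicator {X..X + real n} x \<partial>lborel)"
      unfolding e using Nm
      by (intro nn_integral_monotone_convergence_SUP) (auto simp: incseq_def le_fun_def indicator_def)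
    also have "\<dots> \<le> ennreal B"
    proof (rule SUP_least)
      fix n :: nat
      have i: "set_integrable lborel {X..X + real n} N" by (rule set_integrable_cont_interval[OF c])
      have "(\<integral>\<^sup>+x. ennreal (N x) * indicator {X..X + real n} x \<partial>lborel) = ennreal (LINT x:{X..X + real n}|lborel. N x)"
        unfolding set_lebesgue_integral_def using i nn unfolding set_integrable_def
        by (subst nn_integral_eq_integral[symmetric]) (auto simp: indicator_def intro!: nn_integral_cong)
      also have "(LINT x:{X..X + real n}|lborel. N x) = integral {X..X + real n} N"
        by (rule set_borel_integral_eq_integral(2)[OF i])
      finally show "(\<integral>\<^sup>+x. ennreal (N x) * indicator {X..X + real n} x \<partial>lborel) \<le> ennreal B"
        using b[of "X + real n"] by (simp add: ennreal_leI)
    qed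
    finally show "(\<integral>\<^sup>+x. ennreal (norm (indicator {X..} x *\<^sub>R N x)) \<partial>lborel) < \<infinity>"
      by (simp add: le_less_trans less_top)
  qed
  then have w: "set_integrable lborel {X..} N" by (simp add: set_integrable_def)
  show ?thesis by (rule tail_int_bound[OF c w]) (simp add: nn)
qed

text \<open>The step from a weighted arithmetic-geometric inequality to Cauchy-Schwarz. The optimal
  parameter is \<open>t = x / A\<close>; for \<open>A = 0\<close> the choice
  \<open>(B + 1) / x\<close> is already too large for a positive \<open>x\<close>.\<close>

lemma square_le_of_quadratic:
  assumes "\<And>t. t > 0 \<Longrightarrow> 2 * x \<le> t * A + B / t" "A \<ge> 0" "B \<ge> 0" "x \<ge> (0::real)"
  shows "x\<^sup>2 \<le> A * B"
proof (cases "x = 0")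
  case False
  then have x: "x > 0" using assms by simp
  show ?thesis
  proof (cases "A = 0")
    case True
    have "2 * x \<le> B / ((B + 1) / x)" using assms(1)[of "(B + 1) / x"] x assms(3) True by simp
    then have "B * x + x * 2 \<le> 0" using x assms(3) by (simp add: field_simps)
    then show ?thesis using mult_nonneg_nonneg[of B x] assms(3) x by linarith
  next
    case False
    then have A: "A > 0" using assms by simp
    have "2 * x \<le> x / A * A + B / (x / A)" using assms(1)[of "x / A"] x A by simp
    then have "x \<le> B * A / x" using A x by simp
    then show ?thesis using x by (simp add: field_simps power2_eq_square)
  qed
qed (use assms in simp)

lemma tail_nsq_L2c: assumes "L2c G" "L2c H" shows "set_integrable lborel {x..} (nsq G H)"
  unfolding set_integrable_def using integrable_mult_indicator[OF _ L2c_nsq[OF assms], of "{x..}"] by simp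

lemma pairing_le: assumes "t > 0"
  shows "cmod (g * b - h * a) \<le> (t * ((cmod g)\<^sup>2 + (cmod h)\<^sup>2) + ((cmod a)\<^sup>2 + (cmod b)\<^sup>2) / t) / 2"
proof -
  have k: "2 * (cmod u * cmod v) \<le> t * (cmod u)\<^sup>2 + (cmod v)\<^sup>2 / t" for u v :: complex
    using sum_squares_bound[of "sqrt t * cmod u" "cmod v / sqrt t"] assms
    by (simp add: power_mult_distrib power_divide)
  have "cmod (g * b - h * a) \<le> cmod g * cmod b + cmod h * cmod a"
    using norm_triangle_ineq4[of "g * b" "h * a"] by (simp add: norm_mult)
  also have "\<dots> \<le> (t * ((cmod g)\<^sup>2 + (cmod h)\<^sup>2) + ((cmod a)\<^sup>2 + (cmod b)\<^sup>2) / t) / 2"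
    using k[of g b] k[of h a] by (simp add: algebra_simps add_divide_distrib)
  finally show ?thesis .
qed

text \<open>Cauchy-Schwarz on a half-line for the derivative of a Wronskian. The inequality with
  free weight \<open>t\<close> supplies an integrable majorant and, through
  \<open>square_le_of_quadratic\<close>, the product form.\<close>

lemma tail_pairing:
  assumes G: "L2c G" "L2c H" and c: "continuous_on UNIV f" "continuous_on UNIV h" and N: "tail_int (nsq f h)"
  shows "tail_int (\<lambda>x. G x * h x - H x * f x)"
    and "(cmod (tail (\<lambda>x. G x * h x - H x * f x) x))\<^sup>2 \<le> tail (nsq G H) x * tail (nsq f h) x"
proof -
  have Ni: "set_integrable lborel {x..} (nsq f h)" for x using N by (simp add: tail_int_def)
  have wi: "set_integrable lborel {x..} (\<lambda>y. t / 2 * nsq G H y + 1 / (2 * t) * nsq f h y)" for t x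
    by (intro set_integral_add(1) set_integrable_scale(1) tail_nsq_L2c[OF G] Ni)
  have le: "cmod (G y * h y - H y * f y) \<le> t / 2 * nsq G H y + 1 / (2 * t) * nsq f h y" if "t > 0" for t y
    using pairing_le[OF that, of "G y" "h y" "H y" "f y"] by (simp add: nsq_def add_divide_distrib)
  have m: "(\<lambda>x. G x * h x - H x * f x) \<in> borel_measurable borel"
  proof -
    have "G \<in> borel_measurable borel" "H \<in> borel_measurable borel" using G by (auto simp: L2c_def)
    then show ?thesis
      by (intro borel_measurable_diff borel_measurable_times borel_measurable_continuous_onI[OF c(1)]
          borel_measurable_continuous_onI[OF c(2)])
  qed
  have si: "set_integrable lborel {x..} (\<lambda>x. G x * h x - H x * f x)" for x
  proof (rule set_integrable_bound[OF wi[of x 1]])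
    show "set_borel_measurable lborel {x..} (\<lambda>x. G x * h x - H x * f x)"
      unfolding set_borel_measurable_def using m by measurable
    show "AE y in lborel. y \<in> {x..} \<longrightarrow> norm (G y * h y - H y * f y) \<le> norm (1 / 2 * nsq G H y + 1 / (2 * 1) * nsq f h y)"
    proof (intro AE_I2 impI)
      fix y
      show "norm (G y * h y - H y * f y) \<le> norm (1 / 2 * nsq G H y + 1 / (2 * 1) * nsq f h y)"
        using order_trans[OF le[OF zero_less_one, of y] abs_ge_self] by (simp only: real_norm_def)
    qed
  qed
  then show "tail_int (\<lambda>x. G x * h x - H x * f x)" by (simp add: tail_int_def)
  have nn: "tail (nsq a b) x \<ge> 0" for a b
    unfolding tail_def set_lebesgue_integral_def by (intro Bochner_Integration.integral_nonneg) (auto simp: nsq_nonneg)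
  show "(cmod (tail (\<lambda>x. G x * h x - H x * f x) x))\<^sup>2 \<le> tail (nsq G H) x * tail (nsq f h) x"
  proof (rule square_le_of_quadratic)
    fix t :: real assume t: "t > 0"
    have "cmod (tail (\<lambda>x. G x * h x - H x * f x) x) \<le> tail (\<lambda>y. t / 2 * nsq G H y + 1 / (2 * t) * nsq f h y) x"
      by (rule tail_bound[OF si wi le[OF t]])
    also have "\<dots> = (t * tail (nsq G H) x + tail (nsq f h) x / t) / 2"
      unfolding tail_def
      by (subst set_integral_add(2)) (auto intro!: set_integrable_scale(1) tail_nsq_L2c[OF G] Ni simp: field_simps)
    finally show "2 * cmod (tail (\<lambda>x. G x * h x - H x * f x) x) \<le> t * tail (nsq G H) x + tail (nsq f h) x / t" by simp
  qed (use nn in auto)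
qed

section \<open>The decaying solution and solvability on a half-line\<close>

context jost begin

definition fp where "fp z x = exp (- Om z x) * P z x"
definition hp where "hp z x = exp (- Om z x) * K z x"

lemma W_cont: "continuous_on S (\<lambda>x. of_real (V x) - z :: complex)"
  by (intro continuous_intros continuous_on_subset[OF V_cont]) auto

lemma Om_ac: "ac (\<lambda>x. exp (- Om z x)) (\<lambda>x. - (of_real (V x) - z) * exp (- Om z x))"
proof (rule ac_C1)
  fix x
  have "((\<lambda>x. of_real (om x) - z * of_real x) has_vector_derivative of_real (V x) - z * of_real 1) (at x)"
    by (intro has_vector_derivative_diff has_vector_derivative_mult_right has_vector_derivative_of_real DERIV_ident
        om(1)[folded has_real_derivative_iff_has_vector_derivative])
  then have 1: "((\<lambda>x. - Om z x) has_vector_derivative - (of_real (V x) - z)) (at x)"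
    unfolding Om_def by (intro has_vector_derivative_minus) simp
  show "((\<lambda>x. exp (- Om z x)) has_vector_derivative - (of_real (V x) - z) * exp (- Om z x)) (at x)"
    using field_vector_diff_chain_at[OF 1 DERIV_exp] by (simp add: o_def)
  show "continuous_on UNIV (\<lambda>x. - (of_real (V x) - z) * exp (- Om z x))"
    unfolding Om_def by (intro continuous_intros om_cont V_cont)
qed

lemma jost_sol: "sol m (\<lambda>x. of_real (V x) - z) (fp z) (hp z) (\<lambda>x. 0) (\<lambda>x. 0)"
  unfolding sol_def
proof
  show "ac (fp z) (\<lambda>x. (of_real (V x) - z) * fp z x + of_real m * hp z x + 0)"
    by (rule ac_cong[OF ac_mult[OF Om_ac[of z] P_ac[of z]]]) (auto simp: fp_def hp_def algebra_simps)
  show "ac (hp z) (\<lambda>x. of_real m * fp z x - (of_real (V x) - z) * hp z x + 0)"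
    by (rule ac_cong[OF ac_mult[OF Om_ac[of z] K_ac[of z]]]) (auto simp: fp_def hp_def algebra_simps)
qed

lemma jost_0: "fp z 0 = P z 0" "hp z 0 = K z 0"
  by (auto simp: fp_def hp_def Om_def om(3))

lemma jost_cont: "continuous_on S (fp z)" "continuous_on S (hp z)"
  using sol_cont[OF jost_sol] by auto

lemma jost_nonzero: "nsq (fp z) (hp z) x \<noteq> 0"
proof
  assume "nsq (fp z) (hp z) x = 0"
  then have "fp z x = 0" "hp z x = 0" by (auto simp: nsq_def sum_power2_eq_zero_iff)
  then have "hp z y = 0" for y
    using sol_zero[OF jost_sol _ W_cont] m by (metis less_imp_le)
  then have "K z = (\<lambda>y. 0)" by (auto simp: hp_def)
  then have "((\<lambda>y::real. 0) \<longlongrightarrow> (1::complex)) at_top" using K_lim[of z] by simp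
  then show False by (simp add: tendsto_const_iff)
qed

lemma jost_nsq: "nsq (fp z) (hp z) x = exp (- 2 * omr (Re z) x) * ((cmod (P z x))\<^sup>2 + (cmod (K z x))\<^sup>2)"
  by (simp add: nsq_def fp_def hp_def norm_mult Re_Om power_mult_distrib exp_double[symmetric] algebra_simps)

lemma jost_bound:
  assumes "Re z \<le> r" "x \<ge> 0"
  shows "nsq (fp z) (hp z) x \<le> exp (- 2 * omr r x) * ((m * Th r x * exp (b r x))\<^sup>2 + (exp (b r x))\<^sup>2)"
proof -
  have "omr r x - omr r 0 \<le> omr (Re z) x - omr (Re z) 0" by (rule omr_antimono_r) (use assms in auto)
  then have "omr r x \<le> omr (Re z) x" by (simp add: omr_def)
  moreover have "(cmod (P z x))\<^sup>2 \<le> (m * Th r x * exp (b r x))\<^sup>2" by (intro power_mono P_bound assms) auto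
  moreover have "(cmod (K z x))\<^sup>2 \<le> (exp (b r x))\<^sup>2" by (intro power_mono K_sub_partial assms) auto
  ultimately show ?thesis unfolding jost_nsq by (intro mult_mono add_mono) auto
qed

text \<open>The thresholds serve the later comparison with the decaying solution:
  \<open>1 / 2\<close> and \<open>1 / 8\<close> give \<open>cmod f \<le> cmod h / 4\<close> up to a
  constant, and \<open>2\<close> enters the decay estimate.\<close>

lemma far: "\<exists>X\<ge>x1. X \<ge> 0 \<and> (\<forall>x\<ge>X. V x \<ge> A \<and> cmod (P z x) \<le> 1 / 8 \<and> cmod (K z x) \<ge> 1 / 2 \<and> cmod (K z x) \<le> 2)"
proof -
  obtain X1 where X1: "X1 \<ge> x1" "\<forall>x\<ge>X1. V x \<ge> A" using V_unbounded by blast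
  have "eventually (\<lambda>x. cmod (P z x) < 1 / 8) at_top" using tendstoD[OF P_lim[of z], of "1/8"] by simp
  then obtain X2 where X2: "\<And>x. x \<ge> X2 \<Longrightarrow> cmod (P z x) < 1 / 8" by (auto simp: eventually_at_top_linorder)
  have "eventually (\<lambda>x. dist (K z x) 1 < 1 / 2) at_top" using tendstoD[OF K_lim[of z], of "1/2"] by simp
  then obtain X3 where X3: "\<And>x. x \<ge> X3 \<Longrightarrow> dist (K z x) 1 < 1 / 2" by (auto simp: eventually_at_top_linorder)
  have K: "cmod (K z x) \<ge> 1 / 2 \<and> cmod (K z x) \<le> 2" if "x \<ge> X3" for x
    using X3[OF that] norm_triangle_ineq2[of 1 "1 - K z x"] norm_triangle_ineq2[of "K z x" 1]
    by (simp add: dist_norm norm_minus_commute)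
  show ?thesis
    by (rule exI[of _ "max (max X1 X2) (max X3 0)"]) (use X1 X2 K in \<open>auto intro: less_imp_le\<close>)
qed

lemma jost_decay:
  assumes X: "\<And>x. x \<ge> X \<Longrightarrow> V x \<ge> Re z + 1" "\<And>x. x \<ge> X \<Longrightarrow> cmod (P z x) \<le> 1 / 8" "\<And>x. x \<ge> X \<Longrightarrow> cmod (K z x) \<le> 2"
    and x: "X \<le> x" "x \<le> y"
  shows "nsq (fp z) (hp z) y \<le> exp (- 2 * omr (Re z) x) * 5 * exp (- 2 * (y - x))"
proof -
  have "omr (Re z) y - omr (Re z) x \<ge> 1 * (y - x)" by (rule omr_lower) (use X x in auto)
  then have "exp (- 2 * omr (Re z) y) \<le> exp (- 2 * omr (Re z) x) * exp (- 2 * (y - x))"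
    by (simp flip: exp_add)
  moreover have "(cmod (P z y))\<^sup>2 + (cmod (K z y))\<^sup>2 \<le> 5"
  proof -
    have "(cmod (P z y))\<^sup>2 \<le> (1/8)\<^sup>2" using X(2)[of y] x by (intro power_mono) auto
    moreover have "(cmod (K z y))\<^sup>2 \<le> 2\<^sup>2" using X(3)[of y] x by (intro power_mono) auto
    ultimately show ?thesis by (simp add: power2_eq_square)
  qed
  ultimately have "exp (- 2 * omr (Re z) y) * ((cmod (P z y))\<^sup>2 + (cmod (K z y))\<^sup>2)
    \<le> (exp (- 2 * omr (Re z) x) * exp (- 2 * (y - x))) * 5" by (intro mult_mono) auto
  then show ?thesis by (simp add: jost_nsq mult_ac)
qed

lemma jost_tail_int: "tail_int (nsq (fp z) (hp z))"
proof -
  obtain X where X: "X \<ge> x1" "\<forall>x\<ge>X. V x \<ge> Re z + 1 \<and> cmod (P z x) \<le> 1 / 8 \<and> cmod (K z x) \<ge> 1 / 2 \<and> cmod (K z x) \<le> 2"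
    using far by blast
  show ?thesis
  proof (rule tail_int_bound[OF nsq_cont[OF jost_cont]])
    show "set_integrable lborel {X..} (\<lambda>y. exp (- 2 * omr (Re z) X) * 5 * exp (- 2 * (y - X)))"
      by (rule set_integrable_scale(1)[OF exp_tail(1)]) simp
    fix y assume "y \<ge> X"
    then show "norm (nsq (fp z) (hp z) y) \<le> exp (- 2 * omr (Re z) X) * 5 * exp (- 2 * (y - X))"
      using jost_decay[of X z X y] X(2) nsq_nonneg[of "fp z" "hp z" y] by auto
  qed
qed

text \<open>The Wronskian with the decaying solution is dominated by an integrable function, so its
  limit along suitable points is zero and its value at \<open>0\<close> is minus the integral of its
  derivative. This is the necessary condition for square integrability;
  \<open>half_line_square_integrable\<close> is the converse.\<close>

lemma half_line_pairing:
  assumes s: "sol m (\<lambda>x. of_real (V x) - z) f h G H" and G: "L2c G" "L2c H" and N: "tail_int (nsq f h)"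
  shows "f 0 * hp z 0 - h 0 * fp z 0 = - tail (\<lambda>x. G x * hp z x - H x * fp z x) 0"
proof (rule tail_limit[OF sol_wedge[OF s jost_sol]])
  show "tail_int (\<lambda>x. G x * hp z x - H x * fp z x)"
    by (rule tail_pairing(1)[OF G jost_cont jost_tail_int])
  show "tail_int (\<lambda>x. nsq f h x + nsq (fp z) (hp z) x)"
    using N jost_tail_int[of z] unfolding tail_int_def by (auto intro: set_integral_add(1))
  fix x
  show "cmod (f x * hp z x - h x * fp z x) \<le> nsq f h x + nsq (fp z) (hp z) x"
  proof -
    have "2 * cmod (f x * hp z x - h x * fp z x) \<le> nsq f h x + nsq (fp z) (hp z) x"
      using pairing_le[of 1 "f x" "hp z x" "h x" "fp z x"] by (simp add: nsq_def)
    then show ?thesis using nsq_nonneg[of f h x] nsq_nonneg[of "fp z" "hp z" x] norm_ge_zero[of "f x * hp z x - h x * fp z x"] by linarith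
  qed
qed

text \<open>The pairing condition keeps \<open>f\<close> dominated by \<open>h\<close> far out; then the indefinite energy
  \<open>\<bar>f\<bar>\<^sup>2 - \<bar>h\<bar>\<^sup>2\<close> is bounded above, while its derivative controls \<open>\<bar>f\<bar>\<^sup>2 + \<bar>h\<bar>\<^sup>2\<close>.\<close>

lemma half_line_square_integrable:
  assumes s: "sol m (\<lambda>x. of_real (V x) - z) f h G H" and G: "L2c G" "L2c H"
    and c0: "f 0 * hp z 0 - h 0 * fp z 0 = - tail (\<lambda>x. G x * hp z x - H x * fp z x) 0"
  shows "tail_int (nsq f h)"
proof -
  let ?d = "\<lambda>x. G x * hp z x - H x * fp z x"
  obtain X where X: "X \<ge> x1" "\<forall>x\<ge>X. V x \<ge> Re z + 1 \<and> cmod (P z x) \<le> 1 / 8 \<and> cmod (K z x) \<ge> 1 / 2 \<and> cmod (K z x) \<le> 2"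
    using far by blast
  have ti: "tail_int ?d" by (rule tail_pairing(1)[OF G jost_cont jost_tail_int])
  have a: "ac (\<lambda>x. (f x * hp z x - h x * fp z x) + tail ?d x) (\<lambda>x. 0)"
    using ac_add[OF sol_wedge[OF s jost_sol] tail_ac[OF ti]] by simp
  have w: "f x * hp z x - h x * fp z x = - tail ?d x" for x
  proof -
    have "(f x * hp z x - h x * fp z x) + tail ?d x = (f 0 * hp z 0 - h 0 * fp z 0) + tail ?d 0"
      using ac_integral[OF a, of 0 x] ac_integral[OF a, of x 0] by (cases "0 \<le> x") auto
    then show ?thesis unfolding c0 by (simp add: eq_neg_iff_add_eq_0)
  qed
  define S where "S = integral\<^sup>L lborel (nsq G H)"
  have S0: "S \<ge> 0" unfolding S_def by (intro Bochner_Integration.integral_nonneg nsq_nonneg)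
  \<comment> \<open>From Cauchy-Schwarz for the tail of the Wronskian: \<open>S\<close> bounds the
    sources, and \<open>5 / 2\<close> is the integral of the majorant
    \<open>5 * exp (- 2 * (y - x))\<close> of the decaying solution, with the weight at
    \<open>x\<close> taken out.\<close>
  define C where "C = sqrt (S * (5 / 2))"
  have C0: "C \<ge> 0" using S0 by (simp add: C_def)
  have dom: "cmod (f x) \<le> cmod (h x) / 4 + 2 * C" if x: "x \<ge> X" for x
  proof -
    have "tail (nsq G H) x \<le> S"
      unfolding tail_def set_lebesgue_integral_def S_def
      by (rule integral_mono[OF _ L2c_nsq[OF G]])
        (use tail_nsq_L2c[OF G, of x] in \<open>auto simp: set_integrable_def indicator_def nsq_nonneg\<close>)
    moreover have "tail (nsq (fp z) (hp z)) x \<le> exp (- 2 * omr (Re z) x) * (5 / 2)"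
    proof -
      have "norm (tail (nsq (fp z) (hp z)) x) \<le> tail (\<lambda>y. exp (- 2 * omr (Re z) x) * 5 * exp (- 2 * (y - x))) x"
      proof (rule tail_bound)
        show "set_integrable lborel {x..} (nsq (fp z) (hp z))" using jost_tail_int by (simp add: tail_int_def)
        show "set_integrable lborel {x..} (\<lambda>y. exp (- 2 * omr (Re z) x) * 5 * exp (- 2 * (y - x)))"
          by (rule set_integrable_scale(1)[OF exp_tail(1)]) simp
        fix y assume "y \<ge> x"
        then show "norm (nsq (fp z) (hp z) y) \<le> exp (- 2 * omr (Re z) x) * 5 * exp (- 2 * (y - x))"
          using jost_decay[of X z x y] X(2) nsq_nonneg[of "fp z" "hp z" y] x by auto
      qed
      also have "\<dots> = exp (- 2 * omr (Re z) x) * 5 * tail (\<lambda>y. exp (- 2 * (y - x))) x" by (simp add: tail_def)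
      also have "\<dots> = exp (- 2 * omr (Re z) x) * (5 / 2)" using exp_tail(2)[of 2 x] by simp
      finally show ?thesis by simp
    qed
    moreover have "(cmod (tail ?d x))\<^sup>2 \<le> tail (nsq G H) x * tail (nsq (fp z) (hp z)) x"
      by (rule tail_pairing(2)[OF G jost_cont jost_tail_int])
    moreover have "tail (nsq (fp z) (hp z)) x \<ge> 0"
      unfolding tail_def set_lebesgue_integral_def by (intro Bochner_Integration.integral_nonneg) (auto simp: nsq_nonneg)
    ultimately have "(cmod (tail ?d x))\<^sup>2 \<le> S * (exp (- 2 * omr (Re z) x) * (5 / 2))"
      using S0 by (meson mult_mono order_trans)
    also have "\<dots> = (exp (- omr (Re z) x) * C)\<^sup>2"
      using S0 by (simp add: C_def power_mult_distrib exp_double[symmetric])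
    finally have t: "cmod (tail ?d x) \<le> exp (- omr (Re z) x) * C"
      by (rule power2_le_imp_le) (use C0 in simp)
    have "exp (- Om z x) * (f x * K z x - h x * P z x) = - tail ?d x"
      using w[of x] by (simp add: fp_def hp_def algebra_simps)
    then have "exp (- omr (Re z) x) * cmod (f x * K z x - h x * P z x) = cmod (tail ?d x)"
      by (metis Re_Om norm_exp_eq_Re norm_minus_cancel norm_mult uminus_complex.sel(1))
    then have "exp (- omr (Re z) x) * cmod (f x * K z x - h x * P z x) \<le> exp (- omr (Re z) x) * C" using t by simp
    then have fk: "cmod (f x * K z x - h x * P z x) \<le> C" by simp
    have "cmod (f x) * (1 / 2) \<le> cmod (f x) * cmod (K z x)" using X(2) x by (intro mult_left_mono) auto
    also have "\<dots> \<le> cmod (f x * K z x - h x * P z x) + cmod (h x * P z x)"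
      using norm_triangle_ineq[of "f x * K z x - h x * P z x" "h x * P z x"] by (simp add: norm_mult)
    also have "\<dots> \<le> C + cmod (h x) * (1 / 8)"
      unfolding norm_mult using X(2) x fk by (intro add_mono mult_left_mono) auto
    finally show ?thesis by simp
  qed
  \<comment> \<open>Squaring the comparison costs a factor \<open>2\<close>; as
    \<open>2 * (1/4)\<^sup>2 < 1\<close>, the contribution of \<open>h\<close> is absorbed by the
    negative term.\<close>
  have E: "(cmod (f x))\<^sup>2 - (cmod (h x))\<^sup>2 \<le> 8 * C\<^sup>2" if "x \<ge> X" for x
  proof -
    have "(cmod (f x))\<^sup>2 \<le> (cmod (h x) / 4 + 2 * C)\<^sup>2" using dom[OF that] by (intro power_mono) auto
    also have "\<dots> \<le> 2 * (cmod (h x) / 4)\<^sup>2 + 2 * (2 * C)\<^sup>2"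
      using sum_squares_bound[of "cmod (h x) / 4" "2 * C"] by (simp add: power2_sum)
    also have "\<dots> \<le> (cmod (h x))\<^sup>2 + 8 * C\<^sup>2" by (simp add: power_divide)
    finally show ?thesis by simp
  qed
  show ?thesis
  proof (rule tail_int_of_bounded[OF nsq_cont[OF sol_cont[OF s]] nsq_nonneg])
    fix x assume x: "x \<ge> X"
    have en: "ac (\<lambda>x. (cmod (f x))\<^sup>2 - (cmod (h x))\<^sup>2)
      (\<lambda>x. 2 * Re (of_real (V x) - z) * nsq f h x + 2 * Re (G x * cnj (f x) - H x * cnj (h x)))"
      by (rule sol_energy[OF s])
    have iN: "nsq f h integrable_on {X..x}"
      by (rule integrable_continuous_real[OF nsq_cont[OF sol_cont[OF s]]])
    have iS: "nsq G H integrable_on {X..x}" by (rule integrable_interval[OF L2c_nsq[OF G]])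
    \<comment> \<open>Beyond \<open>X\<close> the derivative of the energy contains at least
      \<open>2 * nsq f h\<close>; splitting the source products gives back one of the two.\<close>
    have "integral {X..x} (\<lambda>y. nsq f h y - nsq G H y) \<le>
      ((cmod (f x))\<^sup>2 - (cmod (h x))\<^sup>2) - ((cmod (f X))\<^sup>2 - (cmod (h X))\<^sup>2)"
    proof (rule has_integral_le[OF integrable_integral[OF integrable_diff[OF iN iS]] ac_has[OF en x]])
      fix y assume "y \<in> {X..x}"
      then have "Re (of_real (V y) - z) \<ge> 1" using X(2) by force
      then have "2 * Re (of_real (V y) - z) * nsq f h y \<ge> 2 * 1 * nsq f h y"
        by (intro mult_right_mono mult_left_mono nsq_nonneg) auto
      then show "nsq f h y - nsq G H y \<le> 2 * Re (of_real (V y) - z) * nsq f h y + 2 * Re (G y * cnj (f y) - H y * cnj (h y))"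
        using two_Re_le[of "G y" "f y"] two_Re_le[of "H y" "h y"] by (simp add: nsq_def del: times_complex.sel cnj.sel)
    qed
    then have "integral {X..x} (nsq f h) - integral {X..x} (nsq G H) \<le>
      ((cmod (f x))\<^sup>2 - (cmod (h x))\<^sup>2) - ((cmod (f X))\<^sup>2 - (cmod (h X))\<^sup>2)"
      by (simp add: Henstock_Kurzweil_Integration.integral_diff[OF iN iS])
    moreover have "integral {X..x} (nsq G H) \<le> S" unfolding S_def
      by (rule integral_interval_le[OF L2c_nsq[OF G] nsq_nonneg])
    ultimately show "integral {X..x} (nsq f h) \<le> 8 * C\<^sup>2 - ((cmod (f X))\<^sup>2 - (cmod (h X))\<^sup>2) + S"
      using E[OF x] by linarith
  qed
qed

section \<open>Growth in the spectral parameter\<close>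

definition \<rho> where "\<rho> = 1 + 1 / \<gamma>"

lemma rho: "1 < \<rho>" "\<rho> < 2"
  using gam by (auto simp: \<rho>_def)

text \<open>The cut \<open>L\<close> is where \<open>V\<close> reaches twice the spectral parameter; \<open>V \<ge> c x\<^sup>\<gamma>\<close> bounds it.\<close>

lemma cut:
  "\<exists>C>0. \<forall>z. \<exists>L\<ge>x1. L \<le> C * (1 + cmod z) powr (1 / \<gamma>) \<and> (\<forall>x\<ge>L. V x \<ge> 2 * (cmod z + 1)) \<and>
    (\<forall>x\<in>{0..L}. \<bar>V x\<bar> \<le> C * (1 + cmod z))"
proof -
  have "compact ((\<lambda>x. \<bar>V x\<bar>) ` {0..x1})"
    by (intro compact_continuous_image continuous_intros continuous_on_subset[OF V_cont]) auto
  from compact_imp_bounded[OF this] obtain B where "\<forall>y\<in>(\<lambda>x. \<bar>V x\<bar>) ` {0..x1}. norm y \<le> B"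
    unfolding bounded_iff by blast
  then have B: "\<bar>V x\<bar> \<le> B" if "x \<in> {0..x1}" for x using that by force
  have x10: "x1 \<in> {0..x1}" using x1 by auto
  have B0: "B \<ge> 0" using B[OF x10] by linarith
  \<comment> \<open>One summand for each demand: \<open>x1\<close> when the cut is \<open>x1\<close>
    itself, \<open>(2 / c) powr (1 / \<gamma>)\<close> from
    \<open>c * L powr \<gamma> \<le> 2 * (cmod z + 1)\<close>, \<open>2\<close> for the values of
    \<open>V\<close> between \<open>x1\<close> and \<open>L\<close>, and \<open>B\<close> for those
    on \<open>{0..x1}\<close>.\<close>
  define C where "C = x1 + (2 / c) powr (1 / \<gamma>) + 2 + B"
  have c2: "(2 / c) powr (1 / \<gamma>) \<ge> 0" by simp
  have C: "C > 0" unfolding C_def using x1 B0 c2 by linarith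
  have "\<exists>L\<ge>x1. L \<le> C * (1 + cmod z) powr (1 / \<gamma>) \<and> (\<forall>x\<ge>L. V x \<ge> 2 * (cmod z + 1)) \<and>
    (\<forall>x\<in>{0..L}. \<bar>V x\<bar> \<le> C * (1 + cmod z))" for z :: complex
  proof -
    let ?t = "2 * (cmod z + 1)"
    have p1: "(1 + cmod z) powr (1 / \<gamma>) \<ge> 1" using gam by (intro ge_one_powr_ge_zero) auto
    have Vpos: "V x \<ge> 0" if "x \<ge> x1" for x
      using V_lower[OF that] c by (meson mult_nonneg_nonneg order_trans less_imp_le powr_ge_zero)
    have inner: "\<bar>V x\<bar> \<le> C * (1 + cmod z)" if "x \<in> {0..x1}" for x
    proof -
      have "\<bar>V x\<bar> \<le> C" unfolding C_def using B[OF that] x1 c2 by linarith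
      also have "C = C * 1" by simp
      also have "\<dots> \<le> C * (1 + cmod z)" using C by (intro mult_left_mono) auto
      finally show ?thesis .
    qed
    show ?thesis
    proof (cases "V x1 \<ge> ?t")
      case True
      have "x1 * 1 \<le> C * (1 + cmod z) powr (1 / \<gamma>)"
        using p1 x1 B0 c2 C by (intro mult_mono) (auto simp: C_def)
      then show ?thesis using True V_mono[of x1] inner by (intro exI[of _ x1]) (force intro: order_trans)
    next
      case False
      obtain X where X: "X \<ge> x1" "\<And>x. x \<ge> X \<Longrightarrow> V x \<ge> ?t" using V_unbounded by blast
      obtain L where L: "L \<ge> x1" "L \<le> X" "V L = ?t"
        using IVT'[of V x1 ?t X] False X continuous_on_subset[OF V_cont, of "{x1..X}"] by auto
      have L0: "L > 0" using L(1) x1 by simp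
      have "c * L powr \<gamma> \<le> ?t" using V_lower[OF L(1)] L(3) by simp
      then have "L powr \<gamma> \<le> (2 / c) * (1 + cmod z)" using c by (simp add: field_simps)
      then have "(L powr \<gamma>) powr (1 / \<gamma>) \<le> ((2 / c) * (1 + cmod z)) powr (1 / \<gamma>)"
        using gam by (intro powr_mono2) auto
      then have "L \<le> (2 / c) powr (1 / \<gamma>) * (1 + cmod z) powr (1 / \<gamma>)"
      proof -
        have "((2 / c) * (1 + cmod z)) powr (1 / \<gamma>) = (2 / c) powr (1 / \<gamma>) * (1 + cmod z) powr (1 / \<gamma>)"
          by (simp only: powr_mult)
        moreover have "(L powr \<gamma>) powr (1 / \<gamma>) = L" using gam L0 by (simp add: powr_powr)
        ultimately show ?thesis using \<open>(L powr \<gamma>) powr (1 / \<gamma>) \<le> ((2 / c) * (1 + cmod z)) powr (1 / \<gamma>)\<close> by (simp only:)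
      qed
      also have "\<dots> \<le> C * (1 + cmod z) powr (1 / \<gamma>)"
        using x1 B0 by (intro mult_right_mono) (auto simp: C_def)
      finally have l1: "L \<le> C * (1 + cmod z) powr (1 / \<gamma>)" .
      have "\<bar>V x\<bar> \<le> C * (1 + cmod z)" if "x \<in> {0..L}" for x
      proof (cases "x \<le> x1")
        case True then show ?thesis using inner that by auto
      next
        case False
        then have "V x \<le> ?t" using V_mono[of x L] L that by auto
        also have "?t \<le> C * (1 + cmod z)"
        proof -
          have "2 * (1 + cmod z) \<le> C * (1 + cmod z)" using x1 B0 c2 by (intro mult_right_mono) (auto simp: C_def)
          then show ?thesis by simp
        qed
        finally show ?thesis using Vpos[of x] False by simp
      qed
      moreover have "\<forall>x\<ge>L. V x \<ge> ?t" using V_mono[OF L(1)] L(3) by auto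
      ultimately show ?thesis using L(1) l1 by (intro exI[of _ L]) auto
    qed
  qed
  then show ?thesis using C by blast
qed

lemma rho_combine: "(1 + cmod z) * (1 + cmod z) powr (1 / \<gamma>) = (1 + cmod z) powr \<rho>" "1 + cmod z \<le> (1 + cmod z) powr \<rho>"
proof -
  have "1 + cmod z = (1 + cmod z) powr 1" by simp
  then show "(1 + cmod z) * (1 + cmod z) powr (1 / \<gamma>) = (1 + cmod z) powr \<rho>"
    unfolding \<rho>_def powr_add by simp
  have "(1 + cmod z) powr 1 \<le> (1 + cmod z) powr \<rho>" using rho by (intro powr_mono) auto
  then show "1 + cmod z \<le> (1 + cmod z) powr \<rho>" by simp
qed

text \<open>Beyond the cut \<open>L\<close> the series bounds are uniform in \<open>z\<close> and
  the solution decays like \<open>exp (- 2 * (x - L))\<close> times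
  \<open>exp (- 2 * omr (cmod z) L)\<close>. That weight costs an exponent of order
  \<open>L * (1 + cmod z)\<close>. On \<open>{0..L}\<close> Gronwall, run backwards, costs a rate of
  order \<open>1 + cmod z\<close> over a length \<open>L\<close>. Both are of order
  \<open>(1 + cmod z) powr \<rho>\<close>, by the bound on \<open>L\<close>.\<close>

lemma jost_growth:
  "\<exists>C>0. \<forall>z. nsq (fp z) (hp z) 0 \<le> exp (C * (1 + cmod z) powr \<rho>) \<and>
    tail (nsq (fp z) (hp z)) 0 \<le> exp (C * (1 + cmod z) powr \<rho>)"
proof -
  obtain C where C: "C > 0" and cutz: "\<And>z. \<exists>L\<ge>x1. L \<le> C * (1 + cmod z) powr (1 / \<gamma>) \<and>
    (\<forall>x\<ge>L. V x \<ge> 2 * (cmod z + 1)) \<and> (\<forall>x\<in>{0..L}. \<bar>V x\<bar> \<le> C * (1 + cmod z))"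
    using cut by blast
  define b0 where "b0 = m\<^sup>2 / (c * (\<gamma> - 1))"
  have b00: "b0 \<ge> 0" using c gam by (simp add: b0_def)
  define K0 where "K0 = (m * exp b0)\<^sup>2 + (exp b0)\<^sup>2"
  have K0: "K0 > 0" by (simp add: K0_def add_nonneg_pos)
  \<comment> \<open>The three summands come from the weight at the cut, from Gronwall on
    \<open>{0..L}\<close>, and from the constant \<open>K0\<close>, whose logarithm is absorbed
    because \<open>(1 + cmod z) powr \<rho> \<ge> 1\<close>.\<close>
  define C1 where "C1 = 2 * (C * (C + 1)) + C * (2 * (C + 1 + m) + 1) + \<bar>ln K0\<bar>"
  have C1: "C1 \<ge> 0" using C m by (simp add: C1_def)
  have main: "(nsq (fp z) (hp z) x \<le> exp (C1 * (1 + cmod z) powr \<rho>) * exp (- 2 * (x - L)) \<and> x \<ge> L) \<or>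
     (x \<le> L \<and> nsq (fp z) (hp z) x \<le> exp (C1 * (1 + cmod z) powr \<rho>))"
    if L: "L \<ge> x1" "L \<le> C * (1 + cmod z) powr (1 / \<gamma>)" "\<And>x. x \<ge> L \<Longrightarrow> V x \<ge> 2 * (cmod z + 1)"
      "\<And>x. x \<in> {0..L} \<Longrightarrow> \<bar>V x\<bar> \<le> C * (1 + cmod z)" and x: "x \<ge> 0" for z L x
  proof -
    let ?r = "cmod z" and ?R = "1 + cmod z"
    let ?p = "?R powr \<rho>"
    have L0: "L \<ge> 1" using L(1) x1 by simp
    have LR: "L * ?R \<le> C * ?p"
    proof -
      have "?R * L \<le> ?R * (C * ?R powr (1 / \<gamma>))" using L(2) by (intro mult_left_mono) auto
      also have "\<dots> = C * ?p" using rho_combine(1)[of z] by (simp add: mult_ac)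
      finally show ?thesis by (simp add: mult.commute)
    qed
    have p1: "?p \<ge> 1" using rho by (intro ge_one_powr_ge_zero) auto
    have out: "nsq (fp z) (hp z) y \<le> exp (2 * (C * (C + 1)) * ?p) * K0 * exp (- 2 * (y - L))" if y: "y \<ge> L" for y
    proof -
      have Vy: "V y \<ge> 2 * ?r + 2" using L(3)[OF y] by simp
      have V1: "V y \<ge> 1" using Vy norm_ge_zero[of z] by linarith
      have V: "V y \<ge> 2 * ?r \<and> V y \<ge> 1 \<and> V y > 0" using Vy V1 by auto
      have yx: "y \<ge> x1" using y L(1) by simp
      have bb: "b ?r y \<le> b0" unfolding b0_def 
      proof (rule b_le[OF yx])
        fix t assume "y \<le> t"
        then show "V t \<ge> 2 * ?r" using L(3)[of t] y by simp
      qed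
      have "Th ?r y \<le> 1 / V y" by (rule Th_le[OF yx]) (use V in auto)
      also have "\<dots> \<le> 1" using V by simp
      finally have th: "Th ?r y \<le> 1" .
      have "m * Th ?r y * exp (b ?r y) \<le> m * 1 * exp b0"
        using m th bb Th_nonneg by (intro mult_mono) auto
      then have a: "(m * Th ?r y * exp (b ?r y))\<^sup>2 + (exp (b ?r y))\<^sup>2 \<le> K0"
        unfolding K0_def using m Th_nonneg bb by (intro add_mono power_mono) auto
      have "omr ?r y - omr ?r L \<ge> 1 * (y - L)"
        by (rule omr_lower[OF y]) (use L(3) norm_ge_zero[of z] in \<open>smt (verit)\<close>)
      moreover have "omr ?r L \<ge> - (C * (C + 1)) * ?p"
      proof -
        have "omr ?r L - omr ?r 0 \<ge> (- (C + 1) * ?R) * (L - 0)"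
        proof (rule omr_lower)
          fix t assume "0 \<le> t" "t \<le> L"
          then have "\<bar>V t\<bar> \<le> C * ?R" using L(4) by auto
          then show "V t \<ge> ?r + - (C + 1) * ?R" by (simp add: algebra_simps)
        qed (use L0 in simp)
        moreover have "(C + 1) * (L * ?R) \<le> (C + 1) * (C * ?p)" using LR C by (intro mult_left_mono) auto
        ultimately show ?thesis by (simp add: omr_def om(3) algebra_simps)
      qed
      ultimately have "exp (- 2 * omr ?r y) \<le> exp (2 * (C * (C + 1)) * ?p) * exp (- 2 * (y - L))"
        by (simp flip: exp_add)
      then have "exp (- 2 * omr ?r y) * ((m * Th ?r y * exp (b ?r y))\<^sup>2 + (exp (b ?r y))\<^sup>2)
        \<le> (exp (2 * (C * (C + 1)) * ?p) * exp (- 2 * (y - L))) * K0"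
        using a by (intro mult_mono) auto
      then show ?thesis using jost_bound[of z ?r y] complex_Re_le_cmod[of z] y L0
        by (simp add: mult_ac)
    qed
    have lnK: "K0 \<le> exp (\<bar>ln K0\<bar> * ?p)"
    proof -
      have "\<bar>ln K0\<bar> * 1 \<le> \<bar>ln K0\<bar> * ?p" using p1 by (intro mult_left_mono) auto
      then have "exp (ln K0) \<le> exp (\<bar>ln K0\<bar> * ?p)" by simp
      then show ?thesis using K0 by simp
    qed
    show ?thesis
    proof (cases "x \<ge> L")
      case True
      have "exp (2 * (C * (C + 1)) * ?p) * K0 \<le> exp (2 * (C * (C + 1)) * ?p) * exp (\<bar>ln K0\<bar> * ?p)"
        using lnK by (intro mult_left_mono) auto
      also have "\<dots> \<le> exp (C1 * ?p)"
      proof -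
        have "(2 * (C * (C + 1)) + \<bar>ln K0\<bar>) * ?p \<le> C1 * ?p"
          using C m by (intro mult_right_mono) (auto simp: C1_def)
        then show ?thesis by (simp add: distrib_right flip: exp_add)
      qed
      finally have "exp (2 * (C * (C + 1)) * ?p) * K0 * exp (- 2 * (x - L)) \<le> exp (C1 * ?p) * exp (- 2 * (x - L))"
        by (intro mult_right_mono) auto
      then show ?thesis using out[OF True] True by linarith
    next
      case False
      let ?k = "(2 * (C + 1 + m) + 1) * ?R"
      have z0: "nsq (\<lambda>x. 0) (\<lambda>x. 0) = (\<lambda>x. 0)" by (auto simp: nsq_def)
      have "nsq (fp z) (hp z) x \<le> exp (?k * (L - x)) * (nsq (fp z) (hp z) L + integral\<^sup>L lborel (nsq (\<lambda>x. 0) (\<lambda>x. 0)))"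
      proof (rule sol_gronwall(2)[OF jost_sol])
        fix t assume t: "x \<le> t" "t \<le> L"
        have "cmod (of_real (V t) - z) \<le> \<bar>V t\<bar> + cmod z"
          using norm_triangle_ineq4[of "of_real (V t)" z] by simp
        also have "\<dots> \<le> C * ?R + ?R" using L(4)[of t] t x by auto
        finally have "2 * (cmod (of_real (V t) - z) + m) + 1 \<le> 2 * (C * ?R + ?R + m * 1) + 1" by simp
        also have "\<dots> \<le> 2 * (C * ?R + ?R + m * ?R) + ?R" using mult_nonneg_nonneg[of m "cmod z"] m by (simp add: algebra_simps)
        finally show "2 * (cmod (of_real (V t) - z) + m) + 1 \<le> ?k" by (simp add: algebra_simps)
      qed (use m W_cont False z0 in auto)
      also have "\<dots> = exp (?k * (L - x)) * nsq (fp z) (hp z) L" by (simp add: z0)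
      also have "\<dots> \<le> exp ((2 * (C + 1 + m) + 1) * (C * ?p)) * (exp (2 * (C * (C + 1)) * ?p) * exp (\<bar>ln K0\<bar> * ?p))"
      proof (rule mult_mono)
        have "?k * (L - x) \<le> ?k * L" using x C m by (intro mult_left_mono) auto
        also have "\<dots> = (2 * (C + 1 + m) + 1) * (L * ?R)" by simp
        also have "\<dots> \<le> (2 * (C + 1 + m) + 1) * (C * ?p)" using LR C m by (intro mult_left_mono) auto
        finally show "exp (?k * (L - x)) \<le> exp ((2 * (C + 1 + m) + 1) * (C * ?p))" by simp
        have "nsq (fp z) (hp z) L \<le> exp (2 * (C * (C + 1)) * ?p) * K0" using out[of L] by simp
        also have "\<dots> \<le> exp (2 * (C * (C + 1)) * ?p) * exp (\<bar>ln K0\<bar> * ?p)" using lnK by (intro mult_left_mono) auto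
        finally show "nsq (fp z) (hp z) L \<le> exp (2 * (C * (C + 1)) * ?p) * exp (\<bar>ln K0\<bar> * ?p)" .
      qed (auto simp: nsq_nonneg)
      also have "\<dots> = exp (C1 * ?p)" by (simp add: C1_def algebra_simps flip: exp_add)
      finally show ?thesis using False by auto
    qed
  qed
  \<comment> \<open>The extra \<open>C + 1\<close> absorbs the factor \<open>L + 1\<close> that
    arises from integrating over \<open>{0..L}\<close> and the remaining tail.\<close>
  define C2 where "C2 = C1 + C + 1"
  have "nsq (fp z) (hp z) 0 \<le> exp (C2 * (1 + cmod z) powr \<rho>) \<and>
    tail (nsq (fp z) (hp z)) 0 \<le> exp (C2 * (1 + cmod z) powr \<rho>)" for z
  proof -
    let ?p = "(1 + cmod z) powr \<rho>"
    obtain L where L: "L \<ge> x1" "L \<le> C * (1 + cmod z) powr (1 / \<gamma>)" "\<And>x. x \<ge> L \<Longrightarrow> V x \<ge> 2 * (cmod z + 1)"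
      "\<And>x. x \<in> {0..L} \<Longrightarrow> \<bar>V x\<bar> \<le> C * (1 + cmod z)" using cutz[of z] by blast
    note mn = main[OF L]
    have L0: "L \<ge> 1" using L(1) x1 by simp
    have p1: "?p \<ge> 1" using rho by (intro ge_one_powr_ge_zero) auto
    have c12: "exp (C1 * ?p) \<le> exp (C2 * ?p)" using C by (auto simp: C2_def intro!: mult_right_mono)
    have 0: "nsq (fp z) (hp z) 0 \<le> exp (C1 * ?p)" using mn[of 0] L0 by auto
    have w0: "set_integrable lborel {0..L} (\<lambda>x::real. exp (C1 * ?p))"
      by (rule set_integrable_cont_interval) (intro continuous_intros)
    have aN: "ac (tail (nsq (fp z) (hp z))) (\<lambda>x. - nsq (fp z) (hp z) x)" by (rule tail_ac[OF jost_tail_int])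
    have "integral {0..L} (nsq (fp z) (hp z)) \<le> integral {0..L} (\<lambda>x. exp (C1 * ?p))"
    proof (rule integral_le)
      show "nsq (fp z) (hp z) integrable_on {0..L}" by (rule integrable_continuous_real[OF nsq_cont[OF jost_cont]])
      fix x assume x: "x \<in> {0..L}"
      then show "nsq (fp z) (hp z) x \<le> exp (C1 * ?p)" using mn[of x] by (cases "x = L") auto
    qed auto
    moreover have "integral {0..L} (\<lambda>x. exp (C1 * ?p)) = L * exp (C1 * ?p)" using L0 by simp
    moreover have "integral {0..L} (nsq (fp z) (hp z)) = tail (nsq (fp z) (hp z)) 0 - tail (nsq (fp z) (hp z)) L"
      using ac_integral[OF ac_uminus[OF aN], of 0 L] L0 by simp
    moreover have "tail (nsq (fp z) (hp z)) L \<le> exp (C1 * ?p)"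
    proof -
      have "norm (tail (nsq (fp z) (hp z)) L) \<le> tail (\<lambda>y. exp (C1 * ?p) * exp (- 2 * (y - L))) L"
      proof (rule tail_bound)
        show "set_integrable lborel {L..} (nsq (fp z) (hp z))" using jost_tail_int by (simp add: tail_int_def)
        show "set_integrable lborel {L..} (\<lambda>y. exp (C1 * ?p) * exp (- 2 * (y - L)))"
          by (rule set_integrable_scale(1)[OF exp_tail(1)]) simp
        fix y assume "y \<ge> L"
        then show "norm (nsq (fp z) (hp z) y) \<le> exp (C1 * ?p) * exp (- 2 * (y - L))"
          using mn[of y] L0 nsq_nonneg[of "fp z" "hp z" y] by (cases "y = L") auto
      qed
      also have "\<dots> = exp (C1 * ?p) * tail (\<lambda>y. exp (- 2 * (y - L))) L" by (simp add: tail_def)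
      also have "\<dots> = exp (C1 * ?p) * (1 / 2)" using exp_tail(2)[of 2 L] by simp
      also have "\<dots> \<le> exp (C1 * ?p)" by simp
      finally show ?thesis by simp
    qed
    ultimately have "tail (nsq (fp z) (hp z)) 0 \<le> (L + 1) * exp (C1 * ?p)" by (simp add: algebra_simps)
    also have "\<dots> \<le> exp ((C + 1) * ?p) * exp (C1 * ?p)"
    proof (rule mult_right_mono)
      have "(1 + cmod z) powr (1 / \<gamma>) \<le> (1 + cmod z) powr \<rho>"
        using gam by (intro powr_mono) (auto simp: \<rho>_def)
      then have "C * (1 + cmod z) powr (1 / \<gamma>) \<le> C * ?p" using C by (intro mult_left_mono) auto
      then have "L + 1 \<le> (C + 1) * ?p + 1" using L(2) p1 by (simp add: algebra_simps)
      then show "L + 1 \<le> exp ((C + 1) * ?p)" using exp_ge_add_one_self[of "(C + 1) * ?p"] by linarith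
    qed simp
    also have "\<dots> = exp (C2 * ?p)" by (simp add: C2_def algebra_simps flip: exp_add)
    finally show ?thesis using 0 c12 by linarith
  qed
  moreover have "C2 > 0" using C C1 by (simp add: C2_def)
  ultimately show ?thesis by blast
qed

end

section \<open>The equation on the whole line\<close>

lemma two_Re_le_weight: assumes "t > 0" shows "2 * \<bar>Re (a * cnj b)\<bar> \<le> (cmod a)\<^sup>2 / t + t * (cmod b)\<^sup>2"
proof -
  have "\<bar>Re (a * cnj b)\<bar> \<le> cmod a * cmod b" using abs_Re_le_cmod[of "a * cnj b"] by (simp add: norm_mult)
  moreover have "2 * (cmod a * cmod b) \<le> (cmod a)\<^sup>2 / t + t * (cmod b)\<^sup>2"
    using sum_squares_bound[of "cmod a / sqrt t" "sqrt t * cmod b"] assms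
    by (simp add: power_mult_distrib power_divide)
  ultimately show ?thesis by linarith
qed

lemma integrable_lborel_reflect:
  fixes N :: "real \<Rightarrow> 'a::euclidean_space"
  shows "integrable lborel (\<lambda>x. N (- x)) \<longleftrightarrow> integrable lborel N"
  using lborel_integrable_real_affine_iff[of "-1" N 0] by simp

lemma integral_lborel_reflect:
  fixes N :: "real \<Rightarrow> 'a::euclidean_space"
  shows "integral\<^sup>L lborel (\<lambda>x. N (- x)) = integral\<^sup>L lborel N"
  using lborel_integral_real_affine[of "-1" N 0] by simp

lemma tail_int_of_integrable:
  fixes N :: "real \<Rightarrow> 'a::euclidean_space"
  shows "integrable lborel N \<Longrightarrow> tail_int N"
  unfolding tail_int_def set_integrable_def by (auto intro: integrable_mult_indicator)

lemma integrable_of_tails: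
  fixes N :: "real \<Rightarrow> 'a::euclidean_space"
  assumes "tail_int N" "tail_int (\<lambda>x. N (- x))" shows "integrable lborel N"
proof -
  have 1: "integrable lborel (\<lambda>x. indicator {0..} x *\<^sub>R N x)" "integrable lborel (\<lambda>x. indicator {0..} x *\<^sub>R N (- x))"
    using assms unfolding tail_int_def set_integrable_def by blast+
  have e: "(\<lambda>x. indicator {0..} x *\<^sub>R N (- x)) = (\<lambda>x. (\<lambda>y. indicator {..0} y *\<^sub>R N y) (- x))"
    by (auto simp: indicator_def)
  have "integrable lborel (\<lambda>y. indicator {..0} y *\<^sub>R N y)"
    using 1(2) unfolding e by (subst (asm) integrable_lborel_reflect)
  then have "set_integrable lborel {..0} N" "set_integrable lborel {0..} N"
    using 1(1) by (auto simp: set_integrable_def)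
  then have "set_integrable lborel ({..0} \<union> {0..}) N" by (intro set_integrable_Un) auto
  moreover have "{..0} \<union> {0..} = (UNIV :: real set)" by auto
  ultimately show ?thesis by (simp add: set_integrable_def)
qed

lemma L2c_reflect: "L2c G \<Longrightarrow> L2c (\<lambda>x. G (- x))"
  unfolding L2c_def using integrable_lborel_reflect[of "\<lambda>x. (cmod (G x))\<^sup>2"] by auto

lemma L2c_uminus: "L2c G \<Longrightarrow> L2c (\<lambda>x. - G x)"
  unfolding L2c_def by auto

lemma tail_le_integral: assumes "L2c G" "L2c H" shows "tail (nsq G H) x \<le> integral\<^sup>L lborel (nsq G H)"
  unfolding tail_def set_lebesgue_integral_def
  by (rule integral_mono[OF _ L2c_nsq[OF assms]])
    (use tail_nsq_L2c[OF assms, of x] in \<open>auto simp: set_integrable_def indicator_def nsq_nonneg\<close>)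

text \<open>Common frame of the energy estimates on the line. \<open>F\<close> is small along
  suitable points tending to both ends, so the integrals of its derivative \<open>d\<close> between
  such points tend to \<open>0\<close>, and any integrable lower bound of \<open>d\<close> has
  integral at most \<open>0\<close>.\<close>

lemma limit_inequality:
  fixes F d s N :: "real \<Rightarrow> real"
  assumes F: "ac F d" and le: "\<And>x. \<bar>F x\<bar> \<le> \<kappa> * N x" and N: "integrable lborel N" and s: "integrable lborel s"
    and sd: "\<And>x. s x \<le> d x" and \<kappa>: "\<kappa> \<ge> 0"
  shows "integral\<^sup>L lborel s \<le> 0"
proof -
  have "\<exists>x\<ge>real n. N x < 1 / real (Suc n)" for n
    by (rule small_values[OF tail_int_of_integrable[OF N]]) simp
  then obtain p where p: "\<And>n. p n \<ge> real n" "\<And>n. N (p n) < 1 / real (Suc n)" by metis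
  have "\<exists>x\<ge>real n. N (- x) < 1 / real (Suc n)" for n
    by (rule small_values[OF tail_int_of_integrable]) (use N integrable_lborel_reflect[of N] in auto)
  then obtain q where q: "\<And>n. q n \<ge> real n" "\<And>n. N (- q n) < 1 / real (Suc n)" by metis
  have sm: "s \<in> borel_measurable lborel" using s by (rule borel_measurable_integrable)
  have "(\<lambda>n. integral\<^sup>L lborel (\<lambda>x. indicator {- q n..p n} x *\<^sub>R s x)) \<longlonglongrightarrow> integral\<^sup>L lborel s"
  proof (rule integral_dominated_convergence[OF sm _ integrable_norm[OF s]])
    show "(\<lambda>x. indicator {- q n..p n} x *\<^sub>R s x) \<in> borel_measurable lborel" for n using sm by measurable
    show "AE x in lborel. (\<lambda>n. indicator {- q n..p n} x *\<^sub>R s x) \<longlonglongrightarrow> s x"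
    proof (rule AE_I2)
      fix x :: real
      obtain M :: nat where M: "real M \<ge> \<bar>x\<bar>" using real_arch_simple by blast
      have "eventually (\<lambda>n. indicator {- q n..p n} x *\<^sub>R s x = s x) sequentially"
        using eventually_ge_at_top[of M]
      proof eventually_elim
        case (elim n)
        then have "x \<in> {- q n..p n}" using M p(1)[of n] q(1)[of n] by auto
        then show ?case by simp
      qed
      then show "(\<lambda>n. indicator {- q n..p n} x *\<^sub>R s x) \<longlonglongrightarrow> s x" by (rule tendsto_eventually)
    qed
  qed (auto simp: indicator_def)
  moreover have "(\<lambda>n. 2 * \<kappa> * (1 / real (Suc n))) \<longlonglongrightarrow> 2 * \<kappa> * 0"
    by (intro tendsto_intros LIMSEQ_Suc[OF lim_1_over_n])
  moreover have "integral\<^sup>L lborel (\<lambda>x. indicator {- q n..p n} x *\<^sub>R s x) \<le> 2 * \<kappa> * (1 / real (Suc n))" for n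
  proof -
    have ab: "- q n \<le> p n" using p(1)[of n] q(1)[of n] by linarith
    have si: "set_integrable lborel {- q n..p n} s"
      unfolding set_integrable_def by (rule integrable_mult_indicator[OF _ s]) auto
    have "integral\<^sup>L lborel (\<lambda>x. indicator {- q n..p n} x *\<^sub>R s x) = integral {- q n..p n} s"
      using set_borel_integral_eq_integral(2)[OF si] by (simp add: set_lebesgue_integral_def)
    also have "\<dots> \<le> F (p n) - F (- q n)"
      by (rule has_integral_le[OF integrable_integral ac_has[OF F ab] sd])
        (rule integrable_interval[OF s])
    also have "\<dots> \<le> \<kappa> * N (p n) + \<kappa> * N (- q n)" using le[of "p n"] le[of "- q n"] by linarith
    also have "\<dots> \<le> \<kappa> * (1 / real (Suc n)) + \<kappa> * (1 / real (Suc n))"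
      using p(2)[of n] q(2)[of n] \<kappa> by (intro add_mono mult_left_mono) auto
    finally show ?thesis by simp
  qed
  ultimately show ?thesis using LIMSEQ_le by fastforce
qed

lemma set_integrable_of_square:
  fixes v :: "real \<Rightarrow> 'a::euclidean_space"
  assumes m: "v \<in> borel_measurable borel" and i: "integrable lborel (\<lambda>x. (norm (v x))\<^sup>2)"
  shows "set_integrable lborel {a..b} v"
proof -
  have w: "set_integrable lborel {a..b} (\<lambda>x. 1 + (norm (v x))\<^sup>2)"
  proof (rule set_integral_add(1))
    show "set_integrable lborel {a..b} (\<lambda>x. 1 :: real)" by (rule set_integrable_cont_interval) simp
    show "set_integrable lborel {a..b} (\<lambda>x. (norm (v x))\<^sup>2)"
      unfolding set_integrable_def by (rule integrable_mult_indicator[OF _ i]) auto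
  qed
  show ?thesis
  proof (rule set_integrable_bound[OF w])
    show "set_borel_measurable lborel {a..b} v" unfolding set_borel_measurable_def using m by measurable
    show "AE x in lborel. x \<in> {a..b} \<longrightarrow> norm (v x) \<le> norm (1 + (norm (v x))\<^sup>2)"
    proof (intro AE_I2 impI)
      fix x
      have "2 * norm (v x) \<le> 1 + (norm (v x))\<^sup>2" using sum_squares_bound[of 1 "norm (v x)"] by simp
      moreover have "norm (1 + (norm (v x))\<^sup>2) = 1 + (norm (v x))\<^sup>2" by simp
      ultimately show "norm (v x) \<le> norm (1 + (norm (v x))\<^sup>2)" using norm_ge_zero[of "v x"] by linarith
    qed
  qed
qed

section \<open>Matching the two half-lines\<close>

locale two_sided = R: jost V m \<gamma> c x1 + L: jost "\<lambda>x. V (- x)" m \<gamma> c x1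
  for V :: "real \<Rightarrow> real" and m \<gamma> c x1 :: real
begin

definition W :: "complex \<Rightarrow> real \<Rightarrow> complex" where "W z x = of_real (V x) - z"

lemma W_eq: "W z = (\<lambda>x. of_real (V x) - z)" by (auto simp: W_def)

definition L2sol where "L2sol z f h G H \<longleftrightarrow> sol m (W z) f h G H \<and> L2c G \<and> L2c H \<and> integrable lborel (nsq f h)"

definition rp where "rp z = R.P z 0"
definition rk where "rk z = R.K z 0"
definition lp where "lp z = L.P z 0"
definition lk where "lk z = L.K z 0"
text \<open>Wronskian at \<open>0\<close> of the two decaying solutions. The right one has the
  values \<open>(rp, rk)\<close>. The left one comes from the reflected problem and has the values
  \<open>(- lk, lp)\<close>, which accounts for the plus sign.\<close>

definition Det where "Det z = rk z * lk z + rp z * lp z"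
text \<open>Values which the Wronskians at \<open>0\<close> of a square integrable solution with the
  right and, in \<open>cb\<close>, the left decaying solution must take.\<close>

definition ca where "ca z G H = - tail (\<lambda>x. G x * R.hp z x - H x * R.fp z x) 0"
definition cb where "cb z G H = - tail (\<lambda>x. - H (- x) * L.hp z x - G (- x) * L.fp z x) 0"

lemma Det_holomorphic: "Det holomorphic_on UNIV"
  unfolding Det_def[abs_def] rk_def lk_def rp_def lp_def
  by (intro holomorphic_intros R.K_holomorphic L.K_holomorphic R.P_holomorphic L.P_holomorphic)

text \<open>Together with the converse \<open>L2sol_of_data\<close> this turns square integrability
  on the line into two linear equations for the values of \<open>f\<close> and \<open>h\<close> at
  \<open>0\<close>. Their coefficient determinant is \<open>Det\<close>, so that solvability is a
  matter of Cramer's rule.\<close>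

lemma L2sol_data:
  assumes "L2sol z f h G H"
  shows "f 0 * rk z - h 0 * rp z = ca z G H" "h 0 * lk z + f 0 * lp z = cb z G H"
proof -
  have s: "sol m (\<lambda>x. of_real (V x) - z) f h G H" and G: "L2c G" "L2c H" and N: "integrable lborel (nsq f h)"
    using assms by (auto simp: L2sol_def W_eq)
  show "f 0 * rk z - h 0 * rp z = ca z G H"
    using R.half_line_pairing[OF s G tail_int_of_integrable[OF N]] by (simp add: ca_def rk_def rp_def R.jost_0)
  have s': "sol m (\<lambda>x. of_real (V (- x)) - z) (\<lambda>x. h (- x)) (\<lambda>x. - f (- x)) (\<lambda>x. - H (- x)) (\<lambda>x. G (- x))"
    using sol_reflect[OF s] by simp
  have "nsq (\<lambda>x. h (- x)) (\<lambda>x. - f (- x)) = (\<lambda>x. nsq f h (- x))" by (auto simp: nsq_def)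
  then have "integrable lborel (nsq (\<lambda>x. h (- x)) (\<lambda>x. - f (- x)))" using N integrable_lborel_reflect[of "nsq f h"] by simp
  from L.half_line_pairing[OF s' L2c_uminus[OF L2c_reflect[OF G(2)]] L2c_reflect[OF G(1)] tail_int_of_integrable[OF this]]
  show "h 0 * lk z + f 0 * lp z = cb z G H"
    by (simp add: cb_def lk_def lp_def L.jost_0)
qed

lemma L2sol_of_data:
  assumes s: "sol m (W z) f h G H" and G: "L2c G" "L2c H"
    and d: "f 0 * rk z - h 0 * rp z = ca z G H" "h 0 * lk z + f 0 * lp z = cb z G H"
  shows "L2sol z f h G H"
proof -
  have s1: "sol m (\<lambda>x. of_real (V x) - z) f h G H" using s by (simp add: W_eq)
  have 1: "tail_int (nsq f h)"
    using d(1) by (intro R.half_line_square_integrable[OF s1 G]) (simp add: ca_def rk_def rp_def R.jost_0)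
  have s': "sol m (\<lambda>x. of_real (V (- x)) - z) (\<lambda>x. h (- x)) (\<lambda>x. - f (- x)) (\<lambda>x. - H (- x)) (\<lambda>x. G (- x))"
    using sol_reflect[OF s1] by simp
  have e: "nsq (\<lambda>x. h (- x)) (\<lambda>x. - f (- x)) = (\<lambda>x. nsq f h (- x))" by (auto simp: nsq_def)
  have "tail_int (nsq (\<lambda>x. h (- x)) (\<lambda>x. - f (- x)))"
    using d(2) by (intro L.half_line_square_integrable[OF s' L2c_uminus[OF L2c_reflect[OF G(2)]] L2c_reflect[OF G(1)]])
      (simp add: cb_def lk_def lp_def L.jost_0)
  then have "integrable lborel (nsq f h)" using integrable_of_tails[OF 1] e by simp
  then show ?thesis using s G by (simp add: L2sol_def)
qed

lemma L2c_abs_int: "L2c G \<Longrightarrow> G absolutely_integrable_on {a..b}"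
  unfolding L2c_def by (intro set_integrable_lborel_abs set_integrable_of_square) auto

lemma L2sol_exists:
  assumes G: "L2c G" "L2c H" and d: "u0 * rk z - v0 * rp z = ca z G H" "v0 * lk z + u0 * lp z = cb z G H"
  shows "\<exists>f h. L2sol z f h G H"
proof -
  obtain f h where "sol m (W z) f h G H" "f 0 = u0" "h 0 = v0"
    using sol_exists[OF R.jost_sol[of z] R.W_cont R.jost_nonzero L2c_abs_int[OF G(1)] L2c_abs_int[OF G(2)], of u0 v0]
    by (auto simp: W_eq)
  then show ?thesis using L2sol_of_data[OF _ G] d by blast
qed

lemma L2sol_solvable:
  assumes "Det z \<noteq> 0" "L2c G" "L2c H" shows "\<exists>f h. L2sol z f h G H"
proof (rule L2sol_exists[OF assms(2,3)])
  let ?a = "ca z G H" and ?b = "cb z G H"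
  let ?u = "(?a * lk z + ?b * rp z) / Det z" and ?v = "(?b * rk z - ?a * lp z) / Det z"
  have "?u * rk z - ?v * rp z = ((?a * lk z + ?b * rp z) * rk z - (?b * rk z - ?a * lp z) * rp z) / Det z"
    by (simp add: diff_divide_distrib left_diff_distrib)
  also have "(?a * lk z + ?b * rp z) * rk z - (?b * rk z - ?a * lp z) * rp z = ?a * Det z"
    by (simp add: Det_def algebra_simps)
  finally show "?u * rk z - ?v * rp z = ?a" using assms(1) by simp
  have "?v * lk z + ?u * lp z = ((?b * rk z - ?a * lp z) * lk z + (?a * lk z + ?b * rp z) * lp z) / Det z"
    by (simp add: add_divide_distrib distrib_right)
  also have "(?b * rk z - ?a * lp z) * lk z + (?a * lk z + ?b * rp z) * lp z = ?b * Det z"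
    by (simp add: Det_def algebra_simps)
  finally show "?v * lk z + ?u * lp z = ?b" using assms(1) by simp
qed

lemma L2c_0: "L2c (\<lambda>x. 0)" by (simp add: L2c_def)

lemma data_0: "ca z (\<lambda>x. 0) (\<lambda>x. 0) = 0" "cb z (\<lambda>x. 0) (\<lambda>x. 0) = 0"
  by (simp_all add: ca_def cb_def tail_def)

lemma jost_data_nonzero: "(cmod (rp z))\<^sup>2 + (cmod (rk z))\<^sup>2 > 0"
  using R.jost_nonzero[of z 0] by (auto simp: nsq_def R.jost_0 rp_def rk_def sum_power2_gt_zero_iff)

text \<open>The factor is the coefficient of the projection onto the nonzero vector
  \<open>(rp, rk)\<close>; dividing by its squared length avoids distinguishing which component
  vanishes.\<close>

lemma proportional:
  assumes "a * rk z - b * rp z = 0"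
  shows "a = (a * cnj (rp z) + b * cnj (rk z)) / of_real ((cmod (rp z))\<^sup>2 + (cmod (rk z))\<^sup>2) * rp z"
    and "b = (a * cnj (rp z) + b * cnj (rk z)) / of_real ((cmod (rp z))\<^sup>2 + (cmod (rk z))\<^sup>2) * rk z"
proof -
  define n where "n = complex_of_real ((cmod (rp z))\<^sup>2 + (cmod (rk z))\<^sup>2)"
  have n0: "n \<noteq> 0" using jost_data_nonzero[of z] unfolding n_def of_real_eq_0_iff by linarith
  have n: "n = rp z * cnj (rp z) + rk z * cnj (rk z)" unfolding n_def by (simp only: of_real_add complex_norm_square)
  have e: "a * rk z = b * rp z" using assms by simp
  have "(a * cnj (rp z) + b * cnj (rk z)) * rp z = a * (rp z * cnj (rp z)) + (b * rp z) * cnj (rk z)" by (simp add: algebra_simps)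
  also have "\<dots> = a * n" unfolding e[symmetric] n by (simp add: algebra_simps)
  finally show "a = (a * cnj (rp z) + b * cnj (rk z)) / of_real ((cmod (rp z))\<^sup>2 + (cmod (rk z))\<^sup>2) * rp z"
    using n0 unfolding n_def[symmetric] by (simp add: field_simps)
  have "(a * cnj (rp z) + b * cnj (rk z)) * rk z = (a * rk z) * cnj (rp z) + b * (rk z * cnj (rk z))" by (simp add: algebra_simps)
  also have "\<dots> = b * n" unfolding e n by (simp add: algebra_simps)
  finally show "b = (a * cnj (rp z) + b * cnj (rk z)) / of_real ((cmod (rp z))\<^sup>2 + (cmod (rk z))\<^sup>2) * rk z"
    using n0 unfolding n_def[symmetric] by (simp add: field_simps)
qed

lemma kernel:
  assumes "Det z = 0"
  shows "L2sol z (R.fp z) (R.hp z) (\<lambda>x. 0) (\<lambda>x. 0)"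
    and "L2sol z f h (\<lambda>x. 0) (\<lambda>x. 0) \<Longrightarrow> \<exists>k. \<forall>x. f x = k * R.fp z x \<and> h x = k * R.hp z x"
proof -
  have s: "sol m (W z) (R.fp z) (R.hp z) (\<lambda>x. 0) (\<lambda>x. 0)" using R.jost_sol by (simp add: W_eq)
  show "L2sol z (R.fp z) (R.hp z) (\<lambda>x. 0) (\<lambda>x. 0)"
    by (rule L2sol_of_data[OF s L2c_0 L2c_0])
      (use assms in \<open>simp_all add: data_0 R.jost_0 Det_def algebra_simps flip: rk_def rp_def\<close>)
  assume a: "L2sol z f h (\<lambda>x. 0) (\<lambda>x. 0)"
  have z0: "f 0 * rk z - h 0 * rp z = 0" using L2sol_data(1)[OF a] by (simp add: data_0)
  define k where "k = (f 0 * cnj (rp z) + h 0 * cnj (rk z)) / of_real ((cmod (rp z))\<^sup>2 + (cmod (rk z))\<^sup>2)"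
  have k: "f 0 = k * rp z" "h 0 = k * rk z" using proportional[OF z0] by (simp_all add: k_def)
  have "sol m (W z) (\<lambda>x. f x - k * R.fp z x) (\<lambda>x. h x - k * R.hp z x) (\<lambda>x. 0 - k * 0) (\<lambda>x. 0 - k * 0)"
    by (rule sol_diff_scale[OF _ s]) (use a in \<open>simp add: L2sol_def\<close>)
  then have s2: "sol m (W z) (\<lambda>x. f x - k * R.fp z x) (\<lambda>x. h x - k * R.hp z x) (\<lambda>x. 0) (\<lambda>x. 0)" by simp
  have "f x - k * R.fp z x = 0 \<and> h x - k * R.hp z x = 0" for x
  proof (rule sol_zero[OF s2])
    show "m \<ge> 0" using R.m by simp
    show "continuous_on UNIV (W z)" unfolding W_eq by (rule R.W_cont)
    show "f 0 - k * R.fp z 0 = 0" "h 0 - k * R.hp z 0 = 0" using k by (simp_all add: R.jost_0 rp_def rk_def)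
  qed
  then show "\<exists>k. \<forall>x. f x = k * R.fp z x \<and> h x = k * R.hp z x" by (intro exI[of _ k]) auto
qed

text \<open>When \<open>Det\<close> vanishes, the second row of the matching system is this multiple
  of the first. The system then has rank one and is solvable exactly if the right-hand sides are in
  the same ratio.\<close>

definition kap where "kap z = (lp z * cnj (rk z) - lk z * cnj (rp z)) / of_real ((cmod (rp z))\<^sup>2 + (cmod (rk z))\<^sup>2)"

lemma range_condition:
  assumes D: "Det z = 0" and G: "L2c G" "L2c H"
  shows "(\<exists>f h. L2sol z f h G H) \<longleftrightarrow> cb z G H - kap z * ca z G H = 0"
proof -
  have "(- lk z) * rk z - lp z * rp z = 0" using D by (simp add: Det_def algebra_simps) (metis add_eq_0_iff mult.commute)
  note pr = proportional[OF this]
  have "- lk z = kap z * rp z" by (rule trans[OF pr(1)]) (simp add: kap_def)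
  moreover have "lp z = kap z * rk z" by (rule trans[OF pr(2)]) (simp add: kap_def)
  ultimately have kp: "lk z = - kap z * rp z" "lp z = kap z * rk z" by (simp_all add: minus_equation_iff[of "lk z"] eq_commute)
  show ?thesis
  proof
    assume "\<exists>f h. L2sol z f h G H"
    then obtain f h where s: "L2sol z f h G H" by blast
    have "cb z G H = kap z * (f 0 * rk z - h 0 * rp z)"
      using L2sol_data(2)[OF s] by (simp add: kp algebra_simps)
    then show "cb z G H - kap z * ca z G H = 0" using L2sol_data(1)[OF s] by simp
  next
    assume c: "cb z G H - kap z * ca z G H = 0"
    define n where "n = complex_of_real ((cmod (rp z))\<^sup>2 + (cmod (rk z))\<^sup>2)"
    have n0: "n \<noteq> 0" using jost_data_nonzero[of z] unfolding n_def of_real_eq_0_iff by linarith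
    have n: "n = rp z * cnj (rp z) + rk z * cnj (rk z)" unfolding n_def by (simp only: of_real_add complex_norm_square)
    let ?u = "ca z G H * cnj (rk z) / n" and ?v = "- ca z G H * cnj (rp z) / n"
    have "?u * rk z - ?v * rp z = ca z G H * (rp z * cnj (rp z) + rk z * cnj (rk z)) / n"
      by (simp add: algebra_simps add_divide_distrib)
    then have 1: "?u * rk z - ?v * rp z = ca z G H" using n0 by (simp flip: n)
    have "?v * lk z + ?u * lp z = kap z * (?u * rk z - ?v * rp z)" unfolding kp by (simp add: algebra_simps)
    then have "?v * lk z + ?u * lp z = cb z G H" using c 1 by simp
    then show "\<exists>f h. L2sol z f h G H" using L2sol_exists[OF G 1] by blast
  qed
qed

lemma nsq_real_int: "integrable lborel (nsq f h) \<Longrightarrow> integral\<^sup>L lborel (nsq f h) \<ge> 0"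
  by (intro Bochner_Integration.integral_nonneg nsq_nonneg)

lemma L2sol_low:
  assumes s: "L2sol z f h G H" and V: "\<And>x. V x \<ge> v" and A: "v - Re z > 0"
  shows "(v - Re z)\<^sup>2 * integral\<^sup>L lborel (nsq f h) \<le> integral\<^sup>L lborel (nsq G H)"
proof -
  have sl: "sol m (W z) f h G H" and G: "L2c G" "L2c H" and N: "integrable lborel (nsq f h)"
    using s by (auto simp: L2sol_def)
  define A where "A = v - Re z"
  have A0: "A > 0" using A by (simp add: A_def)
  have S: "integrable lborel (nsq G H)" by (rule L2c_nsq[OF G])
  have "integral\<^sup>L lborel (\<lambda>x. A * nsq f h x - nsq G H x / A) \<le> 0"
  proof (rule limit_inequality[OF sol_energy[OF sl], of 1 "nsq f h"])
    show "\<bar>(cmod (f x))\<^sup>2 - (cmod (h x))\<^sup>2\<bar> \<le> 1 * nsq f h x" for x by (auto simp: nsq_def abs_le_iff)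
    show "integrable lborel (\<lambda>x. A * nsq f h x - nsq G H x / A)" using N S by auto
    fix x
    have "2 * \<bar>Re (G x * cnj (f x))\<bar> \<le> (cmod (G x))\<^sup>2 / A + A * (cmod (f x))\<^sup>2"
      "2 * \<bar>Re (H x * cnj (h x))\<bar> \<le> (cmod (H x))\<^sup>2 / A + A * (cmod (h x))\<^sup>2"
      by (rule two_Re_le_weight[OF A0])+
    then have "- (nsq G H x / A + A * nsq f h x) \<le> 2 * Re (G x * cnj (f x)) - 2 * Re (H x * cnj (h x))"
      unfolding nsq_def add_divide_distrib distrib_left by linarith
    moreover have "2 * A * nsq f h x \<le> 2 * Re (W z x) * nsq f h x"
      using V[of x] by (intro mult_right_mono mult_left_mono nsq_nonneg) (auto simp: W_def A_def)
    ultimately show "A * nsq f h x - nsq G H x / A \<le> 2 * Re (W z x) * nsq f h x + 2 * Re (G x * cnj (f x) - H x * cnj (h x))"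
      by (simp del: times_complex.sel cnj.sel)
  qed (use N in auto)
  then have "A * integral\<^sup>L lborel (nsq f h) \<le> integral\<^sup>L lborel (nsq G H) / A" using N S by simp
  then show ?thesis unfolding A_def[symmetric] using A0 by (simp add: power2_eq_square pos_le_divide_eq mult_ac)
qed

lemma L2sol_real:
  assumes s: "L2sol z f h G H" and z: "Im z = 0"
  shows "m\<^sup>2 * integral\<^sup>L lborel (nsq f h) \<le> integral\<^sup>L lborel (nsq G H)"
proof -
  have sl: "sol m (W z) f h G H" and G: "L2c G" "L2c H" and N: "integrable lborel (nsq f h)"
    using s by (auto simp: L2sol_def)
  have S: "integrable lborel (nsq G H)" by (rule L2c_nsq[OF G])
  have m: "m > 0" by (rule R.m)
  have W: "\<And>x. Im (W z x) = 0" using z by (simp add: W_def)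
  have "integral\<^sup>L lborel (\<lambda>x. m / 2 * nsq f h x - nsq G H x / (2 * m)) \<le> 0"
  proof (rule limit_inequality[OF sol_cross[OF sl W], of 1 "nsq f h"])
    show "\<bar>Re (f x * cnj (h x))\<bar> \<le> 1 * nsq f h x" for x
      using two_Re_le[of "f x" "h x"] nsq_nonneg[of f h x] unfolding nsq_def mult_1 by linarith
    show "integrable lborel (\<lambda>x. m / 2 * nsq f h x - nsq G H x / (2 * m))" using N S by auto
    fix x
    have "2 * \<bar>Re (G x * cnj (h x))\<bar> \<le> (cmod (G x))\<^sup>2 / m + m * (cmod (h x))\<^sup>2"
      "2 * \<bar>Re (H x * cnj (f x))\<bar> \<le> (cmod (H x))\<^sup>2 / m + m * (cmod (f x))\<^sup>2"
      by (rule two_Re_le_weight[OF m])+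
    moreover have "Re (f x * cnj (H x)) = Re (H x * cnj (f x))" by simp
    ultimately have "- (nsq G H x / m + m * nsq f h x) \<le> 2 * Re (G x * cnj (h x)) + 2 * Re (f x * cnj (H x))"
      unfolding nsq_def add_divide_distrib distrib_left by linarith
    then show "m / 2 * nsq f h x - nsq G H x / (2 * m) \<le> m * nsq f h x + Re (G x * cnj (h x) + f x * cnj (H x))"
      by (simp del: times_complex.sel cnj.sel add: field_simps)
  qed (use N in auto)
  then have "m / 2 * integral\<^sup>L lborel (nsq f h) \<le> integral\<^sup>L lborel (nsq G H) / (2 * m)" using N S by simp
  then show ?thesis using m by (simp add: power2_eq_square field_simps)
qed

lemma CS2: "(cmod (a * x + b * y))\<^sup>2 \<le> ((cmod a)\<^sup>2 + (cmod b)\<^sup>2) * ((cmod x)\<^sup>2 + (cmod y)\<^sup>2)"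
proof -
  have "cmod (a * x + b * y) \<le> cmod a * cmod x + cmod b * cmod y"
    using norm_triangle_ineq[of "a * x" "b * y"] by (simp add: norm_mult)
  then have "(cmod (a * x + b * y))\<^sup>2 \<le> (cmod a * cmod x + cmod b * cmod y)\<^sup>2" by (intro power_mono) auto
  also have "\<dots> \<le> ((cmod a)\<^sup>2 + (cmod b)\<^sup>2) * ((cmod x)\<^sup>2 + (cmod y)\<^sup>2)"
    using sum_squares_bound[of "cmod a * cmod y" "cmod b * cmod x"]
    by (simp add: power2_eq_square algebra_simps)
  finally show ?thesis .
qed

section \<open>Growth of the determinant and of the resolvent\<close>

text \<open>\<open>Det\<close> times the values at \<open>0\<close> is controlled by the sources and
  the data of the decaying solutions. Gronwall spreads this control over the window on which
  \<open>V\<close> may be small compared with \<open>z\<close>; outside it the energy identity is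
  coercive.\<close>

lemma growth:
  "\<exists>C>0. (\<forall>z. cmod (Det z) \<le> exp (C * (1 + cmod z) powr R.\<rho>)) \<and>
    (\<forall>z f h G H. L2sol z f h G H \<longrightarrow>
      (cmod (Det z))\<^sup>2 * integral\<^sup>L lborel (nsq f h) \<le> exp (C * (1 + cmod z) powr R.\<rho>) * integral\<^sup>L lborel (nsq G H))"
proof -
  obtain CR where CR: "CR > 0" "\<And>z. nsq (R.fp z) (R.hp z) 0 \<le> exp (CR * (1 + cmod z) powr R.\<rho>)"
    "\<And>z. tail (nsq (R.fp z) (R.hp z)) 0 \<le> exp (CR * (1 + cmod z) powr R.\<rho>)" using R.jost_growth by blast
  obtain CL where CL: "CL > 0" "\<And>z. nsq (L.fp z) (L.hp z) 0 \<le> exp (CL * (1 + cmod z) powr R.\<rho>)"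
    "\<And>z. tail (nsq (L.fp z) (L.hp z)) 0 \<le> exp (CL * (1 + cmod z) powr R.\<rho>)" using L.jost_growth
    unfolding L.\<rho>_def R.\<rho>_def by blast
  obtain KR where KR: "KR > 0" "\<And>z. \<exists>l\<ge>x1. l \<le> KR * (1 + cmod z) powr (1 / \<gamma>) \<and> (\<forall>x\<ge>l. V x \<ge> 2 * (cmod z + 1)) \<and>
    (\<forall>x\<in>{0..l}. \<bar>V x\<bar> \<le> KR * (1 + cmod z))" using R.cut by blast
  obtain KL where KL: "KL > 0" "\<And>z. \<exists>l\<ge>x1. l \<le> KL * (1 + cmod z) powr (1 / \<gamma>) \<and> (\<forall>x\<ge>l. V (- x) \<ge> 2 * (cmod z + 1)) \<and>
    (\<forall>x\<in>{0..l}. \<bar>V (- x)\<bar> \<le> KL * (1 + cmod z))" using L.cut by blast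
  define C0 where "C0 = max CR CL"
  define K where "K = max KR KL"
  have C0: "C0 > 0" and K: "K > 0" using CR(1) KR(1) by (auto simp: C0_def K_def)
  have m: "m > 0" by (rule R.m)
  define p where "p z = (1 + cmod z) powr R.\<rho>" for z :: complex
  have p1: "p z \<ge> 1" for z unfolding p_def using R.rho by (intro ge_one_powr_ge_zero) auto
  have pR: "1 + cmod z \<le> p z" "(1 + cmod z) * (1 + cmod z) powr (1 / \<gamma>) = p z" for z
    unfolding p_def by (rule R.rho_combine)+
  have up: "exp (CR * p z) \<le> exp (C0 * p z)" "exp (CL * p z) \<le> exp (C0 * p z)" for z
    using p1[of z] by (auto simp: C0_def intro!: mult_right_mono)
  have nR: "(cmod (rp z))\<^sup>2 + (cmod (rk z))\<^sup>2 \<le> exp (C0 * p z)" for z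
    using order_trans[OF CR(2)[of z, folded p_def] up(1)[of z]] by (simp only: nsq_def R.jost_0 rp_def rk_def)
  have nL: "(cmod (lp z))\<^sup>2 + (cmod (lk z))\<^sup>2 \<le> exp (C0 * p z)" for z
    using order_trans[OF CL(2)[of z, folded p_def] up(2)[of z]] by (simp only: nsq_def L.jost_0 lp_def lk_def)
  have tR: "tail (nsq (R.fp z) (R.hp z)) 0 \<le> exp (C0 * p z)" for z by (rule order_trans[OF CR(3)[folded p_def] up(1)])
  have tL: "tail (nsq (L.fp z) (L.hp z)) 0 \<le> exp (C0 * p z)" for z by (rule order_trans[OF CL(3)[folded p_def] up(2)])
  have Det2: "(cmod (Det z))\<^sup>2 \<le> exp (2 * C0 * p z)" for z
  proof -
    have "(cmod (Det z))\<^sup>2 \<le> ((cmod (rp z))\<^sup>2 + (cmod (rk z))\<^sup>2) * ((cmod (lp z))\<^sup>2 + (cmod (lk z))\<^sup>2)"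
      using CS2[of "rk z" "lk z" "rp z" "lp z"] by (simp add: Det_def add.commute)
    also have "\<dots> \<le> exp (C0 * p z) * exp (C0 * p z)" using nR nL by (intro mult_mono) auto
    finally show ?thesis by (simp add: mult.assoc flip: exp_add)
  qed
  define Ck where "Ck = (2 * (K + 1 + m) + 1) * K"
  define Cp where "Cp = (2 * K + 4) * (2 * K)"
  \<comment> \<open>\<open>2 * C0\<close> stems from the decaying solutions on both sides,
    \<open>Ck\<close> from Gronwall on the window, \<open>Cp\<close> from polynomial factors. The
    final \<open>2\<close> absorbs the factor \<open>6 = 1 + 5\<close>, since
    \<open>exp 2 \<ge> (5/2)\<^sup>2\<close>.\<close>
  define C where "C = 2 * C0 + Ck + Cp + 2"
  have Ck: "Ck \<ge> 0" "Cp \<ge> 0" using K m by (auto simp: Ck_def Cp_def)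
  have C: "C > 0" using C0 Ck by (simp add: C_def)
  have "cmod (Det z) \<le> exp (C * (1 + cmod z) powr R.\<rho>)" for z
  proof -
    have "(cmod (Det z))\<^sup>2 \<le> (exp (C0 * p z))\<^sup>2" using Det2[of z] by (simp add: exp_double[symmetric] mult.assoc)
    then have "cmod (Det z) \<le> exp (C0 * p z)" by (rule power2_le_imp_le) simp
    also have "C0 * p z \<le> C * p z" using C0 Ck p1[of z] by (intro mult_right_mono) (auto simp: C_def)
    then have "exp (C0 * p z) \<le> exp (C * p z)" by simp
    finally show ?thesis by (simp add: p_def)
  qed
  moreover have "(cmod (Det z))\<^sup>2 * integral\<^sup>L lborel (nsq f h) \<le> exp (C * (1 + cmod z) powr R.\<rho>) * integral\<^sup>L lborel (nsq G H)"
    if s: "L2sol z f h G H" for z f h G H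
  proof -
    have sl: "sol m (W z) f h G H" and G: "L2c G" "L2c H" and N: "integrable lborel (nsq f h)"
      using s by (auto simp: L2sol_def)
    have S: "integrable lborel (nsq G H)" by (rule L2c_nsq[OF G])
    let ?S = "integral\<^sup>L lborel (nsq G H)" and ?N = "integral\<^sup>L lborel (nsq f h)" and ?D = "(cmod (Det z))\<^sup>2"
    have S0: "?S \<ge> 0" by (rule nsq_real_int[OF S])
    let ?E = "exp (C0 * p z)"
    have tn: "tail (nsq a b) x \<ge> 0" for a b x
      unfolding tail_def set_lebesgue_integral_def by (intro Bochner_Integration.integral_nonneg) (auto simp: nsq_nonneg)
    have a: "(cmod (ca z G H))\<^sup>2 \<le> ?S * ?E"
    proof -
      have "(cmod (ca z G H))\<^sup>2 \<le> tail (nsq G H) 0 * tail (nsq (R.fp z) (R.hp z)) 0"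
        using tail_pairing(2)[OF G R.jost_cont R.jost_tail_int, of z 0] by (simp add: ca_def)
      also have "\<dots> \<le> ?S * ?E" using tail_le_integral[OF G] tR tn S0 by (intro mult_mono) auto
      finally show ?thesis .
    qed
    have b: "(cmod (cb z G H))\<^sup>2 \<le> ?S * ?E"
    proof -
      have G': "L2c (\<lambda>x. - H (- x))" "L2c (\<lambda>x. G (- x))" using G L2c_reflect L2c_uminus by auto
      have e: "nsq (\<lambda>x. - H (- x)) (\<lambda>x. G (- x)) = (\<lambda>x. nsq G H (- x))" by (auto simp: nsq_def)
      have "(cmod (cb z G H))\<^sup>2 \<le> tail (nsq (\<lambda>x. - H (- x)) (\<lambda>x. G (- x))) 0 * tail (nsq (L.fp z) (L.hp z)) 0"
        using tail_pairing(2)[OF G' L.jost_cont L.jost_tail_int, of z 0] by (simp add: cb_def)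
      also have "tail (nsq (\<lambda>x. - H (- x)) (\<lambda>x. G (- x))) 0 \<le> ?S"
        using tail_le_integral[OF G', of 0] integral_lborel_reflect[of "nsq G H"] by (simp add: e)
      then have "tail (nsq (\<lambda>x. - H (- x)) (\<lambda>x. G (- x))) 0 * tail (nsq (L.fp z) (L.hp z)) 0 \<le> ?S * ?E"
        using tL tn S0 by (intro mult_mono) auto
      finally show ?thesis .
    qed
    \<comment> \<open>Cramer's rule without division, so that the estimate also makes sense at zeros
      of \<open>Det\<close>.\<close>
    have N0: "?D * nsq f h 0 \<le> 4 * exp (2 * C0 * p z) * ?S"
    proof -
      note d = L2sol_data[OF s]
      have 1: "Det z * f 0 = ca z G H * lk z + cb z G H * rp z" "Det z * h 0 = cb z G H * rk z + (- ca z G H) * lp z"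
        unfolding d[symmetric] by (simp_all add: Det_def algebra_simps)
      have "?D * nsq f h 0 = (cmod (Det z * f 0))\<^sup>2 + (cmod (Det z * h 0))\<^sup>2"
        by (simp add: nsq_def norm_mult power_mult_distrib distrib_left)
      also have "\<dots> \<le> ((cmod (ca z G H))\<^sup>2 + (cmod (cb z G H))\<^sup>2) * ((cmod (lk z))\<^sup>2 + (cmod (rp z))\<^sup>2)
        + ((cmod (cb z G H))\<^sup>2 + (cmod (ca z G H))\<^sup>2) * ((cmod (rk z))\<^sup>2 + (cmod (lp z))\<^sup>2)"
        unfolding 1 using CS2[of "ca z G H" "lk z" "cb z G H" "rp z"] CS2[of "cb z G H" "rk z" "- ca z G H" "lp z"]
        by (intro add_mono) auto
      also have "\<dots> = ((cmod (ca z G H))\<^sup>2 + (cmod (cb z G H))\<^sup>2) *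
        (((cmod (rp z))\<^sup>2 + (cmod (rk z))\<^sup>2) + ((cmod (lp z))\<^sup>2 + (cmod (lk z))\<^sup>2))" by (simp add: algebra_simps)
      also have "\<dots> \<le> (?S * ?E + ?S * ?E) * (?E + ?E)"
        using a b nR nL S0 by (intro mult_mono add_mono) auto
      also have "\<dots> = 4 * (?E * ?E) * ?S" by (simp add: algebra_simps)
      finally show ?thesis by (simp add: mult.assoc flip: exp_add)
    qed
    obtain l where l: "l \<ge> x1" "l \<le> KR * (1 + cmod z) powr (1 / \<gamma>)" "\<And>x. x \<ge> l \<Longrightarrow> V x \<ge> 2 * (cmod z + 1)"
      "\<And>x. x \<in> {0..l} \<Longrightarrow> \<bar>V x\<bar> \<le> KR * (1 + cmod z)" using KR(2)[of z] by blast
    obtain l' where l': "l' \<ge> x1" "l' \<le> KL * (1 + cmod z) powr (1 / \<gamma>)" "\<And>x. x \<ge> l' \<Longrightarrow> V (- x) \<ge> 2 * (cmod z + 1)"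
      "\<And>x. x \<in> {0..l'} \<Longrightarrow> \<bar>V (- x)\<bar> \<le> KL * (1 + cmod z)" using KL(2)[of z] by blast
    let ?R = "1 + cmod z" and ?q = "(1 + cmod z) powr (1 / \<gamma>)"
    have x1: "x1 \<ge> 1" by (rule R.x1)
    have q0: "?q \<ge> 0" by simp
    have lK: "l \<le> K * ?q" "l' \<le> K * ?q"
      using l(2) l'(2) mult_right_mono[of KR K ?q] mult_right_mono[of KL K ?q] q0 by (auto simp: K_def)
    have VK: "\<bar>V x\<bar> \<le> K * ?R" if "x \<in> {- l'..l}" for x
    proof (cases "x \<ge> 0")
      case True
      then have "\<bar>V x\<bar> \<le> KR * ?R" using l(4) that by auto
      also have "\<dots> \<le> K * ?R" by (intro mult_right_mono) (auto simp: K_def)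
      finally show ?thesis .
    next
      case False
      then have "\<bar>V x\<bar> \<le> KL * ?R" using l'(4)[of "- x"] that by auto
      also have "\<dots> \<le> K * ?R" by (intro mult_right_mono) (auto simp: K_def)
      finally show ?thesis .
    qed
    have WK: "cmod (W z x) \<le> (K + 1) * ?R" if "x \<in> {- l'..l}" for x
      using norm_triangle_ineq4[of "of_real (V x)" z] VK[OF that] by (simp add: W_def algebra_simps)
    let ?k = "(2 * (K + 1 + m) + 1) * ?R"
    have k0: "?k \<ge> 0" using K m by simp
    have kW: "2 * (cmod (W z x) + m) + 1 \<le> ?k" if "x \<in> {- l'..l}" for x
    proof -
      have "2 * (cmod (W z x) + m) + 1 \<le> 2 * ((K + 1) * ?R + m * 1) + 1" using WK[OF that] by simp
      also have "\<dots> \<le> 2 * ((K + 1) * ?R + m * ?R) + ?R" using mult_nonneg_nonneg[of m "cmod z"] m by (simp add: algebra_simps)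
      finally show ?thesis by (simp add: algebra_simps)
    qed
    have kl: "exp (?k * t) \<le> exp (Ck * p z)" if "t \<le> K * ?q" for t
    proof -
      have "?k * t \<le> ?k * (K * ?q)" using that k0 by (intro mult_left_mono)
      also have "\<dots> = Ck * (?R * ?q)" by (simp add: Ck_def)
      finally show ?thesis by (simp add: pR(2))
    qed
    define M where "M = exp (Ck * p z) * (nsq f h 0 + ?S)"
    have M0: "M \<ge> 0" using S0 by (simp add: M_def nsq_nonneg)
    have Wc: "continuous_on UNIV (W z)" unfolding W_eq by (rule R.W_cont)
    have NM: "nsq f h x \<le> M" if x: "x \<in> {- l'..l}" for x
    proof (cases "x \<ge> 0")
      case True
      have "nsq f h x \<le> exp (?k * (x - 0)) * (nsq f h 0 + ?S)"
        by (rule sol_gronwall(1)[OF sl _ Wc S True]) (use m kW x l' x1 in auto)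
      also have "\<dots> \<le> M" unfolding M_def using kl[of x] x lK nsq_nonneg[of f h 0] S0 by (intro mult_right_mono) auto
      finally show ?thesis .
    next
      case False
      then have x0: "x \<le> 0" by simp
      have "nsq f h x \<le> exp (?k * (0 - x)) * (nsq f h 0 + ?S)"
        by (rule sol_gronwall(2)[OF sl _ Wc S x0]) (use m kW x l x1 in auto)
      also have "\<dots> \<le> M" unfolding M_def using kl[of "- x"] x lK nsq_nonneg[of f h 0] S0 by (intro mult_right_mono) auto
      finally show ?thesis .
    qed
    \<comment> \<open>Inside the window \<open>Re W\<close> may have either sign. \<open>c1\<close>
      bounds \<open>2 * \<bar>Re W\<bar> * nsq f h\<close> plus two copies of
      \<open>nsq f h\<close>: the one to be estimated and the one lost in splitting the source
      terms.\<close>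
    define c1 where "c1 = (2 * ((K + 1) * ?R) + 2) * M"
    have c10: "c1 \<ge> 0" using K M0 by (simp add: c1_def)
    have ll: "- l' \<le> l" using l(1) l'(1) x1 by linarith
    have ind: "integrable lborel (\<lambda>x. c1 * indicator {- l'..l} x)" using ll by (intro integrable_mult_right integrable_real_indicator) auto
    have "integral\<^sup>L lborel (\<lambda>x. nsq f h x - nsq G H x - c1 * indicator {- l'..l} x) \<le> 0"
    proof (rule limit_inequality[OF sol_energy[OF sl], of 1 "nsq f h"])
      show "\<bar>(cmod (f x))\<^sup>2 - (cmod (h x))\<^sup>2\<bar> \<le> 1 * nsq f h x" for x by (auto simp: nsq_def abs_le_iff)
      show "integrable lborel (\<lambda>x. nsq f h x - nsq G H x - c1 * indicator {- l'..l} x)" using N S ind by auto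
      fix x
      have t: "- (nsq G H x + nsq f h x) \<le> 2 * Re (G x * cnj (f x)) - 2 * Re (H x * cnj (h x))"
        using two_Re_le[of "G x" "f x"] two_Re_le[of "H x" "h x"] unfolding nsq_def by linarith
      have t2: "2 * Re (G x * cnj (f x) - H x * cnj (h x)) = 2 * Re (G x * cnj (f x)) - 2 * Re (H x * cnj (h x))"
        by (simp del: times_complex.sel cnj.sel)
      show "nsq f h x - nsq G H x - c1 * indicator {- l'..l} x \<le> 2 * Re (W z x) * nsq f h x + 2 * Re (G x * cnj (f x) - H x * cnj (h x))"
      proof (cases "x \<in> {- l'..l}")
        case True
        have "\<bar>2 * Re (W z x) * nsq f h x\<bar> \<le> 2 * ((K + 1) * ?R) * nsq f h x"
          unfolding abs_mult using WK[OF True] abs_Re_le_cmod[of "W z x"] nsq_nonneg[of f h x]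
          by (intro mult_mono) auto
        moreover have "(2 * ((K + 1) * ?R) + 2) * nsq f h x \<le> c1"
          unfolding c1_def using NM[OF True] K by (intro mult_left_mono) auto
        then have "2 * ((K + 1) * ?R) * nsq f h x + 2 * nsq f h x \<le> c1" by (simp only: distrib_right)
        ultimately show ?thesis using t True unfolding t2 by simp
      next
        case False
        have "V x \<ge> 2 * (cmod z + 1)" using l(3)[of x] l'(3)[of "- x"] False by (cases "x \<ge> 0") auto
        moreover have "Re (W z x) = V x - Re z" by (simp add: W_def)
        ultimately have "Re (W z x) \<ge> 1" using complex_Re_le_cmod[of z] norm_ge_zero[of z] unfolding distrib_left by linarith
        then have "2 * 1 * nsq f h x \<le> 2 * Re (W z x) * nsq f h x" by (intro mult_right_mono mult_left_mono nsq_nonneg) auto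
        then show ?thesis using t False unfolding t2 by simp
      qed
    qed (use N in auto)
    then have "?N - ?S - c1 * (l + l') \<le> 0" using N S ind ll by simp
    then have "?N \<le> ?S + c1 * (l + l')" by simp
    also have "\<dots> \<le> ?S + c1 * (2 * K * ?q)" using lK c10 by (intro add_left_mono mult_left_mono) auto
    finally have N1: "?N \<le> ?S + c1 * (2 * K * ?q)" .
    have poly: "(2 * ((K + 1) * ?R) + 2) * (2 * K * ?q) \<le> exp (Cp * p z)"
    proof -
      have "(2 * ((K + 1) * ?R) + 2) * (2 * K * ?q) \<le> (2 * ((K + 1) * ?R) + 2 * ?R) * (2 * K * ?q)"
        using K q0 by (intro mult_right_mono add_left_mono) auto
      also have "\<dots> = Cp * (?R * ?q)" by (simp add: Cp_def algebra_simps)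
      also have "\<dots> = Cp * p z" by (simp only: pR(2))
      also have "\<dots> \<le> exp (Cp * p z)" using exp_ge_add_one_self[of "Cp * p z"] by linarith
      finally show ?thesis .
    qed
    have DM: "?D * M \<le> exp (Ck * p z) * (5 * exp (2 * C0 * p z) * ?S)"
    proof -
      have "?D * ?S \<le> exp (2 * C0 * p z) * ?S" using Det2 S0 by (intro mult_right_mono)
      then have "?D * nsq f h 0 + ?D * ?S \<le> 5 * exp (2 * C0 * p z) * ?S" using N0 by simp
      then have "exp (Ck * p z) * (?D * nsq f h 0 + ?D * ?S) \<le> exp (Ck * p z) * (5 * exp (2 * C0 * p z) * ?S)"
        by (intro mult_left_mono) auto
      then show ?thesis by (simp add: M_def algebra_simps)
    qed
    have "?D * ?N \<le> ?D * (?S + c1 * (2 * K * ?q))" using N1 by (intro mult_left_mono) auto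
    also have "\<dots> = ?D * ?S + ((2 * ((K + 1) * ?R) + 2) * (2 * K * ?q)) * (?D * M)"
      by (simp add: c1_def algebra_simps)
    also have "\<dots> \<le> exp (2 * C0 * p z) * ?S + exp (Cp * p z) * (exp (Ck * p z) * (5 * exp (2 * C0 * p z) * ?S))"
    proof (rule add_mono)
      show "?D * ?S \<le> exp (2 * C0 * p z) * ?S" using Det2 S0 by (intro mult_right_mono)
      show "((2 * ((K + 1) * ?R) + 2) * (2 * K * ?q)) * (?D * M) \<le> exp (Cp * p z) * (exp (Ck * p z) * (5 * exp (2 * C0 * p z) * ?S))"
        by (rule mult_mono[OF poly DM]) (use M0 in auto)
    qed
    also have "\<dots> \<le> exp (C * p z) * ?S"
    proof -
      let ?X = "exp (2 * C0 * p z)" and ?Y = "exp (Cp * p z) * exp (Ck * p z)"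
      have Y1: "?Y \<ge> 1" using Ck p1[of z] by (simp flip: exp_add)
      have "6 \<le> exp (2 * p z)"
      proof -
        have "(exp 1)\<^sup>2 \<le> (exp (p z))\<^sup>2" using p1[of z] by (intro power_mono) auto
        moreover have "(5/2)\<^sup>2 \<le> (exp 1 :: real)\<^sup>2" using e_approx_32 by (intro power_mono) (auto simp: abs_if split: if_splits)
        ultimately show ?thesis by (simp add: exp_double power2_eq_square)
      qed
      have "?X + ?Y * (5 * ?X) \<le> ?Y * ?X + ?Y * (5 * ?X)" using mult_right_mono[OF Y1 exp_ge_zero, of "2 * C0 * p z"] unfolding mult_1 by linarith
      also have "\<dots> = 6 * (?Y * ?X)" by simp
      also have "\<dots> \<le> exp (2 * p z) * (?Y * ?X)" using \<open>6 \<le> exp (2 * p z)\<close> by (intro mult_right_mono) auto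
      also have "\<dots> = exp (C * p z)" by (simp add: C_def algebra_simps flip: exp_add)
      finally have "(?X + ?Y * (5 * ?X)) * ?S \<le> exp (C * p z) * ?S" using S0 by (intro mult_right_mono)
      then show ?thesis by (simp add: algebra_simps)
    qed
    finally show ?thesis by (simp add: p_def)
  qed
  ultimately show ?thesis using C by blast
qed

end

section \<open>Square integrability of the potential term and the range functional\<close>

lemma integrable_dominated_continuous:
  fixes f g :: "real \<Rightarrow> real"
  assumes "integrable lborel g" "continuous_on UNIV f" "\<And>x. \<bar>f x\<bar> \<le> g x" shows "integrable lborel f"
proof (rule Bochner_Integration.integrable_bound[OF assms(1)])
  show "f \<in> borel_measurable lborel" using borel_measurable_continuous_onI[OF assms(2)] by simp
  show "AE x in lborel. norm (f x) \<le> norm (g x)"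
    using order_trans[OF assms(3) abs_ge_self] by (intro AE_I2) simp
qed

lemma integrable_limit_bounded:
  fixes F :: "nat \<Rightarrow> real \<Rightarrow> real"
  assumes i: "\<And>n. integrable lborel (F n)" and p: "\<And>n x. F n x \<ge> 0"
    and l: "\<And>x. (\<lambda>n. F n x) \<longlonglongrightarrow> G x" and b: "\<And>n. integral\<^sup>L lborel (F n) \<le> M"
    and m: "G \<in> borel_measurable lborel"
  shows "integrable lborel G"
proof (rule integrableI_nonneg[OF m])
  have G: "G x \<ge> 0" for x by (rule LIMSEQ_le_const[OF l]) (use p in auto)
  then show "AE x in lborel. 0 \<le> G x" by simp
  have "(\<integral>\<^sup>+ x. ennreal (G x) \<partial>lborel) = (\<integral>\<^sup>+ x. liminf (\<lambda>n. ennreal (F n x)) \<partial>lborel)"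
  proof (rule nn_integral_cong)
    fix x
    have "(\<lambda>n. ennreal (F n x)) \<longlonglongrightarrow> ennreal (G x)" by (rule tendsto_ennrealI[OF l])
    then show "ennreal (G x) = liminf (\<lambda>n. ennreal (F n x))" by (intro lim_imp_Liminf[symmetric]) auto
  qed
  also have "\<dots> \<le> liminf (\<lambda>n. \<integral>\<^sup>+ x. ennreal (F n x) \<partial>lborel)"
    by (rule nn_integral_liminf) (use i in measurable)
  also have "\<dots> \<le> ennreal M"
  proof (rule Liminf_le)
    show "\<forall>\<^sub>F n in sequentially. (\<integral>\<^sup>+ x. ennreal (F n x) \<partial>lborel) \<le> ennreal M"
      using nn_integral_eq_integral[OF i] p b by (intro always_eventually) (auto intro!: ennreal_leI)
  qed simp
  also have "\<dots> < \<infinity>" by simp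
  finally show "(\<integral>\<^sup>+ x. ennreal (G x) \<partial>lborel) < \<infinity>" .
qed

context two_sided
begin

text \<open>The energy identity is multiplied by the cut-off weight
  \<open>\<psi> = Y / (1 + \<delta> * Y)\<close>. It is bounded, so boundary terms vanish, and
  \<open>\<bar>dY\<bar> \<le> B * Y\<close> passes to \<open>\<psi>\<close> with the same
  \<open>B\<close>, so differentiating the weight costs only a lower-order term. The resulting bound
  does not depend on \<open>\<delta>\<close>.\<close>

lemma weighted_estimate:
  assumes s: "L2sol z f h G H" and V: "\<And>x. V x \<ge> Y x - K"
    and d: "\<And>x. (Y has_real_derivative dY x) (at x)" "continuous_on UNIV dY"
    and Y: "\<And>x. Y x \<ge> 1" and dY: "\<And>x. \<bar>dY x\<bar> \<le> B * Y x" and B: "B \<ge> 0" and K: "K \<ge> 0" and \<delta>: "\<delta> > 0"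
  shows "integrable lborel (\<lambda>x. (Y x / (1 + \<delta> * Y x))\<^sup>2 * nsq f h x)"
    and "integral\<^sup>L lborel (\<lambda>x. (Y x / (1 + \<delta> * Y x))\<^sup>2 * nsq f h x)
      \<le> (2 * K + 2 * \<bar>Re z\<bar> + B)\<^sup>2 * integral\<^sup>L lborel (nsq f h) + 4 * integral\<^sup>L lborel (nsq G H)"
proof -
  have sl: "sol m (W z) f h G H" and G: "L2c G" "L2c H" and N: "integrable lborel (nsq f h)"
    using s by (auto simp: L2sol_def)
  have S: "integrable lborel (nsq G H)" by (rule L2c_nsq[OF G])
  define \<psi> where "\<psi> x = Y x / (1 + \<delta> * Y x)" for x
  define d\<psi> where "d\<psi> x = dY x / (1 + \<delta> * Y x)\<^sup>2" for x
  define b where "b = 2 * K + 2 * \<bar>Re z\<bar> + B"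
  have q: "1 + \<delta> * Y x \<ge> 1" for x using \<delta> Y[of x] by (simp add: mult_nonneg_nonneg)
  have Yp: "Y x > 0" for x using Y[of x] by linarith
  have p0: "\<psi> x > 0" for x unfolding \<psi>_def using q[of x] Yp[of x] by (intro divide_pos_pos) linarith+
  have pY: "\<psi> x \<le> Y x" for x
    unfolding \<psi>_def using divide_left_mono[of 1 "1 + \<delta> * Y x" "Y x"] q[of x] Yp[of x] by simp
  have pd: "\<psi> x \<le> 1 / \<delta>" for x
    unfolding \<psi>_def using q[of x] \<delta> by (simp add: divide_simps)
  have cY: "continuous_on UNIV Y" using d(1) by (intro DERIV_continuous_on) auto
  have D: "(\<psi> has_real_derivative d\<psi> x) (at x)" for x
    unfolding \<psi>_def[abs_def] d\<psi>_def using q[of x]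
    by (auto intro!: derivative_eq_intros d(1) simp: power2_eq_square algebra_simps)
  have q0: "1 + \<delta> * Y x \<noteq> 0" for x using q[of x] by linarith
  have c: "continuous_on UNIV \<psi>" "continuous_on UNIV d\<psi>"
    unfolding \<psi>_def[abs_def] d\<psi>_def[abs_def] using q0 by (auto intro!: continuous_intros cY d(2))
  have dp: "\<bar>d\<psi> x\<bar> \<le> B * \<psi> x" for x
  proof -
    have "\<bar>d\<psi> x\<bar> = \<bar>dY x\<bar> / (1 + \<delta> * Y x)\<^sup>2" by (simp add: d\<psi>_def)
    also have "\<dots> \<le> (B * Y x) / (1 + \<delta> * Y x)\<^sup>2" using dY by (intro divide_right_mono) auto
    also have "\<dots> \<le> (B * Y x) / (1 + \<delta> * Y x)"
      using q[of x] B Yp[of x] by (intro divide_left_mono) (auto simp: power2_eq_square)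
    finally show ?thesis by (simp add: \<psi>_def)
  qed
  have cN: "continuous_on UNIV (nsq f h)" by (rule nsq_cont[OF sol_cont[OF sl]])
  have i: "integrable lborel (\<lambda>x. (\<psi> x)\<^sup>2 * nsq f h x)"
  proof (rule integrable_dominated_continuous)
    show "integrable lborel (\<lambda>x. (1 / \<delta>)\<^sup>2 * nsq f h x)" using N by simp
    show "continuous_on UNIV (\<lambda>x. (\<psi> x)\<^sup>2 * nsq f h x)" by (intro continuous_intros c cN)
    show "\<bar>(\<psi> x)\<^sup>2 * nsq f h x\<bar> \<le> (1 / \<delta>)\<^sup>2 * nsq f h x" for x
      using power_mono[OF pd[of x], of 2] p0[of x] nsq_nonneg[of f h x]
      by (simp add: abs_mult mult_right_mono)
  qed
  then show "integrable lborel (\<lambda>x. (Y x / (1 + \<delta> * Y x))\<^sup>2 * nsq f h x)" by (simp add: \<psi>_def)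
  have "integral\<^sup>L lborel (\<lambda>x. (\<psi> x)\<^sup>2 * nsq f h x - b\<^sup>2 * nsq f h x - 4 * nsq G H x) \<le> 0"
  proof (rule limit_inequality[OF ac_mult[OF ac_C1 sol_energy[OF sl]], of \<psi> d\<psi> "1 / \<delta>" "nsq f h"])
    show "(\<psi> has_vector_derivative d\<psi> x) (at x)" for x
      using D by (simp add: has_real_derivative_iff_has_vector_derivative)
    show "\<bar>\<psi> x * ((cmod (f x))\<^sup>2 - (cmod (h x))\<^sup>2)\<bar> \<le> 1 / \<delta> * nsq f h x" for x
      unfolding abs_mult using pd[of x] p0[of x] \<delta>
      by (intro mult_mono) (auto simp: nsq_def abs_le_iff)
    show "integrable lborel (\<lambda>x. (\<psi> x)\<^sup>2 * nsq f h x - b\<^sup>2 * nsq f h x - 4 * nsq G H x)" using i N S by auto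
    fix x
    let ?N = "nsq f h x" and ?p = "\<psi> x"
    let ?g = "Re (G x * cnj (f x))" and ?k = "Re (H x * cnj (h x))"
    let ?E = "(cmod (f x))\<^sup>2 - (cmod (h x))\<^sup>2"
    have N0: "?N \<ge> 0" by (rule nsq_nonneg)
    have "?p * (2 * \<bar>?g\<bar>) \<le> ?p * ((cmod (G x))\<^sup>2 / (?p / 4) + ?p / 4 * (cmod (f x))\<^sup>2)"
      "?p * (2 * \<bar>?k\<bar>) \<le> ?p * ((cmod (H x))\<^sup>2 / (?p / 4) + ?p / 4 * (cmod (h x))\<^sup>2)"
      using p0[of x] by (intro mult_left_mono two_Re_le_weight; simp)+
    moreover have "?p * (y / (?p / 4) + ?p / 4 * w) = 4 * y + ?p\<^sup>2 * w / 4" for y w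
      using p0[of x] by (simp add: field_simps power2_eq_square)
    ultimately have "?p * (2 * \<bar>?g\<bar>) \<le> 4 * (cmod (G x))\<^sup>2 + ?p\<^sup>2 * (cmod (f x))\<^sup>2 / 4"
      "?p * (2 * \<bar>?k\<bar>) \<le> 4 * (cmod (H x))\<^sup>2 + ?p\<^sup>2 * (cmod (h x))\<^sup>2 / 4" by simp_all
    then have "?p * (2 * \<bar>?g\<bar> + 2 * \<bar>?k\<bar>) \<le> 4 * nsq G H x + ?p\<^sup>2 * ?N / 4"
      unfolding nsq_def distrib_left add_divide_distrib by linarith
    moreover have "- (?p * (2 * \<bar>?g\<bar> + 2 * \<bar>?k\<bar>)) \<le> ?p * (2 * ?g - 2 * ?k)"
      unfolding mult_minus_right[symmetric]
    proof (rule mult_left_mono)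
      show "- (2 * \<bar>?g\<bar> + 2 * \<bar>?k\<bar>) \<le> 2 * ?g - 2 * ?k" by linarith
      show "0 \<le> ?p" using p0[of x] by simp
    qed
    ultimately have 1: "?p * (2 * ?g - 2 * ?k) \<ge> - (4 * nsq G H x + ?p\<^sup>2 * ?N / 4)" by linarith
    have "\<bar>d\<psi> x * ?E\<bar> \<le> (B * ?p) * ?N"
      unfolding abs_mult using dp[of x] by (intro mult_mono) (auto simp: nsq_def abs_le_iff)
    then have 2: "d\<psi> x * ?E \<ge> - (B * ?p * ?N)" by linarith
    have "2 * (V x - Re z) \<ge> 2 * ?p - 2 * K - 2 * \<bar>Re z\<bar>" using V[of x] pY[of x] by (simp add: abs_if split: if_splits)
    then have "?p * (2 * ?p - 2 * K - 2 * \<bar>Re z\<bar>) * ?N \<le> ?p * (2 * (V x - Re z)) * ?N"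
      using p0[of x] N0 by (intro mult_right_mono mult_left_mono) auto
    then have 3: "?p * (2 * Re (W z x) * ?N) \<ge> ?p * (2 * ?p - 2 * K - 2 * \<bar>Re z\<bar>) * ?N"
      by (simp add: W_def mult_ac)
    \<comment> \<open>Completing the square absorbs the term linear in \<open>\<psi>\<close>. The
      coefficient \<open>7 / 4\<close> is the \<open>2\<close> from the potential minus the
      \<open>1 / 4\<close> spent on the sources.\<close>
    have "0 \<le> (b - ?p / 2)\<^sup>2 + ?p\<^sup>2 / 2" by simp
    then have "0 \<le> ((b - ?p / 2)\<^sup>2 + ?p\<^sup>2 / 2) * ?N" using N0 by (rule mult_nonneg_nonneg)
    then have 4: "?p\<^sup>2 * ?N - b\<^sup>2 * ?N \<le> 7 / 4 * ?p\<^sup>2 * ?N - b * ?p * ?N"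
      by (simp add: power2_eq_square algebra_simps)
    have 5: "?p * (2 * ?p - 2 * K - 2 * \<bar>Re z\<bar>) * ?N - B * ?p * ?N = 2 * ?p\<^sup>2 * ?N - b * ?p * ?N"
      by (simp add: b_def power2_eq_square algebra_simps)
    have e: "2 * Re (G x * cnj (f x) - H x * cnj (h x)) = 2 * ?g - 2 * ?k"
      by (simp del: times_complex.sel cnj.sel)
    show "?p\<^sup>2 * ?N - b\<^sup>2 * ?N - 4 * nsq G H x
      \<le> d\<psi> x * ?E + ?p * (2 * Re (W z x) * ?N + 2 * Re (G x * cnj (f x) - H x * cnj (h x)))"
      unfolding e distrib_left[of ?p] using 1 2 3 4 5 by linarith
  qed (use N c \<delta> in auto)
  then show "integral\<^sup>L lborel (\<lambda>x. (Y x / (1 + \<delta> * Y x))\<^sup>2 * nsq f h x)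
      \<le> (2 * K + 2 * \<bar>Re z\<bar> + B)\<^sup>2 * integral\<^sup>L lborel (nsq f h) + 4 * integral\<^sup>L lborel (nsq G H)"
    using i N S by (simp add: b_def \<psi>_def)
qed

text \<open>A square integrable solution of the resolvent equation has its potential term square
  integrable by itself. The weight is \<open>Y = sqrt (1 + V\<^sup>2)\<close>, a differentiable
  positive substitute for \<open>V\<close>; the estimate is uniform in the cut-off, and Fatou's
  lemma removes it along \<open>\<delta> = inverse (Suc n)\<close>.\<close>

lemma separation:
  assumes s: "L2sol z f h G H" and V: "\<And>x. V x \<ge> v"
    and d: "\<And>x. (V has_real_derivative dV x) (at x)" "continuous_on UNIV dV"
    and B: "\<And>x. \<bar>dV x\<bar> \<le> B * sqrt (1 + (V x)\<^sup>2)"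
  shows "integrable lborel (\<lambda>x. (V x)\<^sup>2 * nsq f h x)"
proof -
  have sl: "sol m (W z) f h G H" and N: "integrable lborel (nsq f h)" using s by (auto simp: L2sol_def)
  define Y where "Y x = sqrt (1 + (V x)\<^sup>2)" for x
  define dY where "dY x = V x * dV x / Y x" for x
  \<comment> \<open>\<open>Y \<le> 1 + \<bar>V\<bar>\<close>, and the lower bound \<open>v\<close>
    makes \<open>\<bar>V\<bar>\<close> exceed \<open>V\<close> by at most
    \<open>2 * \<bar>v\<bar>\<close>.\<close>
  define K where "K = 1 + 2 * \<bar>v\<bar>"
  have pos: "1 + (V x)\<^sup>2 > 0" for x by (simp add: add_pos_nonneg)
  have Y1: "Y x \<ge> 1" for x by (simp add: Y_def)
  have Yp: "Y x > 0" for x using Y1[of x] by linarith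
  have VY: "\<bar>V x\<bar> \<le> Y x" for x unfolding Y_def by (rule real_le_rsqrt) simp
  have "0 \<le> B * Y 0" using B[of 0] abs_ge_zero[of "dV 0"] unfolding Y_def by linarith
  then have B0: "B \<ge> 0" using Yp[of 0] by (simp add: zero_le_mult_iff)
  have VK: "V x \<ge> Y x - K" for x
  proof -
    have "Y x \<le> 1 + \<bar>V x\<bar>" unfolding Y_def by (rule real_le_lsqrt) (auto simp: power2_sum)
    then show ?thesis using V[of x] unfolding K_def by linarith
  qed
  have D: "(Y has_real_derivative dY x) (at x)" for x
    unfolding Y_def[abs_def] dY_def using pos[of x]
    by (auto intro!: derivative_eq_intros d(1) simp: Y_def divide_simps)
  have cV: "continuous_on UNIV V" using d(1) by (intro DERIV_continuous_on) auto
  have cY: "continuous_on UNIV Y" unfolding Y_def[abs_def] by (intro continuous_intros cV)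
  have c: "continuous_on UNIV dY"
    unfolding dY_def[abs_def] using Yp by (auto intro!: continuous_intros cV cY d(2) simp: less_imp_neq[symmetric])
  have dY: "\<bar>dY x\<bar> \<le> B * Y x" for x
  proof -
    have "\<bar>dY x\<bar> = (\<bar>V x\<bar> / Y x) * \<bar>dV x\<bar>" using Yp[of x] by (simp add: dY_def abs_mult)
    also have "\<dots> \<le> 1 * \<bar>dV x\<bar>" using VY[of x] Yp[of x] by (intro mult_right_mono) auto
    finally show ?thesis using B[of x] unfolding Y_def by linarith
  qed
  have K0: "K \<ge> 0" by (simp add: K_def)
  note we = weighted_estimate[OF s VK D c Y1 dY B0 K0]
  have "integrable lborel (\<lambda>x. (Y x)\<^sup>2 * nsq f h x)"
  proof (rule integrable_limit_bounded[of "\<lambda>n x. (Y x / (1 + inverse (real (Suc n)) * Y x))\<^sup>2 * nsq f h x"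
      _ "(2 * K + 2 * \<bar>Re z\<bar> + B)\<^sup>2 * integral\<^sup>L lborel (nsq f h) + 4 * integral\<^sup>L lborel (nsq G H)"])
    show "(\<lambda>n. (Y x / (1 + inverse (real (Suc n)) * Y x))\<^sup>2 * nsq f h x) \<longlonglongrightarrow> (Y x)\<^sup>2 * nsq f h x" for x
    proof -
      have "(\<lambda>n. (Y x / (1 + inverse (real (Suc n)) * Y x))\<^sup>2 * nsq f h x) \<longlonglongrightarrow> (Y x / (1 + 0 * Y x))\<^sup>2 * nsq f h x"
        by (intro tendsto_intros LIMSEQ_inverse_real_of_nat) simp
      then show ?thesis by simp
    qed
    show "(\<lambda>x. (Y x)\<^sup>2 * nsq f h x) \<in> borel_measurable lborel"
      using borel_measurable_continuous_onI[of "\<lambda>x. (Y x)\<^sup>2 * nsq f h x"] cY nsq_cont[OF sol_cont[OF sl]]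
      by (simp add: continuous_on_mult continuous_on_power)
  qed (use we in \<open>auto simp: nsq_nonneg\<close>)
  then show ?thesis
  proof (rule integrable_dominated_continuous)
    show "continuous_on UNIV (\<lambda>x. (V x)\<^sup>2 * nsq f h x)" by (intro continuous_intros cV nsq_cont[OF sol_cont[OF sl]])
    show "\<bar>(V x)\<^sup>2 * nsq f h x\<bar> \<le> (Y x)\<^sup>2 * nsq f h x" for x
      using nsq_nonneg[of f h x] by (simp add: Y_def abs_mult mult_right_mono add_nonneg_nonneg)
  qed
qed

text \<open>The kernels are the two decaying solutions, each cut to its own half-line and hence
  square integrable. So the solvability condition at a zero of \<open>Det\<close> is orthogonality
  to a single vector.\<close>

lemma range_functional:
  "\<exists>p q. L2c p \<and> L2c q \<and> (\<forall>G H. L2c G \<longrightarrow> L2c H \<longrightarrow>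
    integrable lborel (\<lambda>x. p x * G x + q x * H x) \<and>
    cb z G H - kap z * ca z G H = integral\<^sup>L lborel (\<lambda>x. p x * G x + q x * H x))"
proof -
  define p where "p x = indicator {..0} x *\<^sub>R L.fp z (- x) + kap z * (indicator {0..} x *\<^sub>R R.hp z x)" for x
  define q where "q x = indicator {..0} x *\<^sub>R L.hp z (- x) - kap z * (indicator {0..} x *\<^sub>R R.fp z x)" for x
  have half: "L2c (\<lambda>x. indicator {0..} x *\<^sub>R f x)" "L2c (\<lambda>x. indicator {0..} x *\<^sub>R h x)"
    if c: "continuous_on UNIV f" "continuous_on UNIV h" and t: "tail_int (nsq f h)" for f h :: "real \<Rightarrow> complex"
  proof -
    have [measurable]: "f \<in> borel_measurable borel" "h \<in> borel_measurable borel"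
      using c by (auto intro: borel_measurable_continuous_onI)
    have t: "integrable lborel (\<lambda>x. indicator {0..} x *\<^sub>R nsq f h x)"
      using t by (simp add: tail_int_def set_integrable_def)
    show "L2c (\<lambda>x. indicator {0..} x *\<^sub>R f x)"
      unfolding L2c_def
      by (intro conjI Bochner_Integration.integrable_bound[OF t] AE_I2) (auto simp: nsq_def indicator_def)
    show "L2c (\<lambda>x. indicator {0..} x *\<^sub>R h x)"
      unfolding L2c_def
      by (intro conjI Bochner_Integration.integrable_bound[OF t] AE_I2) (auto simp: nsq_def indicator_def)
  qed
  have lin: "L2c (\<lambda>x. u x + k * w x)" if "L2c u" "L2c w" for u w and k :: complex
  proof -
    have [measurable]: "u \<in> borel_measurable borel" "w \<in> borel_measurable borel" using that by (auto simp: L2c_def)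
    have i: "integrable lborel (\<lambda>x. 2 * (cmod (u x))\<^sup>2 + 2 * (cmod k)\<^sup>2 * (cmod (w x))\<^sup>2)" using that by (simp add: L2c_def)
    show ?thesis unfolding L2c_def
    proof (intro conjI Bochner_Integration.integrable_bound[OF i] AE_I2)
      show "norm ((cmod (u x + k * w x))\<^sup>2) \<le> norm (2 * (cmod (u x))\<^sup>2 + 2 * (cmod k)\<^sup>2 * (cmod (w x))\<^sup>2)" for x
        using norm_add_squared_le[of "u x" "k * w x"] by (simp add: norm_mult power_mult_distrib)
    qed simp_all
  qed
  have neg: "(\<lambda>x. indicator {..0} x *\<^sub>R f (- x)) = (\<lambda>x. (\<lambda>y. indicator {0..} y *\<^sub>R f y) (- x :: real))" for f :: "real \<Rightarrow> complex"
    by (auto simp: indicator_def)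
  note hR = half[OF R.jost_cont R.jost_tail_int, of z] and hL = half[OF L.jost_cont L.jost_tail_int, of z]
  have "L2c p" unfolding p_def[abs_def] by (rule lin[OF L2c_reflect[OF hL(1), folded neg] hR(2)])
  moreover have "L2c q" unfolding q_def[abs_def]
    using lin[OF L2c_reflect[OF hL(2), folded neg] hR(1), of "- kap z"] by simp
  moreover have "integrable lborel (\<lambda>x. p x * G x + q x * H x) \<and>
    cb z G H - kap z * ca z G H = integral\<^sup>L lborel (\<lambda>x. p x * G x + q x * H x)" if G: "L2c G" "L2c H" for G H
  proof -
    define r where "r x = indicator {0..} x *\<^sub>R (G x * R.hp z x - H x * R.fp z x)" for x
    define l where "l x = indicator {0..} x *\<^sub>R (- H (- x) * L.hp z x - G (- x) * L.fp z x)" for x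
    have ri: "integrable lborel r"
      using tail_pairing(1)[OF G R.jost_cont R.jost_tail_int] by (simp add: tail_int_def set_integrable_def r_def[abs_def])
    have li: "integrable lborel l"
      using tail_pairing(1)[OF L2c_uminus[OF L2c_reflect[OF G(2)]] L2c_reflect[OF G(1)] L.jost_cont L.jost_tail_int]
      by (simp add: tail_int_def set_integrable_def l_def[abs_def])
    have e: "(\<lambda>x. p x * G x + q x * H x) = (\<lambda>x. kap z * r x - l (- x))"
      by (auto simp: p_def q_def r_def l_def indicator_def algebra_simps)
    have l': "integrable lborel (\<lambda>x. l (- x))" using li by (subst integrable_lborel_reflect)
    have "integral\<^sup>L lborel (\<lambda>x. kap z * r x - l (- x)) = kap z * integral\<^sup>L lborel r - integral\<^sup>L lborel l"
      using ri l' integral_lborel_reflect[of l] by simp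
    moreover have "ca z G H = - integral\<^sup>L lborel r" "cb z G H = - integral\<^sup>L lborel l"
      by (simp_all add: ca_def cb_def tail_def set_lebesgue_integral_def r_def[abs_def] l_def[abs_def])
    ultimately show ?thesis unfolding e using ri l' by simp
  qed
  ultimately show ?thesis by blast
qed

lemma L2sol_AE:
  assumes s: "L2sol z f h G H" and G: "L2c G'" "L2c H'" and e: "AE x in lborel. G x = G' x" "AE x in lborel. H x = H' x"
  shows "L2sol z f h G' H'"
proof -
  have a: "ac f (\<lambda>x. W z x * f x + of_real m * h x + G x)" "ac h (\<lambda>x. of_real m * f x - W z x * h x + H x)"
    and N: "integrable lborel (nsq f h)" using s by (auto simp: L2sol_def sol_def)
  have "sol m (W z) f h G' H'" unfolding sol_def
  proof
    show "ac f (\<lambda>x. W z x * f x + of_real m * h x + G' x)"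
      by (rule ac_AE[OF a(1)]) (use e(1) in eventually_elim, simp)
    show "ac h (\<lambda>x. of_real m * f x - W z x * h x + H' x)"
      by (rule ac_AE[OF a(2)]) (use e(2) in eventually_elim, simp)
  qed
  then show ?thesis using G N by (simp add: L2sol_def)
qed

end

section \<open>The Dirac operator\<close>

lemma test_function_deriv:
  assumes "test_function \<phi>"
  shows "(\<phi> has_real_derivative deriv \<phi> x) (at x)" and "continuous_on UNIV (deriv \<phi>)"
    and "\<exists>R\<ge>0. \<forall>x. \<bar>x\<bar> > R \<longrightarrow> \<phi> x = 0 \<and> deriv \<phi> x = 0"
proof -
  have n: "(deriv ^^ n) \<phi> differentiable_on UNIV" for n using assms by (simp add: test_function_def)
  show D: "(\<phi> has_real_derivative deriv \<phi> x) (at x)" for x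
    using n[of 0] by (simp add: differentiable_on_def DERIV_deriv_iff_real_differentiable)
  show "continuous_on UNIV (deriv \<phi>)" using differentiable_imp_continuous_on[OF n[of 1]] by simp
  obtain R where R: "\<And>x. \<bar>x\<bar> > R \<Longrightarrow> \<phi> x = 0" using assms by (auto simp: test_function_def)
  have "deriv \<phi> x = 0" if x: "\<bar>x\<bar> > R" for x
  proof -
    have "open {x :: real. \<bar>x\<bar> > R}" by (intro open_Collect_less continuous_intros)
    then have "((\<lambda>x. 0) has_real_derivative deriv \<phi> x) (at x)"
      by (rule has_field_derivative_transform_within_open[OF D[of x]]) (use x R in auto)
    then show ?thesis using DERIV_unique[OF _ DERIV_const] by blast
  qed
  then have "\<forall>x. \<bar>x\<bar> > max R 0 \<longrightarrow> \<phi> x = 0 \<and> deriv \<phi> x = 0" using R by auto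
  then show "\<exists>R\<ge>0. \<forall>x. \<bar>x\<bar> > R \<longrightarrow> \<phi> x = 0 \<and> deriv \<phi> x = 0" by (intro exI[of _ "max R 0"]) auto
qed

lemma integrable_of_support:
  fixes f :: "real \<Rightarrow> 'a::euclidean_space"
  assumes "set_integrable lborel {- R..R} f" "\<And>x. \<bar>x\<bar> > R \<Longrightarrow> f x = 0"
  shows "integrable lborel f" and "integral\<^sup>L lborel f = integral {- R..R} f"
proof -
  have e: "(\<lambda>x. indicator {- R..R} x *\<^sub>R f x) = f" using assms(2) by (auto simp: indicator_def fun_eq_iff abs_if)
  show "integrable lborel f" using assms(1) by (simp add: set_integrable_def e)
  show "integral\<^sup>L lborel f = integral {- R..R} f"
    using set_borel_integral_eq_integral(2)[OF assms(1)] by (simp add: set_lebesgue_integral_def e)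
qed

lemma set_integrable_cont_scaleR:
  fixes f :: "real \<Rightarrow> 'a::euclidean_space"
  assumes c: "continuous_on UNIV \<phi>" and f: "f \<in> borel_measurable borel" "set_integrable lborel {a..b} f"
  shows "set_integrable lborel {a..b} (\<lambda>x. \<phi> x *\<^sub>R f x)"
proof -
  have "compact (\<phi> ` {a..b})" by (rule compact_continuous_image[OF continuous_on_subset[OF c]]) auto
  then obtain M where M: "\<And>x. x \<in> {a..b} \<Longrightarrow> \<bar>\<phi> x\<bar> \<le> M"
    using compact_imp_bounded bounded_iff by (metis imageI real_norm_def)
  have [measurable]: "\<phi> \<in> borel_measurable borel" by (rule borel_measurable_continuous_onI[OF c])
  note f(1)[measurable]
  show ?thesis
  proof (rule set_integrable_bound)
    show "set_integrable lborel {a..b} (\<lambda>x. M *\<^sub>R f x)" using f(2) by simp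
    show "set_borel_measurable lborel {a..b} (\<lambda>x. \<phi> x *\<^sub>R f x)" unfolding set_borel_measurable_def by simp
    show "AE x in lborel. x \<in> {a..b} \<longrightarrow> norm (\<phi> x *\<^sub>R f x) \<le> norm (M *\<^sub>R f x)"
      using M by (intro AE_I2) (auto intro!: mult_right_mono order_trans[OF _ abs_ge_self])
  qed
qed

lemma test_by_parts:
  fixes F f :: "real \<Rightarrow> 'a::euclidean_space"
  assumes t: "test_function \<phi>" and a: "ac F f" and f: "f \<in> borel_measurable borel" "\<And>a b. set_integrable lborel {a..b} f"
  shows "integrable lborel (\<lambda>x. deriv \<phi> x *\<^sub>R F x)" and "integrable lborel (\<lambda>x. \<phi> x *\<^sub>R f x)"
    and "integral\<^sup>L lborel (\<lambda>x. deriv \<phi> x *\<^sub>R F x) = - integral\<^sup>L lborel (\<lambda>x. \<phi> x *\<^sub>R f x)"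
proof -
  note d = test_function_deriv[OF t]
  obtain R where R: "R \<ge> 0" "\<And>x. \<bar>x\<bar> > R \<Longrightarrow> \<phi> x = 0 \<and> deriv \<phi> x = 0" using d(3) by blast
  have c: "continuous_on UNIV \<phi>" using d(1) by (intro DERIV_continuous_on) auto
  have cF: "continuous_on UNIV F" by (rule ac_continuous[OF a])
  have s1: "set_integrable lborel {- r..r} (\<lambda>x. deriv \<phi> x *\<^sub>R F x)" for r
    by (rule set_integrable_cont_interval) (intro continuous_intros d(2) cF)
  have s2: "set_integrable lborel {- r..r} (\<lambda>x. \<phi> x *\<^sub>R f x)" for r
    by (rule set_integrable_cont_scaleR[OF c f])
  show 1: "integrable lborel (\<lambda>x. deriv \<phi> x *\<^sub>R F x)" by (rule integrable_of_support(1)[OF s1, of R]) (use R in auto)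
  show 2: "integrable lborel (\<lambda>x. \<phi> x *\<^sub>R f x)" by (rule integrable_of_support(1)[OF s2, of R]) (use R in auto)
  have "integral\<^sup>L lborel (\<lambda>x. deriv \<phi> x *\<^sub>R F x + \<phi> x *\<^sub>R f x) = 0"
  proof (rule euclidean_eqI)
    fix b :: 'a assume "b \<in> Basis"
    have s: "set_integrable lborel {- (R + 1)..R + 1} (\<lambda>x. deriv \<phi> x *\<^sub>R F x + \<phi> x *\<^sub>R f x)"
      by (rule set_integral_add(1)[OF s1 s2])
    have "ac (\<lambda>x. \<phi> x * (F x \<bullet> b)) (\<lambda>x. deriv \<phi> x * (F x \<bullet> b) + \<phi> x * (f x \<bullet> b))"
      by (intro ac_mult ac_C1 d(2) ac_linear[OF a bounded_linear_inner_left])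
        (use d(1) in \<open>simp add: has_real_derivative_iff_has_vector_derivative\<close>)
    from ac_has[OF this, of "- (R + 1)" "R + 1"]
    have "((\<lambda>x. (deriv \<phi> x *\<^sub>R F x + \<phi> x *\<^sub>R f x) \<bullet> b) has_integral 0) {- (R + 1)..R + 1}"
      using R(1) R(2)[of "R + 1"] R(2)[of "- (R + 1)"] by (simp add: inner_add_left)
    moreover have "((\<lambda>x. (deriv \<phi> x *\<^sub>R F x + \<phi> x *\<^sub>R f x) \<bullet> b) has_integral
      integral {- (R + 1)..R + 1} (\<lambda>x. deriv \<phi> x *\<^sub>R F x + \<phi> x *\<^sub>R f x) \<bullet> b) {- (R + 1)..R + 1}"
      using has_integral_linear[OF integrable_integral[OF set_borel_integral_eq_integral(1)[OF s]] bounded_linear_inner_left[of b]]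
      by (simp add: o_def)
    ultimately have "integral {- (R + 1)..R + 1} (\<lambda>x. deriv \<phi> x *\<^sub>R F x + \<phi> x *\<^sub>R f x) \<bullet> b = 0"
      by (rule has_integral_unique[symmetric])
    moreover have "integral\<^sup>L lborel (\<lambda>x. deriv \<phi> x *\<^sub>R F x + \<phi> x *\<^sub>R f x)
      = integral {- (R + 1)..R + 1} (\<lambda>x. deriv \<phi> x *\<^sub>R F x + \<phi> x *\<^sub>R f x)"
      by (rule integrable_of_support(2)[OF s]) (use R in auto)
    ultimately show "integral\<^sup>L lborel (\<lambda>x. deriv \<phi> x *\<^sub>R F x + \<phi> x *\<^sub>R f x) \<bullet> b = 0 \<bullet> b" by simp
  qed
  then show "integral\<^sup>L lborel (\<lambda>x. deriv \<phi> x *\<^sub>R F x) = - integral\<^sup>L lborel (\<lambda>x. \<phi> x *\<^sub>R f x)"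
    using 1 2 by (simp add: eq_neg_iff_add_eq_0)
qed

lemma square_integrable_interval: "square_integrable v \<Longrightarrow> set_integrable lborel {a..b} v"
  unfolding square_integrable_def by (intro set_integrable_of_square) auto

lemma rep_meas: "rep_L2 u \<in> borel_measurable borel"
  by (rule square_integrable_measurable[OF sq_rep])

lemma rep_interval: "set_integrable lborel {a..b} (rep_L2 u)" "set_integrable lborel {a<..<b} (rep_L2 u)"
proof -
  show 1: "set_integrable lborel {a..b} (rep_L2 u)" by (rule square_integrable_interval[OF sq_rep])
  show "set_integrable lborel {a<..<b} (rep_L2 u)" by (rule set_integrable_subset[OF 1]) auto
qed

lemma integrable_test_rep:
  assumes t: "test_function \<phi>" shows "integrable lborel (\<lambda>x. \<phi> x *\<^sub>R rep_L2 u x)"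
proof -
  obtain R where R: "\<And>x. \<bar>x\<bar> > R \<Longrightarrow> \<phi> x = 0" using test_function_deriv(3)[OF t] by blast
  have c: "continuous_on UNIV \<phi>" using test_function_deriv(1)[OF t] by (intro DERIV_continuous_on) auto
  show ?thesis
    by (rule integrable_of_support(1)[OF set_integrable_cont_scaleR[OF c rep_meas rep_interval(1)], of R]) (use R in auto)
qed

lemma has_weak_derivativeI:
  assumes a: "ac F (rep_L2 w)" and e: "AE x in lborel. rep_L2 u x = F x"
  shows "has_weak_derivative u w"
  unfolding has_weak_derivative_def
proof (intro allI impI)
  fix \<phi> assume t: "test_function \<phi>"
  have [measurable]: "deriv \<phi> \<in> borel_measurable borel" "F \<in> borel_measurable borel" "rep_L2 u \<in> borel_measurable borel"
    using borel_measurable_continuous_onI test_function_deriv(2)[OF t] ac_continuous[OF a] rep_meas by auto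
  have "integral\<^sup>L lborel (\<lambda>x. deriv \<phi> x *\<^sub>R rep_L2 u x) = integral\<^sup>L lborel (\<lambda>x. deriv \<phi> x *\<^sub>R F x)"
    by (rule integral_cong_AE) (use e in \<open>auto elim: eventually_mono\<close>)
  then show "integral\<^sup>L lborel (\<lambda>x. deriv \<phi> x *\<^sub>R rep_L2 u x) = - integral\<^sup>L lborel (\<lambda>x. \<phi> x *\<^sub>R rep_L2 w x)"
    using test_by_parts(3)[OF t a rep_meas rep_interval(1)] by simp
qed

text \<open>Subtract a primitive of \<open>w\<close>: the remainder has zero weak derivative, and
  the du Bois-Reymond lemma makes it constant.\<close>

lemma has_weak_derivativeD:
  assumes "has_weak_derivative u w"
  obtains F where "ac F (rep_L2 w)" "AE x in lborel. rep_L2 u x = F x"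
proof -
  obtain F where F: "ac F (rep_L2 w)" "F 0 = 0"
    using ac_indefinite[OF set_integrable_lborel_abs[OF rep_interval(1)[of _ _ w]], of 0] by blast
  have cF: "continuous_on UNIV F" by (rule ac_continuous[OF F(1)])
  have "\<exists>c. AE x in lborel. rep_L2 u x - F x = c"
  proof (rule du_bois_reymond)
    show "(\<lambda>x. rep_L2 u x - F x) \<in> borel_measurable borel"
      using rep_meas borel_measurable_continuous_onI[OF cF] by (intro borel_measurable_diff)
    show "set_integrable lborel {a<..<b} (\<lambda>x. rep_L2 u x - F x)" for a b
      by (rule set_integrable_subset[OF set_integral_diff(1)[OF rep_interval(1)[of a b] set_integrable_cont_interval[OF cF]]]) auto
    fix \<phi> assume t: "test_function \<phi>"
    obtain R where R: "\<And>x. \<bar>x\<bar> > R \<Longrightarrow> \<phi> x = 0 \<and> deriv \<phi> x = 0" using test_function_deriv(3)[OF t] by blast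
    have i: "integrable lborel (\<lambda>x. deriv \<phi> x *\<^sub>R rep_L2 u x)"
      by (rule integrable_of_support(1)[OF set_integrable_cont_scaleR[OF test_function_deriv(2)[OF t] rep_meas rep_interval(1)], of R])
        (use R in auto)
    show "integral\<^sup>L lborel (\<lambda>x. deriv \<phi> x *\<^sub>R (rep_L2 u x - F x)) = 0"
      using i test_by_parts[OF t F(1) rep_meas rep_interval(1)] assms t
      by (simp add: scaleR_diff_right has_weak_derivative_def)
  qed
  then obtain c where "AE x in lborel. rep_L2 u x - F x = c" by blast
  then have "AE x in lborel. rep_L2 u x = F x + c" by eventually_elim (simp add: diff_eq_eq add.commute)
  moreover have "ac (\<lambda>x. F x + c) (rep_L2 w)" using ac_add[OF F(1) ac_const[of c]] by simp
  ultimately show ?thesis using that by blast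
qed

lemma has_weak_derivative_unique:
  assumes "has_weak_derivative u w" "has_weak_derivative u w'" shows "w = w'"
proof (rule L2_eqI)
  have "AE x in lborel. rep_L2 w x - rep_L2 w' x = 0"
  proof (rule AE_zero_of_test_integrals)
    show "(\<lambda>x. rep_L2 w x - rep_L2 w' x) \<in> borel_measurable borel" using rep_meas by (intro borel_measurable_diff)
    show "set_integrable lborel {a<..<b} (\<lambda>x. rep_L2 w x - rep_L2 w' x)" for a b
      by (rule set_integral_diff(1)[OF rep_interval(2) rep_interval(2)])
    fix f assume "f \<in> bumps"
    then have t: "test_function f" by (rule bumps_test_function)
    note i = integrable_test_rep[OF t]
    show "integral\<^sup>L lborel (\<lambda>x. f x *\<^sub>R (rep_L2 w x - rep_L2 w' x)) = 0"
      using assms t i by (simp add: scaleR_diff_right has_weak_derivative_def)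
  qed
  then show "AE x in lborel. rep_L2 w x = rep_L2 w' x" by eventually_elim simp
qed

lemma weak_derivative_eq: "has_weak_derivative u w \<Longrightarrow> weak_derivative u = w"
  unfolding weak_derivative_def by (rule the_equality) (auto intro: has_weak_derivative_unique)

section \<open>Scalar components of a spinor\<close>

text \<open>\<open>sum_part\<close> and \<open>diff_part\<close> are the coordinates
  \<open>f\<close> and \<open>h\<close> of the overview. They diagonalise
  \<open>\<sigma>\<^sub>1\<close>, so the derivative decouples and the mass term provides the
  coupling.\<close>

definition sum_part :: "complex^2 \<Rightarrow> complex" where "sum_part v = v $ 1 + v $ 2"
definition diff_part :: "complex^2 \<Rightarrow> complex" where "diff_part v = - \<i> * (v $ 1 - v $ 2)"
definition of_parts :: "complex \<Rightarrow> complex \<Rightarrow> complex^2"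
  where "of_parts p q = (\<chi> i. if i = 1 then (p + \<i> * q) / 2 else (p - \<i> * q) / 2)"

lemma vec2_eq_iff: "v = w \<longleftrightarrow> v $ 1 = w $ 1 \<and> v $ 2 = w $ 2" for v w :: "'a^2"
  by (simp add: vec_eq_iff forall_2)

lemma parts_of_parts [simp]: "sum_part (of_parts p q) = p" "diff_part (of_parts p q) = q"
  by (simp_all add: sum_part_def diff_part_def of_parts_def add_divide_distrib[symmetric] diff_divide_distrib[symmetric])

lemma of_parts_parts [simp]: "of_parts (sum_part v) (diff_part v) = v"
  by (simp add: vec2_eq_iff sum_part_def diff_part_def of_parts_def algebra_simps)

lemma parts_eqI: "sum_part v = sum_part w \<Longrightarrow> diff_part v = diff_part w \<Longrightarrow> v = w"
  by (metis of_parts_parts)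

lemma norm_parts: "(cmod (sum_part v))\<^sup>2 + (cmod (diff_part v))\<^sup>2 = 2 * (norm v)\<^sup>2"
  by (simp add: norm_vec_def L2_set_def sum_2 sum_part_def diff_part_def norm_mult cmod_sq algebra_simps)

lemma linear_parts: "bounded_linear sum_part" "bounded_linear diff_part"
  unfolding sum_part_def[abs_def] diff_part_def[abs_def]
  by (intro bounded_linear_intros bounded_linear_vec_nth)+

lemma parts_meas [measurable]: "sum_part \<in> borel_measurable borel" "diff_part \<in> borel_measurable borel"
  using linear_parts[THEN bounded_linear.continuous_on, OF continuous_on_id]
  by (simp_all add: borel_measurable_continuous_onI)

lemma bounded_linear_of_parts: "bounded_linear (\<lambda>(p, q). of_parts p q)"
proof (intro linear_conv_bounded_linear[THEN iffD1] linearI)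
  fix v w :: "complex \<times> complex"
  show "(case v + w of (p, q) \<Rightarrow> of_parts p q) = (case v of (p, q) \<Rightarrow> of_parts p q) + (case w of (p, q) \<Rightarrow> of_parts p q)"
    by (simp add: of_parts_def vec2_eq_iff split_beta field_simps)
next
  fix r and v :: "complex \<times> complex"
  show "(case r *\<^sub>R v of (p, q) \<Rightarrow> of_parts p q) = r *\<^sub>R (case v of (p, q) \<Rightarrow> of_parts p q)"
    by (simp add: of_parts_def vec2_eq_iff split_beta scaleR_conv_of_real[where 'a = complex] field_simps)
qed

lemma parts_of_add: "sum_part (v + w) = sum_part v + sum_part w" "diff_part (v + w) = diff_part v + diff_part w"
    "sum_part (v - w) = sum_part v - sum_part w" "diff_part (v - w) = diff_part v - diff_part w"
    "sum_part (c *s v) = c * sum_part v" "diff_part (c *s v) = c * diff_part v"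
  by (simp_all add: sum_part_def diff_part_def algebra_simps)

lemma parts_sigma:
  "sum_part (\<sigma>\<^sub>1 *v v) = sum_part v" "diff_part (\<sigma>\<^sub>1 *v v) = - diff_part v"
  "sum_part (\<sigma>\<^sub>3 *v v) = \<i> * diff_part v" "diff_part (\<sigma>\<^sub>3 *v v) = - \<i> * sum_part v"
  by (simp_all add: sum_part_def diff_part_def \<sigma>\<^sub>1_def \<sigma>\<^sub>3_def matrix_vector_mult_def sum_2 algebra_simps)

text \<open>Multiplying the sum component by \<open>\<i>\<close> and the difference component by
  \<open>- \<i>\<close> isolates the derivatives. Here \<open>- \<i> * z\<close> is the variable
  \<open>\<zeta>\<close>.\<close>

lemma dirac_pointwise:
  "(- \<i>) *s (\<sigma>\<^sub>1 *v w) + of_real m *s (\<sigma>\<^sub>3 *v p) + (\<i> * of_real t) *s p - z *s p = g \<longleftrightarrow>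
    sum_part w = (of_real t - (- \<i> * z)) * sum_part p + of_real m * diff_part p + \<i> * sum_part g \<and>
    diff_part w = of_real m * sum_part p - (of_real t - (- \<i> * z)) * diff_part p + (- \<i> * diff_part g)"
  (is "?l = g \<longleftrightarrow> ?a \<and> ?b")
proof -
  have i: "\<i> * x = y \<longleftrightarrow> x = - \<i> * y" for x y :: complex by (auto simp: algebra_simps complex_eq_iff)
  have "?l = g \<longleftrightarrow> sum_part ?l = sum_part g \<and> diff_part ?l = diff_part g" using parts_eqI by auto
  also have "sum_part ?l = sum_part g \<longleftrightarrow> ?a"
  proof -
    have "sum_part ?l = sum_part g \<longleftrightarrow> \<i> * (sum_part ?l - sum_part g) = 0" by simp
    also have "\<i> * (sum_part ?l - sum_part g) = sum_part w -
      ((of_real t - (- \<i> * z)) * sum_part p + of_real m * diff_part p + \<i> * sum_part g)"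
      by (simp add: parts_of_add parts_sigma algebra_simps)
    finally show ?thesis by simp
  qed
  also have "diff_part ?l = diff_part g \<longleftrightarrow> ?b"
  proof -
    have "diff_part ?l = diff_part g \<longleftrightarrow> - \<i> * (diff_part ?l - diff_part g) = 0" by simp
    also have "- \<i> * (diff_part ?l - diff_part g) = diff_part w -
      (of_real m * sum_part p - (of_real t - (- \<i> * z)) * diff_part p + (- \<i> * diff_part g))"
      by (simp add: parts_of_add parts_sigma algebra_simps)
    finally show ?thesis by simp
  qed
  finally show ?thesis .
qed

lemma L2c_parts:
  assumes "square_integrable v" shows "L2c (\<lambda>x. k * sum_part (v x))" "L2c (\<lambda>x. k * diff_part (v x))"
    and "nsq (\<lambda>x. sum_part (v x)) (\<lambda>x. diff_part (v x)) = (\<lambda>x. 2 * (norm (v x))\<^sup>2)"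
proof -
  have m: "v \<in> borel_measurable borel" and i: "integrable lborel (\<lambda>x. (cmod k)\<^sup>2 * (2 * (norm (v x))\<^sup>2))"
    using assms by (auto simp: square_integrable_def)
  note m[measurable]
  show "L2c (\<lambda>x. k * sum_part (v x))" unfolding L2c_def
    by (intro conjI Bochner_Integration.integrable_bound[OF i] AE_I2)
      (auto simp: norm_mult power_mult_distrib norm_parts[symmetric] intro!: mult_left_mono)
  show "L2c (\<lambda>x. k * diff_part (v x))" unfolding L2c_def
    by (intro conjI Bochner_Integration.integrable_bound[OF i] AE_I2)
      (auto simp: norm_mult power_mult_distrib norm_parts[symmetric] intro!: mult_left_mono)
  show "nsq (\<lambda>x. sum_part (v x)) (\<lambda>x. diff_part (v x)) = (\<lambda>x. 2 * (norm (v x))\<^sup>2)"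
    by (rule ext) (simp add: nsq_def norm_parts)
qed

lemma of_parts_meas [measurable]:
  assumes [measurable]: "f \<in> borel_measurable borel" "h \<in> borel_measurable borel"
  shows "(\<lambda>x. of_parts (f x) (h x)) \<in> borel_measurable borel"
proof -
  have [measurable]: "(\<lambda>(p, q). of_parts p q) \<in> borel_measurable borel"
    by (rule borel_measurable_continuous_onI[OF bounded_linear.continuous_on[OF bounded_linear_of_parts continuous_on_id]])
  have "(\<lambda>x. (\<lambda>(p, q). of_parts p q) (f x, h x)) \<in> borel_measurable borel" by measurable
  then show ?thesis by simp
qed

lemma norm_of_parts: "2 * (norm (of_parts p q))\<^sup>2 = (cmod p)\<^sup>2 + (cmod q)\<^sup>2"
  using norm_parts[of "of_parts p q"] by simp

lemma square_integrable_of_parts: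
  assumes "f \<in> borel_measurable borel" "h \<in> borel_measurable borel" "integrable lborel (nsq f h)"
  shows "square_integrable (\<lambda>x. of_parts (f x) (h x))"
proof -
  have "(\<lambda>x. (norm (of_parts (f x) (h x)))\<^sup>2) = (\<lambda>x. nsq f h x / 2)"
    using norm_of_parts by (auto simp: nsq_def fun_eq_iff field_simps)
  then show ?thesis using assms of_parts_meas[OF assms(1,2)] by (simp add: square_integrable_def)
qed

lemma ac_of_parts: assumes "ac f f'" "ac h h'" shows "ac (\<lambda>x. of_parts (f x) (h x)) (\<lambda>x. of_parts (f' x) (h' x))"
proof -
  have p: "bounded_linear (\<lambda>p. (p, 0 :: complex))" "bounded_linear (\<lambda>q. (0 :: complex, q))"
    by (intro bounded_linear_Pair bounded_linear_ident bounded_linear_zero)+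
  have "ac (\<lambda>x. (f x, h x)) (\<lambda>x. (f' x, h' x))"
    using ac_add[OF ac_linear[OF assms(1) p(1)] ac_linear[OF assms(2) p(2)]] by simp
  from ac_linear[OF this bounded_linear_of_parts] show ?thesis by simp
qed

lemma norm_rep_parts: "integral\<^sup>L lborel (nsq (\<lambda>x. sum_part (rep_L2 u x)) (\<lambda>x. diff_part (rep_L2 u x))) = 2 * (norm u)\<^sup>2"
  by (simp add: L2c_parts(3)[OF sq_rep] norm_L2_sq)

lemma square_integrable_cong_AE:
  assumes "square_integrable f" "g \<in> borel_measurable borel" "AE x in lborel. f x = g x"
  shows "square_integrable g"
  unfolding square_integrable_def
proof
  show "g \<in> borel_measurable lborel" using assms(2) by simp
  have "integrable lborel (\<lambda>x. (norm (f x))\<^sup>2)" using assms(1) by (simp add: square_integrable_def)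
  then show "integrable lborel (\<lambda>x. (norm (g x))\<^sup>2)"
    by (rule integrable_cong_AE_imp) (use assms(2,3) in \<open>auto elim: eventually_mono\<close>)
qed

lemma square_integrable_linear:
  assumes T: "bounded_linear T" and f: "square_integrable f" shows "square_integrable (\<lambda>x. T (f x))"
proof -
  obtain K where K: "\<And>v. norm (T v) \<le> norm v * K" using bounded_linear.bounded[OF T] by blast
  have [measurable]: "T \<in> borel_measurable borel"
    by (rule borel_measurable_continuous_onI[OF bounded_linear.continuous_on[OF T continuous_on_id]])
  note square_integrable_measurable[OF f, measurable]
  have i: "integrable lborel (\<lambda>x. K\<^sup>2 * (norm (f x))\<^sup>2)" using f by (simp add: square_integrable_def)
  show ?thesis unfolding square_integrable_def
  proof (intro conjI Bochner_Integration.integrable_bound[OF i] AE_I2)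
    show "norm ((norm (T (f x)))\<^sup>2) \<le> norm (K\<^sup>2 * (norm (f x))\<^sup>2)" for x
      using power_mono[OF K[of "f x"], of 2] by (simp add: power_mult_distrib mult.commute)
  qed simp_all
qed

lemma bounded_linear_matrix: "bounded_linear (\<lambda>v. M *v v)" for M :: "complex^2^2"
  by (intro linear_conv_bounded_linear[THEN iffD1] linearI)
    (simp_all add: vec_eq_iff matrix_vector_mult_def scaleR_sum_right distrib_left sum.distrib)

lemma square_integrable_compact_support:
  assumes c: "continuous_on UNIV f" and R: "\<And>x. \<bar>x\<bar> > R \<Longrightarrow> f x = 0"
  shows "square_integrable f"
  unfolding square_integrable_def
proof
  show "f \<in> borel_measurable lborel" using borel_measurable_continuous_onI[OF c] by simp
  show "integrable lborel (\<lambda>x. (norm (f x))\<^sup>2)"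
    by (rule integrable_of_support(1)[of R, OF set_integrable_cont_interval])
      (use R in \<open>auto intro!: continuous_intros c\<close>)
qed

lemma AE_interval_point:
  assumes "AE x in lborel. P x" "a < (b :: real)" obtains x where "a < x" "x < b" "P x"
proof -
  have "\<exists>x. a < x \<and> x < b \<and> P x"
  proof (rule ccontr)
    assume "\<not> ?thesis"
    then have "AE x in lborel. x \<notin> {a<..<b}" using assms(1) by (auto elim: eventually_mono)
    then have "{a<..<b} \<in> null_sets lborel" by (subst (asm) AE_iff_null_sets[symmetric]) auto
    then show False using assms(2) by (simp add: null_sets_def)
  qed
  then show ?thesis using that by blast
qed

text \<open>A set of full measure meets every interval, so arbitrarily close to the jump there are
  points on both sides where the representative agrees with the indicator.\<close>

lemma indicator_not_continuous:
  fixes e :: "'a::real_normed_vector"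
  assumes c: "continuous_on UNIV F" and ae: "AE x in lborel. indicator {0..1::real} x *\<^sub>R e = F x" shows "e = 0"
proof (rule ccontr)
  assume e: "e \<noteq> 0"
  have "isCont F 0" using c by (simp add: continuous_on_eq_continuous_at)
  then obtain d where d: "d > 0" "\<And>x. dist x 0 < d \<Longrightarrow> dist (F x) (F 0) < norm e / 2"
    using e unfolding continuous_at_eps_delta by (metis half_gt_zero zero_less_norm_iff)
  obtain x where x: "- d < x" "x < 0" "indicator {0..1} x *\<^sub>R e = F x" using AE_interval_point[OF ae, of "- d" 0] d(1) by auto
  obtain y where y: "0 < y" "y < min d 1" "indicator {0..1} y *\<^sub>R e = F y" using AE_interval_point[OF ae, of 0 "min d 1"] d(1) by auto
  have "F x = 0" "F y = e" using x y by (auto simp: indicator_def split: if_splits)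
  moreover have "dist (F x) (F 0) < norm e / 2" "dist (F y) (F 0) < norm e / 2"
    by (rule d(2); use x y in \<open>simp add: dist_real_def\<close>)+
  ultimately show False using dist_triangle2[of "F y" "F x" "F 0"] by (simp add: dist_norm)
qed

text \<open>The change to sum and difference components multiplies squared norms by two, hence the
  factor \<open>1/2\<close>.\<close>

lemma cinner_parts:
  "cinner u v = integral\<^sup>L lborel (\<lambda>x. (sum_part (rep_L2 u x) * cnj (sum_part (rep_L2 v x)) +
    diff_part (rep_L2 u x) * cnj (diff_part (rep_L2 v x))) / 2)"
proof -
  let ?a = "\<lambda>x. rep_L2 u x \<bullet> rep_L2 v x" and ?b = "\<lambda>x. rep_L2 u x \<bullet> (\<i> *s rep_L2 v x)"
  have i: "integrable lborel ?a" "integrable lborel ?b"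
    by (intro integrable_inner_square_integrable square_integrable_scaleC sq_rep)+
  have "u \<bullet> (\<i> *\<^sub>C v) = integral\<^sup>L lborel ?b"
    unfolding inner_L2_eq
  proof (rule integral_cong_AE)
    show "AE x in lborel. rep_L2 u x \<bullet> rep_L2 (\<i> *\<^sub>C v) x = rep_L2 u x \<bullet> (\<i> *s rep_L2 v x)"
      using rep_scaleC[of "\<i>" v] by eventually_elim simp
    show "?b \<in> borel_measurable lborel" by (rule borel_measurable_integrable[OF i(2)])
    show "(\<lambda>x. rep_L2 u x \<bullet> rep_L2 (\<i> *\<^sub>C v) x) \<in> borel_measurable lborel"
      by (rule borel_measurable_integrable[OF integrable_inner_square_integrable[OF sq_rep sq_rep]])
  qed
  then have "cinner u v = of_real (integral\<^sup>L lborel ?a) + \<i> * of_real (integral\<^sup>L lborel ?b)"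
    by (simp add: cinner_def inner_L2_eq complex_eq_iff)
  also have "\<dots> = integral\<^sup>L lborel (\<lambda>x. of_real (?a x) + \<i> * of_real (?b x))"
    using i by (subst Bochner_Integration.integral_add) auto
  also have "\<dots> = integral\<^sup>L lborel (\<lambda>x. (sum_part (rep_L2 u x) * cnj (sum_part (rep_L2 v x)) +
    diff_part (rep_L2 u x) * cnj (diff_part (rep_L2 v x))) / 2)"
    by (rule Bochner_Integration.integral_cong)
      (simp_all add: inner_vec_def sum_2 inner_complex_def sum_part_def diff_part_def complex_eq_iff field_simps)
  finally show ?thesis .
qed

section \<open>The Dirac operator as an operator with determinant\<close>

text \<open>The potential in the form used by the estimates: the lower bound \<open>v\<close> gives
  the resolvent bound for large \<open>- Im z\<close>, and the bound on \<open>dV\<close> gives the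
  square integrability of the potential term.\<close>

locale dirac = two_sided V m \<gamma> c x1 for V :: "real \<Rightarrow> real" and m \<gamma> c x1 :: real +
  fixes v B :: real and dV :: "real \<Rightarrow> real"
  assumes V_low: "\<And>x. v \<le> V x" and V_deriv: "\<And>x. (V has_real_derivative dV x) (at x)"
    and dV_cont: "continuous_on UNIV dV" and dV_bound: "\<And>x. \<bar>dV x\<bar> \<le> B * sqrt (1 + (V x)\<^sup>2)"
begin

abbreviation A :: L2_operator where "A \<equiv> dirac_operator m V"

definition src1 where "src1 g x = \<i> * sum_part (rep_L2 g x)"
definition src2 where "src2 g x = - \<i> * diff_part (rep_L2 g x)"

text \<open>Links an element \<open>u\<close> of \<open>L2\<close> with its continuous
  representative in scalar coordinates; the remaining proofs pass between operator and differential
  equation through this relation.\<close>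

definition solves where "solves z f h u g \<longleftrightarrow> L2sol (- \<i> * z) f h (src1 g) (src2 g) \<and>
  (AE x in lborel. rep_L2 u x = of_parts (f x) (h x))"

lemma src_L2c: "L2c (src1 g)" "L2c (src2 g)"
  unfolding src1_def[abs_def] src2_def[abs_def] by (rule L2c_parts[OF sq_rep])+

lemma src_norm: "integral\<^sup>L lborel (nsq (src1 g) (src2 g)) = 2 * (norm g)\<^sup>2"
proof -
  have "nsq (src1 g) (src2 g) = nsq (\<lambda>x. sum_part (rep_L2 g x)) (\<lambda>x. diff_part (rep_L2 g x))"
    by (rule ext) (simp add: nsq_def src1_def src2_def norm_mult)
  then show ?thesis by (simp add: norm_rep_parts)
qed

lemma sol_nsq:
  assumes "continuous_on UNIV f" "continuous_on UNIV h" "AE x in lborel. rep_L2 u x = of_parts (f x) (h x)"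
  shows "integrable lborel (nsq f h)" and "integral\<^sup>L lborel (nsq f h) = 2 * (norm u)\<^sup>2"
proof -
  have m: "nsq f h \<in> borel_measurable borel" by (rule borel_measurable_continuous_onI[OF nsq_cont[OF assms(1,2)]])
  have i: "integrable lborel (\<lambda>x. 2 * (norm (rep_L2 u x))\<^sup>2)" using sq_rep[of u] by (simp add: square_integrable_def)
  have e: "AE x in lborel. 2 * (norm (rep_L2 u x))\<^sup>2 = nsq f h x"
    using assms(3) by eventually_elim (simp add: norm_of_parts nsq_def)
  show I: "integrable lborel (nsq f h)" by (rule integrable_cong_AE_imp[OF i _ e]) (use m in simp)
  have "integral\<^sup>L lborel (nsq f h) = integral\<^sup>L lborel (\<lambda>x. 2 * (norm (rep_L2 u x))\<^sup>2)"
  proof (rule integral_cong_AE)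
    show "nsq f h \<in> borel_measurable lborel" using m by simp
    show "(\<lambda>x. 2 * (norm (rep_L2 u x))\<^sup>2) \<in> borel_measurable lborel" by (rule borel_measurable_integrable[OF i])
    show "AE x in lborel. nsq f h x = 2 * (norm (rep_L2 u x))\<^sup>2" using e by eventually_elim simp
  qed
  then show "integral\<^sup>L lborel (nsq f h) = 2 * (norm u)\<^sup>2" by (simp add: norm_L2_sq)
qed

lemma solves_sol: "solves z f h u g \<Longrightarrow> sol m (W (- \<i> * z)) f h (src1 g) (src2 g)"
  by (simp add: solves_def L2sol_def)

lemma solves_norm:
  assumes "solves z f h u g" shows "integral\<^sup>L lborel (nsq f h) = 2 * (norm u)\<^sup>2"
  using sol_nsq(2)[OF sol_cont[OF solves_sol[OF assms]]] assms by (simp add: solves_def)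

lemma in_domain:
  assumes "u \<in> fst A"
  shows "has_weak_derivative u (weak_derivative u)" and "square_integrable (\<lambda>x. V x *\<^sub>R rep_L2 u x)"
    and "AE x in lborel. rep_L2 (shifted A z u) x = (- \<i>) *s (\<sigma>\<^sub>1 *v rep_L2 (weak_derivative u) x)
      + of_real m *s (\<sigma>\<^sub>3 *v rep_L2 u x) + (\<i> * of_real (V x)) *s rep_L2 u x - z *s rep_L2 u x"
proof -
  show "has_weak_derivative u (weak_derivative u)"
    using assms weak_derivative_eq by (auto simp: dirac_operator_def Sobolev_H1_def)
  show V: "square_integrable (\<lambda>x. V x *\<^sub>R rep_L2 u x)"
    using assms by (simp add: dirac_operator_def multiplication_domain_def)
  let ?T = "\<lambda>x. (- \<i>) *s (\<sigma>\<^sub>1 *v rep_L2 (weak_derivative u) x) + of_real m *s (\<sigma>\<^sub>3 *v rep_L2 u x)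
    + (\<i> * of_real (V x)) *s rep_L2 u x"
  have "square_integrable (\<lambda>x. \<i> *s (V x *\<^sub>R rep_L2 u x))" by (rule square_integrable_scaleC[OF V])
  then have "square_integrable (\<lambda>x. (\<i> * of_real (V x)) *s rep_L2 u x)"
    by (simp add: scaleR_eq_scalar_mult vector_smult_assoc)
  then have "square_integrable ?T"
    by (intro square_integrable_add square_integrable_scaleC square_integrable_linear[OF bounded_linear_matrix] sq_rep)
  from rep_abs[OF this] have 1: "AE x in lborel. rep_L2 (snd A u) x = ?T x" by (simp add: dirac_operator_def)
  show "AE x in lborel. rep_L2 (shifted A z u) x = (- \<i>) *s (\<sigma>\<^sub>1 *v rep_L2 (weak_derivative u) x)
      + of_real m *s (\<sigma>\<^sub>3 *v rep_L2 u x) + (\<i> * of_real (V x)) *s rep_L2 u x - z *s rep_L2 u x"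
    unfolding shifted_def using 1 rep_diff[of "snd A u" "z *\<^sub>C u"] rep_scaleC[of z u] by eventually_elim simp
qed

lemma solves_of_domain:
  assumes u: "u \<in> fst A" shows "\<exists>f h. solves z f h u (shifted A z u)"
proof -
  let ?g = "shifted A z u" and ?w = "weak_derivative u"
  obtain F where F: "ac F (rep_L2 ?w)" "AE x in lborel. rep_L2 u x = F x"
    using has_weak_derivativeD[OF in_domain(1)[OF u]] .
  define f where "f x = sum_part (F x)" for x
  define h where "h x = diff_part (F x)" for x
  have e: "AE x in lborel. sum_part (rep_L2 ?w x) = W (- \<i> * z) x * f x + of_real m * h x + src1 ?g x \<and>
    diff_part (rep_L2 ?w x) = of_real m * f x - W (- \<i> * z) x * h x + src2 ?g x"
    using in_domain(3)[OF u, of z] F(2)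
  proof eventually_elim
    case (elim x)
    from elim(1)[symmetric, unfolded dirac_pointwise] show ?case
      by (simp only: elim(2) f_def h_def W_def src1_def src2_def)
  qed
  have "ac f (\<lambda>x. W (- \<i> * z) x * f x + of_real m * h x + src1 ?g x)"
    by (rule ac_AE[OF ac_linear[OF F(1) linear_parts(1), folded f_def]]) (use e in eventually_elim, simp)
  moreover have "ac h (\<lambda>x. of_real m * f x - W (- \<i> * z) x * h x + src2 ?g x)"
    by (rule ac_AE[OF ac_linear[OF F(1) linear_parts(2), folded h_def]]) (use e in eventually_elim, simp)
  ultimately have s: "sol m (W (- \<i> * z)) f h (src1 ?g) (src2 ?g)" by (simp add: sol_def)
  have r: "AE x in lborel. rep_L2 u x = of_parts (f x) (h x)"
    using F(2) by eventually_elim (simp add: f_def h_def)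
  show ?thesis
    using s r src_L2c sol_nsq(1)[OF sol_cont[OF s] r] by (auto simp: solves_def L2sol_def)
qed

text \<open>The solution is known to be square integrable only as a whole. By
  \<open>separation\<close> the potential term is square integrable as well, and then the equation
  itself exhibits the derivative as a square integrable function.\<close>

lemma domain_of_solves:
  assumes "solves z f h u g" shows "u \<in> fst A" "shifted A z u = g"
proof -
  have s: "L2sol (- \<i> * z) f h (src1 g) (src2 g)" and r: "AE x in lborel. rep_L2 u x = of_parts (f x) (h x)"
    using assms by (auto simp: solves_def)
  let ?W = "W (- \<i> * z)"
  have a: "ac f (\<lambda>x. ?W x * f x + of_real m * h x + src1 g x)" "ac h (\<lambda>x. of_real m * f x - ?W x * h x + src2 g x)"
    and N: "integrable lborel (nsq f h)" using s by (auto simp: L2sol_def sol_def)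
  have cf: "continuous_on UNIV f" "continuous_on UNIV h" using a by (auto intro: ac_continuous)
  have [measurable]: "f \<in> borel_measurable borel" "h \<in> borel_measurable borel" "V \<in> borel_measurable borel"
    using cf R.V_cont by (auto intro: borel_measurable_continuous_onI)
  have V2: "integrable lborel (\<lambda>x. (V x)\<^sup>2 * nsq f h x)"
    by (rule separation[OF s V_low V_deriv dV_cont dV_bound])
  have sqV: "square_integrable (\<lambda>x. V x *\<^sub>R of_parts (f x) (h x))"
  proof -
    have "(\<lambda>x. (norm (V x *\<^sub>R of_parts (f x) (h x)))\<^sup>2) = (\<lambda>x. (V x)\<^sup>2 * nsq f h x / 2)"
    proof
      fix x
      show "(norm (V x *\<^sub>R of_parts (f x) (h x)))\<^sup>2 = (V x)\<^sup>2 * nsq f h x / 2"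
        using norm_of_parts[of "f x" "h x"] by (simp add: nsq_def power_mult_distrib flip: norm_of_parts)
    qed
    moreover have "(\<lambda>x. V x *\<^sub>R of_parts (f x) (h x)) \<in> borel_measurable borel" by measurable
    ultimately show ?thesis using V2 by (simp add: square_integrable_def)
  qed
  have sqF: "square_integrable (\<lambda>x. of_parts (f x) (h x))"
    by (rule square_integrable_of_parts) (use N in simp_all)
  let ?w = "\<lambda>x. of_parts (?W x * f x + of_real m * h x + src1 g x) (of_real m * f x - ?W x * h x + src2 g x)"
  have w: "(- \<i>) *s (\<sigma>\<^sub>1 *v ?w x) + of_real m *s (\<sigma>\<^sub>3 *v of_parts (f x) (h x)) +
      (\<i> * of_real (V x)) *s of_parts (f x) (h x) - z *s of_parts (f x) (h x) = rep_L2 g x" for x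
    unfolding dirac_pointwise by (simp add: W_def src1_def src2_def)
  have "square_integrable ?w"
  proof -
    \<comment> \<open>The equation solved for the derivative: \<open>\<sigma>\<^sub>1\<close> is its
      own inverse, so applying it to \<open>?r\<close>, a sum of square integrable terms, returns
      \<open>?w\<close>.\<close>
    let ?r = "\<lambda>x. \<i> *s (rep_L2 g x - of_real m *s (\<sigma>\<^sub>3 *v of_parts (f x) (h x)) -
      \<i> *s (V x *\<^sub>R of_parts (f x) (h x)) + z *s of_parts (f x) (h x))"
    have "square_integrable ?r"
      by (intro square_integrable_scaleC square_integrable_add square_integrable_diff sq_rep sqV sqF
          square_integrable_linear[OF bounded_linear_matrix])
    from square_integrable_linear[OF bounded_linear_matrix this, of \<sigma>\<^sub>1]
    have "square_integrable (\<lambda>x. \<sigma>\<^sub>1 *v ?r x)" .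
    moreover have "\<sigma>\<^sub>1 *v ?r x = ?w x" for x
      by (rule parts_eqI; simp add: parts_of_add parts_sigma scaleR_eq_scalar_mult W_def src1_def src2_def algebra_simps)
    ultimately show ?thesis by simp
  qed
  then have rw: "AE x in lborel. rep_L2 (abs_L2 ?w) x = ?w x" by (rule rep_abs)
  have "ac (\<lambda>x. of_parts (f x) (h x)) (rep_L2 (abs_L2 ?w))"
    by (rule ac_AE[OF ac_of_parts[OF a]]) (use rw in eventually_elim, simp)
  then have hw: "has_weak_derivative u (abs_L2 ?w)" by (rule has_weak_derivativeI[OF _ r])
  have "square_integrable (\<lambda>x. V x *\<^sub>R rep_L2 u x)"
  proof (rule square_integrable_cong_AE[OF sqV])
    show "(\<lambda>x. V x *\<^sub>R rep_L2 u x) \<in> borel_measurable borel" using rep_meas[of u] by measurable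
    show "AE x in lborel. V x *\<^sub>R of_parts (f x) (h x) = V x *\<^sub>R rep_L2 u x" using r by eventually_elim simp
  qed
  then show d: "u \<in> fst A" using hw by (auto simp: dirac_operator_def Sobolev_H1_def multiplication_domain_def)
  show "shifted A z u = g"
  proof (rule L2_eqI)
    show "AE x in lborel. rep_L2 (shifted A z u) x = rep_L2 g x"
      using in_domain(3)[OF d, of z] r rw unfolding weak_derivative_eq[OF hw]
      by eventually_elim (simp only: w)
  qed
qed

lemma solves_abs:
  assumes s: "L2sol (- \<i> * z) f h (src1 g) (src2 g)" shows "\<exists>u. solves z f h u g"
proof -
  have sl: "sol m (W (- \<i> * z)) f h (src1 g) (src2 g)" and N: "integrable lborel (nsq f h)"
    using s by (auto simp: L2sol_def)
  have "square_integrable (\<lambda>x. of_parts (f x) (h x))"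
    by (intro square_integrable_of_parts N borel_measurable_continuous_onI sol_cont[OF sl])
  from rep_abs[OF this] show ?thesis using s by (auto simp: solves_def)
qed

lemma solves_iff_range: "g \<in> shifted A z ` fst A \<longleftrightarrow> (\<exists>f h. L2sol (- \<i> * z) f h (src1 g) (src2 g))"
proof
  assume "g \<in> shifted A z ` fst A"
  then show "\<exists>f h. L2sol (- \<i> * z) f h (src1 g) (src2 g)" using solves_of_domain by (force simp: solves_def)
next
  assume "\<exists>f h. L2sol (- \<i> * z) f h (src1 g) (src2 g)"
  then show "g \<in> shifted A z ` fst A" using solves_abs domain_of_solves by (metis imageI)
qed

lemma L2sol_src_AE:
  assumes "L2sol \<zeta> f h G H" "AE x in lborel. G x = src1 g x" "AE x in lborel. H x = src2 g x"
  shows "L2sol \<zeta> f h (src1 g) (src2 g)"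
  by (rule L2sol_AE[OF assms(1) src_L2c assms(2,3)])

lemma src_0: "AE x in lborel. src1 0 x = 0" "AE x in lborel. src2 0 x = 0"
proof -
  show "AE x in lborel. src1 0 x = 0" using rep_0 by eventually_elim (simp add: src1_def sum_part_def)
  show "AE x in lborel. src2 0 x = 0" using rep_0 by eventually_elim (simp add: src2_def diff_part_def)
qed

lemma solves_zero_iff:
  "L2sol \<zeta> f h (src1 0) (src2 0) \<longleftrightarrow> L2sol \<zeta> f h (\<lambda>x. 0) (\<lambda>x. 0)"
proof
  assume "L2sol \<zeta> f h (src1 0) (src2 0)"
  from L2sol_AE[OF this L2c_0 L2c_0 src_0] show "L2sol \<zeta> f h (\<lambda>x. 0) (\<lambda>x. 0)" .
next
  assume s: "L2sol \<zeta> f h (\<lambda>x. 0) (\<lambda>x. 0)"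
  show "L2sol \<zeta> f h (src1 0) (src2 0)"
    by (rule L2sol_src_AE[OF s]) (use src_0 in \<open>eventually_elim, simp\<close>)+
qed

lemma solves_diff:
  assumes a: "solves z f h u g" and b: "solves z f' h' u' g'"
  shows "solves z (\<lambda>x. f x - k * f' x) (\<lambda>x. h x - k * h' x) (u - k *\<^sub>C u') (g - k *\<^sub>C g')"
proof -
  let ?f = "\<lambda>x. f x - k * f' x" and ?h = "\<lambda>x. h x - k * h' x"
  have s: "sol m (W (- \<i> * z)) ?f ?h (\<lambda>x. src1 g x - k * src1 g' x) (\<lambda>x. src2 g x - k * src2 g' x)"
    by (rule sol_diff_scale[OF solves_sol[OF a] solves_sol[OF b]])
  have r: "AE x in lborel. rep_L2 (u - k *\<^sub>C u') x = of_parts (?f x) (?h x)"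
    using a[unfolded solves_def, THEN conjunct2] b[unfolded solves_def, THEN conjunct2]
      rep_diff[of u "k *\<^sub>C u'"] rep_scaleC[of k u']
    by eventually_elim (rule parts_eqI; simp add: parts_of_add)
  have "AE x in lborel. rep_L2 (g - k *\<^sub>C g') x = rep_L2 g x - k *s rep_L2 g' x"
    using rep_diff[of g "k *\<^sub>C g'"] rep_scaleC[of k g'] by eventually_elim simp
  then have g: "AE x in lborel. src1 (g - k *\<^sub>C g') x = src1 g x - k * src1 g' x \<and>
    src2 (g - k *\<^sub>C g') x = src2 g x - k * src2 g' x"
    by eventually_elim (simp add: src1_def src2_def parts_of_add right_diff_distrib mult.left_commute)
  have N: "integrable lborel (nsq ?f ?h)" by (rule sol_nsq(1)[OF sol_cont[OF s] r])
  have ac: "ac ?f (\<lambda>x. W (- \<i> * z) x * ?f x + of_real m * ?h x + (src1 g x - k * src1 g' x))"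
    "ac ?h (\<lambda>x. of_real m * ?f x - W (- \<i> * z) x * ?h x + (src2 g x - k * src2 g' x))"
    using s by (auto simp: sol_def)
  have "ac ?f (\<lambda>x. W (- \<i> * z) x * ?f x + of_real m * ?h x + src1 (g - k *\<^sub>C g') x)"
    by (rule ac_AE[OF ac(1)]) (use g in eventually_elim, simp)
  moreover have "ac ?h (\<lambda>x. of_real m * ?f x - W (- \<i> * z) x * ?h x + src2 (g - k *\<^sub>C g') x)"
    by (rule ac_AE[OF ac(2)]) (use g in eventually_elim, simp)
  ultimately show ?thesis using N r src_L2c by (simp add: solves_def L2sol_def sol_def)
qed

lemma domain_zero: "0 \<in> fst A"
proof -
  have "L2sol 0 (\<lambda>x. 0) (\<lambda>x. 0) (\<lambda>x. 0) (\<lambda>x. 0)"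
    using ac_const[of "0 :: complex"] by (simp add: L2sol_def sol_def L2c_0 nsq_def[abs_def])
  then have "L2sol (- \<i> * 0) (\<lambda>x. 0) (\<lambda>x. 0) (src1 0) (src2 0)" by (simp add: solves_zero_iff)
  moreover have "AE x in lborel. rep_L2 0 x = of_parts 0 0"
    using rep_0 by eventually_elim (simp add: of_parts_def vec_eq_iff)
  ultimately have "solves 0 (\<lambda>x. 0) (\<lambda>x. 0) 0 0" by (simp add: solves_def)
  then show ?thesis by (rule domain_of_solves)
qed

text \<open>One operation for both linearity laws: \<open>k = - 1\<close> gives sums and
  \<open>u = 0\<close> gives multiples.\<close>

lemma domain_diff:
  assumes "u \<in> fst A" "u' \<in> fst A"
  shows "u - k *\<^sub>C u' \<in> fst A" and "snd A (u - k *\<^sub>C u') = snd A u - k *\<^sub>C snd A u'"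
proof -
  obtain f h f' h' where "solves 0 f h u (shifted A 0 u)" "solves 0 f' h' u' (shifted A 0 u')"
    using solves_of_domain assms by metis
  note s = solves_diff[OF this, of k]
  show "u - k *\<^sub>C u' \<in> fst A" by (rule domain_of_solves(1)[OF s])
  show "snd A (u - k *\<^sub>C u') = snd A u - k *\<^sub>C snd A u'"
    using domain_of_solves(2)[OF s] by (simp add: shifted_def)
qed

lemma bump_in_domain:
  assumes \<beta>: "\<beta> \<in> bumps" shows "square_integrable (\<lambda>x. \<beta> x *\<^sub>R e)" and "abs_L2 (\<lambda>x. \<beta> x *\<^sub>R e) \<in> fst A"
proof -
  have t: "test_function \<beta>" by (rule bumps_test_function[OF \<beta>])
  note d = test_function_deriv[OF t]
  obtain R where R: "\<And>x. \<bar>x\<bar> > R \<Longrightarrow> \<beta> x = 0 \<and> deriv \<beta> x = 0" using d(3) by blast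
  have c: "continuous_on UNIV \<beta>" by (rule bumps_continuous[OF \<beta>])
  show s: "square_integrable (\<lambda>x. \<beta> x *\<^sub>R e)"
    by (rule square_integrable_compact_support[of _ R]) (use R in \<open>auto intro!: continuous_intros c\<close>)
  have s1: "square_integrable (\<lambda>x. deriv \<beta> x *\<^sub>R e)"
    by (rule square_integrable_compact_support[of _ R]) (use R in \<open>auto intro!: continuous_intros d(2)\<close>)
  have sV: "square_integrable (\<lambda>x. V x *\<^sub>R \<beta> x *\<^sub>R e)"
    by (rule square_integrable_compact_support[of _ R]) (use R in \<open>auto intro!: continuous_intros c R.V_cont\<close>)
  have "ac \<beta> (deriv \<beta>)"
    by (rule ac_C1[OF _ d(2)]) (use d(1) in \<open>simp add: has_real_derivative_iff_has_vector_derivative\<close>)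
  from ac_linear[OF this bounded_linear_scaleR_left]
  have "ac (\<lambda>x. \<beta> x *\<^sub>R e) (rep_L2 (abs_L2 (\<lambda>x. deriv \<beta> x *\<^sub>R e)))"
    by (rule ac_AE) (use rep_abs[OF s1] in eventually_elim, simp)
  from has_weak_derivativeI[OF this rep_abs[OF s]]
  have "abs_L2 (\<lambda>x. \<beta> x *\<^sub>R e) \<in> Sobolev_H1" by (auto simp: Sobolev_H1_def)
  moreover have "square_integrable (\<lambda>x. V x *\<^sub>R rep_L2 (abs_L2 (\<lambda>x. \<beta> x *\<^sub>R e)) x)"
  proof (rule square_integrable_cong_AE[OF sV])
    have "V \<in> borel_measurable borel" by (rule borel_measurable_continuous_onI[OF R.V_cont])
    then show "(\<lambda>x. V x *\<^sub>R rep_L2 (abs_L2 (\<lambda>x. \<beta> x *\<^sub>R e)) x) \<in> borel_measurable borel"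
      using rep_meas by measurable
    show "AE x in lborel. V x *\<^sub>R \<beta> x *\<^sub>R e = V x *\<^sub>R rep_L2 (abs_L2 (\<lambda>x. \<beta> x *\<^sub>R e)) x"
      using rep_abs[OF s] by eventually_elim simp
  qed
  ultimately show "abs_L2 (\<lambda>x. \<beta> x *\<^sub>R e) \<in> fst A" by (simp add: dirac_operator_def multiplication_domain_def)
qed

lemma domain_dense:
  assumes o: "\<And>u. u \<in> fst A \<Longrightarrow> u \<bullet> w = 0" shows "w = 0"
proof (rule L2_eqI)
  have "AE x in lborel. rep_L2 w x = 0"
  proof (rule AE_zero_of_test_integrals[OF rep_meas rep_interval(2)])
    fix \<beta> assume \<beta>: "\<beta> \<in> bumps"
    have t: "test_function \<beta>" by (rule bumps_test_function[OF \<beta>])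
    note i = integrable_test_rep[OF t, of w]
    show "integral\<^sup>L lborel (\<lambda>x. \<beta> x *\<^sub>R rep_L2 w x) = 0"
    proof (rule euclidean_eqI)
      fix e :: "complex^2" assume "e \<in> Basis"
      note s = bump_in_domain[OF \<beta>, of e]
      have "abs_L2 (\<lambda>x. \<beta> x *\<^sub>R e) \<bullet> w = integral\<^sup>L lborel (\<lambda>x. (\<beta> x *\<^sub>R rep_L2 w x) \<bullet> e)"
        unfolding inner_L2_eq
      proof (rule integral_cong_AE)
        show "(\<lambda>x. rep_L2 (abs_L2 (\<lambda>x. \<beta> x *\<^sub>R e)) x \<bullet> rep_L2 w x) \<in> borel_measurable lborel"
          by (rule borel_measurable_integrable[OF integrable_inner_square_integrable[OF sq_rep sq_rep]])
        show "(\<lambda>x. (\<beta> x *\<^sub>R rep_L2 w x) \<bullet> e) \<in> borel_measurable lborel"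
          by (intro borel_measurable_inner borel_measurable_const borel_measurable_integrable[OF i])
        show "AE x in lborel. rep_L2 (abs_L2 (\<lambda>x. \<beta> x *\<^sub>R e)) x \<bullet> rep_L2 w x = (\<beta> x *\<^sub>R rep_L2 w x) \<bullet> e"
          using rep_abs[OF s(1)] by eventually_elim (simp add: inner_commute)
      qed
      then show "integral\<^sup>L lborel (\<lambda>x. \<beta> x *\<^sub>R rep_L2 w x) \<bullet> e = 0 \<bullet> e"
        using o[OF s(2)] integral_inner_left[OF i, of e] by simp
    qed
  qed
  then show "AE x in lborel. rep_L2 w x = rep_L2 0 x" using rep_0 by eventually_elim simp
qed

lemma domain_proper: "fst A \<noteq> UNIV"
proof
  assume U: "fst A = UNIV"
  define e :: "complex^2" where "e = axis 1 1"
  let ?f = "\<lambda>x. indicator {0..1::real} x *\<^sub>R e"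
  have s: "square_integrable ?f" unfolding square_integrable_def
  proof
    show "?f \<in> borel_measurable lborel" by measurable
    have "(\<lambda>x. (norm (?f x))\<^sup>2) = (\<lambda>x. (norm e)\<^sup>2 * indicator {0..1} x)" by (auto simp: indicator_def fun_eq_iff)
    moreover have "integrable lborel (\<lambda>x. (norm e)\<^sup>2 * indicator {0..1::real} x)"
      by (intro integrable_mult_right integrable_real_indicator) auto
    ultimately show "integrable lborel (\<lambda>x. (norm (?f x))\<^sup>2)" by simp
  qed
  have mem: "abs_L2 ?f \<in> fst A" using U by simp
  obtain F where F: "ac F (rep_L2 (weak_derivative (abs_L2 ?f)))" "AE x in lborel. rep_L2 (abs_L2 ?f) x = F x"
    using has_weak_derivativeD[OF in_domain(1)[OF mem]] .
  have "AE x in lborel. ?f x = F x" using F(2) rep_abs[OF s] by eventually_elim simp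
  then have "e = 0" by (rule indicator_not_continuous[OF ac_continuous[OF F(1)]])
  then show False by (simp add: e_def axis_eq_0_iff)
qed

text \<open>\<open>L2sol_low\<close> gives the factor \<open>v - Im z\<close>; replacing
  \<open>- v\<close> by \<open>max 0 (- v)\<close> makes the shift nonnegative. If
  \<open>v \<le> Im z\<close>, the left-hand side is not positive.\<close>

lemma low_bound: assumes u: "u \<in> fst A" shows "(- Im z - max 0 (- v)) * norm u \<le> norm (shifted A z u)"
proof (cases "v - Im z > 0")
  case True
  obtain f h where s: "solves z f h u (shifted A z u)" using solves_of_domain[OF u] by blast
  have "(v - Im z)\<^sup>2 * (2 * (norm u)\<^sup>2) \<le> 2 * (norm (shifted A z u))\<^sup>2"
    using L2sol_low[of "- \<i> * z" f h "src1 (shifted A z u)" "src2 (shifted A z u)" v] s V_low True solves_norm[OF s] src_norm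
    by (simp add: solves_def)
  then have "((v - Im z) * norm u)\<^sup>2 \<le> (norm (shifted A z u))\<^sup>2" by (simp add: power_mult_distrib)
  then have "(v - Im z) * norm u \<le> norm (shifted A z u)" by (rule power2_le_imp_le) simp
  moreover have "(- Im z - max 0 (- v)) * norm u \<le> (v - Im z) * norm u" by (intro mult_right_mono) auto
  ultimately show ?thesis by linarith
next
  case False
  then have "(- Im z - max 0 (- v)) * norm u \<le> 0 * norm u" by (intro mult_right_mono) auto
  then show ?thesis by (rule order_trans) simp
qed

lemma imaginary_bound: assumes u: "u \<in> fst A" and z: "Re z = 0" shows "m * norm u \<le> norm (shifted A z u)"
proof -
  obtain f h where s: "solves z f h u (shifted A z u)" using solves_of_domain[OF u] by blast
  have "m\<^sup>2 * (2 * (norm u)\<^sup>2) \<le> 2 * (norm (shifted A z u))\<^sup>2"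
    using L2sol_real[of "- \<i> * z" f h "src1 (shifted A z u)" "src2 (shifted A z u)"] s z solves_norm[OF s] src_norm
    by (simp add: solves_def)
  then have "(m * norm u)\<^sup>2 \<le> (norm (shifted A z u))\<^sup>2" by (simp add: power_mult_distrib)
  then show ?thesis by (rule power2_le_imp_le) simp
qed

lemma kernel_vector:
  assumes D: "Det (- \<i> * z) = 0"
  shows "\<exists>e\<in>fst A. e \<noteq> 0 \<and> shifted A z e = 0 \<and> (\<forall>u\<in>fst A. shifted A z u = 0 \<longrightarrow> (\<exists>k. u = k *\<^sub>C e))"
proof -
  let ?f = "R.fp (- \<i> * z)" and ?h = "R.hp (- \<i> * z)"
  have "L2sol (- \<i> * z) ?f ?h (src1 0) (src2 0)" using kernel(1)[OF D] by (simp only: solves_zero_iff)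
  then obtain e where e: "solves z ?f ?h e 0" using solves_abs by blast
  have er: "AE x in lborel. rep_L2 e x = of_parts (?f x) (?h x)" using e by (simp add: solves_def)
  have "e \<noteq> 0"
  proof
    assume "e = 0"
    then have ae: "AE x in lborel. of_parts (?f x) (?h x) = 0" using er rep_0 by (auto elim: eventually_elim2)
    obtain x :: real where "0 < x" "x < 1" "of_parts (?f x) (?h x) = 0"
      using AE_interval_point[OF ae zero_less_one] .
    then have "nsq ?f ?h x = 0" using norm_of_parts[of "?f x" "?h x"] by (simp add: nsq_def)
    then show False using R.jost_nonzero by blast
  qed
  moreover have "\<exists>k. u = k *\<^sub>C e" if u: "u \<in> fst A" "shifted A z u = 0" for u
  proof -
    obtain f h where s: "solves z f h u 0" using solves_of_domain[OF u(1), of z] u(2) by auto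
    then have "L2sol (- \<i> * z) f h (\<lambda>x. 0) (\<lambda>x. 0)" by (simp only: solves_def solves_zero_iff)
    from kernel(2)[OF D this] obtain k where k: "\<And>x. f x = k * ?f x \<and> h x = k * ?h x" by blast
    have "u = k *\<^sub>C e"
    proof (rule L2_eqI)
      show "AE x in lborel. rep_L2 u x = rep_L2 (k *\<^sub>C e) x"
        using s[unfolded solves_def, THEN conjunct2] er rep_scaleC[of k e]
        by eventually_elim (rule parts_eqI; simp add: parts_of_add k)
    qed
    then show ?thesis by blast
  qed
  ultimately show ?thesis using domain_of_solves[OF e] by blast
qed

lemma range_kernel:
  assumes D: "Det (- \<i> * z) = 0"
  shows "\<exists>e. shifted A z ` fst A = {g. cinner g e = 0}"
proof -
  obtain p q where p: "L2c p" "L2c q" and pq: "\<And>G H. L2c G \<Longrightarrow> L2c H \<Longrightarrow>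
    cb (- \<i> * z) G H - kap (- \<i> * z) * ca (- \<i> * z) G H = integral\<^sup>L lborel (\<lambda>x. p x * G x + q x * H x)"
    using range_functional[of "- \<i> * z"] by blast
  \<comment> \<open>The conjugates compensate the antilinearity of \<open>cinner\<close> in its
    second argument, the factors \<open>2\<close> the \<open>1/2\<close> of
    \<open>cinner_parts\<close>, and the factors \<open>\<i>\<close> those in \<open>src1\<close>
    and \<open>src2\<close>.\<close>
  let ?e = "\<lambda>x. of_parts (2 * cnj (\<i> * p x)) (2 * \<i> * cnj (q x))"
  have [measurable]: "cnj \<in> borel_measurable borel" by (rule borel_measurable_continuous_onI) (intro continuous_intros)
  have [measurable]: "p \<in> borel_measurable borel" "q \<in> borel_measurable borel" using p by (auto simp: L2c_def)
  have "square_integrable ?e"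
  proof (rule square_integrable_of_parts)
    have "nsq (\<lambda>x. 2 * cnj (\<i> * p x)) (\<lambda>x. 2 * \<i> * cnj (q x)) = (\<lambda>x. 4 * nsq p q x)"
      by (rule ext) (simp add: nsq_def norm_mult power_mult_distrib)
    then show "integrable lborel (nsq (\<lambda>x. 2 * cnj (\<i> * p x)) (\<lambda>x. 2 * \<i> * cnj (q x)))" using L2c_nsq[OF p] by simp
  qed measurable
  then have re: "AE x in lborel. rep_L2 (abs_L2 ?e) x = ?e x" by (rule rep_abs)
  have ci: "cinner g (abs_L2 ?e) = integral\<^sup>L lborel (\<lambda>x. p x * src1 g x + q x * src2 g x)" for g
    unfolding cinner_parts
  proof (rule integral_cong_AE)
    note rep_meas[measurable]
    have [measurable]: "src1 g \<in> borel_measurable borel" "src2 g \<in> borel_measurable borel" using src_L2c by (auto simp: L2c_def)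
    show "(\<lambda>x. p x * src1 g x + q x * src2 g x) \<in> borel_measurable lborel" by simp
    show "(\<lambda>x. (sum_part (rep_L2 g x) * cnj (sum_part (rep_L2 (abs_L2 ?e) x)) +
      diff_part (rep_L2 g x) * cnj (diff_part (rep_L2 (abs_L2 ?e) x))) / 2) \<in> borel_measurable lborel" by simp
    show "AE x in lborel. (sum_part (rep_L2 g x) * cnj (sum_part (rep_L2 (abs_L2 ?e) x)) +
      diff_part (rep_L2 g x) * cnj (diff_part (rep_L2 (abs_L2 ?e) x))) / 2 = p x * src1 g x + q x * src2 g x"
      using re by eventually_elim (simp add: src1_def src2_def diff_divide_distrib add_divide_distrib algebra_simps)
  qed
  have "g \<in> shifted A z ` fst A \<longleftrightarrow> cinner g (abs_L2 ?e) = 0" for g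
    unfolding solves_iff_range range_condition[OF D src_L2c] pq[OF src_L2c] ci ..
  then have "shifted A z ` fst A = {g. cinner g (abs_L2 ?e) = 0}" by blast
  then show ?thesis by blast
qed

lemma determinant: "\<exists>C. determinant_operator A (\<lambda>z. Det (- \<i> * z)) R.\<rho> C (max 0 (- v)) m"
proof -
  obtain C where C: "C > 0" and D: "\<And>z. cmod (Det z) \<le> exp (C * (1 + cmod z) powr R.\<rho>)"
    and ap: "\<And>z f h G H. L2sol z f h G H \<Longrightarrow> (cmod (Det z))\<^sup>2 * integral\<^sup>L lborel (nsq f h)
      \<le> exp (C * (1 + cmod z) powr R.\<rho>) * integral\<^sup>L lborel (nsq G H)"
    using growth by blast
  have "determinant_operator A (\<lambda>z. Det (- \<i> * z)) R.\<rho> C (max 0 (- v)) m"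
  proof
    show "0 \<in> fst A" by (rule domain_zero)
    show "u + w \<in> fst A" "snd A (u + w) = snd A u + snd A w" if "u \<in> fst A" "w \<in> fst A" for u w
      using domain_diff[OF that, of "- 1"] by (simp_all add: scaleC_minus_left)
    show "k *\<^sub>C u \<in> fst A" "snd A (k *\<^sub>C u) = k *\<^sub>C snd A u" if u: "u \<in> fst A" for k u
    proof -
      have z: "snd A 0 = 0" using domain_diff(2)[OF domain_zero domain_zero, of 1] by simp
      show "k *\<^sub>C u \<in> fst A" "snd A (k *\<^sub>C u) = k *\<^sub>C snd A u"
        using domain_diff[OF domain_zero u, of "- k"] z by (simp_all add: scaleC_minus_left)
    qed
    show "0 < R.\<rho>" "R.\<rho> < 2" using R.rho by auto
    show "0 < C" "0 < m" "0 \<le> max 0 (- v)" using C R.m by auto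
    have "Det \<circ> (\<lambda>z. - \<i> * z) holomorphic_on UNIV"
      by (rule holomorphic_on_compose_gen[OF _ Det_holomorphic]) (auto intro!: holomorphic_intros)
    then show "(\<lambda>z. Det (- \<i> * z)) holomorphic_on UNIV" by (simp add: o_def)
    show "cmod (Det (- \<i> * z)) \<le> exp (C * (1 + cmod z) powr R.\<rho>)" for z
      using D[of "- \<i> * z"] by (simp add: norm_mult)
    show "cmod (Det (- \<i> * z)) * norm u \<le> exp (C * (1 + cmod z) powr R.\<rho>) * norm (shifted A z u)" if u: "u \<in> fst A" for z u
    proof -
      let ?g = "shifted A z u" and ?E = "exp (C * (1 + cmod z) powr R.\<rho>)"
      obtain f h where s: "solves z f h u ?g" using solves_of_domain[OF u] by blast
      have "(cmod (Det (- \<i> * z)))\<^sup>2 * (2 * (norm u)\<^sup>2) \<le> ?E * (2 * (norm ?g)\<^sup>2)"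
        using ap[of "- \<i> * z" f h "src1 ?g" "src2 ?g"] s solves_norm[OF s] src_norm[of ?g]
        by (simp add: solves_def norm_mult)
      \<comment> \<open>The growth estimate is quadratic in \<open>Det\<close> but has a single
        exponential on the right; as \<open>?E \<ge> 1\<close>, squaring it prepares the square
        root.\<close>
      also have "\<dots> \<le> ?E\<^sup>2 * (2 * (norm ?g)\<^sup>2)"
        using C self_le_power[of ?E 2] by (intro mult_right_mono) auto
      finally have "(cmod (Det (- \<i> * z)) * norm u)\<^sup>2 \<le> (?E * norm ?g)\<^sup>2" by (simp add: power_mult_distrib)
      then show ?thesis by (rule power2_le_imp_le) simp
    qed
    show "\<exists>u\<in>fst A. shifted A z u = g" if "Det (- \<i> * z) \<noteq> 0" for z g
      using L2sol_solvable[OF that src_L2c] solves_iff_range[of g z] by auto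
    show "\<exists>e\<in>fst A. e \<noteq> 0 \<and> shifted A z e = 0 \<and> (\<forall>u\<in>fst A. shifted A z u = 0 \<longrightarrow> (\<exists>k. u = k *\<^sub>C e))"
      if "Det (- \<i> * z) = 0" for z by (rule kernel_vector[OF that])
    show "\<exists>l :: L2 \<Rightarrow> complex. (\<forall>u v. l (u + v) = l u + l v) \<and> (\<forall>k u. l (k *\<^sub>C u) = k * l u) \<and>
      (\<exists>K. \<forall>u. cmod (l u) \<le> K * norm u) \<and> shifted A z ` fst A = {g. l g = 0}" if D: "Det (- \<i> * z) = 0" for z
    proof -
      obtain e where e: "shifted A z ` fst A = {g. cinner g e = 0}" using range_kernel[OF D] by blast
      have "\<exists>K. \<forall>u. cmod (cinner u e) \<le> K * norm u"
        using cmod_cinner_le[of _ e] by (intro exI[of _ "2 * norm e"]) (simp add: mult_ac)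
      then show ?thesis
        using e by (intro exI[of _ "\<lambda>g. cinner g e"]) (simp add: cinner_add_left cinner_scaleC_left)
    qed
    show "m * norm u \<le> norm (shifted A z u)" if "Re z = 0" "u \<in> fst A" for z u
      by (rule imaginary_bound[OF that(2,1)])
    show "(- Im z - max 0 (- v)) * norm u \<le> norm (shifted A z u)" if "u \<in> fst A" for z u
      by (rule low_bound[OF that])
    show "w = 0" if "\<And>u. u \<in> fst A \<Longrightarrow> u \<bullet> w = 0" for w by (rule domain_dense[OF that])
    show "fst A \<noteq> UNIV" by (rule domain_proper)
  qed
  then show ?thesis by blast
qed

end

section \<open>From the assumptions on the potential to the estimates\<close>

lemma jost_of_growth:
  fixes V dV :: "real \<Rightarrow> real"
  assumes d: "\<And>x. (V has_real_derivative dV x) (at x)" and p: "\<And>x. x > a \<Longrightarrow> dV x > 0"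
    and g: "\<And>x. x > b \<Longrightarrow> japanese_bracket x powr \<gamma> \<le> C * V x" and C: "C > 0"
    and m: "m > 0" and \<gamma>: "\<gamma> > 1" and X: "X \<ge> 1" "X > a" "X > b"
  shows "jost V m \<gamma> (1 / C) X"
proof
  show "continuous_on UNIV V" using d by (intro DERIV_continuous_on) auto
  show "1 / C * x powr \<gamma> \<le> V x" if x: "x \<ge> X" for x
  proof -
    have "x \<le> japanese_bracket x" unfolding japanese_bracket_def by (rule real_le_rsqrt) simp
    then have "x powr \<gamma> \<le> japanese_bracket x powr \<gamma>" using x X \<gamma> by (intro powr_mono2) auto
    also have "\<dots> \<le> C * V x" using g x X by simp
    finally show ?thesis using C by (simp add: field_simps)
  qed
  show "V x \<le> V y" if "X \<le> x" "x \<le> y" for x y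
  proof (rule DERIV_nonneg_imp_nondecreasing[OF that(2)])
    fix t assume "x \<le> t" "t \<le> y"
    then show "\<exists>y. (V has_real_derivative y) (at t) \<and> 0 \<le> y" using d p[of t] that X by (intro exI[of _ "dV t"]) auto
  qed
qed (use C m \<gamma> X in auto)

text \<open>Beyond \<open>X\<close> the growth and the signs of the derivative give the two
  half-line instances; reflection turns the decreasing left branch of \<open>V\<close> into an
  increasing right one. On \<open>{- X..X}\<close> continuity and compactness supply the bounds for
  \<open>V\<close> and its derivative.\<close>

lemma dirac_of_admissible:
  assumes m: "m > 0" and V: "admissible_potential V" and \<gamma>: "\<gamma> > 1"
    and g: "lesssim_on {x. \<bar>x\<bar> > x0} (\<lambda>x. japanese_bracket x powr \<gamma>) V"
  shows "\<exists>c X v B. dirac V m \<gamma> c X v B (deriv V)"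
proof -
  obtain D where D: "\<And>x. (V has_vector_derivative D x) (at x)" "continuous_on UNIV D"
    using V by (auto simp: admissible_potential_def C1_differentiable_on_def)
  have DV: "(V has_real_derivative D x) (at x)" for x
    using D(1) by (simp add: has_real_derivative_iff_has_vector_derivative)
  then have "deriv V = D" by (auto simp: fun_eq_iff intro: DERIV_imp_deriv)
  then have d: "(V has_real_derivative deriv V x) (at x)" and dc: "continuous_on UNIV (deriv V)" for x
    using DV D(2) by auto
  obtain x1 C1 where x1: "x1 > 1" and pos: "\<And>x. x > x1 \<Longrightarrow> deriv V x > 0" and neg: "\<And>x. x < - x1 \<Longrightarrow> deriv V x < 0"
    and C1: "C1 > 0" "\<And>x. \<bar>x\<bar> > x1 \<Longrightarrow> \<bar>deriv V x\<bar> \<le> C1 * (V x / \<bar>x\<bar>)"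
    using V by (auto simp: admissible_potential_def lesssim_on_def)
  obtain C where C: "C > 0" "\<And>x. \<bar>x\<bar> > x0 \<Longrightarrow> japanese_bracket x powr \<gamma> \<le> C * V x"
    using g by (auto simp: lesssim_on_def)
  define X where "X = max x1 x0 + 1"
  have X: "X \<ge> 1" "X > x1" "X > x0" using x1 by (auto simp: X_def)
  have j1: "jost V m \<gamma> (1 / C) X"
    by (rule jost_of_growth[OF d pos _ C(1) m \<gamma> X]) (use C(2) in auto)
  have jb: "japanese_bracket (- x) = japanese_bracket x" for x by (simp add: japanese_bracket_def)
  have d': "((\<lambda>x. V (- x)) has_real_derivative - deriv V (- x)) (at x)" for x
    using DERIV_mirror[of V "deriv V (- x)" x] d[of "- x"] by simp
  have j2: "jost (\<lambda>x. V (- x)) m \<gamma> (1 / C) X"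
  proof (rule jost_of_growth[OF d' _ _ C(1) m \<gamma> X])
    show "0 < - deriv V (- x)" if "x > x1" for x using neg[of "- x"] that by simp
    show "japanese_bracket x powr \<gamma> \<le> C * V (- x)" if "x > x0" for x using C(2)[of "- x"] that jb by auto
  qed
  have cV: "continuous_on UNIV V" using d by (intro DERIV_continuous_on) auto
  have V0: "V x \<ge> 0" if "\<bar>x\<bar> > x0" for x
  proof -
    have "0 \<le> C * V x" using order_trans[OF powr_ge_zero C(2)[OF that]] .
    then show ?thesis using C(1) by (simp add: zero_le_mult_iff)
  qed
  have bd: "\<exists>M. \<forall>x\<in>{- X..X}. \<bar>f x\<bar> \<le> M" if "continuous_on UNIV f" for f :: "real \<Rightarrow> real"
  proof -
    have "bounded (f ` {- X..X})"
      by (rule compact_imp_bounded[OF compact_continuous_image[OF continuous_on_subset[OF that]]]) auto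
    then show ?thesis by (simp add: bounded_iff)
  qed
  obtain M where M: "\<And>x. x \<in> {- X..X} \<Longrightarrow> \<bar>V x\<bar> \<le> M" using bd[OF cV] by blast
  obtain M' where M': "\<And>x. x \<in> {- X..X} \<Longrightarrow> \<bar>deriv V x\<bar> \<le> M'" using bd[OF dc] by blast
  have low: "V x \<ge> min 0 (- M)" for x
  proof (cases "x \<in> {- X..X}")
    case True
    then show ?thesis using M[OF True] by linarith
  next
    case False
    then have "\<bar>x\<bar> > x0" using X by auto
    then show ?thesis using V0[of x] by linarith
  qed
  \<comment> \<open>On the compact part the root is at least \<open>1\<close>, so the bound
    \<open>M'\<close> suffices. Outside, \<open>\<bar>x\<bar> \<ge> 1\<close> turns the bound by
    \<open>V x / \<bar>x\<bar>\<close> into one by \<open>V x\<close>, which is below the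
    root.\<close>
  have "\<bar>deriv V x\<bar> \<le> max C1 M' * sqrt (1 + (V x)\<^sup>2)" for x
  proof (cases "x \<in> {- X..X}")
    case True
    have "\<bar>deriv V x\<bar> * 1 \<le> max C1 M' * sqrt (1 + (V x)\<^sup>2)"
      using M'[OF True] C1(1) by (intro mult_mono) auto
    then show ?thesis by simp
  next
    case False
    then have x: "\<bar>x\<bar> > x1" "\<bar>x\<bar> > x0" "\<bar>x\<bar> \<ge> 1" using X by auto
    have "V x / \<bar>x\<bar> \<le> V x / 1" using x V0[of x] by (intro divide_left_mono) auto
    also have "V x / 1 \<le> sqrt (1 + (V x)\<^sup>2)" by (simp add: real_le_rsqrt)
    finally have "C1 * (V x / \<bar>x\<bar>) \<le> max C1 M' * sqrt (1 + (V x)\<^sup>2)"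
      using C1(1) x V0[of x] by (intro mult_mono) auto
    then show ?thesis using C1(2)[OF x(1)] by linarith
  qed
  then have "dirac V m \<gamma> (1 / C) X (min 0 (- M)) (max C1 M') (deriv V)"
    using low d dc by (intro dirac.intro two_sided.intro dirac_axioms.intro j1 j2)
  then show ?thesis by blast
qed

theorem corollary2p15:
  fixes m \<gamma> x0 :: real and V :: "real \<Rightarrow> real"
  assumes "m > 0"
    and "admissible_potential V"
    and "x0 \<ge> 0" and "\<gamma> > 1"
    and "lesssim_on {x. \<bar>x\<bar> > x0} (\<lambda>x. japanese_bracket x powr \<gamma>) V"
  shows "infinite (spectrum (dirac_operator m V)) \<and>
    (\<forall>z\<in>spectrum (dirac_operator m V). discrete_eigenvalue (dirac_operator m V) z) \<and>
    closure (L2_span (generalised_eigenfunctions (dirac_operator m V))) = UNIV"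
proof -
  obtain c X v B where "dirac V m \<gamma> c X v B (deriv V)"
    using dirac_of_admissible[OF assms(1,2,4,5)] by blast
  then interpret dirac V m \<gamma> c X v B "deriv V" .
  obtain C where "determinant_operator A (\<lambda>z. Det (- \<i> * z)) R.\<rho> C (max 0 (- v)) m" using determinant by blast
  then interpret determinant_operator A "\<lambda>z. Det (- \<i> * z)" R.\<rho> C "max 0 (- v)" m .
  show ?thesis using infinite_spectrum complete discrete by (simp add: spectrum_eq)
qed

end
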